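(* Consider the recursion for $\boldsymbol X(n)\in\mathbb R^{S+1}$ given in the context and suppose (A1), (A2) and (A3) (listed in the context) hold. As $\mu\to0$, the interpolated process $(\boldsymbol X^\mu(\cdot),\theta^\mu(\cdot))$ is tight in $D([0,\infty):\mathbb R^{S+1}\times\mathcal Q)$ and converges weakly to $(\boldsymbol X(\cdot),\theta(\cdot))$ that is a solution of the Markovian switched ODE $$\frac{d\boldsymbol X}{dt}=\boldsymbol G(\boldsymbol X,\theta(t))-\boldsymbol X,$$ where, writing $\boldsymbol X=[\hat{\boldsymbol f}',r]'$ with $\hat{\boldsymbol f}\in\mathbb R^S$, $r\in\mathbb R$, $$\boldsymbol G(\boldsymbol X,\theta(t))=\begin{bmatrix}\mathbf 0_S\\ \boldsymbol b^\gamma\big(\hat{\boldsymbol f}+\boldsymbol F(\theta(t))\big)\cdot\boldsymbol F(\theta(t))-F_{\min}(\theta(t))\end{bmatrix},$$ $\mathbf 0_S$ is the $S\times1$ zero vector, and $\theta(t)$ is a continuous-time Markov chain with generator $Q$.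
   Context: Setting. $\mathcal M=\{1,\dots,S\}$ is a finite search space and $\mathcal Q=\{1,\dots,\Theta\}$ a finite set of regimes. For each $s\in\mathcal M$, $\theta\in\mathcal Q$, $\{f_n(s,\theta)\}_n$ is a sequence of real random variables (simulation data), and $F(s,\theta)=\mathbb E\{f_n(s,\theta)\}$. $F_{\min}(\theta)=\min_{s\in\mathcal M}F(s,\theta)$ and $\boldsymbol F(\theta)=[F(1,\theta),\dots,F(S,\theta)]'$ (prime denotes transpose). Write $f_n(s)$ for $f_n(s,\theta(n))$, where $\theta(n)$ is the (unobserved) regime. (A1) $\{\theta(n)\}$ is a discrete-time Markov chain with state space $\mathcal Q$ and transition matrix $P^\varepsilon=I+\varepsilon Q$, where $\varepsilon>0$ is a small parameter, $I$ is the identity, and $Q=[q_{ij}]\in\mathbb R^{\Theta\times\Theta}$ is an irreducible generator of a continuous-time Markov chain with $q_{ij}\ge 0$ for $i\ne j$, $|q_{ij}|\le 1$ for all $i,j$, and zero row sums. The initial distribution of $\theta(0)$ is independent of $\varepsilon$. (A2) For each $s\in\mathcal M$, $\theta\in\mathcal Q$, $\{f_n(s,\theta)\}$ is a sequence of bounded real-valued random variables; moreover, for any $\ell\ge 0$, $\frac1n\sum_{\tau=\ell}^{n+\ell-1}\mathbb E_\ell f_\tau(i,j)\to F(i,j)$ in probability as $n\to\infty$ for all $i\in\mathcal M$, $j\in\mathcal Q$, where $\mathbb E_\ell$ is conditional expectation given the $\sigma$-algebra generated by $\{f_n(s,\theta(n)), s\in\mathcal M, \theta(n): n<\ell\}$.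 (A3) $\varepsilon=\mu$, where $\mu$ is the step-size of the algorithm. Smooth best-response strategy. $\Delta\mathcal M=\{\boldsymbol p\in\mathbb R^S: p_i\ge 0,\ \sum_{i\in\mathcal M}p_i=1\}$. Fix a function $\rho:\mathrm{int}(\Delta\mathcal M)\to\mathbb R$ that is continuously differentiable, strictly concave, satisfies $|\rho|\le 1$, and $\|\nabla\rho(\boldsymbol\sigma)\|\to\infty$ as $\boldsymbol\sigma\to\partial(\Delta\mathcal M)$. For $\gamma>0$ and $\tilde{\boldsymbol f}\in\mathbb R^S$, $$\boldsymbol b^\gamma(\tilde{\boldsymbol f})=(b_1^\gamma(\tilde{\boldsymbol f}),\dots,b_S^\gamma(\tilde{\boldsymbol f})):=\arg\min_{\boldsymbol\sigma\in\Delta\mathcal M}\Big\{\sum_{i\in\mathcal M}\sigma_i\tilde f_i-\gamma\rho(\boldsymbol\sigma)\Big\}.$$ Algorithm. Initialize $\tilde{\boldsymbol f}(0)=\mathbf 0_S$. At each $n=0,1,2,\dots$: sample $s(n)\in\mathcal M$ from the distribution $\boldsymbol b^\gamma(\tilde{\boldsymbol f}(n))$; simulate $f_n(s(n))$; update $\tilde{\boldsymbol f}(n+1)=\tilde{\boldsymbol f}(n)+\mu[\boldsymbol g(s(n),\tilde{\boldsymbol f}(n))-\tilde{\boldsymbol f}(n)]$, where $g_i(s(n),\tilde{\boldsymbol f}(n))=\frac{f_n(s(n))}{b_i^\gamma(\tilde{\boldsymbol f}(n))}I_{\{s(n)=i\}}$. Recursion. Let $\hat{\boldsymbol f}(n)=\tilde{\boldsymbol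 f}(n)-\boldsymbol F(\theta(n))$, let $r(n)$ be the regret (discounted average with factor $\mu$ of the realized values $f_\tau(s(\tau))$, minus $F_{\min}(\theta(n))$), and $\boldsymbol X(n)=[\hat{\boldsymbol f}(n)',r(n)]'$. These satisfy the recursion $$\boldsymbol X(n+1)=\boldsymbol X(n)+\mu[\boldsymbol A_n(s(n))-\boldsymbol X(n)]+\begin{bmatrix}\boldsymbol F(\theta(n))-\boldsymbol F(\theta(n+1))\\ F_{\min}(\theta(n))-F_{\min}(\theta(n+1))\end{bmatrix},$$ $$\boldsymbol A_n(s(n))=\begin{bmatrix}\hat{\boldsymbol g}(s(n),\hat{\boldsymbol f}(n))-\boldsymbol F(\theta(n))\\ f_n(s(n))-F_{\min}(\theta(n))\end{bmatrix},\qquad \hat g_i=\frac{f_n(s(n))}{b_i^\gamma(\hat{\boldsymbol f}(n)+\boldsymbol F(\theta(n)))}I_{\{s(n)=i\}}.$$ The initial value $r(0)$ is assumed independent of $\mu$ (otherwise required to converge weakly as $\mu\to 0$). Interpolations: $\boldsymbol X^\mu(t)=\boldsymbol X(n)$, $\theta^\mu(t)=\theta(n)$ for $t\in[n\mu,(n+1)\mu)$. $D([0,\infty):\tilde G)$ is the space of right-continuous functions with left limits on $[0,\infty)$ with values in $\tilde G$, with the Skorohod topology.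
   Formalization: The averages in (A2) converge uniformly in ℓ and ε; the data have one bound for all n; r(0) has a μ-free joint law with θ(0) and tells nothing more of later regimes; X solves the ODE between switches and jumps at each switch by the change of −F and −F_min. *)

theory Defs
  imports "HOL-Probability.Probability"
begin

section \<open>Path space with the Skorohod topology\<close>

text \<open>
  A path on \<open>[0,\<infinity>)\<close> is a function on \<open>real\<close> that is \<open>undefined\<close> at negative times, so that
  equality of paths is equality on \<open>[0,\<infinity>)\<close>.
\<close>

definition cadlag :: "(real \<Rightarrow> 'e::topological_space) set" where
  "cadlag = {x \<in> extensional {0..}.
     (\<forall>t\<ge>0. continuous (at_right t) x) \<and> (\<forall>t>0. \<exists>l. (x \<longlongrightarrow> l) (at_left t))}"

definition time_changes :: "(real \<Rightarrow> real) set" where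
  "time_changes = {\<kappa>. strict_mono_on {0..} \<kappa> \<and> continuous_on {0..} \<kappa> \<and> \<kappa> ` {0..} = {0..}}"

definition skorohod_nbhd ::
  "(real \<Rightarrow> 'e::metric_space) \<Rightarrow> real \<Rightarrow> real \<Rightarrow> (real \<Rightarrow> 'e) set" where
  "skorohod_nbhd x T e = {y \<in> cadlag. \<exists>\<kappa>\<in>time_changes.
     (\<forall>t\<ge>0. \<bar>\<kappa> t - t\<bar> < e) \<and> (\<forall>t\<in>{0..T}. dist (y (\<kappa> t)) (x t) < e)}"

text \<open>
  The Skorohod topology on \<open>D([0,\<infinity>))\<close> is the metrizable topology in which \<open>x\<^sub>n\<close> tends to \<open>x\<close> iff there are
  time changes \<open>\<kappa>\<^sub>n\<close> with \<open>sup\<^sub>t \<bar>\<kappa>\<^sub>n t - t\<bar>\<close> tending to 0 and, for every \<open>T\<close>,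
  \<open>sup {dist (x\<^sub>n (\<kappa>\<^sub>n t)) (x t) | t \<le> T}\<close> tending to 0 (Billingsley, Convergence of Probability
  Measures, 2nd ed., Theorem 16.1).  By a diagonal argument this says that \<open>x\<^sub>n\<close> is eventually in
  every \<open>skorohod_nbhd x T e\<close>; in a metrizable space the open sets are the sequentially open ones.
\<close>

definition skorohod_topology :: "(real \<Rightarrow> 'e::metric_space) topology" where
  "skorohod_topology = topology (\<lambda>U. U \<subseteq> cadlag \<and>
     (\<forall>x\<in>U. \<exists>T>0. \<exists>e>0. skorohod_nbhd x T e \<subseteq> U))"

lemma skorohod_nbhd_mono:
  "T' \<le> T \<Longrightarrow> e \<le> e' \<Longrightarrow> skorohod_nbhd x T e \<subseteq> skorohod_nbhd x T' e'"
proof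
  fix y assume "T' \<le> T" "e \<le> e'" and "y \<in> skorohod_nbhd x T e"
  then obtain \<kappa> where "y \<in> cadlag" "\<kappa> \<in> time_changes" and
    *: "\<forall>t\<ge>0. \<bar>\<kappa> t - t\<bar> < e" "\<forall>t\<in>{0..T}. dist (y (\<kappa> t)) (x t) < e"
    by (auto simp: skorohod_nbhd_def)
  moreover have "\<forall>t\<ge>0. \<bar>\<kappa> t - t\<bar> < e'" "\<forall>t\<in>{0..T'}. dist (y (\<kappa> t)) (x t) < e'"
    using * \<open>T' \<le> T\<close> \<open>e \<le> e'\<close> by (force intro: less_le_trans)+
  ultimately show "y \<in> skorohod_nbhd x T' e'"
    by (auto simp: skorohod_nbhd_def)
qed

lemma openin_skorohod:
  "openin skorohod_topology U \<longleftrightarrow> U \<subseteq> cadlag \<and>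
     (\<forall>x\<in>U. \<exists>T>0. \<exists>e>0. skorohod_nbhd x T e \<subseteq> U)"
proof -
  have "istopology (\<lambda>U. U \<subseteq> cadlag \<and> (\<forall>x\<in>U. \<exists>T>0. \<exists>e>0. skorohod_nbhd x T e \<subseteq> U))"
    (is "istopology ?P")
    unfolding istopology_def
  proof (intro conjI allI impI)
    fix U V assume U: "?P U" and V: "?P V"
    show "U \<inter> V \<subseteq> cadlag" using U by blast
    show "\<forall>x\<in>U \<inter> V. \<exists>T>0. \<exists>e>0. skorohod_nbhd x T e \<subseteq> U \<inter> V"
    proof
      fix x assume "x \<in> U \<inter> V"
      then obtain T e T' e' where *: "0 < T" "0 < e" "skorohod_nbhd x T e \<subseteq> U"
        "0 < T'" "0 < e'" "skorohod_nbhd x T' e' \<subseteq> V"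
        using U V by (meson IntD1 IntD2)
      have "skorohod_nbhd x (max T T') (min e e') \<subseteq> skorohod_nbhd x T e"
        "skorohod_nbhd x (max T T') (min e e') \<subseteq> skorohod_nbhd x T' e'"
        by (rule skorohod_nbhd_mono; simp)+
      with * have "0 < max T T'" "0 < min e e'"
        "skorohod_nbhd x (max T T') (min e e') \<subseteq> U \<inter> V" by auto
      then show "\<exists>T>0. \<exists>e>0. skorohod_nbhd x T e \<subseteq> U \<inter> V" by blast
    qed
  next
    fix K assume K: "\<forall>U\<in>K. ?P U"
    show "\<Union> K \<subseteq> cadlag" using K by blast
    show "\<forall>x\<in>\<Union> K. \<exists>T>0. \<exists>e>0. skorohod_nbhd x T e \<subseteq> \<Union> K"
      using K by (meson Union_iff Union_upper subset_trans)
  qed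
  then show ?thesis unfolding skorohod_topology_def by (subst topology_inverse') auto
qed

lemma topspace_skorohod: "topspace skorohod_topology = cadlag"
proof
  show "topspace skorohod_topology \<subseteq> cadlag"
    using openin_skorohod openin_topspace by blast
  have "openin skorohod_topology cadlag"
    unfolding openin_skorohod skorohod_nbhd_def by (auto intro!: exI[of _ 1])
  then show "cadlag \<subseteq> topspace skorohod_topology" by (rule openin_subset)
qed

definition skorohod_borel :: "(real \<Rightarrow> 'e::metric_space) measure" where
  "skorohod_borel = sigma cadlag {U. openin skorohod_topology U}"

section \<open>Tightness and weak convergence\<close>

definition tight_family :: "'p topology \<Rightarrow> 'i set \<Rightarrow> ('i \<Rightarrow> 'p measure) \<Rightarrow> bool" where
  "tight_family T A P \<longleftrightarrow> (\<forall>\<eta>>0. \<exists>K. compactin T K \<and> (\<forall>i\<in>A. measure (P i) K \<ge> 1 - \<eta>))"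

definition weakly_converges ::
  "'p topology \<Rightarrow> ('i \<Rightarrow> 'p measure) \<Rightarrow> 'p measure \<Rightarrow> 'i filter \<Rightarrow> bool" where
  "weakly_converges T P L A \<longleftrightarrow> (\<forall>h. continuous_map T euclideanreal h \<and> bounded (h ` topspace T) \<longrightarrow>
     ((\<lambda>i. \<integral>z. h z \<partial>P i) \<longlongrightarrow> (\<integral>z. h z \<partial>L)) A)"

section \<open>Markov chains\<close>

definition irreducible_generator :: "real^'q::finite^'q \<Rightarrow> bool" where
  "irreducible_generator Q \<longleftrightarrow>
     (\<forall>i j. i \<noteq> j \<longrightarrow> Q $ i $ j \<ge> 0) \<and> (\<forall>i. (\<Sum>j\<in>UNIV. Q $ i $ j) = 0) \<and>
     (\<forall>i j. (i, j) \<in> {(k, l). k \<noteq> l \<and> Q $ k $ l > 0}\<^sup>*)"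

definition markov_chain ::
  "'a measure \<Rightarrow> ('q::finite \<Rightarrow> real) \<Rightarrow> real^'q^'q \<Rightarrow> (nat \<Rightarrow> 'a \<Rightarrow> 'q) \<Rightarrow> bool" where
  "markov_chain M \<pi> P \<theta> \<longleftrightarrow> (\<forall>n. \<theta> n \<in> measurable M (count_space UNIV)) \<and>
     (\<forall>n x. measure M {\<omega>\<in>space M. \<forall>k\<le>n. \<theta> k \<omega> = x k} =
        \<pi> (x 0) * (\<Prod>k<n. P $ x k $ x (Suc k)))"

text \<open>The iterated product \<open>**\<close> is needed because \<open>^\<close> on \<open>real^'q^'q\<close> is the componentwise power.\<close>

definition matrix_exp :: "real^'q::finite^'q \<Rightarrow> real^'q^'q" where
  "matrix_exp A = (\<Sum>k. (1 / fact k) *\<^sub>R ((\<lambda>B. A ** B) ^^ k) (mat 1))"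

definition ctmc :: "'b measure \<Rightarrow> real^'q::finite^'q \<Rightarrow> (real \<Rightarrow> 'b \<Rightarrow> 'q) \<Rightarrow> bool" where
  "ctmc N Q Y \<longleftrightarrow> (\<forall>t\<ge>0. Y t \<in> measurable N (count_space UNIV)) \<and>
     (\<forall>n t x. 0 \<le> t 0 \<and> incseq t \<longrightarrow>
        measure N {z\<in>space N. \<forall>k\<le>n. Y (t k) z = x k} =
        measure N {z\<in>space N. Y (t 0) z = x 0} *
          (\<Prod>k<n. matrix_exp ((t (Suc k) - t k) *\<^sub>R Q) $ x k $ x (Suc k)))"

section \<open>Simulation data\<close>

definition observed_data ::
  "'a measure \<Rightarrow> (nat \<Rightarrow> 's \<Rightarrow> 'q \<Rightarrow> 'a \<Rightarrow> real) \<Rightarrow> (nat \<Rightarrow> 'a \<Rightarrow> 'q) \<Rightarrow> nat set \<Rightarrow> 'a set set" where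
  "observed_data M f \<theta> I =
     {(\<lambda>\<omega>. f n i (\<theta> n \<omega>) \<omega>) -` B \<inter> space M | n i B. n \<in> I \<and> B \<in> sets borel} \<union>
     {\<theta> n -` C \<inter> space M | n C. n \<in> I}"

text \<open>\<open>avg_cond_exp M f \<theta> l n i j\<close> is \<open>(1/n) * (\<Sum>\<tau>=l..n+l-1. E\<^sub>l f\<^sub>\<tau>(i,j))\<close>.\<close>

definition avg_cond_exp ::
  "'a measure \<Rightarrow> (nat \<Rightarrow> 's \<Rightarrow> 'q \<Rightarrow> 'a \<Rightarrow> real) \<Rightarrow> (nat \<Rightarrow> 'a \<Rightarrow> 'q) \<Rightarrow>
    nat \<Rightarrow> nat \<Rightarrow> 's \<Rightarrow> 'q \<Rightarrow> 'a \<Rightarrow> real" where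
  "avg_cond_exp M f \<theta> l n i j \<omega> = (\<Sum>\<tau>\<in>{l..<l + n}.
     real_cond_exp M (sigma (space M) (observed_data M f \<theta> {..<l})) (f \<tau> i j) \<omega>) / real n"

text \<open>
  The bound on the data is uniform in \<open>n\<close>, and the convergence in probability of the averages is
  uniform in the conditioning time \<open>l\<close> and in the parameter \<open>\<epsilon>\<close> of the regime chain.  Without
  uniformity in \<open>l\<close> the limit theorem fails: if \<open>f\<^sub>\<tau> = \<zeta>\<^sub>k\<close> for \<open>2^k \<le> \<tau> < 2^(k+1)\<close> with independent
  fair signs \<open>\<zeta>\<^sub>k\<close>, then for each fixed \<open>l\<close> the averages tend to 0, whereas averages of the data over
  time windows of length proportional to \<open>1/\<mu>\<close> do not.
\<close>

definition admissible_data ::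
  "'a measure \<Rightarrow> real set \<Rightarrow> (nat \<Rightarrow> 's \<Rightarrow> 'q \<Rightarrow> 'a \<Rightarrow> real) \<Rightarrow> (real \<Rightarrow> nat \<Rightarrow> 'a \<Rightarrow> 'q) \<Rightarrow>
    ('s \<Rightarrow> 'q \<Rightarrow> real) \<Rightarrow> bool" where
  "admissible_data M E f \<theta> F \<longleftrightarrow>
     (\<forall>n i j. f n i j \<in> borel_measurable M) \<and>
     (\<exists>C. \<forall>n i j. AE \<omega> in M. \<bar>f n i j \<omega>\<bar> \<le> C) \<and>
     (\<forall>i j. \<forall>\<delta>>0. uniform_limit (E \<times> UNIV)
        (\<lambda>n (\<epsilon>, l). measure M {\<omega>\<in>space M. \<bar>avg_cond_exp M f (\<theta> \<epsilon>) l n i j \<omega> - F i j\<bar> > \<delta>})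
        (\<lambda>_. 0) sequentially)"

section \<open>Smooth best response\<close>

definition prob_simplex :: "(real^'s::finite) set" where
  "prob_simplex = {p. (\<forall>i. p $ i \<ge> 0) \<and> (\<Sum>i\<in>UNIV. p $ i) = 1}"

text \<open>
  The simplex has empty interior in \<open>real^'s\<close>, so its interior and boundary are the relative ones,
  and the gradient of \<open>\<rho>\<close> is the vector \<open>g \<sigma>\<close> tangent to the simplex that represents the derivative.
\<close>

definition admissible_perturbation :: "(real^'s::finite \<Rightarrow> real) \<Rightarrow> bool" where
  "admissible_perturbation \<rho> \<longleftrightarrow>
     (\<forall>x\<in>rel_interior prob_simplex. \<forall>y\<in>rel_interior prob_simplex. \<forall>u. x \<noteq> y \<and> 0 < u \<and> u < 1 \<longrightarrow>
        \<rho> ((1 - u) *\<^sub>R x + u *\<^sub>R y) > (1 - u) * \<rho> x + u * \<rho> y) \<and>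
     (\<forall>\<sigma>\<in>rel_interior prob_simplex. \<bar>\<rho> \<sigma>\<bar> \<le> 1) \<and>
     (\<exists>g :: real^'s \<Rightarrow> real^'s.
        continuous_on (rel_interior prob_simplex) g \<and>
        (\<forall>\<sigma>\<in>rel_interior prob_simplex. (\<Sum>i\<in>UNIV. g \<sigma> $ i) = 0 \<and>
           (\<rho> has_derivative (\<lambda>v. g \<sigma> \<bullet> v)) (at \<sigma> within rel_interior prob_simplex)) \<and>
        (\<forall>z\<in>rel_frontier prob_simplex.
           filterlim (\<lambda>\<sigma>. norm (g \<sigma>)) at_top (at z within rel_interior prob_simplex)))"

text \<open>
  \<open>\<rho>\<close> is a function on the interior of the simplex only, so the minimum is over the interior.  The
  growth of the gradient makes the objective essentially smooth, hence its lower semicontinuous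
  extension to the whole simplex has its unique minimizer in the interior.
\<close>

definition best_response :: "real \<Rightarrow> (real^'s::finite \<Rightarrow> real) \<Rightarrow> real^'s \<Rightarrow> real^'s" where
  "best_response \<gamma> \<rho> v = arg_min_on (\<lambda>\<sigma>. (\<Sum>i\<in>UNIV. \<sigma> $ i * v $ i) - \<gamma> * \<rho> \<sigma>) (rel_interior prob_simplex)"

section \<open>The algorithm\<close>

definition F_vec :: "('s::finite \<Rightarrow> 'q \<Rightarrow> real) \<Rightarrow> 'q \<Rightarrow> real^'s" where
  "F_vec F j = (\<chi> i. F i j)"

definition F_min :: "('s::finite \<Rightarrow> 'q \<Rightarrow> real) \<Rightarrow> 'q \<Rightarrow> real" where
  "F_min F j = Min (range (\<lambda>i. F i j))"

text \<open>
  The recursions are along a single realization: \<open>b\<close> is the best-response map, \<open>y n i\<close> the value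
  \<open>f\<^sub>n(i)\<close> for the current regime, \<open>s n\<close> the sampled point and \<open>\<theta> n\<close> the regime at time \<open>n\<close>.
\<close>

definition g_vec :: "real^'s::finite \<Rightarrow> 's \<Rightarrow> real \<Rightarrow> real^'s" where
  "g_vec p s v = (\<chi> i. if s = i then v / p $ i else 0)"

primrec f_tilde ::
  "real \<Rightarrow> (real^'s::finite \<Rightarrow> real^'s) \<Rightarrow> (nat \<Rightarrow> 's \<Rightarrow> real) \<Rightarrow> (nat \<Rightarrow> 's) \<Rightarrow> nat \<Rightarrow> real^'s" where
  "f_tilde \<mu> b y s 0 = 0"
| "f_tilde \<mu> b y s (Suc n) = f_tilde \<mu> b y s n +
     \<mu> *\<^sub>R (g_vec (b (f_tilde \<mu> b y s n)) (s n) (y n (s n)) - f_tilde \<mu> b y s n)"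

text \<open>\<open>X_rec\<close> is \<open>X(n) = (f_hat(n), r(n))\<close>, with \<open>R\<^sup>S\<^sup>+\<^sup>1\<close> rendered as \<open>R\<^sup>S \<times> R\<close>.\<close>

primrec X_rec ::
  "real \<Rightarrow> (real^'s::finite \<Rightarrow> real^'s) \<Rightarrow> ('s \<Rightarrow> 'q \<Rightarrow> real) \<Rightarrow> (nat \<Rightarrow> 's \<Rightarrow> real) \<Rightarrow> (nat \<Rightarrow> 's) \<Rightarrow>
    (nat \<Rightarrow> 'q) \<Rightarrow> real \<Rightarrow> nat \<Rightarrow> (real^'s) \<times> real" where
  "X_rec \<mu> b F y s \<theta> r0 0 = (f_tilde \<mu> b y s 0 - F_vec F (\<theta> 0), r0)"
| "X_rec \<mu> b F y s \<theta> r0 (Suc n) = X_rec \<mu> b F y s \<theta> r0 n +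
     \<mu> *\<^sub>R ((g_vec (b (fst (X_rec \<mu> b F y s \<theta> r0 n) + F_vec F (\<theta> n))) (s n) (y n (s n)) - F_vec F (\<theta> n),
            y n (s n) - F_min F (\<theta> n)) - X_rec \<mu> b F y s \<theta> r0 n) +
     (F_vec F (\<theta> n) - F_vec F (\<theta> (Suc n)), F_min F (\<theta> n) - F_min F (\<theta> (Suc n)))"

lemma fst_X_rec: "fst (X_rec \<mu> b F y s \<theta> r0 n) = f_tilde \<mu> b y s n - F_vec F (\<theta> n)"
proof (induction n)
  case (Suc n)
  have "f_tilde \<mu> b y s n - F_vec F (\<theta> n) + F_vec F (\<theta> n) = f_tilde \<mu> b y s n" by simp
  then show ?case by (simp add: Suc scaleR_diff_right)
qed simp

text \<open>
  The draw \<open>s n\<close> uses fresh randomness: given the earlier draws and all (also future) data and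
  regimes, its distribution is \<open>b (f_tilde n)\<close>.
\<close>

definition samples_from ::
  "'a measure \<Rightarrow> (nat \<Rightarrow> 's::finite \<Rightarrow> 'q \<Rightarrow> 'a \<Rightarrow> real) \<Rightarrow> (nat \<Rightarrow> 'a \<Rightarrow> 'q) \<Rightarrow> (nat \<Rightarrow> 'a \<Rightarrow> 's) \<Rightarrow>
    (nat \<Rightarrow> 'a \<Rightarrow> real^'s) \<Rightarrow> bool" where
  "samples_from M f \<theta> s p \<longleftrightarrow> (\<forall>n. s n \<in> measurable M (count_space UNIV)) \<and>
     (\<forall>n i. AE \<omega> in M. real_cond_exp M
        (sigma (space M) (observed_data M f \<theta> UNIV \<union> {s k -` C \<inter> space M | k C. k < n}))
        (indicator {\<omega>\<in>space M. s n \<omega> = i}) \<omega> = p n \<omega> $ i)"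

text \<open>
  The initial regret may be random.  Its joint law with the initial regime does not depend on \<open>\<epsilon>\<close>,
  and it carries no information on the later regimes beyond that in \<open>\<theta>(0)\<close>.
\<close>

definition admissible_initial_regret ::
  "'a measure \<Rightarrow> real set \<Rightarrow> (real \<Rightarrow> real^'q::finite^'q) \<Rightarrow> (real \<Rightarrow> nat \<Rightarrow> 'a \<Rightarrow> 'q) \<Rightarrow> ('a \<Rightarrow> real) \<Rightarrow> bool"
  where
  "admissible_initial_regret M E P \<theta> r0 \<longleftrightarrow> r0 \<in> borel_measurable M \<and>
     (\<forall>\<epsilon>\<in>E. \<forall>\<epsilon>'\<in>E. distr M (borel \<Otimes>\<^sub>M count_space UNIV) (\<lambda>\<omega>. (r0 \<omega>, \<theta> \<epsilon> 0 \<omega>)) =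
        distr M (borel \<Otimes>\<^sub>M count_space UNIV) (\<lambda>\<omega>. (r0 \<omega>, \<theta> \<epsilon>' 0 \<omega>))) \<and>
     (\<forall>\<epsilon>\<in>E. \<forall>n x. \<forall>B\<in>sets borel.
        measure M {\<omega>\<in>space M. r0 \<omega> \<in> B \<and> (\<forall>k\<le>n. \<theta> \<epsilon> k \<omega> = x k)} =
        measure M {\<omega>\<in>space M. r0 \<omega> \<in> B \<and> \<theta> \<epsilon> 0 \<omega> = x 0} * (\<Prod>k<n. P \<epsilon> $ x k $ x (Suc k)))"

definition interpolate :: "real \<Rightarrow> (nat \<Rightarrow> 'e) \<Rightarrow> real \<Rightarrow> 'e" where
  "interpolate \<mu> x = (\<lambda>t\<in>{0..}. x (nat \<lfloor>t / \<mu>\<rfloor>))"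

section \<open>The switched ODE\<close>

definition G_field ::
  "(real^'s::finite \<Rightarrow> real^'s) \<Rightarrow> ('s \<Rightarrow> 'q \<Rightarrow> real) \<Rightarrow> (real^'s) \<times> real \<Rightarrow> 'q \<Rightarrow> (real^'s) \<times> real" where
  "G_field b F x j = (0, b (fst x + F_vec F j) \<bullet> F_vec F j - F_min F j)"

text \<open>
  The differential equation holds at all times at which the regime does not switch.  At a switching
  time \<open>f_hat = f_tilde - F_vec F \<theta>\<close> and \<open>r\<close> cannot be continuous: the last term of \<open>X_rec\<close> is not
  multiplied by \<open>\<mu>\<close> and persists in the limit as the jump prescribed by \<open>regime_resets\<close>.
\<close>

definition solves_switched_ode ::
  "((real^'s) \<times> real \<Rightarrow> 'q::metric_space \<Rightarrow> (real^'s::finite) \<times> real) \<Rightarrow>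
    (real \<Rightarrow> (real^'s) \<times> real) \<Rightarrow> (real \<Rightarrow> 'q) \<Rightarrow> bool" where
  "solves_switched_ode G x \<theta> \<longleftrightarrow> (\<forall>t\<ge>0. continuous (at t within {0..}) \<theta> \<longrightarrow>
     (x has_vector_derivative (G (x t) (\<theta> t) - x t)) (at t within {0..}))"

definition regime_resets ::
  "('s::finite \<Rightarrow> 'q::metric_space \<Rightarrow> real) \<Rightarrow> (real \<Rightarrow> (real^'s) \<times> real) \<Rightarrow> (real \<Rightarrow> 'q) \<Rightarrow> bool" where
  "regime_resets F x \<theta> \<longleftrightarrow> (\<forall>t>0. \<forall>j. (\<theta> \<longlongrightarrow> j) (at_left t) \<longrightarrow>
     (x \<longlongrightarrow> x t - (F_vec F j - F_vec F (\<theta> t), F_min F j - F_min F (\<theta> t))) (at_left t))"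

end

theory Submission
  imports Defs
begin

text \<open>
  The map \<open>flow\<close> solves the switched ODE along any regime path and any initial regret, with initial
  \<open>f_tilde\<close> equal to 0.  In terms of \<open>f_tilde\<close> and \<open>r + F_min\<close> the recursion is a relaxation with small steps towards the
  averaged data plus noise; the sampling noise is a sum of martingale differences, and the noise of the
  data is averaged over windows that are long for (A2) but short compared with the time \<open>1/\<mu>\<close> between
  switches.  Hence the interpolated process is uniformly close, in probability, to the flow driven by
  the interpolated regime chain.

  For the regime the chains of all step sizes are realized on one probability space: a chain with
  transition matrix \<open>I + \<mu>Q\<close> jumps, with probability \<open>\<mu>\<close>, according to \<open>I + Q\<close>, and geometric waiting times
  with parameter \<open>\<mu>\<close> are obtained by rounding exponential ones.  On this space the paths of the regime converge
  almost surely, and so do the flows, since the flow depends continuously on the jump times and the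
  states.  This yields the limit law, and compact sets of flows that have large probability for all
  small step sizes.  Closeness to a compact set turns into convergence of expectations and tightness.
\<close>

section \<open>The Skorohod topology\<close>

text \<open>Regime switches have a bounded rate in limit time, so \<open>f_hat\<close> and
  \<open>r\<close> keep jumps of order one. These jumps cancel in \<open>f_tilde\<close> and
  \<open>r + F_min\<close>, whose limits are Lipschitz on bounded time intervals. The algorithm is
  compared with the flow driven by its own regime: both switch at the same instants and the identity
  serves as time change. Nontrivial time changes are needed only between flows of different regimes,
  and there jump times are matched exactly, so that states need no error term.

  The best response may have tiny components far from the origin, so the sampling noise has no a
  priori bound. It is truncated outside a ball, and an induction over time shows that the truncation
  stays inactive as long as the noise is small.

  Tightness is asked for all step sizes in \<open>{0<..\<mu>0}\<close> at once. Away from 0 no limit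
  helps; there compactness comes from deterministic bounds on each single iterate. The two ranges of
  step sizes are joined by shrinking tubes around one compact set of flows.\<close>

lemma time_changes_ge0: "\<kappa> \<in> time_changes \<Longrightarrow> 0 \<le> t \<Longrightarrow> 0 \<le> \<kappa> t"
  unfolding time_changes_def by (auto simp: image_def set_eq_iff)

lemma time_changes_less: "\<kappa> \<in> time_changes \<Longrightarrow> 0 \<le> s \<Longrightarrow> s < t \<Longrightarrow> \<kappa> s < \<kappa> t"
  unfolding time_changes_def by (auto simp: strict_mono_on_def)

lemma time_changes_comp:
  assumes "\<kappa> \<in> time_changes" "\<kappa>' \<in> time_changes"
  shows "(\<lambda>t. \<kappa>' (\<kappa> t)) \<in> time_changes"
proof -
  have "(\<lambda>t. \<kappa>' (\<kappa> t)) ` {0..} = \<kappa>' ` (\<kappa> ` {0..})" by auto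
  moreover have "continuous_on {0..} (\<lambda>t. \<kappa>' (\<kappa> t))"
    by (rule continuous_on_compose2[of "{0..}" \<kappa>']) (use assms in \<open>auto simp: time_changes_def\<close>)
  ultimately show ?thesis
    using assms time_changes_less[OF assms(1)] time_changes_less[OF assms(2)] time_changes_ge0[OF assms(1)]
    unfolding time_changes_def by (auto simp: strict_mono_on_def)
qed

lemma time_changes_id: "(\<lambda>t. t) \<in> time_changes"
  unfolding time_changes_def by (auto simp: strict_mono_on_def)

text \<open>An increasing map whose range has no gaps cannot jump. Extension by the identity to
  negative times makes the range the whole line, an open set, as the continuity criterion for
  monotone maps asks.\<close>

lemma time_changesI:
  assumes mono: "\<And>s t. 0 \<le> s \<Longrightarrow> s < t \<Longrightarrow> \<kappa> s < \<kappa> t" and im: "\<kappa> ` {0..} = {0..}"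
  shows "\<kappa> \<in> time_changes"
proof -
  define g where "g t = (if t < 0 then t else \<kappa> t)" for t
  have 0: "0 \<le> \<kappa> t" if "0 \<le> t" for t using im that by (auto simp: image_def set_eq_iff)
  have "x \<in> range g" for x
  proof (cases "x < 0")
    case True then have "g x = x" by (simp add: g_def) then show ?thesis by (metis rangeI)
  next
    case False then have "x \<in> \<kappa> ` {0..}" using im by auto
    then obtain t where "0 \<le> t" "x = \<kappa> t" by auto
    then have "g t = x" by (simp add: g_def) then show ?thesis by auto
  qed
  then have r: "range g = UNIV" by auto
  have gm: "x \<le> y \<Longrightarrow> g x \<le> g y" for x y
    using mono[of x y] 0[of y] by (cases "x = y") (auto simp: g_def not_less)
  have "continuous_on UNIV g"
    by (rule continuous_onI_mono) (use r gm in auto)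
  then have "continuous_on {0..} g" using continuous_on_subset by blast
  then have "continuous_on {0..} \<kappa>"
    by (rule continuous_on_cong[THEN iffD1, rotated -1]) (auto simp: g_def)
  then show ?thesis using mono im by (auto simp: time_changes_def strict_mono_on_def)
qed

lemma time_changes_inverse:
  assumes k: "\<kappa> \<in> time_changes"
  obtains \<kappa>' where "\<kappa>' \<in> time_changes" "\<And>t. 0 \<le> t \<Longrightarrow> \<kappa> (\<kappa>' t) = t" "\<And>t. 0 \<le> t \<Longrightarrow> \<kappa>' (\<kappa> t) = t"
proof -
  define \<kappa>' where "\<kappa>' = inv_into {0..} \<kappa>"
  have im: "\<kappa> ` {0..} = {0..}" using k by (simp add: time_changes_def)
  have inj: "inj_on \<kappa> {0..}"
    using k unfolding time_changes_def by (auto intro: strict_mono_on_imp_inj_on)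
  have a: "\<kappa> (\<kappa>' t) = t" if "0 \<le> t" for t
    unfolding \<kappa>'_def using im that by (intro f_inv_into_f) auto
  have b: "\<kappa>' (\<kappa> t) = t" if "0 \<le> t" for t
    unfolding \<kappa>'_def using inj that by (intro inv_into_f_f) auto
  have c: "0 \<le> \<kappa>' t" if "0 \<le> t" for t
    using inv_into_into[of t \<kappa> "{0..}"] im that unfolding \<kappa>'_def by auto
  have "\<kappa>' \<in> time_changes"
  proof (rule time_changesI)
    show "\<kappa>' s < \<kappa>' t" if "0 \<le> s" "s < t" for s t
    proof (rule ccontr)
      assume "\<not> \<kappa>' s < \<kappa>' t"
      then have "\<kappa> (\<kappa>' t) \<le> \<kappa> (\<kappa>' s)"
        using time_changes_less[OF k, of "\<kappa>' t" "\<kappa>' s"] c[of t] that by (cases "\<kappa>' t = \<kappa>' s") auto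
      then show False using a[of s] a[of t] that by simp
    qed
    show "\<kappa>' ` {0..} = {0..}"
    proof
      show "{0..} \<subseteq> \<kappa>' ` {0..}"
      proof
        fix t :: real assume "t \<in> {0..}"
        then show "t \<in> \<kappa>' ` {0..}" using b[of t] time_changes_ge0[OF k, of t] by (intro image_eqI[of _ _ "\<kappa> t"]) auto
      qed
    qed (use c in auto)
  qed
  then show thesis using that a b by blast
qed

section \<open>Calculus of the basic neighbourhoods\<close>

lemma openin_skorohodE:
  assumes "openin skorohod_topology U" "x \<in> U"
  obtains T e where "0 < T" "0 < e" "skorohod_nbhd x T e \<subseteq> U"
proof -
  have "\<exists>T>0. \<exists>e>0. skorohod_nbhd x T e \<subseteq> U" using assms by (simp add: openin_skorohod)
  then show thesis using that by blast
qed

lemma skorohod_nbhd_cadlag: "y \<in> skorohod_nbhd x T e \<Longrightarrow> y \<in> cadlag"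
  by (auto simp: skorohod_nbhd_def)

lemma skorohod_nbhd_self: "x \<in> cadlag \<Longrightarrow> 0 < e \<Longrightarrow> x \<in> skorohod_nbhd x T e"
  unfolding skorohod_nbhd_def using time_changes_id by (auto intro!: bexI[of _ "\<lambda>t. t"])

text \<open>The time changes are composed. The first may move a time in \<open>{0..T}\<close>
  forward by \<open>e\<close>, hence the longer horizon asked of the second.\<close>

lemma skorohod_nbhd_trans:
  assumes "y \<in> skorohod_nbhd x T e" "z \<in> skorohod_nbhd y (T + e) e'"
  shows "z \<in> skorohod_nbhd x T (e + e')"
proof -
  obtain k where k: "k \<in> time_changes" "\<forall>t\<ge>0. \<bar>k t - t\<bar> < e" "\<forall>t\<in>{0..T}. dist (y (k t)) (x t) < e"
    using assms(1) by (auto simp: skorohod_nbhd_def)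
  obtain k' where k': "k' \<in> time_changes" "\<forall>t\<ge>0. \<bar>k' t - t\<bar> < e'" "\<forall>t\<in>{0..T+e}. dist (z (k' t)) (y t) < e'"
    using assms(2) by (auto simp: skorohod_nbhd_def)
  have "\<bar>k' (k t) - t\<bar> < e + e'" if "0 \<le> t" for t
    using k(2)[rule_format, of t] k'(2)[rule_format, of "k t"] time_changes_ge0[OF k(1), of t] that by auto
  moreover have "dist (z (k' (k t))) (x t) < e + e'" if "t \<in> {0..T}" for t
  proof -
    have "\<bar>k t - t\<bar> < e" "0 \<le> k t" using k(2) time_changes_ge0[OF k(1), of t] that by auto
    then have "k t \<in> {0..T+e}" using that by auto
    then show ?thesis using k(3)[rule_format, OF that] k'(3)[rule_format, of "k t"]
      by (smt (verit) dist_triangle)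
  qed
  ultimately show ?thesis using time_changes_comp[OF k(1) k'(1)] skorohod_nbhd_cadlag[OF assms(2)]
    unfolding skorohod_nbhd_def by (auto intro!: bexI[of _ "\<lambda>t. k' (k t)"])
qed

text \<open>The inverse time change serves. It may move a time forward by \<open>e\<close>, so the
  horizon shrinks by that amount.\<close>

lemma skorohod_nbhd_sym:
  assumes "y \<in> skorohod_nbhd x T e" "x \<in> cadlag"
  shows "x \<in> skorohod_nbhd y (T - e) e"
proof -
  obtain k where k: "k \<in> time_changes" "\<forall>t\<ge>0. \<bar>k t - t\<bar> < e" "\<forall>t\<in>{0..T}. dist (y (k t)) (x t) < e"
    using assms(1) by (auto simp: skorohod_nbhd_def)
  obtain k' where k': "k' \<in> time_changes" "\<And>t. 0 \<le> t \<Longrightarrow> k (k' t) = t"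
    using time_changes_inverse[OF k(1)] by metis
  have a: "\<bar>k' t - t\<bar> < e" if "0 \<le> t" for t
    using k(2)[rule_format, of "k' t"] time_changes_ge0[OF k'(1) that] k'(2)[OF that] by auto
  have "dist (x (k' t)) (y t) < e" if "t \<in> {0..T - e}" for t
  proof -
    have "k' t \<in> {0..T}" using a[of t] time_changes_ge0[OF k'(1), of t] that by auto
    then show ?thesis using k(3)[rule_format, of "k' t"] k'(2)[of t] that by (auto simp: dist_commute)
  qed
  then show ?thesis using a k'(1) assms(2)
    unfolding skorohod_nbhd_def by (auto intro!: bexI[of _ "k'"])
qed

text \<open>The set \<open>U\<close> is the interior of the neighbourhood, described by its points
  that have a whole neighbourhood inside. It is open because half of a radius can be spent on moving
  the centre and half on the neighbours of the new centre.\<close>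

lemma skorohod_nbhd_contains_open:
  assumes "x \<in> cadlag" "0 < T" "0 < e"
  shows "\<exists>U. openin skorohod_topology U \<and> x \<in> U \<and> U \<subseteq> skorohod_nbhd x T e"
proof -
  define U where "U = {y \<in> cadlag. \<exists>T'>0. \<exists>e'>0. skorohod_nbhd y T' e' \<subseteq> skorohod_nbhd x T e}"
  have "openin skorohod_topology U"
    unfolding openin_skorohod
  proof (intro conjI ballI)
    show "U \<subseteq> cadlag" by (auto simp: U_def)
    fix y assume "y \<in> U"
    then obtain T' e' where *: "y \<in> cadlag" "0 < T'" "0 < e'" "skorohod_nbhd y T' e' \<subseteq> skorohod_nbhd x T e"
      by (auto simp: U_def)
    have "skorohod_nbhd y (T' + e') (e'/2) \<subseteq> U"
    proof
      fix z assume z: "z \<in> skorohod_nbhd y (T' + e') (e'/2)"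
      then have "z \<in> skorohod_nbhd y T' (e'/2)"
        using skorohod_nbhd_mono[of T' "T' + e'" "e'/2" "e'/2" y] * by auto
      then have "skorohod_nbhd z (T' + e'/2) (e'/2) \<subseteq> skorohod_nbhd y T' e'"
        using skorohod_nbhd_trans[of z y T' "e'/2" _ "e'/2"] by (auto simp del: add_divide_distrib)
      then have "skorohod_nbhd z (T' + e'/2) (e'/2) \<subseteq> skorohod_nbhd x T e" using *(4) by (rule subset_trans)
      moreover have "0 < T' + e'/2" "0 < e'/2" using * by auto
      ultimately show "z \<in> U" using skorohod_nbhd_cadlag[OF z] unfolding U_def by blast
    qed
    then show "\<exists>T>0. \<exists>e>0. skorohod_nbhd y T e \<subseteq> U" using *
      by (intro exI[of _ "T' + e'"] conjI exI[of _ "e'/2"]) auto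
  qed
  moreover have "x \<in> U" using assms by (auto simp: U_def)
  moreover have "U \<subseteq> skorohod_nbhd x T e" using skorohod_nbhd_self by (fastforce simp: U_def)
  ultimately show ?thesis by blast
qed

text \<open>In a first countable domain sequences detect continuity, so the convergence results for
  flows and step paths can be used as they stand.\<close>

lemma continuous_map_skorohodI:
  fixes g :: "'p::first_countable_topology \<Rightarrow> real \<Rightarrow> 'e::metric_space"
  assumes g: "\<And>p. p \<in> P \<Longrightarrow> g p \<in> cadlag"
    and lim: "\<And>p X T e. p \<in> P \<Longrightarrow> (\<And>n. X n \<in> P) \<Longrightarrow> X \<longlonglongrightarrow> p \<Longrightarrow> 0 < T \<Longrightarrow> 0 < e \<Longrightarrow>
      eventually (\<lambda>n. g (X n) \<in> skorohod_nbhd (g p) T e) sequentially"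
  shows "continuous_map (top_of_set P) skorohod_topology g"
  unfolding continuous_map_def
proof (intro conjI allI impI)
  show "g \<in> topspace (top_of_set P) \<rightarrow> topspace skorohod_topology" using g by (auto simp: topspace_skorohod)
  fix U :: "(real \<Rightarrow> 'e) set" assume U: "openin skorohod_topology U"
  have ex: "\<exists>S. open S \<and> p \<in> S \<and> S \<inter> P \<subseteq> {q \<in> P. g q \<in> U}" if p: "p \<in> P" "g p \<in> U" for p
  proof -
    obtain T e where Te: "0 < T" "0 < e" "skorohod_nbhd (g p) T e \<subseteq> U"
      using openin_skorohodE[OF U p(2)] .
    have "eventually (\<lambda>q. g q \<in> U) (at p within P)"
    proof (rule sequentially_imp_eventually_within, intro allI impI)
      fix X assume X: "(\<forall>n. X n \<in> P \<and> X n \<noteq> p) \<and> X \<longlonglongrightarrow> p"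
      have "eventually (\<lambda>n. g (X n) \<in> skorohod_nbhd (g p) T e) sequentially"
        by (rule lim[OF p(1) _ _ Te(1,2)]) (use X in auto)
      then show "eventually (\<lambda>n. g (X n) \<in> U) sequentially"
        by (rule eventually_mono) (use Te(3) in blast)
    qed
    then obtain S where "open S" "p \<in> S" "\<forall>q\<in>S. q \<noteq> p \<longrightarrow> q \<in> P \<longrightarrow> g q \<in> U"
      by (auto simp: eventually_at_topological)
    then show ?thesis using p(2) by (intro exI[of _ S]) auto
  qed
  then show "openin (top_of_set P) {x \<in> topspace (top_of_set P). g x \<in> U}"
  proof (subst openin_subopen, intro ballI)
    fix p assume "p \<in> {x \<in> topspace (top_of_set P). g x \<in> U}"
    then have p: "p \<in> P" "g p \<in> U" by simp_all
    from this(1) this obtain S where S: "open S" "p \<in> S" "S \<inter> P \<subseteq> {q \<in> P. g q \<in> U}"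
      using ex by blast
    show "\<exists>T. openin (top_of_set P) T \<and> p \<in> T \<and> T \<subseteq> {x \<in> topspace (top_of_set P). g x \<in> U}"
      using S p by (intro exI[of _ "P \<inter> S"] conjI openin_open_Int) auto
  qed
qed

lemma cadlag_at_rightD:
  fixes x :: "real \<Rightarrow> 'e::metric_space"
  assumes "x \<in> cadlag" "0 \<le> t" "0 < d"
  shows "\<exists>u>t. \<forall>s\<in>{t..<u}. dist (x s) (x t) < d"
proof -
  have "(x \<longlongrightarrow> x t) (at_right t)" using assms by (auto simp: cadlag_def continuous_within)
  then have "eventually (\<lambda>s. dist (x s) (x t) < d) (at_right t)" using assms(3) by (auto simp: tendsto_iff)
  then obtain u where "u > t" "\<And>s. t < s \<Longrightarrow> s < u \<Longrightarrow> dist (x s) (x t) < d"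
    by (auto simp: eventually_at_right_field)
  then show ?thesis using assms(3) by (intro exI[of _ u]) (metis atLeastLessThan_iff dist_self less_eq_real_def)
qed

text \<open>Two paths that differ at a time differ, by right continuity, by a fixed amount on a
  whole interval to its right. A path near both would bring them together at the midpoint
  \<open>m\<close> of that interval.\<close>

lemma Hausdorff_skorohod: "Hausdorff_space (skorohod_topology :: (real \<Rightarrow> 'e::metric_space) topology)"
  unfolding Hausdorff_space_def topspace_skorohod
proof (intro allI impI)
  fix x y :: "real \<Rightarrow> 'e" assume *: "x \<in> cadlag \<and> y \<in> cadlag \<and> x \<noteq> y"
  then obtain t where t: "x t \<noteq> y t" by auto
  have t0: "0 \<le> t" using * t unfolding cadlag_def extensional_def by force
  define d where "d = dist (x t) (y t) / 3"
  have d: "0 < d" using t by (auto simp: d_def)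
  obtain u where u: "u > t" "\<And>s. s \<in> {t..<u} \<Longrightarrow> dist (x s) (x t) < d"
    using cadlag_at_rightD[of x t d] * t0 d by blast
  obtain u' where u': "u' > t" "\<And>s. s \<in> {t..<u'} \<Longrightarrow> dist (y s) (y t) < d"
    using cadlag_at_rightD[of y t d] * t0 d by blast
  define w where "w = min u u'"
  \<comment> \<open>Passing from one path to the other costs \<open>2*e\<close> in time and in
    value. The first term keeps this within \<open>d\<close>, the second keeps the moved midpoint
    inside the interval. The horizon \<open>m+1+2*e\<close> below pays for symmetry and
    transitivity.\<close>
  define e where "e = min (d/2) ((w - t)/4)"
  define m where "m = (t + w)/2"
  have e: "0 < e" "e \<le> d/2" "e \<le> (w - t)/4" using d u(1) u'(1) by (simp_all add: e_def w_def min_def)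
  have tw: "t < w" using u u' by (auto simp: w_def)
  have disj: "z \<notin> skorohod_nbhd y (m+1+2*e) e" if z: "z \<in> skorohod_nbhd x (m+1+2*e) e" for z
  proof
    assume zy: "z \<in> skorohod_nbhd y (m+1+2*e) e"
    have "x \<in> skorohod_nbhd z (m+1+e) e"
      using skorohod_nbhd_sym[OF z] * by (simp add: algebra_simps)
    from skorohod_nbhd_trans[of z y "m+1" e x e] zy this
    have "x \<in> skorohod_nbhd y (m+1) (e+e)"
      using skorohod_nbhd_mono[of "m+1" "m+1+2*e" e e y] e by auto
    then obtain k where k: "\<forall>t\<ge>0. \<bar>k t - t\<bar> < e+e" "\<forall>t\<in>{0..m+1}. dist (x (k t)) (y t) < e+e"
      by (auto simp: skorohod_nbhd_def)
    have m: "m \<in> {0..m+1}" using t0 tw by (auto simp: m_def)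
    have "\<bar>k m - m\<bar> < e+e" using k(1) m by auto
    then have "k m \<in> {t..<w}" using e tw unfolding m_def by (auto simp: field_simps)
    then have "dist (x (k m)) (x t) < d" using u(2) by (auto simp: w_def)
    moreover have "dist (y m) (y t) < d" using u'(2)[of m] tw by (auto simp: w_def m_def)
    moreover have "dist (x (k m)) (y m) < d" using k(2) m e by fastforce
    moreover have "dist (x t) (y t) \<le> dist (x (k m)) (x t) + dist (x (k m)) (y m) + dist (y m) (y t)"
      by (smt (verit) dist_commute dist_triangle)
    ultimately show False by (simp add: d_def)
  qed
  have "0 < m+1+2*e" using t0 tw e by (simp add: m_def add_pos_pos)
  with * e(1) obtain U V where
    "openin skorohod_topology U" "x \<in> U" "U \<subseteq> skorohod_nbhd x (m+1+2*e) e"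
    "openin skorohod_topology V" "y \<in> V" "V \<subseteq> skorohod_nbhd y (m+1+2*e) e"
    using skorohod_nbhd_contains_open by metis
  moreover have "disjnt (skorohod_nbhd x (m+1+2*e) e) (skorohod_nbhd y (m+1+2*e) e)"
    using disj by (auto simp: disjnt_def)
  ultimately show "\<exists>U V. openin skorohod_topology U \<and> openin skorohod_topology V \<and> x \<in> U \<and> y \<in> V \<and> disjnt U V"
    by (meson disjnt_subset1 disjnt_subset2)
qed

text \<open>The analogue of a Lebesgue number: cover \<open>K\<close> by neighbourhoods of half the
  radius, take a finite subcover, and use the other half to pass from its centres to all points of
  \<open>K\<close>.\<close>

lemma compactin_skorohod_uniform:
  assumes K: "compactin skorohod_topology K"
    and loc: "\<And>x. x \<in> K \<Longrightarrow> \<exists>T>0. \<exists>e>0. \<forall>z\<in>K \<inter> skorohod_nbhd x T e. \<forall>y\<in>skorohod_nbhd x T e. R z y"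
  shows "\<exists>T>0. \<exists>e>0. \<forall>x\<in>K. \<forall>y\<in>skorohod_nbhd x T e. R x y"
proof -
  have Kc: "K \<subseteq> cadlag" using compactin_subset_topspace[OF K] by (simp add: topspace_skorohod)
  obtain T e where Te: "\<And>x. x \<in> K \<Longrightarrow> 0 < T x \<and> 0 < e x \<and>
      (\<forall>z\<in>K \<inter> skorohod_nbhd x (T x) (e x). \<forall>y\<in>skorohod_nbhd x (T x) (e x). R z y)"
    using loc by metis
  have "\<exists>U. openin skorohod_topology U \<and> x \<in> U \<and> U \<subseteq> skorohod_nbhd x (T x) (e x / 2)" if "x \<in> K" for x
    using skorohod_nbhd_contains_open[of x "T x" "e x / 2"] Te[OF that] that Kc by auto
  then obtain U where U: "\<And>x. x \<in> K \<Longrightarrow> openin skorohod_topology (U x) \<and> x \<in> U x \<and> U x \<subseteq> skorohod_nbhd x (T x) (e x / 2)"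
    by metis
  obtain X where X: "finite X" "X \<subseteq> K" "K \<subseteq> (\<Union>x\<in>X. U x)"
  proof -
    have "\<exists>\<F>. finite \<F> \<and> \<F> \<subseteq> U ` K \<and> K \<subseteq> \<Union>\<F>"
      by (rule compactinD[OF K]) (use U in auto)
    then show thesis using that by (metis finite_subset_image)
  qed
  define T' where "T' = Max (insert 1 ((\<lambda>x. T x + e x) ` X))"
  define e' where "e' = Min (insert 1 ((\<lambda>x. e x / 2) ` X))"
  have T': "0 < T'" "\<And>x. x \<in> X \<Longrightarrow> T x + e x \<le> T'" using X(1) unfolding T'_def
    by (auto simp: Max_gr_iff intro!: Max_ge)
  have e': "0 < e'" "\<And>x. x \<in> X \<Longrightarrow> e' \<le> e x / 2" using X Te unfolding e'_def
    by (auto simp: Min_gr_iff subset_iff simp del: le_divide_eq_numeral1 intro!: Min_le)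
  have "R z y" if z: "z \<in> K" and y: "y \<in> skorohod_nbhd z T' e'" for z y
  proof -
    obtain x where x: "x \<in> X" "z \<in> U x" using X(3) z by blast
    then have xK: "x \<in> K" using X by auto
    have zx: "z \<in> skorohod_nbhd x (T x) (e x / 2)" using U xK x by blast
    have "y \<in> skorohod_nbhd z (T x + e x / 2) (e x / 2)"
      using y skorohod_nbhd_mono[of "T x + e x / 2" T' e' "e x / 2" z] T'(2)[OF x(1)] e'(2)[OF x(1)] Te[OF xK] by auto
    from skorohod_nbhd_trans[OF zx this] have "y \<in> skorohod_nbhd x (T x) (e x)" by simp
    moreover have "z \<in> skorohod_nbhd x (T x) (e x)"
      using zx skorohod_nbhd_mono[of "T x" "T x" "e x / 2" "e x" x] Te[OF xK] by auto
    ultimately show ?thesis using Te[OF xK] \<open>z \<in> K\<close> by blast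
  qed
  then show ?thesis using T'(1) e'(1) by blast
qed

lemma compactin_skorohod_open:
  assumes K: "compactin skorohod_topology K" and U: "openin skorohod_topology U" "K \<subseteq> U"
  shows "\<exists>T>0. \<exists>e>0. \<forall>x\<in>K. skorohod_nbhd x T e \<subseteq> U"
proof -
  have "\<exists>T>0. \<exists>e>0. \<forall>x\<in>K. \<forall>y\<in>skorohod_nbhd x T e. y \<in> U"
  proof (rule compactin_skorohod_uniform[OF K])
    fix x assume "x \<in> K"
    then obtain T e where "0 < T" "0 < e" "skorohod_nbhd x T e \<subseteq> U"
      using openin_skorohodE U by (metis subsetD)
    then show "\<exists>T>0. \<exists>e>0. \<forall>z\<in>K \<inter> skorohod_nbhd x T e. \<forall>y\<in>skorohod_nbhd x T e. y \<in> U" by blast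
  qed
  then show ?thesis by (meson subsetI)
qed

text \<open>Uniform continuity at \<open>K\<close> with respect to all nearby paths, also those
  outside \<open>K\<close>. This is what compares the values of \<open>h\<close> at the process and
  at a flow in a compact set.\<close>

lemma compactin_skorohod_continuous:
  fixes h :: "(real \<Rightarrow> 'e::metric_space) \<Rightarrow> real"
  assumes K: "compactin skorohod_topology K" and h: "continuous_map skorohod_topology euclideanreal h" and d: "0 < d"
  shows "\<exists>T>0. \<exists>e>0. \<forall>x\<in>K. \<forall>y\<in>skorohod_nbhd x T e. \<bar>h y - h x\<bar> < d"
proof (rule compactin_skorohod_uniform[OF K])
  fix x assume "x \<in> K"
  then have x: "x \<in> cadlag" using compactin_subset_topspace[OF K] by (auto simp: topspace_skorohod)
  have "openin skorohod_topology {y \<in> topspace skorohod_topology. h y \<in> ball (h x) (d/2)}"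
    by (rule openin_continuous_map_preimage[OF h]) auto
  moreover have "x \<in> {y \<in> topspace skorohod_topology. h y \<in> ball (h x) (d/2)}"
    using x d by (auto simp: topspace_skorohod)
  ultimately obtain T e where "0 < T" "0 < e"
    "skorohod_nbhd x T e \<subseteq> {y \<in> topspace skorohod_topology. h y \<in> ball (h x) (d/2)}"
    by (rule openin_skorohodE)
  then have "\<forall>y\<in>skorohod_nbhd x T e. \<bar>h y - h x\<bar> < d/2"
    by (auto simp: dist_real_def abs_minus_commute)
  then have "\<forall>z\<in>K \<inter> skorohod_nbhd x T e. \<forall>y\<in>skorohod_nbhd x T e. \<bar>h y - h z\<bar> < d"
    by (smt (verit) IntD2 field_sum_of_halves)
  then show "\<exists>T>0. \<exists>e>0. \<forall>z\<in>K \<inter> skorohod_nbhd x T e. \<forall>y\<in>skorohod_nbhd x T e. \<bar>h y - h z\<bar> < d"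
    using \<open>0 < T\<close> \<open>0 < e\<close> by blast
qed

text \<open>Horizons grow and radii shrink together, so the tubes of a compact set eventually enter
  each of its open neighbourhoods.\<close>

definition skorohod_tube :: "(real \<Rightarrow> 'e::metric_space) set \<Rightarrow> nat \<Rightarrow> (real \<Rightarrow> 'e) set" where
  "skorohod_tube K k = (\<Union>x\<in>K. skorohod_nbhd x (real k + 1) (1 / (real k + 1)))"

text \<open>A finite subcover of \<open>K0\<close> covers all but finitely many of the tubes.\<close>

lemma compactin_tubes:
  fixes K0 :: "(real \<Rightarrow> 'e::metric_space) set"
  assumes K0: "compactin skorohod_topology K0" and A: "\<And>k. compactin skorohod_topology (A k)"
  shows "compactin skorohod_topology (K0 \<union> (\<Union>k. A k \<inter> skorohod_topology closure_of skorohod_tube K0 k))"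
    (is "compactin _ (K0 \<union> (\<Union>k. ?B k))")
  unfolding compactin_def
proof (intro conjI allI impI)
  have B: "compactin skorohod_topology (?B k)" for k
    using A[of k] by (intro compact_Int_closedin) auto
  have K0c: "K0 \<subseteq> cadlag" using compactin_subset_topspace[OF K0] by (simp add: topspace_skorohod)
  then show "K0 \<union> (\<Union>k. ?B k) \<subseteq> topspace skorohod_topology"
    using compactin_subset_topspace[OF B] by (auto simp: topspace_skorohod)
  fix \<U> :: "(real \<Rightarrow> 'e) set set"
  assume \<U>: "Ball \<U> (openin skorohod_topology) \<and> K0 \<union> (\<Union>k. ?B k) \<subseteq> \<Union>\<U>"
  obtain \<F> where F: "finite \<F>" "\<F> \<subseteq> \<U>" "K0 \<subseteq> \<Union>\<F>"
    using compactinD[OF K0, of \<U>] \<U> by auto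
  have "openin skorohod_topology (\<Union>\<F>)" using F \<U> by blast
  from compactin_skorohod_open[OF K0 this F(3)] obtain T e where Te: "0 < T" "0 < e"
    "\<And>x. x \<in> K0 \<Longrightarrow> skorohod_nbhd x T e \<subseteq> \<Union>\<F>" by blast
  \<comment> \<open>A point of the closure of the \<open>k\<close>-th tube is within
    \<open>d\<close> of a point of the tube, which is within \<open>d\<close> of \<open>K0\<close>.
    So \<open>k\<close> has to exceed \<open>T\<close> and make \<open>2*d\<close> at most
    \<open>e\<close>.\<close>
  define m where "m = nat \<lceil>max T (2/e)\<rceil>"
  have tail: "?B k \<subseteq> \<Union>\<F>" if "k \<ge> m" for k
  proof
    fix y assume y: "y \<in> ?B k"
    define d where "d = 1 / (real k + 1)"
    have d: "0 < d" "d \<le> 1" by (auto simp: d_def)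
    have km: "real k \<ge> T" "real k \<ge> 2/e" using that by (auto simp: m_def nat_le_iff ceiling_le_iff)
    have de: "d + d \<le> e" using km Te(2) unfolding d_def by (simp add: field_simps)
    have yc: "y \<in> cadlag" using y closure_of_subset_topspace[of skorohod_topology "skorohod_tube K0 k"]
      by (auto simp: topspace_skorohod)
    obtain U where U: "openin skorohod_topology U" "y \<in> U" "U \<subseteq> skorohod_nbhd y (real k + 2) d"
      using skorohod_nbhd_contains_open[OF yc, of "real k + 2" d] d(1) by auto
    have "\<forall>V. y \<in> V \<and> openin skorohod_topology V \<longrightarrow> (\<exists>z. z \<in> skorohod_tube K0 k \<and> z \<in> V)"
      using y by (simp add: in_closure_of)
    with U(1,2) obtain z where z: "z \<in> U" "z \<in> skorohod_tube K0 k" by auto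
    then obtain x where x: "x \<in> K0" "z \<in> skorohod_nbhd x (real k + 1) d" unfolding skorohod_tube_def d_def by blast
    have "y \<in> skorohod_nbhd z (real k + 2 - d) d" using skorohod_nbhd_sym[of z y "real k + 2" d] U(3) z(1) yc by auto
    then have "y \<in> skorohod_nbhd z (real k + d) d"
      using skorohod_nbhd_mono[of "real k + d" "real k + 2 - d" d d z] d by auto
    moreover have "z \<in> skorohod_nbhd x (real k) d" using x skorohod_nbhd_mono[of "real k" "real k + 1" d d x] by auto
    ultimately have "y \<in> skorohod_nbhd x (real k) (d + d)" by (rule skorohod_nbhd_trans[rotated])
    then show "y \<in> \<Union>\<F>" using skorohod_nbhd_mono[of T "real k" "d + d" e x] km de Te(3)[OF x(1)] by blast
  qed
  have "\<exists>\<G>. finite \<G> \<and> \<G> \<subseteq> \<U> \<and> ?B k \<subseteq> \<Union>\<G>" for k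
  proof (rule compactinD[OF B])
    show "openin skorohod_topology U" if "U \<in> \<U>" for U using \<U> that by blast
    show "?B k \<subseteq> \<Union>\<U>" using \<U> by blast
  qed
  then obtain G where G: "\<And>k. finite (G k)" "\<And>k. G k \<subseteq> \<U>" "\<And>k. ?B k \<subseteq> \<Union>(G k)" by metis
  have "K0 \<union> (\<Union>k. ?B k) \<subseteq> \<Union>(\<F> \<union> (\<Union>k<m. G k))"
  proof -
    have "?B k \<subseteq> \<Union>(\<F> \<union> (\<Union>k<m. G k))" for k
    proof (cases "k < m")
      case True
      then have "G k \<subseteq> \<F> \<union> (\<Union>k<m. G k)" by blast
      then show ?thesis using G(3)[of k] by (meson Union_mono subset_trans)
    next
      case False
      then show ?thesis using tail[of k] by (simp add: le_supI1)
    qed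
    moreover have "K0 \<subseteq> \<Union>(\<F> \<union> (\<Union>k<m. G k))" using F(3) by (simp add: le_supI1)
    ultimately show ?thesis by (simp only: Un_least UN_least)
  qed
  moreover have "finite (\<F> \<union> (\<Union>k<m. G k))" using F(1) G(1) by simp
  moreover have "\<F> \<union> (\<Union>k<m. G k) \<subseteq> \<U>" using F(2) G(2) by (simp add: UN_least)
  ultimately show "\<exists>\<F>. finite \<F> \<and> \<F> \<subseteq> \<U> \<and> K0 \<union> (\<Union>k. ?B k) \<subseteq> \<Union>\<F>" by blast
qed

section \<open>Borel sets of path space\<close>

lemma space_skorohod_borel [simp]: "space skorohod_borel = cadlag"
  unfolding skorohod_borel_def by (rule space_measure_of) (auto simp: openin_skorohod)

lemma sets_skorohod_borel: "sets skorohod_borel = sigma_sets cadlag {U. openin skorohod_topology U}"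
  unfolding skorohod_borel_def by (rule sets_measure_of) (auto simp: openin_skorohod)

lemma open_in_skorohod_borel: "openin skorohod_topology U \<Longrightarrow> U \<in> sets skorohod_borel"
  by (auto simp: sets_skorohod_borel)

lemma closed_in_skorohod_borel:
  assumes "closedin skorohod_topology K" shows "K \<in> sets skorohod_borel"
proof -
  have "cadlag - K \<in> sets skorohod_borel" "K \<subseteq> cadlag"
    using assms by (auto simp: closedin_def topspace_skorohod intro: open_in_skorohod_borel)
  then have "space skorohod_borel - (cadlag - K) \<in> sets skorohod_borel" by blast
  moreover have "space skorohod_borel - (cadlag - K) = K" using \<open>K \<subseteq> cadlag\<close> by auto
  ultimately show ?thesis by simp
qed

lemma compact_in_skorohod_borel: "compactin skorohod_topology K \<Longrightarrow> K \<in> sets skorohod_borel"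
  by (intro closed_in_skorohod_borel compactin_imp_closedin Hausdorff_skorohod)

lemma continuous_skorohod_borel_measurable:
  assumes "continuous_map skorohod_topology euclideanreal h"
  shows "h \<in> borel_measurable skorohod_borel"
proof (rule borel_measurableI)
  fix S :: "real set" assume "open S"
  then have "openin skorohod_topology {x \<in> topspace skorohod_topology. h x \<in> S}"
    by (intro openin_continuous_map_preimage[OF assms]) auto
  moreover have "{x \<in> topspace skorohod_topology. h x \<in> S} = h -` S \<inter> space skorohod_borel"
    by (auto simp: topspace_skorohod)
  ultimately show "h -` S \<inter> space skorohod_borel \<in> sets skorohod_borel"
    using open_in_skorohod_borel by metis
qed

text \<open>Path-valued random variables are obtained as continuous images of parameters whose Borel
  sets are known coordinatewise. Preimages of open sets are open relative to \<open>P\<close>, and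
  since \<open>p\<close> takes values in \<open>P\<close> they may be replaced by open sets of the
  whole parameter space.\<close>

lemma measurable_skorohod_borel:
  fixes g :: "'p::topological_space \<Rightarrow> real \<Rightarrow> 'e::metric_space"
  assumes g: "continuous_map (top_of_set P) skorohod_topology g"
    and p: "p \<in> borel_measurable N" "\<And>w. w \<in> space N \<Longrightarrow> p w \<in> P"
  shows "(\<lambda>w. g (p w)) \<in> measurable N skorohod_borel"
  unfolding skorohod_borel_def
proof (rule measurable_measure_of)
  show "{U. openin skorohod_topology U} \<subseteq> Pow cadlag" by (auto simp: openin_skorohod)
  show "(\<lambda>w. g (p w)) \<in> space N \<rightarrow> cadlag"
    using continuous_map_funspace[OF g] p(2) by (auto simp: topspace_skorohod)
  fix U :: "(real \<Rightarrow> 'e) set" assume "U \<in> {U. openin skorohod_topology U}"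
  then have "openin (top_of_set P) {x \<in> P. g x \<in> U}"
    using openin_continuous_map_preimage[OF g] by auto
  then obtain V where V: "open V" "{x \<in> P. g x \<in> U} = P \<inter> V" by (auto simp: openin_open)
  have "(\<lambda>w. g (p w)) -` U \<inter> space N = p -` V \<inter> space N" using V(2) p(2) by blast
  also have "\<dots> \<in> sets N" using p(1) V(1) by (simp add: measurable_sets_borel)
  finally show "(\<lambda>w. g (p w)) -` U \<inter> space N \<in> sets N" .
qed

lemma finite_separation:
  obtains d where "0 < d" "\<And>i j :: 'q::{finite,metric_space}. dist i j < d \<Longrightarrow> i = j"
proof -
  define D where "D = {dist i j | i j :: 'q. i \<noteq> j}"
  have "D \<subseteq> (\<lambda>p :: 'q \<times> 'q. dist (fst p) (snd p)) ` UNIV"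
  proof
    fix a assume "a \<in> D"
    then obtain i j :: 'q where "a = dist i j" by (auto simp: D_def)
    then show "a \<in> (\<lambda>p :: 'q \<times> 'q. dist (fst p) (snd p)) ` UNIV" by (intro image_eqI[of _ _ "(i, j)"]) auto
  qed
  then have "finite D" by (rule finite_subset) simp
  have pos: "0 < a" if "a \<in> D" for a using that unfolding D_def by fastforce
  have "0 < Min (insert 1 D)" using \<open>finite D\<close> pos by (simp add: Min_gr_iff)
  moreover have "i = j" if "dist i j < Min (insert 1 D)" for i j :: 'q
  proof (rule ccontr)
    assume "i \<noteq> j"
    then have "dist i j \<in> D" unfolding D_def by blast
    then have "Min (insert 1 D) \<le> dist i j" using \<open>finite D\<close> by (intro Min_le) auto
    then show False using that by simp
  qed
  ultimately show thesis by (rule that)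
qed

text \<open>Evaluation at a fixed time is not continuous on path space. By right continuity and
  discreteness the event is the union of the sets \<open>V m\<close>, on which the second component
  equals \<open>q\<close> immediately after \<open>t\<close>. These are closed: a violation occurs
  at an inner point of an open time interval and survives a small time change.\<close>

lemma measurable_skorohod_snd:
  fixes q :: "'q::{finite,metric_space}"
  assumes t: "0 \<le> t"
  shows "{z \<in> cadlag. snd (z t) = q} \<in> sets (skorohod_borel :: (real \<Rightarrow> 'e::metric_space \<times> 'q) measure)"
proof -
  obtain d where d: "0 < d" "\<And>i j :: 'q. dist i j < d \<Longrightarrow> i = j" using finite_separation by metis
  define V :: "nat \<Rightarrow> (real \<Rightarrow> 'e \<times> 'q) set" where "V m = {z \<in> cadlag. \<forall>u\<in>{t<..<t + inverse (Suc m)}. snd (z u) = q}" for m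
  have VB: "V m \<in> sets (skorohod_borel :: (real \<Rightarrow> 'e \<times> 'q) measure)" for m
  proof (rule closed_in_skorohod_borel)
    have "openin skorohod_topology (cadlag - V m :: (real \<Rightarrow> 'e \<times> 'q) set)"
      unfolding openin_skorohod
    proof (intro conjI ballI)
      fix x :: "real \<Rightarrow> 'e \<times> 'q" assume x: "x \<in> cadlag - V m"
      then obtain u where u: "t < u" "u < t + inverse (Suc m)" "snd (x u) \<noteq> q" by (auto simp: V_def)
      define e where "e = Min {d, u - t, t + inverse (Suc m) - u}"
      have e: "0 < e" "e \<le> d" "e \<le> u - t" "e \<le> t + inverse (Suc m) - u" using u d by (auto simp: e_def)
      have "skorohod_nbhd x u e \<subseteq> cadlag - V m"
      proof
        fix y assume y: "y \<in> skorohod_nbhd x u e"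
        then obtain k where k: "\<forall>t\<ge>0. \<bar>k t - t\<bar> < e" "\<forall>t\<in>{0..u}. dist (y (k t)) (x t) < e"
          by (auto simp: skorohod_nbhd_def)
        have k: "\<bar>k u - u\<bar> < e" "dist (y (k u)) (x u) < e" using k u t by auto
        have "dist (snd (y (k u))) (snd (x u)) < d" using k(2) e dist_snd_le[of "y (k u)" "x u"] by linarith
        then have "snd (y (k u)) \<noteq> q" using d(2) u(3) by metis
        moreover have "k u \<in> {t<..<t + inverse (Suc m)}" using k(1) e by auto
        ultimately show "y \<in> cadlag - V m" using skorohod_nbhd_cadlag[OF y] by (auto simp: V_def)
      qed
      then show "\<exists>T>0. \<exists>e>0. skorohod_nbhd x T e \<subseteq> cadlag - V m" using e u t by (meson le_less_trans)
    qed auto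
    then show "closedin skorohod_topology (V m :: (real \<Rightarrow> 'e \<times> 'q) set)"
      by (auto simp: closedin_def topspace_skorohod V_def)
  qed
  have "{z \<in> cadlag. snd (z t) = q} = (\<Union>m. V m :: (real \<Rightarrow> 'e \<times> 'q) set)"
  proof safe
    fix z :: "real \<Rightarrow> 'e \<times> 'q" assume z: "z \<in> cadlag" "q = snd (z t)"
    obtain u where u: "u > t" "\<forall>s\<in>{t..<u}. dist (z s) (z t) < d" using cadlag_at_rightD[OF z(1) t d(1)] by blast
    obtain m where m: "inverse (Suc m) < u - t" using u(1) reals_Archimedean[of "u - t"] by auto
    have "snd (z s) = snd (z t)" if "t < s" "s < t + inverse (Suc m)" for s
    proof -
      have "dist (snd (z s)) (snd (z t)) < d"
        using u(2)[rule_format, of s] that m dist_snd_le[of "z s" "z t"] by auto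
      then show ?thesis by (rule d(2))
    qed
    then show "z \<in> (\<Union>m. V m)" using z by (auto simp: V_def intro!: exI[of _ m])
  next
    fix z :: "real \<Rightarrow> 'e \<times> 'q" and m assume z: "z \<in> V m"
    then have zc: "z \<in> cadlag" by (simp add: V_def)
    then show "z \<in> cadlag" .
    obtain u where u: "u > t" "\<forall>s\<in>{t..<u}. dist (z s) (z t) < d" using cadlag_at_rightD[OF zc t d(1)] by blast
    obtain s where s: "t < s" "s < min u (t + inverse (Suc m))"
      using dense[of t "min u (t + inverse (Suc m))"] u by auto
    have "dist (snd (z s)) (snd (z t)) < d" using u(2)[rule_format, of s] s dist_snd_le[of "z s" "z t"] by auto
    then have "snd (z s) = snd (z t)" by (rule d(2))
    then show "snd (z t) = q" using z s by (auto simp: V_def)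
  qed
  then show ?thesis using VB by auto
qed

section \<open>Step paths\<close>

definition jump_times :: "(nat \<Rightarrow> real) set" where
  "jump_times = {\<tau>. \<tau> 0 = 0 \<and> strict_mono \<tau> \<and> (\<forall>T. \<exists>k. T < \<tau> k)}"

text \<open>For \<open>\<tau>\<close> in \<open>jump_times\<close> this is the number of jumps in
  the half-open interval from 0, excluded, to \<open>t\<close>, included.\<close>

definition step_index :: "(nat \<Rightarrow> real) \<Rightarrow> real \<Rightarrow> nat" where
  "step_index \<tau> t = (LEAST k. t < \<tau> (Suc k))"

definition step_path :: "(nat \<Rightarrow> real) \<Rightarrow> (nat \<Rightarrow> 'e) \<Rightarrow> real \<Rightarrow> 'e" where
  "step_path \<tau> x = (\<lambda>t\<in>{0..}. x (step_index \<tau> t))"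

lemma jump_times_mono: "\<tau> \<in> jump_times \<Longrightarrow> k \<le> l \<Longrightarrow> \<tau> k \<le> \<tau> l"
  by (simp add: jump_times_def strict_mono_less_eq)

lemma jump_times_Suc: "\<tau> \<in> jump_times \<Longrightarrow> \<tau> k < \<tau> (Suc k)"
  by (simp add: jump_times_def strict_mono_Suc_iff)

lemma jump_times_0: "\<tau> \<in> jump_times \<Longrightarrow> \<tau> 0 = 0"
  by (simp add: jump_times_def)

lemma jump_times_ge0: "\<tau> \<in> jump_times \<Longrightarrow> 0 \<le> \<tau> k"
  using jump_times_mono[of \<tau> 0 k] by (simp add: jump_times_0)

lemma step_index_bounds:
  assumes "\<tau> \<in> jump_times" "0 \<le> t"
  shows "\<tau> (step_index \<tau> t) \<le> t" "t < \<tau> (Suc (step_index \<tau> t))"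
proof -
  obtain k where k: "t < \<tau> k" using assms by (auto simp: jump_times_def)
  then obtain m where "t < \<tau> (Suc m)" using jump_times_Suc[OF assms(1), of k] by (metis order.strict_trans)
  then show "t < \<tau> (Suc (step_index \<tau> t))" unfolding step_index_def by (rule LeastI)
  show "\<tau> (step_index \<tau> t) \<le> t"
  proof (cases "step_index \<tau> t")
    case 0 then show ?thesis using assms by (simp add: jump_times_0)
  next
    case (Suc l)
    then have "\<not> t < \<tau> (Suc l)" unfolding step_index_def by (intro not_less_Least) simp
    then show ?thesis using Suc by simp
  qed
qed

lemma step_index_eqI:
  assumes "\<tau> \<in> jump_times" "\<tau> k \<le> t" "t < \<tau> (Suc k)"
  shows "step_index \<tau> t = k"
proof (rule antisym)
  show "step_index \<tau> t \<le> k" unfolding step_index_def by (rule Least_le) (rule assms(3))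
  have "0 \<le> t" using assms(2) jump_times_ge0[OF assms(1), of k] by simp
  note b = step_index_bounds[OF assms(1) this]
  have "\<tau> k < \<tau> (Suc (step_index \<tau> t))" using b(2) assms(2) by simp
  then have "k < Suc (step_index \<tau> t)" using assms(1) by (simp add: jump_times_def strict_mono_less)
  then show "k \<le> step_index \<tau> t" by simp
qed

lemma step_index_near:
  assumes J: "\<tau> \<in> jump_times" and t: "0 \<le> t"
  shows "\<exists>d>0. \<forall>s\<in>{t..<t+d}. step_index \<tau> s = step_index \<tau> t"
    and "0 < t \<Longrightarrow> \<exists>d>0. \<exists>k. \<forall>s\<in>{t-d..<t}. 0 \<le> s \<and> step_index \<tau> s = k"
proof -
  let ?k = "step_index \<tau> t"
  note b = step_index_bounds[OF J t]
  show "\<exists>d>0. \<forall>s\<in>{t..<t+d}. step_index \<tau> s = step_index \<tau> t"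
    using b by (intro exI[of _ "\<tau> (Suc ?k) - t"]) (auto intro!: step_index_eqI[OF J])
  assume t: "0 < t"
  show "\<exists>d>0. \<exists>k. \<forall>s\<in>{t-d..<t}. 0 \<le> s \<and> step_index \<tau> s = k"
  proof (cases "\<tau> ?k < t")
    case True
    then show ?thesis using b jump_times_ge0[OF J, of ?k]
      by (intro exI[of _ "t - \<tau> ?k"] conjI exI[of _ ?k]) (auto intro!: step_index_eqI[OF J])
  next
    case False
    then have "\<tau> ?k = t" using b by simp
    moreover from this t jump_times_0[OF J] obtain l where l: "?k = Suc l" by (cases ?k) auto
    ultimately show ?thesis using jump_times_ge0[OF J, of l] jump_times_Suc[OF J, of l]
      by (intro exI[of _ "t - \<tau> l"] conjI exI[of _ l]) (auto intro!: step_index_eqI[OF J])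
  qed
qed

lemma step_path_near:
  assumes J: "\<tau> \<in> jump_times" and t: "0 \<le> t"
  shows "eventually (\<lambda>s. step_path \<tau> x s = step_path \<tau> x t) (at_right t)"
    and "0 < t \<Longrightarrow> \<exists>c. eventually (\<lambda>s. step_path \<tau> x s = c) (at_left t)"
proof -
  obtain d where d: "d > 0" "\<forall>s\<in>{t..<t+d}. step_index \<tau> s = step_index \<tau> t"
    using step_index_near(1)[OF J t] by blast
  show "eventually (\<lambda>s. step_path \<tau> x s = step_path \<tau> x t) (at_right t)"
    unfolding eventually_at_right_field
  proof (intro exI[of _ "t+d"] conjI allI impI)
    fix s assume "t < s" "s < t + d"
    then have "step_index \<tau> s = step_index \<tau> t" by (intro d(2)[rule_format]) simp
    then show "step_path \<tau> x s = step_path \<tau> x t" using t \<open>t < s\<close> by (simp add: step_path_def)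
  qed (use d in simp)
  assume "0 < t"
  then obtain d k where d: "d > 0" "\<forall>s\<in>{t-d..<t}. 0 \<le> s \<and> step_index \<tau> s = k"
    using step_index_near(2)[OF J t] by metis
  have "eventually (\<lambda>s. step_path \<tau> x s = x k) (at_left t)"
    unfolding eventually_at_left_field
  proof (intro exI[of _ "t-d"] conjI allI impI)
    fix s assume "t - d < s" "s < t"
    then have "0 \<le> s" "step_index \<tau> s = k" using d(2)[rule_format, of s] by auto
    then show "step_path \<tau> x s = x k" by (simp add: step_path_def)
  qed (use d in simp)
  then show "\<exists>c. eventually (\<lambda>s. step_path \<tau> x s = c) (at_left t)" by blast
qed

lemma step_path_cadlag:
  fixes x :: "nat \<Rightarrow> 'e::metric_space"
  assumes J: "\<tau> \<in> jump_times" shows "step_path \<tau> x \<in> cadlag"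
  unfolding cadlag_def
proof (intro CollectI conjI allI impI)
  show "step_path \<tau> x \<in> extensional {0..}" by (simp add: step_path_def)
  show "continuous (at_right t) (step_path \<tau> x)" if "0 \<le> t" for t
    unfolding continuous_within using step_path_near(1)[OF J that] by (rule tendsto_eventually)
  show "\<exists>l. (step_path \<tau> x \<longlongrightarrow> l) (at_left t)" if "0 < t" for t
    using step_path_near(2)[OF J _ that] that by (metis less_imp_le tendsto_eventually)
qed

section \<open>Time changes that match jump times\<close>

lemma linear_piece_time_change:
  fixes a p q :: real
  assumes "0 \<le> a" "0 < p" "0 < q"
  shows "(\<lambda>u. if u \<le> a then u else if u \<le> a + p then a + (u - a) * (q / p) else u + (q - p)) \<in> time_changes"
proof -
  define f where "f p q u = (if u \<le> a then u else if u \<le> a + p then a + (u - a) * (q / p) else u + (q - p))"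
    for p q u :: real
  have low: "a < f p q u" if "0 < p" "0 < q" "a < u" for p q u
    using that by (auto simp: f_def not_le intro!: divide_pos_pos mult_pos_pos)
  have high: "f p q u \<le> a + q" if "0 < p" "0 < q" "u \<le> a + p" for p q u
    using that by (auto simp: f_def divide_le_eq mult_right_mono)
  \<comment> \<open>Exchanging \<open>p\<close> and \<open>q\<close> gives the inverse map, which
    settles surjectivity.\<close>
  have inv: "f p q (f q p x) = x" if pq: "0 < p" "0 < q" for p q x
  proof -
    consider "x \<le> a" | "a < x" "x \<le> a + q" | "a + q < x" by linarith
    then show ?thesis
    proof cases
      case 2
      have "f q p x \<le> a + p" "a < f q p x" using high[OF pq(2,1) 2(2)] low[OF pq(2,1) 2(1)] by auto
      then have "f p q (f q p x) = a + (f q p x - a) * (q / p)" by (simp add: f_def)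
      also have "\<dots> = x" using 2 pq by (simp add: f_def)
      finally show ?thesis .
    qed (use pq in \<open>auto simp: f_def\<close>)
  qed
  have "f p q \<in> time_changes"
  proof (rule time_changesI)
    show "f p q s < f p q t" if "0 \<le> s" "s < t" for s t
    proof -
      consider "s \<le> a" "t \<le> a" | "s \<le> a" "a < t" | "a < s" "t \<le> a + p" | "a < s" "s \<le> a + p" "a + p < t" | "a + p < s"
        by linarith
      then show ?thesis
      proof cases
        case 2 then show ?thesis using low[OF assms(2,3), of t] by (simp add: f_def[of _ _ s])
      next
        case 3 then show ?thesis using that assms by (simp add: f_def divide_strict_right_mono)
      next
        case 4
        moreover have "f p q t = t + (q - p)" using 4 assms by (simp add: f_def)
        ultimately show ?thesis using high[OF assms(2,3), of s] by linarith
      qed (use that assms in \<open>auto simp: f_def\<close>)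
    qed
    have nn: "0 \<le> f p q u" if "0 < p" "0 < q" "0 \<le> u" for p q u
      using low[OF that(1,2), of u] that assms by (cases "u \<le> a") (auto simp: f_def[of _ _ u])
    show "f p q ` {0..} = {0..}"
    proof (intro equalityI subsetI)
      fix x assume "x \<in> f p q ` {0..}"
      then show "x \<in> {0..}" using nn assms by auto
    next
      fix x :: real assume x: "x \<in> {0..}"
      then show "x \<in> f p q ` {0..}"
        using inv[of p q x] nn[of q p x] assms by (intro image_eqI[of _ _ "f q p x"]) auto
    qed
  qed
  then show ?thesis unfolding f_def .
qed

text \<open>Induction over the jumps. Behind the last matched jump the time change is a translation,
  which is why the last conclusion is carried along; the next gap is then stretched to its new
  length by a linear piece that fixes everything up to \<open>\<sigma> K\<close>.\<close>

lemma time_change_matching: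
  assumes J: "\<tau> \<in> jump_times" "\<sigma> \<in> jump_times" and e: "\<And>k. k \<le> K \<Longrightarrow> \<bar>\<sigma> k - \<tau> k\<bar> \<le> e"
  shows "\<exists>\<kappa>\<in>time_changes. (\<forall>k\<le>K. \<kappa> (\<tau> k) = \<sigma> k) \<and> (\<forall>t\<ge>0. \<bar>\<kappa> t - t\<bar> \<le> e) \<and>
     (\<forall>t\<ge>\<tau> K. \<kappa> t = t + (\<sigma> K - \<tau> K))"
  using e
proof (induction K)
  case 0
  then show ?case using J by (intro bexI[of _ "\<lambda>t. t"]) (auto simp: jump_times_0 time_changes_id)
next
  case (Suc K)
  then obtain \<kappa> where k: "\<kappa> \<in> time_changes" "\<And>k. k \<le> K \<Longrightarrow> \<kappa> (\<tau> k) = \<sigma> k"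
    "\<And>t. t \<ge> 0 \<Longrightarrow> \<bar>\<kappa> t - t\<bar> \<le> e" "\<And>t. t \<ge> \<tau> K \<Longrightarrow> \<kappa> t = t + (\<sigma> K - \<tau> K)"
    by (metis le_SucI)
  define p q a where "p = \<tau> (Suc K) - \<tau> K" and "q = \<sigma> (Suc K) - \<sigma> K" and "a = \<sigma> K"
  have pq: "0 < p" "0 < q" "0 \<le> a" using jump_times_Suc[OF J(1), of K] jump_times_Suc[OF J(2), of K]
      jump_times_ge0[OF J(2), of K] by (auto simp: p_def q_def a_def)
  define \<phi> where "\<phi> u = (if u \<le> a then u else if u \<le> a + p then a + (u - a) * (q / p) else u + (q - p))" for u
  have phi: "\<phi> \<in> time_changes"
    unfolding \<phi>_def using linear_piece_time_change[OF pq(3,1,2)] by simp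
  have phi': "\<phi> u = u + (q - p)" if "u \<ge> a + p" for u
    using that pq by (cases "u = a + p") (auto simp: \<phi>_def)
  show ?case
  proof (intro bexI[of _ "\<lambda>t. \<phi> (\<kappa> t)"] conjI allI impI)
    show "(\<lambda>t. \<phi> (\<kappa> t)) \<in> time_changes" by (rule time_changes_comp[OF k(1) phi])
    have K1: "\<kappa> (\<tau> (Suc K)) = a + p"
      using k(4)[of "\<tau> (Suc K)"] jump_times_Suc[OF J(1), of K] by (simp add: a_def p_def)
    show "\<phi> (\<kappa> (\<tau> k)) = \<sigma> k" if "k \<le> Suc K" for k
    proof (cases "k = Suc K")
      case True then show ?thesis using K1 phi'[of "a + p"] by (simp add: a_def p_def q_def)
    next
      case False
      then have "\<kappa> (\<tau> k) = \<sigma> k" "\<sigma> k \<le> a" using k(2)[of k] jump_times_mono[OF J(2), of k K] that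
        by (auto simp: a_def)
      then show ?thesis by (simp add: \<phi>_def)
    qed
    show tail: "\<phi> (\<kappa> t) = t + (\<sigma> (Suc K) - \<tau> (Suc K))" if "\<tau> (Suc K) \<le> t" for t
      using k(4)[of t] phi'[of "\<kappa> t"] that jump_times_Suc[OF J(1), of K]
      by (simp add: a_def p_def q_def)
    fix t :: real assume t: "0 \<le> t"
    consider "t \<le> \<tau> K" | "\<tau> K < t" "t \<le> \<tau> (Suc K)" | "\<tau> (Suc K) \<le> t" by linarith
    then show "\<bar>\<phi> (\<kappa> t) - t\<bar> \<le> e"
    proof cases
      case 1
      then have "\<kappa> t \<le> a"
        using time_changes_less[OF k(1) t, of "\<tau> K"] k(2)[of K] by (cases "t = \<tau> K") (auto simp: a_def)
      then show ?thesis using k(3)[OF t] by (simp add: \<phi>_def)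
    next
      case 2
      define s where "s = (t - \<tau> K) / p"
      have s: "0 \<le> s" "s \<le> 1" "t = \<tau> K + s * p" using 2 pq unfolding s_def by (auto simp: p_def)
      have "\<kappa> t = a + s * p" using k(4)[of t] 2 s(3) by (simp add: a_def)
      moreover have "s * p \<le> p" using s(2) pq by simp
      moreover have "0 < s * p" using s(3) 2(1) by simp
      ultimately have "\<phi> (\<kappa> t) = a + s * q" using pq by (auto simp: \<phi>_def)
      then have "\<phi> (\<kappa> t) - t = a + s * q - (\<tau> K + s * p)" using s(3) by simp
      \<comment> \<open>Between two jumps the displacement interpolates linearly between the
        displacements at the two jumps, so it inherits their bound.\<close>
      then have "\<phi> (\<kappa> t) - t = (1 - s) * (\<sigma> K - \<tau> K) + s * (\<sigma> (Suc K) - \<tau> (Suc K))"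
        by (simp add: a_def q_def p_def algebra_simps)
      also have "\<bar>\<dots>\<bar> \<le> (1 - s) * \<bar>\<sigma> K - \<tau> K\<bar> + s * \<bar>\<sigma> (Suc K) - \<tau> (Suc K)\<bar>"
        using s abs_triangle_ineq[of "(1 - s) * (\<sigma> K - \<tau> K)" "s * (\<sigma> (Suc K) - \<tau> (Suc K))"]
        by (simp add: abs_mult)
      also have "\<dots> \<le> (1 - s) * e + s * e"
        using s Suc.prems[of K] Suc.prems[of "Suc K"] by (intro add_mono mult_left_mono) auto
      finally show ?thesis by (simp add: algebra_simps)
    next
      case 3
      then show ?thesis using tail Suc.prems[of "Suc K"] by simp
    qed
  qed
qed

text \<open>Up to time \<open>T\<close> only finitely many jumps matter, and their convergence is
  uniform. As the jump times are matched exactly, the indices agree at all times up to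
  \<open>T\<close>, and the bound \<open>K\<close> leaves only finitely many states to
  compare.\<close>

lemma step_index_time_change:
  assumes J: "\<tau> \<in> jump_times" "\<And>n. \<sigma> n \<in> jump_times" and lim: "\<And>k. (\<lambda>n. \<sigma> n k) \<longlonglongrightarrow> \<tau> k" and e: "0 < e"
  shows "\<exists>K. eventually (\<lambda>n. \<exists>\<kappa>\<in>time_changes. (\<forall>t\<ge>0. \<bar>\<kappa> t - t\<bar> < e) \<and>
     (\<forall>t\<in>{0..T}. step_index \<tau> t < K \<and> step_index (\<sigma> n) (\<kappa> t) = step_index \<tau> t)) sequentially"
proof -
  obtain K where K: "T < \<tau> K" using J(1) by (auto simp: jump_times_def)
  have "eventually (\<lambda>n. \<forall>k\<in>{..K}. \<bar>\<sigma> n k - \<tau> k\<bar> < e / 2) sequentially"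
    using tendstoD[OF lim, of "e/2"] e by (subst eventually_ball_finite_distrib) (auto simp: dist_real_def simp del: less_divide_eq_numeral1)
  then have "eventually (\<lambda>n. \<exists>\<kappa>\<in>time_changes. (\<forall>t\<ge>0. \<bar>\<kappa> t - t\<bar> < e) \<and>
     (\<forall>t\<in>{0..T}. step_index \<tau> t < K \<and> step_index (\<sigma> n) (\<kappa> t) = step_index \<tau> t)) sequentially"
  proof eventually_elim
    case (elim n)
    then have "\<And>k. k \<le> K \<Longrightarrow> \<bar>\<sigma> n k - \<tau> k\<bar> \<le> e / 2" by force
    from time_change_matching[OF J(1) J(2)[of n] this] obtain \<kappa> where k: "\<kappa> \<in> time_changes"
      "\<And>k. k \<le> K \<Longrightarrow> \<kappa> (\<tau> k) = \<sigma> n k" "\<And>t. t \<ge> 0 \<Longrightarrow> \<bar>\<kappa> t - t\<bar> \<le> e / 2" by blast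
    have "step_index \<tau> t < K \<and> step_index (\<sigma> n) (\<kappa> t) = step_index \<tau> t" if t: "t \<in> {0..T}" for t
    proof -
      let ?k = "step_index \<tau> t"
      have t0: "0 \<le> t" using t by simp
      note b = step_index_bounds[OF J(1) t0]
      have "\<tau> ?k < \<tau> K" using b(1) t K by simp
      then have kK: "?k < K" using J(1) by (simp add: jump_times_def strict_mono_less)
      have "\<kappa> (\<tau> ?k) \<le> \<kappa> t"
        using time_changes_less[OF k(1) jump_times_ge0[OF J(1)], of ?k t] b(1) by (cases "\<tau> ?k = t") auto
      moreover have "\<kappa> t < \<kappa> (\<tau> (Suc ?k))" by (rule time_changes_less[OF k(1) t0 b(2)])
      ultimately have "step_index (\<sigma> n) (\<kappa> t) = ?k"
        using kK k(2)[of ?k] k(2)[of "Suc ?k"] by (intro step_index_eqI[OF J(2)]) auto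
      with kK show ?thesis by blast
    qed
    moreover have "\<bar>\<kappa> t - t\<bar> < e" if "0 \<le> t" for t using k(3)[OF that] e by linarith
    ultimately show ?case using k(1) by blast
  qed
  then show ?thesis by blast
qed

lemma step_path_tendsto:
  fixes x :: "nat \<Rightarrow> 'e::metric_space"
  assumes J: "\<tau> \<in> jump_times" "\<And>n. \<sigma> n \<in> jump_times" and lim: "\<And>k. (\<lambda>n. \<sigma> n k) \<longlonglongrightarrow> \<tau> k"
    and x: "\<And>k. (\<lambda>n. X n k) \<longlonglongrightarrow> x k" and e: "0 < e"
  shows "eventually (\<lambda>n. step_path (\<sigma> n) (X n) \<in> skorohod_nbhd (step_path \<tau> x) T e) sequentially"
proof -
  obtain K where K: "eventually (\<lambda>n. \<exists>\<kappa>\<in>time_changes. (\<forall>t\<ge>0. \<bar>\<kappa> t - t\<bar> < e) \<and>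
     (\<forall>t\<in>{0..T}. step_index \<tau> t < K \<and> step_index (\<sigma> n) (\<kappa> t) = step_index \<tau> t)) sequentially"
    using step_index_time_change[OF J lim e] by blast
  have "eventually (\<lambda>n. \<forall>k\<in>{..<K}. dist (X n k) (x k) < e) sequentially"
    using x e by (subst eventually_ball_finite_distrib) (auto simp: tendsto_iff)
  with K show ?thesis
  proof eventually_elim
    case (elim n)
    then obtain \<kappa> where k: "\<kappa> \<in> time_changes" "\<forall>t\<ge>0. \<bar>\<kappa> t - t\<bar> < e"
      "\<And>t. t \<in> {0..T} \<Longrightarrow> step_index \<tau> t < K \<and> step_index (\<sigma> n) (\<kappa> t) = step_index \<tau> t" by blast
    have "dist (step_path (\<sigma> n) (X n) (\<kappa> t)) (step_path \<tau> x t) < e" if "t \<in> {0..T}" for t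
      using elim(2) k(3)[OF that] time_changes_ge0[OF k(1), of t] that by (auto simp: step_path_def)
    then show ?case using k step_path_cadlag[OF J(2)] unfolding skorohod_nbhd_def by blast
  qed
qed

text \<open>Approximating jump times may lie on either side of a jump time of the limit, so
  \<open>s\<close> has to avoid those. The index 0 is exempt because all these sequences start at
  time 0.\<close>

lemma step_path_eventually:
  fixes j :: "nat \<Rightarrow> 'e"
  assumes J: "\<tau> \<in> jump_times" "\<And>n. \<sigma> n \<in> jump_times" and lim: "\<And>k. (\<lambda>n. \<sigma> n k) \<longlonglongrightarrow> \<tau> k"
    and j: "\<And>k. eventually (\<lambda>n. i n k = j k) sequentially" and s: "0 \<le> s" "\<And>k. 0 < k \<Longrightarrow> \<tau> k \<noteq> s"
  shows "eventually (\<lambda>n. step_path (\<sigma> n) (i n) s = step_path \<tau> j s) sequentially"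
proof -
  let ?k = "step_index \<tau> s"
  have b: "\<tau> ?k \<le> s" "s < \<tau> (Suc ?k)" using step_index_bounds[OF J(1) s(1)] .
  have "eventually (\<lambda>n. \<sigma> n ?k \<le> s) sequentially"
  proof (cases ?k)
    case 0
    then show ?thesis using jump_times_0[OF J(2)] s(1) by simp
  next
    case (Suc m)
    then have "\<tau> ?k < s" using b(1) s(2)[of ?k] by simp
    then show ?thesis using order_tendstoD(2)[OF lim, of ?k s] by (auto elim: eventually_mono)
  qed
  moreover have "eventually (\<lambda>n. s < \<sigma> n (Suc ?k)) sequentially"
    using order_tendstoD(1)[OF lim b(2)] .
  ultimately show ?thesis using j[of ?k]
  proof eventually_elim
    case (elim n)
    then have "step_index (\<sigma> n) s = ?k" by (intro step_index_eqI[OF J(2)]) auto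
    then show ?case using elim s by (simp add: step_path_def)
  qed
qed

lemma mesh_jump_times: "0 < \<mu> \<Longrightarrow> (\<lambda>k. real k * \<mu>) \<in> jump_times"
  using reals_Archimedean3[of \<mu>] unfolding jump_times_def by (auto simp: strict_mono_def)

lemma interpolate_eq_step_path:
  assumes "0 < \<mu>" shows "interpolate \<mu> x = step_path (\<lambda>k. real k * \<mu>) x"
proof -
  have "nat \<lfloor>t / \<mu>\<rfloor> = step_index (\<lambda>k. real k * \<mu>) t" if "0 \<le> t" for t
  proof (rule step_index_eqI[OF mesh_jump_times[OF assms], symmetric])
    have f: "real (nat \<lfloor>t / \<mu>\<rfloor>) = of_int \<lfloor>t / \<mu>\<rfloor>" using assms that by simp
    show "real (nat \<lfloor>t / \<mu>\<rfloor>) * \<mu> \<le> t" unfolding f using assms that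
      by (metis divide_le_eq of_int_floor_le pos_le_divide_eq)
    have "t / \<mu> < of_int \<lfloor>t / \<mu>\<rfloor> + 1" by linarith
    then have "t < (of_int \<lfloor>t / \<mu>\<rfloor> + 1) * \<mu>" using assms by (simp only: divide_less_eq if_True)
    then show "t < real (Suc (nat \<lfloor>t / \<mu>\<rfloor>)) * \<mu>" unfolding of_nat_Suc f by (simp only: add.commute)
  qed
  then show ?thesis unfolding interpolate_def step_path_def by (auto simp: restrict_def)
qed

section \<open>Exponentially weighted averages\<close>

text \<open>Variation of constants: where \<open>g\<close> is continuous this solves x' = g - x,
  with value 0 at time 0. The integral form also makes sense across the jumps of
  \<open>g\<close>.\<close>

definition exp_conv :: "(real \<Rightarrow> 'v::euclidean_space) \<Rightarrow> real \<Rightarrow> 'v" where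
  "exp_conv g t = integral {0..t} (\<lambda>s. exp (s - t) *\<^sub>R g s)"

lemma bounded_borel_integrable_on:
  fixes g :: "real \<Rightarrow> 'v::euclidean_space"
  assumes g: "g \<in> borel_measurable borel" "\<And>s. norm (g s) \<le> C"
  shows "(\<lambda>s. exp (s - t) *\<^sub>R g s) integrable_on {a..b}"
proof (rule measurable_bounded_by_integrable_imp_integrable)
  have "(\<lambda>s. exp (s - t) *\<^sub>R g s) \<in> borel_measurable borel" using g by measurable
  then show "(\<lambda>s. exp (s - t) *\<^sub>R g s) \<in> borel_measurable (lebesgue_on {a..b})"
    by (intro measurable_restrict_space1 measurable_completion) simp
  show "(\<lambda>s. exp (s - t) * C) integrable_on {a..b}"
    by (intro integrable_continuous_real continuous_intros)
  show "norm (exp (s - t) *\<^sub>R g s) \<le> exp (s - t) * C" for s using g(2)[of s] by simp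
qed auto

lemma has_integral_exp_shift: "a \<le> b \<Longrightarrow> ((\<lambda>s. exp (s - t) :: real) has_integral exp (b - t) - exp (a - t)) {a..b}"
  by (rule fundamental_theorem_of_calculus)
    (auto intro!: derivative_eq_intros simp flip: has_real_derivative_iff_has_vector_derivative)

lemma exp_conv_0: "exp_conv g 0 = 0"
  by (simp add: exp_conv_def)

lemma exp_conv_neg: "t < 0 \<Longrightarrow> exp_conv g t = 0"
  by (simp add: exp_conv_def)

lemma exp_conv_add:
  fixes g :: "real \<Rightarrow> 'v::euclidean_space"
  assumes g: "g \<in> borel_measurable borel" "\<And>s. norm (g s) \<le> C" and "0 \<le> t" "0 \<le> h"
  shows "exp_conv g (t + h) = exp (-h) *\<^sub>R exp_conv g t + integral {t..t+h} (\<lambda>s. exp (s - (t + h)) *\<^sub>R g s)"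
proof -
  have "exp_conv g (t + h) = integral {0..t} (\<lambda>s. exp (s - (t + h)) *\<^sub>R g s) + integral {t..t+h} (\<lambda>s. exp (s - (t + h)) *\<^sub>R g s)"
    unfolding exp_conv_def
    by (rule Henstock_Kurzweil_Integration.integral_combine[symmetric]) (use assms bounded_borel_integrable_on[OF g] in auto)
  also have "integral {0..t} (\<lambda>s. exp (s - (t + h)) *\<^sub>R g s) = integral {0..t} (\<lambda>s. exp (-h) *\<^sub>R exp (s - t) *\<^sub>R g s)"
    by (rule Henstock_Kurzweil_Integration.integral_cong) (simp flip: exp_add)
  also have "\<dots> = exp (-h) *\<^sub>R exp_conv g t"
    unfolding exp_conv_def by (rule Henstock_Kurzweil_Integration.integral_cmul)
  finally show ?thesis .
qed

text \<open>If \<open>g\<close> is nearly \<open>c\<close> during a step, the average relaxes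
  exponentially towards \<open>c\<close>. The closeness is asked only inside the step, since a
  regime may switch at its end points.\<close>

lemma exp_conv_increment:
  fixes g :: "real \<Rightarrow> 'v::euclidean_space"
  assumes g: "g \<in> borel_measurable borel" "\<And>s. norm (g s) \<le> C" and t: "0 \<le> t" "0 \<le> h"
    and w: "\<And>s. t < s \<Longrightarrow> s < t + h \<Longrightarrow> norm (g s - c) \<le> w" "0 \<le> w"
  shows "norm (exp_conv g (t + h) - (exp (-h) *\<^sub>R exp_conv g t + (1 - exp (-h)) *\<^sub>R c)) \<le> w * h"
proof -
  have c: "((\<lambda>s. exp (s - (t + h)) *\<^sub>R c) has_integral (1 - exp (-h)) *\<^sub>R c) {t..t+h}"
    using has_integral_scaleR_left[OF has_integral_exp_shift[of t "t+h" "t+h"], of c] t by simp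
  have i: "(\<lambda>s. exp (s - (t + h)) *\<^sub>R g s) integrable_on {t..t+h}" by (rule bounded_borel_integrable_on[OF g])
  have "exp_conv g (t + h) - (exp (-h) *\<^sub>R exp_conv g t + (1 - exp (-h)) *\<^sub>R c) =
    integral {t..t+h} (\<lambda>s. exp (s - (t + h)) *\<^sub>R g s) - integral {t..t+h} (\<lambda>s. exp (s - (t + h)) *\<^sub>R c)"
    using exp_conv_add[OF g t] integral_unique[OF c] by simp
  also have "\<dots> = integral {t..t+h} (\<lambda>s. exp (s - (t + h)) *\<^sub>R g s - exp (s - (t + h)) *\<^sub>R c)"
    by (rule Henstock_Kurzweil_Integration.integral_diff[symmetric]) (use i c in auto)
  also have "\<dots> = integral {t..t+h} (\<lambda>s. exp (s - (t + h)) *\<^sub>R (g s - c))"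
    by (simp add: scaleR_diff_right)
  \<comment> \<open>The end points are dropped because the bound by \<open>w\<close> holds only
    between them.\<close>
  also have "\<dots> = integral {t<..<t+h} (\<lambda>s. exp (s - (t + h)) *\<^sub>R (g s - c))"
    by (simp add: integral_open_interval_real)
  also have "norm \<dots> \<le> integral {t<..<t+h} (\<lambda>s. w)"
  proof (rule Henstock_Kurzweil_Integration.integral_norm_bound_integral)
    have "(\<lambda>s. exp (s - (t + h)) *\<^sub>R (g s - c)) integrable_on {t..t+h}"
      using integrable_diff[OF i has_integral_integrable[OF c]] by (simp add: scaleR_diff_right)
    then show "(\<lambda>s. exp (s - (t + h)) *\<^sub>R (g s - c)) integrable_on {t<..<t+h}"
      by (simp add: integrable_on_open_interval_real)
    show "(\<lambda>s. w) integrable_on {t<..<t+h}"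
      using integrable_const_ivl[of w t "t+h"] by (simp add: integrable_on_open_interval_real)
    show "norm (exp (s - (t + h)) *\<^sub>R (g s - c)) \<le> w" if "s \<in> {t<..<t+h}" for s
    proof -
      have "exp (s - (t + h)) * norm (g s - c) \<le> 1 * w" using that w by (intro mult_mono) auto
      then show ?thesis by simp
    qed
  qed
  also have "\<dots> = w * h" using t by (simp add: integral_open_interval_real[symmetric])
  finally show ?thesis .
qed

lemma exp_minus_bounds:
  fixes h :: real assumes "0 \<le> h"
  shows "1 - h \<le> exp (-h)" "exp (-h) \<le> 1 - h + h\<^sup>2" "exp (-h) \<le> 1"
proof -
  show "1 - h \<le> exp (-h)" using exp_ge_add_one_self[of "-h"] by simp
  have "exp (-h) \<le> 1 / (1 + h)"
    using exp_ge_add_one_self[of h] assms by (simp add: exp_minus field_simps)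
  also have "\<dots> \<le> 1 - h + h\<^sup>2"
  proof -
    have "1 \<le> (1 - h + h\<^sup>2) * (1 + h)" using assms by (simp add: algebra_simps power2_eq_square)
    then show ?thesis using assms by (simp add: divide_le_eq)
  qed
  finally show "exp (-h) \<le> 1 - h + h\<^sup>2" .
qed (use assms in simp)

lemma exp_conv_norm:
  fixes g :: "real \<Rightarrow> 'v::euclidean_space"
  assumes g: "g \<in> borel_measurable borel" "\<And>s. norm (g s) \<le> C"
  shows "norm (exp_conv g t) \<le> C"
proof (cases "t < 0")
  case True
  have "0 \<le> C" using order_trans[OF norm_ge_zero g(2)[of 0]] .
  then show ?thesis using True by (simp add: exp_conv_neg)
next
  case False
  have C: "0 \<le> C" using order_trans[OF norm_ge_zero g(2)[of 0]] .
  have "norm (exp_conv g t) \<le> integral {0..t} (\<lambda>s. exp (s - t) * C)"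
    unfolding exp_conv_def
  proof (rule Henstock_Kurzweil_Integration.integral_norm_bound_integral)
    show "(\<lambda>s. exp (s - t) *\<^sub>R g s) integrable_on {0..t}" by (rule bounded_borel_integrable_on[OF g])
    show "(\<lambda>s. exp (s - t) * C) integrable_on {0..t}"
      by (intro integrable_continuous_real continuous_intros)
    show "norm (exp (s - t) *\<^sub>R g s) \<le> exp (s - t) * C" for s using g(2)[of s] by simp
  qed
  also have "\<dots> = (1 - exp (-t)) * C"
    using integral_unique[OF has_integral_mult_left[OF has_integral_exp_shift[of 0 t t], of C]] False by simp
  also have "\<dots> \<le> 1 * C" using C by (intro mult_right_mono) auto
  finally show ?thesis by simp
qed

text \<open>Local error of the explicit Euler step, which is the form of the recursion. The
  variation of \<open>g\<close> contributes \<open>w * h\<close>, and replacing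
  \<open>exp (-h)\<close> by \<open>1 - h\<close> costs at most the square of \<open>h\<close> times
  the distance of the average from \<open>c\<close>.\<close>

lemma exp_conv_Euler:
  fixes g :: "real \<Rightarrow> 'v::euclidean_space"
  assumes g: "g \<in> borel_measurable borel" "\<And>s. norm (g s) \<le> C" and t: "0 \<le> t" "0 \<le> h"
    and w: "\<And>s. t < s \<Longrightarrow> s < t + h \<Longrightarrow> norm (g s - c) \<le> w" "0 \<le> w" and c: "norm c \<le> C"
  shows "norm (exp_conv g (t + h) - (exp_conv g t + h *\<^sub>R (c - exp_conv g t))) \<le> w * h + 2 * C * h\<^sup>2"
proof -
  define E where "E = exp_conv g t"
  have 1: "norm (exp_conv g (t + h) - (exp (-h) *\<^sub>R E + (1 - exp (-h)) *\<^sub>R c)) \<le> w * h"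
    unfolding E_def by (rule exp_conv_increment[OF g t w])
  have "exp (-h) *\<^sub>R E + (1 - exp (-h)) *\<^sub>R c - (E + h *\<^sub>R (c - E)) = (exp (-h) - 1 + h) *\<^sub>R (E - c)"
    by (simp add: algebra_simps)
  also have "norm \<dots> = (exp (-h) - 1 + h) * norm (E - c)" using exp_minus_bounds[OF t(2)] by simp
  also have "\<dots> \<le> h\<^sup>2 * (C + C)"
    using exp_minus_bounds[OF t(2)] exp_conv_norm[OF g, of t] c norm_triangle_ineq4[of E c]
    unfolding E_def by (intro mult_mono) auto
  finally have 2: "norm (exp (-h) *\<^sub>R E + (1 - exp (-h)) *\<^sub>R c - (E + h *\<^sub>R (c - E))) \<le> 2 * C * h\<^sup>2"
    by (simp add: algebra_simps)
  show ?thesis using norm_triangle_le[OF add_mono[OF 1 2]] by (simp add: E_def algebra_simps)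
qed

text \<open>The average does not see jumps of \<open>g\<close>: over a time \<open>h\<close> the new
  contribution and the decay of the old one are both at most \<open>C * h\<close>.\<close>

lemma exp_conv_Lipschitz:
  fixes g :: "real \<Rightarrow> 'v::euclidean_space"
  assumes g: "g \<in> borel_measurable borel" "\<And>s. norm (g s) \<le> C" and t: "0 \<le> s" "0 \<le> t"
  shows "norm (exp_conv g t - exp_conv g s) \<le> 2 * C * \<bar>t - s\<bar>"
proof -
  have *: "norm (exp_conv g t - exp_conv g s) \<le> 2 * C * (t - s)" if "0 \<le> s" "s \<le> t" for s t
  proof -
    define E h where "E = exp_conv g s" and "h = t - s"
    have h: "0 \<le> h" "s + h = t" using that by (auto simp: h_def)
    have C: "0 \<le> C" using order_trans[OF norm_ge_zero g(2)[of 0]] .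
    have 1: "norm (exp_conv g t - exp (-h) *\<^sub>R E) \<le> C * h"
      using exp_conv_increment[OF g that(1) h(1), of 0 C] C g(2) h(2) by (simp add: E_def)
    have "norm (exp (-h) *\<^sub>R E - E) = (1 - exp (-h)) * norm E"
    proof -
      have "exp (-h) *\<^sub>R E - E = - ((1 - exp (-h)) *\<^sub>R E)" by (simp add: algebra_simps)
      then show ?thesis using h by simp
    qed
    also have "\<dots> \<le> h * C"
      using exp_minus_bounds[OF h(1)] exp_conv_norm[OF g, of s] C h unfolding E_def by (intro mult_mono) auto
    finally have 2: "norm (exp (-h) *\<^sub>R E - E) \<le> C * h" by (simp add: algebra_simps)
    show ?thesis using norm_triangle_le[OF add_mono[OF 1 2]] by (simp add: E_def h_def algebra_simps)
  qed
  show ?thesis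
    using *[of s t] *[of t s] t by (cases "s \<le> t") (auto simp: norm_minus_commute abs_if algebra_simps)
qed

lemma at_within_Ici_eq: "0 \<le> t \<Longrightarrow> at t within {0..t+1} = at (t::real) within {0..}"
  by (rule at_within_nhd[where S="{t - 1<..<t + 1}"]) auto

lemma exp_conv_has_derivative:
  fixes g :: "real \<Rightarrow> 'v::euclidean_space"
  assumes g: "g \<in> borel_measurable borel" "\<And>s. norm (g s) \<le> C" and t: "0 \<le> t"
    and cont: "continuous (at t within {0..}) g"
  shows "(exp_conv g has_vector_derivative (g t - exp_conv g t)) (at t within {0..})"
proof -
  \<comment> \<open>Pulling the factor \<open>exp (-u)\<close> out removes the variable upper limit
    from the integrand, so that the fundamental theorem applies.\<close>
  have eq: "exp_conv g = (\<lambda>u. exp (-u) *\<^sub>R integral {0..u} (\<lambda>s. exp (s - 0) *\<^sub>R g s))"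
  proof
    fix u
    have "integral {0..u} (\<lambda>s. exp (s - u) *\<^sub>R g s) = integral {0..u} (\<lambda>s. exp (-u) *\<^sub>R exp (s - 0) *\<^sub>R g s)"
      by (rule Henstock_Kurzweil_Integration.integral_cong) (simp flip: exp_add)
    then show "exp_conv g u = exp (-u) *\<^sub>R integral {0..u} (\<lambda>s. exp (s - 0) *\<^sub>R g s)"
      unfolding exp_conv_def by (simp only: Henstock_Kurzweil_Integration.integral_cmul)
  qed
  have "((\<lambda>u. integral {0..u} (\<lambda>s. exp (s - 0) *\<^sub>R g s)) has_vector_derivative exp (t - 0) *\<^sub>R g t)
    (at t within ({0..t+1} - {}))"
  proof (rule integral_has_vector_derivative_continuous_at)
    show "(\<lambda>s. exp (s - 0) *\<^sub>R g s) integrable_on {0..t+1}" by (rule bounded_borel_integrable_on[OF g])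
    show "continuous (at t within {0..t+1} - {}) (\<lambda>s. exp (s - 0) *\<^sub>R g s)"
      using cont t by (auto simp: at_within_Ici_eq intro!: continuous_intros)
  qed (use t in auto)
  then have d: "((\<lambda>u. integral {0..u} (\<lambda>s. exp (s - 0) *\<^sub>R g s)) has_vector_derivative exp t *\<^sub>R g t) (at t within {0..})"
    using t by (simp add: at_within_Ici_eq)
  have "((\<lambda>u. exp (-u)) has_real_derivative - exp (-t)) (at t within {0..})"
    by (auto intro!: derivative_eq_intros)
  from has_vector_derivative_scaleR[OF this d]
  have "(exp_conv g has_vector_derivative
      exp (-t) *\<^sub>R (exp t *\<^sub>R g t) + (- exp (-t)) *\<^sub>R integral {0..t} (\<lambda>s. exp (s - 0) *\<^sub>R g s)) (at t within {0..})"
    unfolding eq .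
  moreover have "exp (-t) *\<^sub>R (exp t *\<^sub>R g t) = g t" by (simp flip: exp_add)
  moreover have "(- exp (-t)) *\<^sub>R integral {0..t} (\<lambda>s. exp (s - 0) *\<^sub>R g s) = - exp_conv g t"
    using fun_cong[OF eq, of t] by simp
  ultimately show ?thesis by simp
qed

lemma exp_conv_measurable:
  fixes g :: "real \<Rightarrow> 'v::euclidean_space"
  assumes g: "g \<in> borel_measurable borel" "\<And>s. norm (g s) \<le> C"
  shows "continuous_on {0..} (exp_conv g)" "exp_conv g \<in> borel_measurable borel"
proof -
  have "(2 * C)-lipschitz_on {0..} (exp_conv g)"
  proof (rule lipschitz_onI)
    show "dist (exp_conv g s) (exp_conv g t) \<le> 2 * C * dist s t" if "s \<in> {0..}" "t \<in> {0..}" for s t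
      using exp_conv_Lipschitz[OF g, of t s] that by (simp add: dist_norm)
    show "0 \<le> 2 * C" using order_trans[OF norm_ge_zero g(2)[of 0]] by simp
  qed
  then show c: "continuous_on {0..} (exp_conv g)" by (rule lipschitz_on_continuous_on)
  have "exp_conv g = (\<lambda>t. if t \<in> {0..} then exp_conv g t else 0)" by (auto simp: exp_conv_neg)
  moreover have "(\<lambda>t. if t \<in> {0..} then exp_conv g t else 0) \<in> borel_measurable borel"
    by (rule borel_measurable_continuous_on_if) (use c in auto)
  ultimately show "exp_conv g \<in> borel_measurable borel" by simp
qed

text \<open>The kernel is at most 1, so the distance of the integrands in mean over
  \<open>{0..T}\<close> bounds the difference at all times up to \<open>T\<close> simultaneously.
  Dominated convergence makes this distance small.\<close>

lemma exp_conv_tendsto: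
  fixes g :: "real \<Rightarrow> 'v::euclidean_space"
  assumes g: "g \<in> borel_measurable borel" "\<And>s. norm (g s) \<le> C"
    and h: "\<And>n. h n \<in> borel_measurable borel" "\<And>n s. norm (h n s) \<le> C"
    and lim: "AE s in lborel. 0 \<le> s \<longrightarrow> (\<lambda>n. h n s) \<longlonglongrightarrow> g s" and e: "0 < e"
  shows "eventually (\<lambda>n. \<forall>t\<in>{0..T}. norm (exp_conv (h n) t - exp_conv g t) < e) sequentially"
proof -
  define D where "D n = (LINT s:{0..T}|lborel. norm (h n s - g s))" for n
  have meas: "(\<lambda>s. norm (h n s - g s)) \<in> borel_measurable borel" for n using g h by measurable
  have bd: "norm (h n s - g s) \<le> 2 * C" for n s
    using g(2)[of s] h(2)[of n s] norm_triangle_ineq4[of "h n s" "g s"] by linarith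
  have int2: "set_integrable lborel {0..t} (\<lambda>s. 2 * C)" for t :: real
    by (rule borel_integrable_atLeastAtMost') simp
  have si: "set_integrable lborel {0..t} (\<lambda>s. norm (h n s - g s))" for n and t :: real
    by (rule set_integrable_bound[OF int2]) (use meas order_trans[OF bd abs_ge_self] in \<open>auto simp: set_borel_measurable_def intro!: AE_I2\<close>)
  have "D \<longlonglongrightarrow> (LINT s:{0..T}|lborel. 0)"
    unfolding D_def set_lebesgue_integral_def
  proof (rule integral_dominated_convergence)
    show "integrable lborel (\<lambda>s. indicat_real {0..T} s *\<^sub>R (2 * C))" using int2 by (simp add: set_integrable_def)
    show "AE s in lborel. (\<lambda>n. indicat_real {0..T} s *\<^sub>R norm (h n s - g s)) \<longlonglongrightarrow> indicat_real {0..T} s *\<^sub>R 0"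
      using lim
    proof eventually_elim
      case (elim s)
      show ?case
      proof (cases "s \<in> {0..T}")
        case True
        then have "(\<lambda>n. norm (h n s - g s)) \<longlonglongrightarrow> 0" using elim by (simp add: LIM_zero tendsto_norm_zero)
        then show ?thesis using True by simp
      qed simp
    qed
    show "AE s in lborel. norm (indicat_real {0..T} s *\<^sub>R norm (h n s - g s)) \<le> indicat_real {0..T} s *\<^sub>R (2 * C)" for n
      using bd by (auto simp: indicator_def)
  qed (use meas in auto)
  then have "D \<longlonglongrightarrow> 0" by (simp add: set_lebesgue_integral_def)
  then have "eventually (\<lambda>n. D n < e) sequentially" using e by (rule order_tendstoD)
  then show ?thesis
  proof eventually_elim
    case (elim n)
    have "norm (exp_conv (h n) t - exp_conv g t) < e" if t: "t \<in> {0..T}" for t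
    proof -
      have "exp_conv (h n) t - exp_conv g t = integral {0..t} (\<lambda>s. exp (s - t) *\<^sub>R h n s - exp (s - t) *\<^sub>R g s)"
        unfolding exp_conv_def
        by (rule Henstock_Kurzweil_Integration.integral_diff[symmetric])
          (rule bounded_borel_integrable_on[OF h] bounded_borel_integrable_on[OF g])+
      also have "norm \<dots> \<le> integral {0..t} (\<lambda>s. norm (h n s - g s))"
      proof (rule Henstock_Kurzweil_Integration.integral_norm_bound_integral)
        show "(\<lambda>s. exp (s - t) *\<^sub>R h n s - exp (s - t) *\<^sub>R g s) integrable_on {0..t}"
          by (intro integrable_diff bounded_borel_integrable_on[OF h] bounded_borel_integrable_on[OF g])
        show "(\<lambda>s. norm (h n s - g s)) integrable_on {0..t}" using set_borel_integral_eq_integral(1)[OF si] .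
        show "norm (exp (s - t) *\<^sub>R h n s - exp (s - t) *\<^sub>R g s) \<le> norm (h n s - g s)" if "s \<in> {0..t}" for s
        proof -
          have "norm (exp (s - t) *\<^sub>R h n s - exp (s - t) *\<^sub>R g s) = exp (s - t) * norm (h n s - g s)"
            by (simp flip: scaleR_diff_right)
          also have "\<dots> \<le> 1 * norm (h n s - g s)" using that by (intro mult_right_mono) auto
          finally show ?thesis by simp
        qed
      qed
      also have "\<dots> \<le> integral {0..T} (\<lambda>s. norm (h n s - g s))"
        by (rule integral_subset_le) (use t set_borel_integral_eq_integral(1)[OF si] in auto)
      also have "\<dots> = D n" unfolding D_def using set_borel_integral_eq_integral(2)[OF si] by simp
      finally show ?thesis using elim by simp
    qed
    then show ?case by blast
  qed
qed

section \<open>The switched flow\<close>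

definition F_bound :: "('s::finite \<Rightarrow> 'q::finite \<Rightarrow> real) \<Rightarrow> real" where
  "F_bound F = Max (range (\<lambda>j. norm (F_vec F j)))"

lemma F_bound: "norm (F_vec F j) \<le> F_bound F"
  unfolding F_bound_def by (rule Max_ge) auto

lemma F_bound_ge0: "0 \<le> F_bound F"
  using order_trans[OF norm_ge_zero F_bound] .

definition regime_path :: "(real \<Rightarrow> 'q) \<Rightarrow> bool" where
  "regime_path q \<longleftrightarrow> q \<in> measurable borel (count_space UNIV) \<and>
     (\<forall>t\<ge>0. eventually (\<lambda>s. q s = q t) (at_right t)) \<and>
     (\<forall>t>0. \<exists>c. eventually (\<lambda>s. q s = c) (at_left t))"

lemma step_index_measurable [measurable]: "step_index \<tau> \<in> measurable borel (count_space UNIV)"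
  unfolding step_index_def by measurable

lemma regime_path_step_path:
  assumes "\<tau> \<in> jump_times" shows "regime_path (step_path \<tau> j)"
  unfolding regime_path_def
proof (intro conjI allI impI)
  have "(\<lambda>t. if 0 \<le> t then j (step_index \<tau> t) else undefined) \<in> measurable borel (count_space UNIV)"
    by measurable
  then show "step_path \<tau> j \<in> measurable borel (count_space UNIV)"
    unfolding step_path_def restrict_def by simp
  show "\<forall>\<^sub>F s in at_right t. step_path \<tau> j s = step_path \<tau> j t" if "0 \<le> t" for t
    by (rule step_path_near(1)[OF assms that])
  show "\<exists>c. \<forall>\<^sub>F s in at_left t. step_path \<tau> j s = c" if "0 < t" for t
    using step_path_near(2)[OF assms _ that] that by simp
qed

text \<open>The bound by 1 is the one satisfied by probability vectors.\<close>

locale response =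
  fixes b :: "real^'s::finite \<Rightarrow> real^'s" and F :: "'s \<Rightarrow> 'q::{finite,metric_space} \<Rightarrow> real"
  assumes b_cont: "continuous_on UNIV b" and b_norm: "norm (b v) \<le> 1"
begin

text \<open>The limit of \<open>f_tilde\<close>. It starts at 0 like \<open>f_tilde\<close> and is
  continuous across switches of the regime.\<close>

definition V_path :: "(real \<Rightarrow> 'q) \<Rightarrow> real \<Rightarrow> real^'s" where
  "V_path q = exp_conv (\<lambda>s. F_vec F (q s))"

text \<open>The limit of \<open>r + F_min\<close>, with initial value \<open>u\<close>; like
  \<open>V_path\<close> it is continuous across switches.\<close>

definition U_path :: "real \<Rightarrow> (real \<Rightarrow> 'q) \<Rightarrow> real \<Rightarrow> real" where
  "U_path u q t = exp (-t) * u + exp_conv (\<lambda>s. b (V_path q s) \<bullet> F_vec F (q s)) t"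

text \<open>The jumps prescribed by \<open>regime_resets\<close> come back when the current
  \<open>F_vec\<close> and \<open>F_min\<close> are subtracted from the continuous paths.\<close>

definition flow :: "real \<Rightarrow> (real \<Rightarrow> 'q) \<Rightarrow> real \<Rightarrow> ((real^'s) \<times> real) \<times> 'q" where
  "flow r q = (\<lambda>t\<in>{0..}. ((V_path q t - F_vec F (q t), U_path (r + F_min F (q 0)) q t - F_min F (q t)), q t))"

lemma V_drive:
  assumes "q \<in> measurable borel (count_space UNIV)"
  shows "(\<lambda>s. F_vec F (q s)) \<in> borel_measurable borel" "\<And>s. norm (F_vec F (q s)) \<le> F_bound F"
proof -
  have "F_vec F \<in> measurable (count_space UNIV) borel" by simp
  then show "(\<lambda>s. F_vec F (q s)) \<in> borel_measurable borel" using assms by measurable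
qed (rule F_bound)

lemma V_norm: "q \<in> measurable borel (count_space UNIV) \<Longrightarrow> norm (V_path q t) \<le> F_bound F"
  unfolding V_path_def using exp_conv_norm[OF V_drive] .

lemma V_continuous:
  assumes "q \<in> measurable borel (count_space UNIV)"
  shows "continuous_on {0..} (V_path q)" "V_path q \<in> borel_measurable borel"
  unfolding V_path_def using exp_conv_measurable[OF V_drive[OF assms]] by auto

lemma response_inner: "\<bar>b v \<bullet> F_vec F j\<bar> \<le> F_bound F"
proof -
  have "\<bar>b v \<bullet> F_vec F j\<bar> \<le> norm (b v) * norm (F_vec F j)" by (rule Cauchy_Schwarz_ineq2)
  also have "\<dots> \<le> 1 * F_bound F" by (intro mult_mono b_norm F_bound) auto
  finally show ?thesis by simp
qed

lemma U_drive:
  assumes "q \<in> measurable borel (count_space UNIV)"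
  shows "(\<lambda>s. b (V_path q s) \<bullet> F_vec F (q s)) \<in> borel_measurable borel"
    "\<And>s. norm (b (V_path q s) \<bullet> F_vec F (q s)) \<le> F_bound F"
proof -
  have "b \<in> borel_measurable borel" using b_cont by (rule borel_measurable_continuous_onI)
  then show "(\<lambda>s. b (V_path q s) \<bullet> F_vec F (q s)) \<in> borel_measurable borel"
    using V_continuous(2)[OF assms] V_drive(1)[OF assms] by measurable
qed (simp add: response_inner)

lemma U_continuous:
  assumes "q \<in> measurable borel (count_space UNIV)"
  shows "continuous_on {0..} (U_path u q)"
  unfolding U_path_def by (intro continuous_intros exp_conv_measurable(1)[OF U_drive[OF assms]])

text \<open>On either side of a time the regime is constant for a while, and there the flow is a
  continuous path minus a constant.\<close>

lemma regime_path_flow_cadlag: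
  assumes q: "regime_path q" shows "flow r q \<in> cadlag"
  unfolding cadlag_def
proof (intro CollectI conjI allI impI)
  have qm: "q \<in> measurable borel (count_space UNIV)" using q by (simp add: regime_path_def)
  have cont: "(V_path q \<longlongrightarrow> V_path q t) (at t within A)" "(U_path u q \<longlongrightarrow> U_path u q t) (at t within A)"
    if "0 \<le> t" "A \<subseteq> {0..}" for t A u
    using V_continuous(1)[OF qm] U_continuous[OF qm, of u] that unfolding continuous_on_def
    by (auto intro: tendsto_within_subset)
  show "flow r q \<in> extensional {0..}" by (simp add: flow_def)
  show "continuous (at_right t) (flow r q)" if t: "0 \<le> t" for t
  proof -
    have "((\<lambda>s. ((V_path q s - F_vec F (q t), U_path (r + F_min F (q 0)) q s - F_min F (q t)), q t)) \<longlongrightarrow> flow r q t) (at_right t)"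
      using t unfolding flow_def by (auto intro!: tendsto_intros cont)
    moreover have "eventually (\<lambda>s. ((V_path q s - F_vec F (q t), U_path (r + F_min F (q 0)) q s - F_min F (q t)), q t) = flow r q s) (at_right t)"
    proof -
      have "eventually (\<lambda>s. q s = q t) (at_right t)" using q t by (simp add: regime_path_def)
      moreover have "eventually (\<lambda>s. t < s) (at_right t)" by (simp add: eventually_at_right_less)
      ultimately show ?thesis by eventually_elim (use t in \<open>simp add: flow_def\<close>)
    qed
    ultimately show ?thesis unfolding continuous_within by (rule Lim_transform_eventually)
  qed
  show "\<exists>l. (flow r q \<longlongrightarrow> l) (at_left t)" if t: "0 < t" for t
  proof -
    obtain c where c: "eventually (\<lambda>s. q s = c) (at_left t)" using q t by (auto simp: regime_path_def)
    have al: "at_left t = at t within {0..<t}" using t by (intro at_within_nhd[where S="{0<..}"]) auto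
    have "((\<lambda>s. ((V_path q s - F_vec F c, U_path (r + F_min F (q 0)) q s - F_min F c), c)) \<longlongrightarrow>
        ((V_path q t - F_vec F c, U_path (r + F_min F (q 0)) q t - F_min F c), c)) (at_left t)"
      using t unfolding al by (intro tendsto_intros cont) auto
    moreover have "eventually (\<lambda>s. ((V_path q s - F_vec F c, U_path (r + F_min F (q 0)) q s - F_min F c), c) = flow r q s) (at_left t)"
    proof -
      have "eventually (\<lambda>s. 0 < s) (at_left t)" using t by (auto simp: eventually_at_left_field)
      with c show ?thesis by eventually_elim (simp add: flow_def)
    qed
    ultimately show ?thesis using Lim_transform_eventually by blast
  qed
qed

lemma discrete_eventually:
  fixes f :: "'a \<Rightarrow> 'q"
  assumes "(f \<longlongrightarrow> c) A" shows "eventually (\<lambda>s. f s = c) A"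
proof -
  obtain d where d: "0 < d" "\<And>i j :: 'q. dist i j < d \<Longrightarrow> i = j" using finite_separation by metis
  have "eventually (\<lambda>s. dist (f s) c < d) A" using assms d(1) by (rule tendstoD)
  then show ?thesis by eventually_elim (rule d(2))
qed

text \<open>A regime continuous at \<open>t\<close> is constant near \<open>t\<close>, because its
  values are discrete. So both integrands are continuous at \<open>t\<close>, and the subtracted
  terms do not contribute to the derivative.\<close>

lemma flow_solves:
  assumes q: "q \<in> measurable borel (count_space UNIV)"
  shows "solves_switched_ode (G_field b F) (\<lambda>t. fst (flow r q t)) (\<lambda>t. snd (flow r q t))"
  unfolding solves_switched_ode_def
proof (intro allI impI)
  fix t :: real assume t: "0 \<le> t" and c: "continuous (at t within {0..}) (\<lambda>t. snd (flow r q t))"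
  define c where "c = q t"
  define u where "u = r + F_min F (q 0)"
  have "eventually (\<lambda>s. snd (flow r q s) = snd (flow r q t)) (at t within {0..})"
    using c unfolding continuous_within by (rule discrete_eventually)
  moreover have "eventually (\<lambda>s. s \<in> {0..}) (at t within {0..})" by (simp add: eventually_at_filter)
  ultimately have ev: "eventually (\<lambda>s. q s = c) (at t within {0..})"
    by eventually_elim (use t in \<open>simp add: flow_def c_def\<close>)
  have Vc: "(V_path q \<longlongrightarrow> V_path q t) (at t within {0..})"
    using V_continuous(1)[OF q] t by (simp add: continuous_on_def)
  have g1: "continuous (at t within {0..}) (\<lambda>s. F_vec F (q s))"
    unfolding continuous_within using ev by (intro tendsto_eventually) (auto simp: c_def elim: eventually_mono)
  have "isCont b (V_path q t)" using b_cont by (simp add: continuous_on_eq_continuous_at)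
  then have "((\<lambda>s. b (V_path q s)) \<longlongrightarrow> b (V_path q t)) (at t within {0..})" using Vc by (rule isCont_tendsto_compose)
  then have g2: "continuous (at t within {0..}) (\<lambda>s. b (V_path q s) \<bullet> F_vec F (q s))"
    using g1 unfolding continuous_within by (intro tendsto_intros)
  have d1: "(V_path q has_vector_derivative F_vec F c - V_path q t) (at t within {0..})"
    using exp_conv_has_derivative[OF V_drive[OF q] t g1] by (simp add: V_path_def c_def)
  have "((\<lambda>s. exp (-s) * u) has_vector_derivative - (exp (-t) * u)) (at t within {0..})"
    unfolding has_real_derivative_iff_has_vector_derivative[symmetric] by (auto intro!: derivative_eq_intros)
  from has_vector_derivative_add[OF this exp_conv_has_derivative[OF U_drive[OF q] t g2]]
  have d2: "(U_path u q has_vector_derivative b (V_path q t) \<bullet> F_vec F c - U_path u q t) (at t within {0..})"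
    unfolding U_path_def by (simp add: c_def algebra_simps)
  have "((\<lambda>s. (V_path q s - F_vec F c, U_path u q s - F_min F c)) has_vector_derivative
     (F_vec F c - V_path q t, b (V_path q t) \<bullet> F_vec F c - U_path u q t)) (at t within {0..})"
    using d1 d2 by (auto intro!: derivative_eq_intros)
  \<comment> \<open>With \<open>f_hat = V - F\<close> the drift \<open>F - V\<close> is
    \<open>0 - f_hat\<close>, and \<open>f_hat + F\<close>, the argument of \<open>b\<close> in
    \<open>G_field\<close>, is \<open>V\<close>.\<close>
  moreover have "(F_vec F c - V_path q t, b (V_path q t) \<bullet> F_vec F c - U_path u q t) =
     G_field b F (fst (flow r q t)) (snd (flow r q t)) - fst (flow r q t)"
    using t by (simp add: G_field_def flow_def c_def u_def)
  moreover have "((\<lambda>s. (V_path q s - F_vec F c, U_path u q s - F_min F c)) has_vector_derivative D) (at t within {0..}) =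
     ((\<lambda>s. fst (flow r q s)) has_vector_derivative D) (at t within {0..})" for D
  proof (rule has_vector_derivative_cong_ev)
    show "(V_path q t - F_vec F c, U_path u q t - F_min F c) = fst (flow r q t)"
      using t by (simp add: flow_def c_def u_def)
    have "eventually (\<lambda>s. s \<noteq> t \<longrightarrow> s \<in> {0..} \<longrightarrow> q s = c) (nhds t)"
      using ev by (simp add: eventually_at_filter)
    then show "\<forall>\<^sub>F s in nhds t. s \<in> {0..} \<longrightarrow> (V_path q s - F_vec F c, U_path u q s - F_min F c) = fst (flow r q s)"
      by eventually_elim (use c_def in \<open>auto simp: flow_def u_def\<close>)
  qed
  ultimately show "((\<lambda>t. fst (flow r q t)) has_vector_derivative
     G_field b F (fst (flow r q t)) (snd (flow r q t)) - fst (flow r q t)) (at t within {0..})" by simp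
qed

lemma flow_resets:
  assumes q: "q \<in> measurable borel (count_space UNIV)"
  shows "regime_resets F (\<lambda>t. fst (flow r q t)) (\<lambda>t. snd (flow r q t))"
  unfolding regime_resets_def
proof (intro allI impI)
  fix t :: real and c assume t: "0 < t" and c: "((\<lambda>t. snd (flow r q t)) \<longlongrightarrow> c) (at_left t)"
  define u where "u = r + F_min F (q 0)"
  have pos: "eventually (\<lambda>s. 0 < s) (at_left t)" using t by (auto simp: eventually_at_left_field)
  have ev: "eventually (\<lambda>s. snd (flow r q s) = c) (at_left t)" using c by (rule discrete_eventually)
  have al: "at_left t = at t within {0..<t}" using t by (intro at_within_nhd[where S="{0<..}"]) auto
  have cont: "(V_path q \<longlongrightarrow> V_path q t) (at_left t)" "(U_path u q \<longlongrightarrow> U_path u q t) (at_left t)"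
    using V_continuous(1)[OF q] U_continuous[OF q, of u] t unfolding continuous_on_def al
    by - (rule tendsto_within_subset[where S="{0..}"]; force)+
  have "((\<lambda>s. (V_path q s - F_vec F c, U_path u q s - F_min F c)) \<longlongrightarrow> (V_path q t - F_vec F c, U_path u q t - F_min F c)) (at_left t)"
    by (intro tendsto_intros cont)
  moreover have "eventually (\<lambda>s. (V_path q s - F_vec F c, U_path u q s - F_min F c) = fst (flow r q s)) (at_left t)"
    using pos ev by eventually_elim (simp add: flow_def u_def)
  ultimately have "((\<lambda>s. fst (flow r q s)) \<longlongrightarrow> (V_path q t - F_vec F c, U_path u q t - F_min F c)) (at_left t)"
    by (rule Lim_transform_eventually)
  then show "((\<lambda>t. fst (flow r q t)) \<longlongrightarrow> fst (flow r q t) -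
     (F_vec F c - F_vec F (snd (flow r q t)), F_min F c - F_min F (snd (flow r q t)))) (at_left t)"
    using t by (simp add: flow_def u_def algebra_simps)
qed

section \<open>Continuous dependence of the flow on regime and initial regret\<close>

lemma V_path_tendsto:
  assumes q: "q \<in> measurable borel (count_space UNIV)" "\<And>n. p n \<in> measurable borel (count_space UNIV)"
    and lim: "AE s in lborel. 0 \<le> s \<longrightarrow> eventually (\<lambda>n. p n s = q s) sequentially" and e: "0 < e"
  shows "eventually (\<lambda>n. \<forall>t\<in>{0..T}. norm (V_path (p n) t - V_path q t) < e) sequentially"
  unfolding V_path_def
proof (rule exp_conv_tendsto[OF V_drive[OF q(1)] V_drive[OF q(2)] _ e])
  show "AE s in lborel. 0 \<le> s \<longrightarrow> (\<lambda>n. F_vec F (p n s)) \<longlonglongrightarrow> F_vec F (q s)"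
    using lim by eventually_elim (auto intro!: tendsto_eventually elim: eventually_mono)
qed

lemma U_drive_tendsto:
  assumes q: "q \<in> measurable borel (count_space UNIV)" "\<And>n. p n \<in> measurable borel (count_space UNIV)"
    and lim: "AE s in lborel. 0 \<le> s \<longrightarrow> eventually (\<lambda>n. p n s = q s) sequentially" and e: "0 < e"
  shows "eventually (\<lambda>n. \<forall>t\<in>{0..T}. norm (exp_conv (\<lambda>s. b (V_path (p n) s) \<bullet> F_vec F (p n s)) t -
     exp_conv (\<lambda>s. b (V_path q s) \<bullet> F_vec F (q s)) t) < e) sequentially"
proof (rule exp_conv_tendsto[OF U_drive[OF q(1)] U_drive[OF q(2)] _ e])
  have V: "(\<lambda>n. V_path (p n) s) \<longlonglongrightarrow> V_path q s" if "0 \<le> s" for s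
    unfolding tendsto_iff
  proof (intro allI impI)
    fix d :: real assume "0 < d"
    from V_path_tendsto[OF q lim this, of s]
    show "\<forall>\<^sub>F n in sequentially. dist (V_path (p n) s) (V_path q s) < d"
      by eventually_elim (use that in \<open>auto simp: dist_norm\<close>)
  qed
  show "AE s in lborel. 0 \<le> s \<longrightarrow> (\<lambda>n. b (V_path (p n) s) \<bullet> F_vec F (p n s)) \<longlonglongrightarrow> b (V_path q s) \<bullet> F_vec F (q s)"
    using lim
  proof eventually_elim
    case (elim s)
    show ?case
    proof
      assume s: "0 \<le> s"
      have "isCont b (V_path q s)" using b_cont by (simp add: continuous_on_eq_continuous_at)
      then have "(\<lambda>n. b (V_path (p n) s)) \<longlonglongrightarrow> b (V_path q s)" using V[OF s] by (rule isCont_tendsto_compose)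
      moreover have "(\<lambda>n. F_vec F (p n s)) \<longlonglongrightarrow> F_vec F (q s)"
        using elim s by (auto intro!: tendsto_eventually elim: eventually_mono)
      ultimately show "(\<lambda>n. b (V_path (p n) s) \<bullet> F_vec F (p n s)) \<longlonglongrightarrow> b (V_path q s) \<bullet> F_vec F (q s)"
        by (rule tendsto_inner)
    qed
  qed
qed

lemma exp_minus_Lipschitz: "0 \<le> s \<Longrightarrow> 0 \<le> t \<Longrightarrow> \<bar>exp (-s) - exp (-t)\<bar> \<le> \<bar>s - t\<bar>" for s t :: real
proof -
  have *: "\<bar>exp (-s) - exp (-t)\<bar> \<le> \<bar>s - t\<bar>" if "0 \<le> s" "s \<le> t" for s t :: real
  proof -
    have "exp (-t) = exp (-s) * exp (-(t - s))" by (simp flip: exp_add)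
    then have "exp (-s) - exp (-t) = exp (-s) * (1 - exp (-(t - s)))" by (simp add: algebra_simps)
    moreover have "exp (-s) * (1 - exp (-(t - s))) \<le> 1 * (t - s)"
      using exp_minus_bounds[of "t - s"] that by (intro mult_mono) auto
    moreover have "0 \<le> exp (-s) * (1 - exp (-(t - s)))" using that by simp
    ultimately show ?thesis using that by simp
  qed
  show "0 \<le> s \<Longrightarrow> 0 \<le> t \<Longrightarrow> \<bar>exp (-s) - exp (-t)\<bar> \<le> \<bar>s - t\<bar>"
    using *[of s t] *[of t s] by (cases "s \<le> t") (auto simp: abs_minus_commute)
qed

lemma step_path_eventually_AE:
  fixes j :: "nat \<Rightarrow> 'q"
  assumes J: "\<tau> \<in> jump_times" "\<And>n. \<sigma> n \<in> jump_times" and lim: "\<And>k. (\<lambda>n. \<sigma> n k) \<longlonglongrightarrow> \<tau> k"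
    and j: "\<And>k. eventually (\<lambda>n. i n k = j k) sequentially"
  shows "AE s in lborel. 0 \<le> s \<longrightarrow> eventually (\<lambda>n. step_path (\<sigma> n) (i n) s = step_path \<tau> j s) sequentially"
proof -
  have "AE s in lborel. s \<notin> range \<tau>"
    by (intro AE_not_in countable_imp_null_set_lborel) auto
  then show ?thesis
    by eventually_elim (intro impI step_path_eventually[OF J lim j], auto)
qed

text \<open>One time change makes the regimes coincide exactly. The averages converge uniformly
  without any time change, and their Lipschitz bounds absorb the displacement of time.\<close>

lemma flow_tendsto:
  fixes j :: "nat \<Rightarrow> 'q"
  assumes J: "\<tau> \<in> jump_times" "\<And>n. \<sigma> n \<in> jump_times" and lim: "\<And>k. (\<lambda>n. \<sigma> n k) \<longlonglongrightarrow> \<tau> k"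
    and j: "\<And>k. eventually (\<lambda>n. i n k = j k) sequentially" and r: "(\<lambda>n. s n) \<longlonglongrightarrow> r" and e: "0 < e"
  shows "eventually (\<lambda>n. flow (s n) (step_path (\<sigma> n) (i n)) \<in> skorohod_nbhd (flow r (step_path \<tau> j)) T e) sequentially"
proof -
  define q where "q = step_path \<tau> j"
  define p where "p n = step_path (\<sigma> n) (i n)" for n
  have qm: "q \<in> measurable borel (count_space UNIV)" "\<And>n. p n \<in> measurable borel (count_space UNIV)"
    using regime_path_step_path[OF J(1), of j] regime_path_step_path[OF J(2), of _ "i _"]
    unfolding q_def p_def by (simp_all add: regime_path_def)
  define C where "C = F_bound F"
  have C: "0 \<le> C" by (simp add: C_def F_bound_ge0)
  have idx0: "step_index \<tau> 0 = 0" if "\<tau> \<in> jump_times" for \<tau> :: "nat \<Rightarrow> real"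
    using that jump_times_Suc[OF that, of 0] by (intro step_index_eqI) (auto simp: jump_times_0)
  define u where "u = r + F_min F (q 0)"
  define v where "v n = s n + F_min F (p n 0)" for n
  have q0: "q 0 = j 0" "p n 0 = i n 0" for n using idx0[OF J(1)] idx0[OF J(2)] by (auto simp: q_def p_def step_path_def)
  have "(\<lambda>n. F_min F (p n 0)) \<longlonglongrightarrow> F_min F (q 0)"
    using j[of 0] by (intro tendsto_eventually) (auto simp: q0 elim: eventually_mono)
  then have v: "v \<longlonglongrightarrow> u" unfolding v_def u_def using r by (intro tendsto_intros)
  \<comment> \<open>The errors below add up to \<open>e1 * (4 * C + 3 + \<bar>u\<bar>)\<close>; one
    unit more makes the final inequality strict.\<close>
  define e1 where "e1 = e / (4 * C + 4 + \<bar>u\<bar>)"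
  have den: "0 < 4 * C + 4 + \<bar>u\<bar>" using C by (simp add: add_nonneg_pos add_pos_nonneg)
  have e1: "0 < e1" "e1 * (4 * C + 4 + \<bar>u\<bar>) = e" using e den by (auto simp: e1_def)
  have ae: "AE s in lborel. 0 \<le> s \<longrightarrow> eventually (\<lambda>n. p n s = q s) sequentially"
    unfolding p_def q_def by (rule step_path_eventually_AE[OF J lim j])
  have ee: "0 < min e e1" using e e1 by simp
  obtain K where K: "eventually (\<lambda>n. \<exists>\<kappa>\<in>time_changes. (\<forall>t\<ge>0. \<bar>\<kappa> t - t\<bar> < min e e1) \<and>
     (\<forall>t\<in>{0..T}. step_index \<tau> t < K \<and> step_index (\<sigma> n) (\<kappa> t) = step_index \<tau> t)) sequentially"
    using step_index_time_change[OF J lim ee] by blast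
  have jK: "eventually (\<lambda>n. \<forall>k\<in>{..<K}. i n k = j k) sequentially"
    using j by (subst eventually_ball_finite_distrib) auto
  have ev: "eventually (\<lambda>n. dist (v n) u < e1) sequentially" using v e1(1) by (rule tendstoD)
  show ?thesis
    using K jK V_path_tendsto[OF qm ae e1(1), of T] U_drive_tendsto[OF qm ae e1(1), of T] ev
  proof eventually_elim
    case (elim n)
    then obtain \<kappa> where k: "\<kappa> \<in> time_changes" "\<And>t. t\<ge>0 \<Longrightarrow> \<bar>\<kappa> t - t\<bar> < min e e1"
      "\<And>t. t \<in> {0..T} \<Longrightarrow> step_index \<tau> t < K \<and> step_index (\<sigma> n) (\<kappa> t) = step_index \<tau> t" by blast
    have "dist (flow (s n) (p n) (\<kappa> t)) (flow r q t) < e" if t: "t \<in> {0..T}" for t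
    proof -
      have t0: "0 \<le> t" "0 \<le> \<kappa> t" using t time_changes_ge0[OF k(1), of t] by auto
      have kt: "\<bar>\<kappa> t - t\<bar> < e1" using k(2)[OF t0(1)] by simp
      have same: "p n (\<kappa> t) = q t" using k(3)[OF t] elim(2) t0 by (simp add: p_def q_def step_path_def)
      have "norm (V_path (p n) (\<kappa> t) - V_path (p n) t) \<le> 2 * C * \<bar>\<kappa> t - t\<bar>"
        unfolding V_path_def C_def by (rule exp_conv_Lipschitz[OF V_drive[OF qm(2)] t0])
      also have "\<dots> \<le> 2 * C * e1" using kt C by (intro mult_left_mono) auto
      finally have V1: "norm (V_path (p n) (\<kappa> t) - V_path (p n) t) \<le> 2 * C * e1" .
      have V: "norm (V_path (p n) (\<kappa> t) - V_path q t) \<le> 2 * C * e1 + e1"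
        using norm_triangle_le[OF add_mono[OF V1 less_imp_le[OF elim(3)[rule_format, OF t]]]] by simp
      let ?h = "\<lambda>q. exp_conv (\<lambda>s. b (V_path q s) \<bullet> F_vec F (q s))"
      have "norm (?h (p n) (\<kappa> t) - ?h (p n) t) \<le> 2 * C * \<bar>\<kappa> t - t\<bar>"
        unfolding C_def by (rule exp_conv_Lipschitz[OF U_drive[OF qm(2)] t0])
      also have "\<dots> \<le> 2 * C * e1" using kt C by (intro mult_left_mono) auto
      finally have U1: "\<bar>?h (p n) (\<kappa> t) - ?h (p n) t\<bar> \<le> 2 * C * e1" by simp
      have U2: "\<bar>?h (p n) t - ?h q t\<bar> < e1" using elim(4) t by simp
      have "\<bar>exp (-\<kappa> t) * v n - exp (-t) * u\<bar> \<le> \<bar>exp (-\<kappa> t) * (v n - u)\<bar> + \<bar>(exp (-\<kappa> t) - exp (-t)) * u\<bar>"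
        using abs_triangle_ineq[of "exp (-\<kappa> t) * (v n - u)" "(exp (-\<kappa> t) - exp (-t)) * u"]
        by (simp add: algebra_simps)
      also have "\<dots> \<le> 1 * e1 + e1 * \<bar>u\<bar>"
        unfolding abs_mult
        using elim(5) t0 exp_minus_Lipschitz[OF t0(2,1)] kt by (intro add_mono mult_mono) (auto simp: dist_real_def)
      finally have U3: "\<bar>exp (-\<kappa> t) * v n - exp (-t) * u\<bar> \<le> e1 + e1 * \<bar>u\<bar>" by simp
      have U: "\<bar>U_path (v n) (p n) (\<kappa> t) - U_path u q t\<bar> \<le> 2 * C * e1 + 2 * e1 + e1 * \<bar>u\<bar>"
        using U1 U2 U3 unfolding U_path_def by linarith
      have "dist (flow (s n) (p n) (\<kappa> t)) (flow r q t) =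
        norm (V_path (p n) (\<kappa> t) - V_path q t, U_path (v n) (p n) (\<kappa> t) - U_path u q t)"
        using t0 same by (simp add: flow_def v_def u_def dist_Pair_Pair dist_norm norm_Pair)
      also have "\<dots> \<le> norm (V_path (p n) (\<kappa> t) - V_path q t) + \<bar>U_path (v n) (p n) (\<kappa> t) - U_path u q t\<bar>"
        using norm_Pair_le[of "V_path (p n) (\<kappa> t) - V_path q t" "U_path (v n) (p n) (\<kappa> t) - U_path u q t"] by simp
      also have "\<dots> \<le> e1 * (4 * C + 3 + \<bar>u\<bar>)" using V U by (simp add: algebra_simps)
      also have "\<dots> < e" using e1 by (simp add: algebra_simps)
      finally show ?thesis .
    qed
    moreover have "\<bar>\<kappa> t - t\<bar> < e" if "0 \<le> t" for t using k(2)[OF that] by simp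
    moreover have "flow (s n) (p n) \<in> cadlag"
      unfolding p_def by (rule regime_path_flow_cadlag[OF regime_path_step_path[OF J(2)]])
    ultimately show ?case
      using k(1) unfolding skorohod_nbhd_def p_def q_def by blast
  qed
qed

end

section \<open>Pathwise stability\<close>

text \<open>The pattern for all choices of small constants: dividing by \<open>K + 1\<close> also
  covers \<open>K = 0\<close>.\<close>

lemma small_scaling: "0 \<le> K \<Longrightarrow> 0 < x \<Longrightarrow> 0 < x / (K + 1) \<and> K * (x / (K + 1)) \<le> x" for K x :: real
  by (simp add: divide_le_eq algebra_simps)

text \<open>Only the partial sums of the noise enter, so its cancellations are kept. Subtracting
  them turns the recursion into a convex combination of the previous difference and a negated
  partial sum, which preserves the bound \<open>a\<close>.\<close>

lemma relaxation_bound: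
  fixes d z :: "nat \<Rightarrow> real"
  assumes rec: "\<And>k. k < n \<Longrightarrow> d (Suc k) = (1 - \<mu>) * d k + z k" and "d 0 = 0" and mu: "0 \<le> \<mu>" "\<mu> \<le> 1"
    and z: "\<And>m. m \<le> n \<Longrightarrow> \<bar>\<Sum>k<m. z k\<bar> \<le> a"
  shows "\<bar>d n\<bar> \<le> 2 * a"
proof -
  define S where "S m = (\<Sum>k<m. z k)" for m
  have "m \<le> n \<Longrightarrow> \<bar>d m - S m\<bar> \<le> a" for m
  proof (induction m)
    case 0
    then show ?case using z[of 0] assms(2) by (simp add: S_def)
  next
    case (Suc m)
    have "d (Suc m) - S (Suc m) = (1 - \<mu>) * (d m - S m) + \<mu> * (- S m)"
      using rec[of m] Suc.prems by (simp add: S_def algebra_simps)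
    also have "\<bar>\<dots>\<bar> \<le> (1 - \<mu>) * \<bar>d m - S m\<bar> + \<mu> * \<bar>S m\<bar>"
      using abs_triangle_ineq[of "(1 - \<mu>) * (d m - S m)" "\<mu> * (- S m)"] mu by (simp add: abs_mult)
    also have "\<dots> \<le> (1 - \<mu>) * a + \<mu> * a"
      using Suc z[of m] mu by (intro add_mono mult_left_mono) (auto simp: S_def)
    finally show ?case by (simp add: algebra_simps)
  qed
  from this[of n] z[of n] show ?thesis by (simp add: S_def)
qed

lemma block_bound:
  fixes c x :: "nat \<Rightarrow> real"
  assumes L: "0 < L" and c: "\<And>k. \<bar>c k\<bar> \<le> 1"
    and w: "\<And>j k. j \<le> k \<Longrightarrow> k < n \<Longrightarrow> k \<le> j + L \<Longrightarrow> \<bar>c k - c j\<bar> \<le> w"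
    and x: "\<And>k. k < n \<Longrightarrow> \<bar>x k\<bar> \<le> B" and X: "\<And>m. m \<le> n \<Longrightarrow> \<bar>\<Sum>k<m. x k\<bar> \<le> a"
  shows "\<bar>\<Sum>k<n. c k * x k\<bar> \<le> real n * (w * B) + (real n / real L + 1) * (2 * a)"
  using w x X
proof (induction n rule: less_induct)
  case (less n)
  \<comment> \<open>The last block is split off. By truncated subtraction the first block may be
    shorter than \<open>L\<close>, whence the extra 1 in the number of blocks.\<close>
  define m where "m = n - L"
  have a0: "0 \<le> a" using less.prems(3)[of 0] by simp
  have w0: "0 \<le> w * B" if "0 < n"
    using less.prems(1)[of 0 0] less.prems(2)[of 0] that by (intro mult_nonneg_nonneg) auto
  have m: "m \<le> n" "n \<le> m + L" "m < n \<or> n = 0" using L unfolding m_def by linarith+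
  have split: "(\<Sum>k<n. f k) = (\<Sum>k<m. f k) + (\<Sum>k=m..<n. f k)" for f :: "nat \<Rightarrow> real"
    using m(1) by (metis add.commute lessThan_atLeast0 le0 sum.atLeastLessThan_concat)
  have "(\<Sum>k=m..<n. c k * x k) = (\<Sum>k=m..<n. (c k - c m) * x k) + c m * (\<Sum>k=m..<n. x k)"
    by (simp add: sum_distrib_left algebra_simps flip: sum.distrib)
  also have "\<bar>\<dots>\<bar> \<le> (\<Sum>k=m..<n. w * B) + 1 * (2 * a)"
  proof -
    have "\<bar>\<Sum>k=m..<n. (c k - c m) * x k\<bar> \<le> (\<Sum>k=m..<n. w * B)"
    proof (rule order_trans[OF sum_abs sum_mono])
      fix k assume k: "k \<in> {m..<n}"
      then have "\<bar>c k - c m\<bar> \<le> w" "\<bar>x k\<bar> \<le> B" using less.prems(1)[of m k] less.prems(2)[of k] m by auto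
      then show "\<bar>(c k - c m) * x k\<bar> \<le> w * B" unfolding abs_mult by (intro mult_mono) auto
    qed
    moreover have "(\<Sum>k=m..<n. x k) = (\<Sum>k<n. x k) - (\<Sum>k<m. x k)" using split[of x] by simp
    then have "\<bar>\<Sum>k=m..<n. x k\<bar> \<le> 2 * a" using less.prems(3)[of n] less.prems(3)[of m] m by auto
    then have "\<bar>c m * (\<Sum>k=m..<n. x k)\<bar> \<le> 1 * (2 * a)" unfolding abs_mult using c[of m] a0 by (intro mult_mono) auto
    ultimately show ?thesis by linarith
  qed
  finally have last: "\<bar>\<Sum>k=m..<n. c k * x k\<bar> \<le> real (n - m) * (w * B) + 2 * a" by simp
  show ?case
  proof (cases "m = 0")
    case True
    have "0 \<le> real n / real L * (2 * a)" using a0 by simp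
    then show ?thesis using last split[of "\<lambda>k. c k * x k"] True by (simp add: algebra_simps)
  next
    case False
    then have nm: "m < n" "n = m + L" using L unfolding m_def by linarith+
    have "\<bar>\<Sum>k<m. c k * x k\<bar> \<le> real m * (w * B) + (real m / real L + 1) * (2 * a)"
      by (rule less.IH[OF nm(1)]) (use less.prems m in auto)
    moreover have "real n / real L = real m / real L + 1" using nm(2) L by (simp add: add_divide_distrib)
    moreover have "real n * (w * B) = real m * (w * B) + real (n - m) * (w * B)" using nm by (simp add: algebra_simps)
    ultimately show ?thesis using last split[of "\<lambda>k. c k * x k"] by (simp add: algebra_simps)
  qed
qed

context response
begin

section \<open>The recursion as a perturbed Euler scheme for the flow\<close>

lemma interpolate_on_cell:
  assumes "0 < \<mu>" "real n * \<mu> \<le> t" "t < real (Suc n) * \<mu>"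
  shows "interpolate \<mu> x t = x n"
proof -
  have "0 \<le> t" using assms(1,2) by (meson mult_nonneg_nonneg of_nat_0_le_iff less_imp_le order_trans)
  moreover have "step_index (\<lambda>k. real k * \<mu>) t = n"
    by (rule step_index_eqI[OF mesh_jump_times[OF assms(1)]]) (use assms in auto)
  ultimately show ?thesis by (simp add: interpolate_eq_step_path[OF assms(1)] step_path_def)
qed

lemma interpolate_regime:
  "0 < \<mu> \<Longrightarrow> regime_path (interpolate \<mu> \<theta>)"
  by (simp add: interpolate_eq_step_path regime_path_step_path mesh_jump_times)

lemma interpolate_measurable:
  "0 < \<mu> \<Longrightarrow> interpolate \<mu> \<theta> \<in> measurable borel (count_space UNIV)"
  using interpolate_regime by (auto simp: regime_path_def)

text \<open>The regime is constant inside a cell, so only the quadratic error remains.\<close>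

lemma V_Euler:
  fixes \<theta> :: "nat \<Rightarrow> 'q"
  assumes mu: "0 < \<mu>"
  defines "q \<equiv> interpolate \<mu> \<theta>"
  shows "norm (V_path q (real (Suc n) * \<mu>) - (V_path q (real n * \<mu>) + \<mu> *\<^sub>R (F_vec F (\<theta> n) - V_path q (real n * \<mu>))))
    \<le> 2 * F_bound F * \<mu>\<^sup>2"
proof -
  have qm: "q \<in> measurable borel (count_space UNIV)" unfolding q_def by (rule interpolate_measurable[OF mu])
  have e: "real (Suc n) * \<mu> = real n * \<mu> + \<mu>" by (simp add: algebra_simps)
  have "norm (exp_conv (\<lambda>s. F_vec F (q s)) (real n * \<mu> + \<mu>) - (exp_conv (\<lambda>s. F_vec F (q s)) (real n * \<mu>) +
     \<mu> *\<^sub>R (F_vec F (\<theta> n) - exp_conv (\<lambda>s. F_vec F (q s)) (real n * \<mu>)))) \<le> 0 * \<mu> + 2 * F_bound F * \<mu>\<^sup>2"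
  proof (rule exp_conv_Euler[OF V_drive[OF qm]])
    show "norm (F_vec F (q s) - F_vec F (\<theta> n)) \<le> 0" if "real n * \<mu> < s" "s < real n * \<mu> + \<mu>" for s
      using interpolate_on_cell[OF mu, of n s \<theta>] that by (simp add: q_def algebra_simps)
  qed (use mu F_bound in auto)
  then show ?thesis unfolding e V_path_def by simp
qed

text \<open>Within a cell \<open>V_path\<close> moves by at most
  \<open>2 * F_bound F * \<mu>\<close>, hence by at most \<open>\<eta>\<close>, and the response by
  at most \<open>w\<close>. The term with \<open>\<bar>u\<bar>\<close> is the Euler error of the
  decaying initial value.\<close>

lemma U_Euler:
  fixes \<theta> :: "nat \<Rightarrow> 'q"
  assumes mu: "0 < \<mu>" "2 * F_bound F * \<mu> \<le> \<eta>"
    and w: "\<And>x y. norm x \<le> F_bound F \<Longrightarrow> norm y \<le> F_bound F \<Longrightarrow> norm (x - y) \<le> \<eta> \<Longrightarrow> norm (b x - b y) \<le> w" "0 \<le> w"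
  defines "q \<equiv> interpolate \<mu> \<theta>"
  shows "\<bar>U_path u q (real (Suc n) * \<mu>) - (U_path u q (real n * \<mu>) +
      \<mu> * (b (V_path q (real n * \<mu>)) \<bullet> F_vec F (\<theta> n) - U_path u q (real n * \<mu>)))\<bar>
    \<le> w * F_bound F * \<mu> + (2 * F_bound F + \<bar>u\<bar>) * \<mu>\<^sup>2"
proof -
  define C where "C = F_bound F"
  define t where "t = real n * \<mu>"
  have t: "0 \<le> t" using mu by (simp add: t_def)
  have qm: "q \<in> measurable borel (count_space UNIV)" unfolding q_def by (rule interpolate_measurable[OF mu(1)])
  have e: "real (Suc n) * \<mu> = t + \<mu>" by (simp add: algebra_simps t_def)
  define g where "g s = b (V_path q s) \<bullet> F_vec F (q s)" for s
  define c where "c = b (V_path q t) \<bullet> F_vec F (\<theta> n)"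
  have "norm (exp_conv g (t + \<mu>) - (exp_conv g t + \<mu> *\<^sub>R (c - exp_conv g t))) \<le> (w * C) * \<mu> + 2 * C * \<mu>\<^sup>2"
    unfolding g_def C_def
  proof (rule exp_conv_Euler[OF U_drive[OF qm] t])
    fix s assume s: "t < s" "s < t + \<mu>"
    have qs: "q s = \<theta> n"
      using interpolate_on_cell[OF mu(1), of n s \<theta>] s by (simp add: q_def t_def algebra_simps)
    have "norm (V_path q s - V_path q t) \<le> 2 * F_bound F * \<bar>s - t\<bar>"
      unfolding V_path_def by (rule exp_conv_Lipschitz[OF V_drive[OF qm] t]) (use s t in auto)
    also have "\<dots> \<le> 2 * F_bound F * \<mu>" using s F_bound_ge0[of F] by (intro mult_left_mono) auto
    also have "\<dots> \<le> \<eta>" by (rule mu(2))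
    finally have "norm (b (V_path q s) - b (V_path q t)) \<le> w" by (intro w V_norm qm)
    then have "norm (b (V_path q s) - b (V_path q t)) * norm (F_vec F (\<theta> n)) \<le> w * F_bound F"
      by (intro mult_mono F_bound w(2)) auto
    then show "norm (b (V_path q s) \<bullet> F_vec F (q s) - c) \<le> w * F_bound F"
      using Cauchy_Schwarz_ineq2[of "b (V_path q s) - b (V_path q t)" "F_vec F (\<theta> n)"]
      unfolding qs c_def by (simp add: inner_diff_left)
  next
    show "norm c \<le> F_bound F" using response_inner by (simp add: c_def)
  qed (use mu w F_bound_ge0[of F] in auto)
  then have 1: "\<bar>exp_conv g (t + \<mu>) - (exp_conv g t + \<mu> * (c - exp_conv g t))\<bar> \<le> w * C * \<mu> + 2 * C * \<mu>\<^sup>2" by simp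
  have "exp (-(t + \<mu>)) * u - (exp (-t) * u - \<mu> * (exp (-t) * u)) = (exp (-\<mu>) - 1 + \<mu>) * (exp (-t) * u)"
  proof -
    have "exp (-(t + \<mu>)) = exp (-\<mu>) * exp (-t)" by (simp flip: exp_add)
    then show ?thesis by (simp only:) (simp add: algebra_simps)
  qed
  also have "\<bar>\<dots>\<bar> \<le> \<mu>\<^sup>2 * (1 * \<bar>u\<bar>)"
    unfolding abs_mult using exp_minus_bounds[of \<mu>] mu t by (intro mult_mono) auto
  finally have 2: "\<bar>exp (-(t + \<mu>)) * u - (exp (-t) * u - \<mu> * (exp (-t) * u))\<bar> \<le> \<mu>\<^sup>2 * \<bar>u\<bar>" by simp
  have "U_path u q (t + \<mu>) - (U_path u q t + \<mu> * (c - U_path u q t)) =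
     (exp_conv g (t + \<mu>) - (exp_conv g t + \<mu> * (c - exp_conv g t))) +
     (exp (-(t + \<mu>)) * u - (exp (-t) * u - \<mu> * (exp (-t) * u)))"
    unfolding U_path_def g_def[abs_def] by (simp add: algebra_simps)
  then have "\<bar>U_path u q (t + \<mu>) - (U_path u q t + \<mu> * (c - U_path u q t))\<bar> \<le> (w * C * \<mu> + 2 * C * \<mu>\<^sup>2) + \<mu>\<^sup>2 * \<bar>u\<bar>"
    using 1 2 by linarith
  then show ?thesis unfolding e t_def[symmetric] c_def[symmetric] C_def by (simp add: algebra_simps)
qed

text \<open>
  The truncation keeps the noise bounded: beyond norm \<open>R\<close> the components of the best response may be
  arbitrarily small.
\<close>

definition sampling_noise :: "real \<Rightarrow> real \<Rightarrow> (nat \<Rightarrow> 's \<Rightarrow> real) \<Rightarrow> (nat \<Rightarrow> 's) \<Rightarrow> 's \<Rightarrow> nat \<Rightarrow> real" where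
  "sampling_noise \<mu> R y s i n = (\<Sum>k<n. \<mu> * (if norm (f_tilde \<mu> b y s k) \<le> R
     then g_vec (b (f_tilde \<mu> b y s k)) (s k) (y k (s k)) $ i - y k i else 0))"

text \<open>Nothing is divided by a component of the response here, so the summands are bounded by
  the data without truncation.\<close>

definition value_noise :: "real \<Rightarrow> (nat \<Rightarrow> 's \<Rightarrow> real) \<Rightarrow> (nat \<Rightarrow> 's) \<Rightarrow> nat \<Rightarrow> real" where
  "value_noise \<mu> y s n = (\<Sum>k<n. \<mu> * (y k (s k) - b (f_tilde \<mu> b y s k) \<bullet> (\<chi> i. y k i)))"

definition data_noise :: "real \<Rightarrow> (nat \<Rightarrow> 's \<Rightarrow> real) \<Rightarrow> (nat \<Rightarrow> 'q) \<Rightarrow> 's \<Rightarrow> nat \<Rightarrow> real" where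
  "data_noise \<mu> y \<theta> i n = (\<Sum>k<n. \<mu> * (y k i - F i (\<theta> k)))"

text \<open>Strong induction closes a loop: as long as the earlier iterates are within
  \<open>d\<close> of \<open>V_path\<close>, they lie in the ball of radius \<open>R\<close>, so the
  truncated noise is the true noise and the next iterate is close as well. Each component errs by
  twice the sum of sampling noise, data noise and Euler errors; the norm is bounded by the sum over
  components.\<close>

lemma f_tilde_near_V:
  assumes mu: "0 < \<mu>" "\<mu> \<le> 1"
    and A: "\<And>i m. m \<le> n \<Longrightarrow> \<bar>sampling_noise \<mu> R y s i m\<bar> \<le> \<delta>"
    and D: "\<And>i m. m \<le> n \<Longrightarrow> \<bar>data_noise \<mu> y \<theta> i m\<bar> \<le> \<delta>"
    and n: "real n * \<mu> \<le> T"
    and small: "real CARD('s) * (4 * \<delta> + 4 * F_bound F * T * \<mu>) \<le> d" "F_bound F + d \<le> R"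
  shows "norm (f_tilde \<mu> b y s n - V_path (interpolate \<mu> \<theta>) (real n * \<mu>)) \<le> d"
  using A D n
proof (induction n rule: less_induct)
  case (less n)
  define q where "q = interpolate \<mu> \<theta>"
  define V where "V k = V_path q (real k * \<mu>)" for k
  define v where "v = f_tilde \<mu> b y s"
  define err where "err k = V (Suc k) - (V k + \<mu> *\<^sub>R (F_vec F (\<theta> k) - V k))" for k
  have qm: "q \<in> measurable borel (count_space UNIV)" unfolding q_def by (rule interpolate_measurable[OF mu(1)])
  have err: "norm (err k) \<le> 2 * F_bound F * \<mu>\<^sup>2" for k unfolding err_def V_def q_def by (rule V_Euler[OF mu(1)])
  have inR: "norm (v k) \<le> R" if "k < n" for k
  proof -
    have "real k * \<mu> \<le> real n * \<mu>" using that mu by (intro mult_right_mono) auto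
    then have "norm (v k - V k) \<le> d" unfolding v_def V_def q_def
      by (intro less.IH[OF that]) (use less.prems that in auto)
    then show ?thesis using V_norm[OF qm, of "real k * \<mu>"] norm_triangle_sub[of "v k" "V k"] small(2)
      by (simp add: V_def)
  qed
  have comp: "\<bar>(v n - V n) $ i\<bar> \<le> 2 * (2 * \<delta> + 2 * F_bound F * T * \<mu>)" for i
  proof (rule relaxation_bound[where \<mu>=\<mu> and z="\<lambda>k. \<mu> * (g_vec (b (v k)) (s k) (y k (s k)) $ i - F i (\<theta> k)) - err k $ i"])
    show "(v (Suc k) - V (Suc k)) $ i = (1 - \<mu>) * (v k - V k) $ i +
      (\<mu> * (g_vec (b (v k)) (s k) (y k (s k)) $ i - F i (\<theta> k)) - err k $ i)" for k
      by (simp add: err_def v_def F_vec_def algebra_simps)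
    show "(v 0 - V 0) $ i = 0" by (simp add: v_def V_def V_path_def exp_conv_0)
    fix m assume m: "m \<le> n"
    have "(\<Sum>k<m. \<mu> * (g_vec (b (v k)) (s k) (y k (s k)) $ i - F i (\<theta> k)) - err k $ i) =
      sampling_noise \<mu> R y s i m + data_noise \<mu> y \<theta> i m - (\<Sum>k<m. err k $ i)"
      unfolding sampling_noise_def data_noise_def sum_subtractf sum.distrib[symmetric]
      using inR m by (auto simp: v_def algebra_simps intro!: sum.cong)
    moreover have "\<bar>\<Sum>k<m. err k $ i\<bar> \<le> (\<Sum>k<m. 2 * F_bound F * \<mu>\<^sup>2)"
      by (rule order_trans[OF sum_abs sum_mono]) (use err component_le_norm_cart order_trans in blast)
    \<comment> \<open>There are at most \<open>T / \<mu>\<close> steps, so quadratic local errors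
      accumulate to order \<open>\<mu>\<close>.\<close>
    moreover have "(\<Sum>k<m. 2 * F_bound F * \<mu>\<^sup>2) \<le> 2 * F_bound F * T * \<mu>"
    proof -
      have "real m * \<mu> \<le> T" using m mu less.prems(3) by (meson mult_right_mono of_nat_mono less_imp_le order_trans)
      then have "(real m * \<mu>) * (2 * F_bound F * \<mu>) \<le> T * (2 * F_bound F * \<mu>)"
        using mu F_bound_ge0[of F] by (intro mult_right_mono) auto
      then show ?thesis by (simp add: power2_eq_square algebra_simps)
    qed
    ultimately show "\<bar>\<Sum>k<m. \<mu> * (g_vec (b (v k)) (s k) (y k (s k)) $ i - F i (\<theta> k)) - err k $ i\<bar>
      \<le> 2 * \<delta> + 2 * F_bound F * T * \<mu>"
      using less.prems(1)[OF m, of i] less.prems(2)[OF m, of i] by linarith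
  qed (use mu in auto)
  have "norm (v n - V n) \<le> (\<Sum>i\<in>UNIV. \<bar>(v n - V n) $ i\<bar>)" by (rule norm_le_l1_cart)
  also have "\<dots> \<le> (\<Sum>i\<in>(UNIV::'s set). 2 * (2 * \<delta> + 2 * F_bound F * T * \<mu>))" by (rule sum_mono) (rule comp)
  also have "\<dots> \<le> d" using small(1) by (simp add: algebra_simps)
  finally show ?case by (simp add: v_def V_def q_def)
qed

lemma F_le_bound: "\<bar>F i j\<bar> \<le> F_bound F"
  using component_le_norm_cart[of "F_vec F j" i] F_bound[of F j] by (simp add: F_vec_def)

lemma F_min_le_bound: "\<bar>F_min F j\<bar> \<le> F_bound F"
proof -
  have "F_min F j \<in> range (\<lambda>i. F i j)" unfolding F_min_def by (rule Min_in) auto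
  then show ?thesis using F_le_bound by auto
qed

text \<open>The driving term differs from its limit by four sums: the martingale part of the sampled
  value, the replacement of \<open>b (v k)\<close> by \<open>b (V k)\<close>, the data noise
  weighted by \<open>b (V k)\<close>, and the Euler error. The third is known only through
  unweighted partial sums; as \<open>V\<close> moves slowly, the weights are frozen on blocks of
  \<open>L\<close> steps.\<close>

lemma value_near_U:
  fixes \<theta> :: "nat \<Rightarrow> 'q" and r0 :: real
  assumes mu: "0 < \<mu>" "\<mu> \<le> 1"
    and A: "\<And>i m. m \<le> n \<Longrightarrow> \<bar>sampling_noise \<mu> R y s i m\<bar> \<le> \<delta>"
    and D: "\<And>i m. m \<le> n \<Longrightarrow> \<bar>data_noise \<mu> y \<theta> i m\<bar> \<le> \<delta>"
    and M: "\<And>m. m \<le> n \<Longrightarrow> \<bar>value_noise \<mu> y s m\<bar> \<le> \<delta>"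
    and y: "\<And>k i. \<bar>y k i\<bar> \<le> C"
    and n: "real n * \<mu> \<le> T"
    and small: "real CARD('s) * (4 * \<delta> + 4 * F_bound F * T * \<mu>) \<le> d" "F_bound F + d \<le> R" "d \<le> \<eta>" "0 \<le> d"
      "2 * F_bound F * \<mu> \<le> \<eta>"
    and w: "\<And>x y. norm x \<le> R \<Longrightarrow> norm y \<le> R \<Longrightarrow> norm (x - y) \<le> \<eta> \<Longrightarrow> norm (b x - b y) \<le> w" "0 \<le> w"
    and L: "0 < L" "2 * F_bound F * (real L * \<mu>) \<le> \<eta>"
  defines "u0 \<equiv> r0 + F_min F (\<theta> 0)" and "S \<equiv> real CARD('s)"
  shows "\<bar>snd (X_rec \<mu> b F y s \<theta> r0 n) + F_min F (\<theta> n) - U_path u0 (interpolate \<mu> \<theta>) (real n * \<mu>)\<bar>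
    \<le> 2 * (\<delta> + T * w * (S * C) + S * (T * w * (C + F_bound F) + (T / (real L * \<mu>) + 1) * (2 * \<delta>)) +
       (T * w * F_bound F + (2 * F_bound F + \<bar>u0\<bar>) * T * \<mu>))"
proof -
  define q where "q = interpolate \<mu> \<theta>"
  define V where "V k = V_path q (real k * \<mu>)" for k
  define U where "U k = U_path u0 q (real k * \<mu>)" for k
  define v where "v = f_tilde \<mu> b y s"
  define u where "u k = snd (X_rec \<mu> b F y s \<theta> r0 k) + F_min F (\<theta> k)" for k
  define Y where "Y k = (\<chi> i. y k i)" for k
  define err where "err k = U (Suc k) - (U k + \<mu> * (b (V k) \<bullet> F_vec F (\<theta> k) - U k))" for k
  have qm: "q \<in> measurable borel (count_space UNIV)" unfolding q_def by (rule interpolate_measurable[OF mu(1)])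
  have Fb: "0 \<le> F_bound F" by (rule F_bound_ge0)
  have C0: "0 \<le> C" using y[of 0 undefined] by simp
  have S0: "0 \<le> S" by (simp add: S_def)
  have mT: "real m * \<mu> \<le> T" if "m \<le> n" for m
    using that mu n by (meson mult_right_mono of_nat_mono less_imp_le order_trans)
  have Vn: "norm (V k) \<le> F_bound F" for k unfolding V_def by (rule V_norm[OF qm])
  have vV: "norm (v k - V k) \<le> d" if "k \<le> n" for k
    unfolding v_def V_def q_def by (rule f_tilde_near_V[OF mu _ _ mT[OF that] small(1,2)]) (use A D that in auto)
  have err: "\<bar>err k\<bar> \<le> w * F_bound F * \<mu> + (2 * F_bound F + \<bar>u0\<bar>) * \<mu>\<^sup>2" for k
    unfolding err_def V_def U_def q_def
    by (rule U_Euler[OF mu(1) small(5)]) (use w small(2,4) in auto)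
  have bv: "norm (b (v k) - b (V k)) \<le> w" if "k \<le> n" for k
  proof (rule w(1))
    show "norm (v k) \<le> R" using vV[OF that] Vn[of k] norm_triangle_sub[of "v k" "V k"] small(2) by linarith
    show "norm (V k) \<le> R" using Vn[of k] small(2,4) by linarith
    show "norm (v k - V k) \<le> \<eta>" using vV[OF that] small(3) by linarith
  qed
  have bV: "norm (b (V k) - b (V j)) \<le> w" if "j \<le> k" "k \<le> j + L" for j k
  proof (rule w(1))
    show "norm (V k) \<le> R" "norm (V j) \<le> R" using Vn[of k] Vn[of j] small(2,4) by linarith+
    have "norm (V k - V j) \<le> 2 * F_bound F * \<bar>real k * \<mu> - real j * \<mu>\<bar>"
      unfolding V_def V_path_def by (rule exp_conv_Lipschitz[OF V_drive[OF qm]]) (use mu in auto)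
    also have "\<dots> \<le> 2 * F_bound F * (real L * \<mu>)"
    proof -
      have "real k * \<mu> \<le> real (j + L) * \<mu>" "real j * \<mu> \<le> real k * \<mu>" using that mu by (intro mult_right_mono; simp)+
      then have "\<bar>real k * \<mu> - real j * \<mu>\<bar> \<le> real L * \<mu>" by (simp add: algebra_simps)
      then show ?thesis using Fb by (intro mult_left_mono) auto
    qed
    finally show "norm (V k - V j) \<le> \<eta>" using L(2) by linarith
  qed
  have Yn: "norm (Y k) \<le> S * C" for k
    using norm_le_l1_cart[of "Y k"] sum_mono[of UNIV "\<lambda>i. \<bar>y k i\<bar>" "\<lambda>_. C"] y by (auto simp: Y_def S_def intro: order_trans)
  have "\<bar>u n - U n\<bar> \<le> 2 * (\<delta> + T * w * (S * C) + S * (T * w * (C + F_bound F) + (T / (real L * \<mu>) + 1) * (2 * \<delta>)) +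
       (T * w * F_bound F + (2 * F_bound F + \<bar>u0\<bar>) * T * \<mu>))"
  proof (rule relaxation_bound[where \<mu>=\<mu> and z="\<lambda>k. \<mu> * (y k (s k) - b (V k) \<bullet> F_vec F (\<theta> k)) - err k"])
    show "u (Suc k) - U (Suc k) = (1 - \<mu>) * (u k - U k) + (\<mu> * (y k (s k) - b (V k) \<bullet> F_vec F (\<theta> k)) - err k)" for k
      by (simp add: u_def err_def algebra_simps)
    show "u 0 - U 0 = 0" by (simp add: u_def U_def U_path_def exp_conv_0 u0_def)
    fix m assume m: "m \<le> n"
    have e1: "(\<Sum>k<m. \<mu> * (y k (s k) - b (V k) \<bullet> F_vec F (\<theta> k)) - err k) =
      value_noise \<mu> y s m + (\<Sum>k<m. \<mu> * ((b (v k) - b (V k)) \<bullet> Y k)) +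
      (\<Sum>k<m. \<mu> * (b (V k) \<bullet> (Y k - F_vec F (\<theta> k)))) - (\<Sum>k<m. err k)"
    proof -
      have "(\<Sum>k<m. \<mu> * (y k (s k) - b (V k) \<bullet> F_vec F (\<theta> k)) - err k) =
        (\<Sum>k<m. \<mu> * (y k (s k) - b (v k) \<bullet> Y k) + \<mu> * ((b (v k) - b (V k)) \<bullet> Y k) +
          \<mu> * (b (V k) \<bullet> (Y k - F_vec F (\<theta> k))) - err k)"
        by (rule sum.cong) (simp_all add: inner_diff_left inner_diff_right algebra_simps)
      also have "\<dots> = (\<Sum>k<m. \<mu> * (y k (s k) - b (v k) \<bullet> Y k)) + (\<Sum>k<m. \<mu> * ((b (v k) - b (V k)) \<bullet> Y k)) +
         (\<Sum>k<m. \<mu> * (b (V k) \<bullet> (Y k - F_vec F (\<theta> k)))) - (\<Sum>k<m. err k)"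
        by (simp only: sum.distrib sum_subtractf)
      finally show ?thesis unfolding value_noise_def v_def Y_def .
    qed
    have e2: "\<bar>\<Sum>k<m. \<mu> * ((b (v k) - b (V k)) \<bullet> Y k)\<bar> \<le> T * w * (S * C)"
    proof -
      have "\<bar>\<Sum>k<m. \<mu> * ((b (v k) - b (V k)) \<bullet> Y k)\<bar> \<le> (\<Sum>k<m. \<mu> * (w * (S * C)))"
      proof (rule order_trans[OF sum_abs sum_mono])
        fix k assume "k \<in> {..<m}"
        then have "norm (b (v k) - b (V k)) * norm (Y k) \<le> w * (S * C)" using bv[of k] Yn[of k] m w(2) by (intro mult_mono) auto
        then have "\<bar>(b (v k) - b (V k)) \<bullet> Y k\<bar> \<le> w * (S * C)" by (rule order_trans[OF Cauchy_Schwarz_ineq2])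
        then show "\<bar>\<mu> * ((b (v k) - b (V k)) \<bullet> Y k)\<bar> \<le> \<mu> * (w * (S * C))" using mu by (simp add: abs_mult)
      qed
      also have "\<dots> = (real m * \<mu>) * (w * (S * C))" by simp
      also have "\<dots> \<le> T * (w * (S * C))" using mT[OF m] w(2) S0 C0 by (intro mult_right_mono) auto
      finally show ?thesis by (simp add: mult.assoc)
    qed
    have e3: "\<bar>\<Sum>k<m. \<mu> * (b (V k) \<bullet> (Y k - F_vec F (\<theta> k)))\<bar> \<le>
       S * (T * w * (C + F_bound F) + (T / (real L * \<mu>) + 1) * (2 * \<delta>))"
    proof -
      have "(\<Sum>k<m. \<mu> * (b (V k) \<bullet> (Y k - F_vec F (\<theta> k)))) = (\<Sum>k<m. \<Sum>i\<in>UNIV. b (V k) $ i * (\<mu> * (y k i - F i (\<theta> k))))"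
        by (simp add: inner_vec_def Y_def F_vec_def sum_distrib_left algebra_simps)
      also have "\<dots> = (\<Sum>i\<in>UNIV. \<Sum>k<m. b (V k) $ i * (\<mu> * (y k i - F i (\<theta> k))))" by (rule sum.swap)
      also have "\<bar>\<dots>\<bar> \<le> (\<Sum>i\<in>(UNIV::'s set). T * w * (C + F_bound F) + (T / (real L * \<mu>) + 1) * (2 * \<delta>))"
      proof (rule order_trans[OF sum_abs sum_mono])
        fix i
        have "\<bar>\<Sum>k<m. b (V k) $ i * (\<mu> * (y k i - F i (\<theta> k)))\<bar> \<le>
          real m * (w * (\<mu> * (C + F_bound F))) + (real m / real L + 1) * (2 * \<delta>)"
        proof (rule block_bound[OF L(1)])
          show "\<bar>b (V k) $ i\<bar> \<le> 1" for k using component_le_norm_cart[of "b (V k)" i] b_norm[of "V k"] by simp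
          show "\<bar>b (V k) $ i - b (V j) $ i\<bar> \<le> w" if "j \<le> k" "k \<le> j + L" for j k
            using bV[OF that] component_le_norm_cart[of "b (V k) - b (V j)" i] by simp
          show "\<bar>\<mu> * (y k i - F i (\<theta> k))\<bar> \<le> \<mu> * (C + F_bound F)" for k
          proof -
            have "\<bar>y k i - F i (\<theta> k)\<bar> \<le> C + F_bound F" using y[of k i] F_le_bound[of i "\<theta> k"] by linarith
            then show ?thesis using mu by (simp add: abs_mult)
          qed
          show "\<bar>\<Sum>k<j. \<mu> * (y k i - F i (\<theta> k))\<bar> \<le> \<delta>" if "j \<le> m" for j
            using D[of j i] that m by (simp add: data_noise_def)
        qed
        also have "\<dots> \<le> T * w * (C + F_bound F) + (T / (real L * \<mu>) + 1) * (2 * \<delta>)"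
        proof (rule add_mono)
          have "(real m * \<mu>) * (w * (C + F_bound F)) \<le> T * (w * (C + F_bound F))"
            using mT[OF m] w(2) C0 Fb by (intro mult_right_mono) auto
          then show "real m * (w * (\<mu> * (C + F_bound F))) \<le> T * w * (C + F_bound F)" by (simp add: algebra_simps)
          have "real m / real L = (real m * \<mu>) / (real L * \<mu>)" using mu by simp
          also have "\<dots> \<le> T / (real L * \<mu>)" using mT[OF m] mu L(1) by (intro divide_right_mono) auto
          finally show "(real m / real L + 1) * (2 * \<delta>) \<le> (T / (real L * \<mu>) + 1) * (2 * \<delta>)"
            using M[of 0] by (intro mult_right_mono) auto
        qed
        finally show "\<bar>\<Sum>k<m. b (V k) $ i * (\<mu> * (y k i - F i (\<theta> k)))\<bar> \<le> \<dots>" .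
      qed
      finally show ?thesis by (simp add: S_def)
    qed
    have e4: "\<bar>\<Sum>k<m. err k\<bar> \<le> T * w * F_bound F + (2 * F_bound F + \<bar>u0\<bar>) * T * \<mu>"
    proof -
      have "\<bar>\<Sum>k<m. err k\<bar> \<le> (\<Sum>k<m. w * F_bound F * \<mu> + (2 * F_bound F + \<bar>u0\<bar>) * \<mu>\<^sup>2)"
        by (rule order_trans[OF sum_abs sum_mono]) (rule err)
      also have "\<dots> = (real m * \<mu>) * (w * F_bound F + (2 * F_bound F + \<bar>u0\<bar>) * \<mu>)"
        by (simp add: algebra_simps power2_eq_square)
      also have "\<dots> \<le> T * (w * F_bound F + (2 * F_bound F + \<bar>u0\<bar>) * \<mu>)"
        using mT[OF m] w(2) Fb mu by (intro mult_right_mono) auto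
      finally show ?thesis by (simp add: algebra_simps)
    qed
    show "\<bar>\<Sum>k<m. \<mu> * (y k (s k) - b (V k) \<bullet> F_vec F (\<theta> k)) - err k\<bar> \<le> \<delta> + T * w * (S * C) +
      S * (T * w * (C + F_bound F) + (T / (real L * \<mu>) + 1) * (2 * \<delta>)) +
       (T * w * F_bound F + (2 * F_bound F + \<bar>u0\<bar>) * T * \<mu>)"
      unfolding e1 using M[OF m] e2 e3 e4 by linarith
  qed (use mu in auto)
  then show ?thesis by (simp add: u_def U_def q_def)
qed

text \<open>The order of the choices matters. The accuracy \<open>e\<close> fixes the tolerance
  \<open>w\<close> for the response, then a modulus \<open>\<eta>\<close> of uniform continuity,
  then the block duration \<open>h\<close>. The noise level \<open>\<delta>\<close> comes after
  \<open>h\<close>, since it is multiplied by the number of blocks, of order \<open>T / h\<close>;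
  the step size comes last.\<close>

lemma pathwise_stability:
  assumes T: "0 < T" and e: "0 < e" and C: "0 \<le> C" and R0: "0 \<le> R0"
  shows "\<exists>\<delta>>0. \<exists>\<mu>1>0. \<forall>\<mu> y s \<theta> r0. 0 < \<mu> \<longrightarrow> \<mu> \<le> \<mu>1 \<longrightarrow> \<bar>r0\<bar> \<le> R0 \<longrightarrow> (\<forall>k i. \<bar>y k i\<bar> \<le> C) \<longrightarrow>
     (\<forall>m. real m * \<mu> \<le> T \<longrightarrow> \<bar>value_noise \<mu> y s m\<bar> \<le> \<delta> \<and>
       (\<forall>i. \<bar>sampling_noise \<mu> (F_bound F + 1) y s i m\<bar> \<le> \<delta> \<and> \<bar>data_noise \<mu> y \<theta> i m\<bar> \<le> \<delta>)) \<longrightarrow>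
     (\<forall>t\<in>{0..T}. dist (interpolate \<mu> (\<lambda>n. (X_rec \<mu> b F y s \<theta> r0 n, \<theta> n)) t) (flow r0 (interpolate \<mu> \<theta>) t) < e)"
proof -
  define S where "S = real CARD('s)"
  define Fb where "Fb = F_bound F"
  define R where "R = Fb + 1"
  define K0 where "K0 = R0 + Fb"
  have Fb: "0 \<le> Fb" by (simp add: Fb_def F_bound_ge0)
  have S: "0 \<le> S" by (simp add: S_def)
  have K0: "0 \<le> K0" using R0 Fb by (simp add: K0_def)
  define W where "W = 2 * T * (S * C + S * (C + Fb) + Fb)"
  define w where "w = (e / 4) / (W + 1)"
  have W: "0 \<le> W" using T S C Fb by (simp add: W_def)
  have w: "0 < w" "W * w \<le> e / 4" using small_scaling[OF W, of "e/4"] e by (auto simp: w_def)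
  have "uniformly_continuous_on (cball 0 R) b"
    by (rule compact_uniformly_continuous) (use b_cont continuous_on_subset in auto)
  then obtain \<eta>' where eta': "0 < \<eta>'" "\<And>x y. x \<in> cball 0 R \<Longrightarrow> y \<in> cball 0 R \<Longrightarrow> dist y x < \<eta>' \<Longrightarrow> dist (b y) (b x) < w"
    unfolding uniformly_continuous_on_def using w(1) by metis
  define \<eta> where "\<eta> = \<eta>' / 2"
  have eta: "0 < \<eta>" "\<And>x y. norm x \<le> R \<Longrightarrow> norm y \<le> R \<Longrightarrow> norm (x - y) \<le> \<eta> \<Longrightarrow> norm (b x - b y) \<le> w"
  proof -
    show "0 < \<eta>" using eta'(1) by (simp add: \<eta>_def)
    fix x y :: "real^'s" assume "norm x \<le> R" "norm y \<le> R" "norm (x - y) \<le> \<eta>"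
    then show "norm (b x - b y) \<le> w" using eta'(2)[of y x] eta'(1) by (simp add: dist_norm \<eta>_def)
  qed
  define d where "d = min 1 (min \<eta> (e / 4))"
  have d: "0 < d" "d \<le> 1" "d \<le> \<eta>" "d \<le> e / 4" using eta(1) e by (auto simp: d_def)
  define h where "h = \<eta> / (2 * Fb + 1)"
  have h: "0 < h" "2 * Fb * h \<le> \<eta>" using small_scaling[of "2 * Fb" \<eta>] Fb eta(1) by (auto simp: h_def)
  define D1 where "D1 = 2 * (1 + S * ((2 * T / h + 1) * 2))"
  have D1: "0 \<le> D1" using S T h by (simp add: D1_def)
  define \<delta> where "\<delta> = min ((d / 2) / (4 * S + 1)) ((e / 8) / (D1 + 1))"
  have delta: "0 < \<delta>" "4 * S * \<delta> \<le> d / 2" "D1 * \<delta> \<le> e / 8"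
  proof -
    have 1: "0 < (d / 2) / (4 * S + 1)" "4 * S * ((d / 2) / (4 * S + 1)) \<le> d / 2"
      using small_scaling[of "4 * S" "d / 2"] S d by auto
    have 2: "0 < (e / 8) / (D1 + 1)" "D1 * ((e / 8) / (D1 + 1)) \<le> e / 8" using small_scaling[OF D1, of "e/8"] e by auto
    show "0 < \<delta>" using 1 2 by (simp add: \<delta>_def)
    show "4 * S * \<delta> \<le> d / 2" using 1(2) S by (smt (verit) \<delta>_def min.cobounded1 mult_left_mono)
    show "D1 * \<delta> \<le> e / 8" using 2(2) D1 by (smt (verit) \<delta>_def min.cobounded2 mult_left_mono)
  qed
  define D2 where "D2 = S * (4 * Fb * T)"
  define D3 where "D3 = 2 * ((2 * Fb + K0) * T) + (2 * Fb + K0) + 2 * Fb"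
  have D2: "0 \<le> D2" and D3: "0 \<le> D3" using S Fb T K0 by (auto simp: D2_def D3_def)
  define \<mu>1 where "\<mu>1 = min (min 1 (h / 2)) (min ((d / 2) / (D2 + 1)) ((e / 8) / (D3 + 1)))"
  have m1: "0 < \<mu>1" "\<mu>1 \<le> 1" "\<mu>1 \<le> h / 2" "D2 * \<mu>1 \<le> d / 2" "D3 * \<mu>1 \<le> e / 8"
  proof -
    have 1: "0 < (d / 2) / (D2 + 1)" "D2 * ((d / 2) / (D2 + 1)) \<le> d / 2" using small_scaling[OF D2, of "d / 2"] d by auto
    have 2: "0 < (e / 8) / (D3 + 1)" "D3 * ((e / 8) / (D3 + 1)) \<le> e / 8" using small_scaling[OF D3, of "e/8"] e by auto
    show "0 < \<mu>1" "\<mu>1 \<le> 1" using 1 2 h by (auto simp: \<mu>1_def)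
    show "\<mu>1 \<le> h / 2" unfolding \<mu>1_def by (meson min.cobounded1 min.cobounded2 order_trans)
    have "\<mu>1 \<le> (d / 2) / (D2 + 1)" "\<mu>1 \<le> (e / 8) / (D3 + 1)" by (auto simp: \<mu>1_def min_le_iff_disj)
    then show "D2 * \<mu>1 \<le> d / 2" "D3 * \<mu>1 \<le> e / 8" using 1(2) 2(2) mult_left_mono[OF _ D2] mult_left_mono[OF _ D3] order_trans by blast+
  qed
  show ?thesis
  proof (rule exI[of _ \<delta>], intro conjI delta(1) exI[of _ \<mu>1] m1(1) allI impI ballI)
    fix \<mu> r0 t :: real and y and s :: "nat \<Rightarrow> 's" and \<theta> :: "nat \<Rightarrow> 'q"
    assume mu: "0 < \<mu>" "\<mu> \<le> \<mu>1" and r0: "\<bar>r0\<bar> \<le> R0" and y: "\<forall>k i. \<bar>y k i\<bar> \<le> C"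
      and noise: "\<forall>m. real m * \<mu> \<le> T \<longrightarrow> \<bar>value_noise \<mu> y s m\<bar> \<le> \<delta> \<and>
       (\<forall>i. \<bar>sampling_noise \<mu> (F_bound F + 1) y s i m\<bar> \<le> \<delta> \<and> \<bar>data_noise \<mu> y \<theta> i m\<bar> \<le> \<delta>)"
      and t: "t \<in> {0..T}"
    define q where "q = interpolate \<mu> \<theta>"
    have qm: "q \<in> measurable borel (count_space UNIV)" unfolding q_def by (rule interpolate_measurable[OF mu(1)])
    define n where "n = step_index (\<lambda>k. real k * \<mu>) t"
    have n: "real n * \<mu> \<le> t" "t < real (Suc n) * \<mu>"
      using step_index_bounds[OF mesh_jump_times[OF mu(1)], of t] t by (auto simp: n_def)
    have nT: "real n * \<mu> \<le> T" using n t by simp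
    have mT: "real m * \<mu> \<le> T" if "m \<le> n" for m
      using that mu(1) nT by (meson mult_right_mono of_nat_mono less_imp_le order_trans)
    have tn: "\<bar>t - real n * \<mu>\<bar> \<le> \<mu>" using n by (simp add: algebra_simps)
    have mu1: "\<mu> \<le> 1" "\<mu> \<le> h / 2" using mu m1 by auto
    have D2': "D2 * \<mu> \<le> d / 2" "D3 * \<mu> \<le> e / 8"
      using mult_left_mono[OF mu(2) D2] mult_left_mono[OF mu(2) D3] m1(4,5) by auto
    \<comment> \<open>The bound \<open>h / 2\<close> on the step size guarantees that rounding loses
      at most half, so the number of blocks is bounded in terms of \<open>T / h\<close> for all
      small step sizes.\<close>
    define L where "L = nat \<lfloor>h / \<mu>\<rfloor>"
    have hm: "2 \<le> h / \<mu>" using mu1(2) mu(1) by (simp add: le_divide_eq)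
    have L: "real L \<le> h / \<mu>" "h / \<mu> - 1 < real L" using hm unfolding L_def by linarith+
    have Lm: "real L * \<mu> \<le> h" using L(1) mu(1) by (simp add: pos_le_divide_eq)
    have Lh: "h / 2 \<le> real L * \<mu>"
    proof -
      define x where "x = h / \<mu>"
      have "x / 2 \<le> real L" using L(2) hm unfolding x_def[symmetric] by linarith
      then show ?thesis using mu(1) by (simp add: x_def pos_divide_le_eq field_simps)
    qed
    have L0: "0 < L" using L(2) hm by linarith
    have sm1: "real CARD('s) * (4 * \<delta> + 4 * F_bound F * T * \<mu>) \<le> d"
      using delta(2) D2'(1) by (simp add: D2_def S_def Fb_def algebra_simps)
    have sm2: "F_bound F + d \<le> F_bound F + 1" using d by simp
    have sm5: "2 * F_bound F * \<mu> \<le> \<eta>"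
    proof -
      have "2 * Fb * \<mu> \<le> 2 * Fb * h" using mu1(2) h(1) Fb by (intro mult_left_mono) auto
      then show ?thesis using h(2) by (simp add: Fb_def)
    qed
    have sL: "2 * F_bound F * (real L * \<mu>) \<le> \<eta>"
    proof -
      have "2 * Fb * (real L * \<mu>) \<le> 2 * Fb * h" using Lm Fb by (intro mult_left_mono) auto
      then show ?thesis using h(2) by (simp add: Fb_def)
    qed
    have eta2: "norm (b x - b y) \<le> w" if "norm x \<le> F_bound F + 1" "norm y \<le> F_bound F + 1" "norm (x - y) \<le> \<eta>" for x y
      using eta(2) that by (simp add: R_def Fb_def)
    define u0 where "u0 = r0 + F_min F (\<theta> 0)"
    have u0: "\<bar>u0\<bar> \<le> K0" using r0 F_min_le_bound[of "\<theta> 0"] unfolding u0_def K0_def Fb_def by linarith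
    have v: "norm (f_tilde \<mu> b y s n - V_path q (real n * \<mu>)) \<le> d"
      unfolding q_def by (rule f_tilde_near_V[OF mu(1) mu1(1) _ _ nT sm1 sm2]) (use noise mT in auto)
    have "\<bar>snd (X_rec \<mu> b F y s \<theta> r0 n) + F_min F (\<theta> n) - U_path u0 q (real n * \<mu>)\<bar>
      \<le> 2 * (\<delta> + T * w * (S * C) + S * (T * w * (C + F_bound F) + (T / (real L * \<mu>) + 1) * (2 * \<delta>)) +
       (T * w * F_bound F + (2 * F_bound F + \<bar>u0\<bar>) * T * \<mu>))"
      unfolding q_def u0_def S_def
      by (rule value_near_U[OF mu(1) mu1(1) _ _ _ _ nT sm1 sm2 d(3) less_imp_le[OF d(1)] sm5 eta2 less_imp_le[OF w(1)] L0 sL])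
        (use noise mT y in auto)
    also have "\<dots> \<le> 2 * (\<delta> + T * w * (S * C) + S * (T * w * (C + Fb) + (2 * T / h + 1) * (2 * \<delta>)) +
       (T * w * Fb + (2 * Fb + K0) * T * \<mu>))"
    proof -
      have "T / (real L * \<mu>) \<le> T / (h / 2)" using Lh T h(1) by (intro divide_left_mono mult_pos_pos) (use L0 mu in auto)
      then have "T / (real L * \<mu>) \<le> 2 * T / h" by (simp add: mult.commute)
      then have "(T / (real L * \<mu>) + 1) * (2 * \<delta>) \<le> (2 * T / h + 1) * (2 * \<delta>)" using delta(1) by (intro mult_right_mono) auto
      then have "S * (T * w * (C + Fb) + (T / (real L * \<mu>) + 1) * (2 * \<delta>)) \<le> S * (T * w * (C + Fb) + (2 * T / h + 1) * (2 * \<delta>))"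
        using S by (intro mult_left_mono) auto
      moreover have "(2 * Fb + \<bar>u0\<bar>) * T * \<mu> \<le> (2 * Fb + K0) * T * \<mu>" using u0 T mu by (intro mult_right_mono) auto
      ultimately show ?thesis
        unfolding Fb_def[symmetric] by (intro mult_left_mono[of _ _ 2] add_mono order.refl) simp_all
    qed
    also have "\<dots> = D1 * \<delta> + W * w + 2 * ((2 * Fb + K0) * T) * \<mu>"
      by (simp add: D1_def W_def algebra_simps)
    finally have u: "\<bar>snd (X_rec \<mu> b F y s \<theta> r0 n) + F_min F (\<theta> n) - U_path u0 q (real n * \<mu>)\<bar>
      \<le> D1 * \<delta> + W * w + 2 * ((2 * Fb + K0) * T) * \<mu>" .
    have t0: "0 \<le> t" "0 \<le> real n * \<mu>" using t mu by auto
    have "norm (V_path q t - V_path q (real n * \<mu>)) \<le> 2 * F_bound F * \<bar>t - real n * \<mu>\<bar>"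
      unfolding V_path_def by (rule exp_conv_Lipschitz[OF V_drive[OF qm] t0(2,1)])
    also have "\<dots> \<le> 2 * Fb * \<mu>" using tn Fb unfolding Fb_def by (intro mult_left_mono) auto
    finally have dV: "norm (V_path q t - V_path q (real n * \<mu>)) \<le> 2 * Fb * \<mu>" .
    have "norm (exp_conv (\<lambda>s. b (V_path q s) \<bullet> F_vec F (q s)) t - exp_conv (\<lambda>s. b (V_path q s) \<bullet> F_vec F (q s)) (real n * \<mu>))
      \<le> 2 * F_bound F * \<bar>t - real n * \<mu>\<bar>" by (rule exp_conv_Lipschitz[OF U_drive[OF qm] t0(2,1)])
    also have "\<dots> \<le> 2 * Fb * \<mu>" using tn Fb unfolding Fb_def by (intro mult_left_mono) auto
    finally have dU1: "\<bar>exp_conv (\<lambda>s. b (V_path q s) \<bullet> F_vec F (q s)) t - exp_conv (\<lambda>s. b (V_path q s) \<bullet> F_vec F (q s)) (real n * \<mu>)\<bar>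
      \<le> 2 * Fb * \<mu>" by simp
    have "\<bar>exp (-t) * u0 - exp (-(real n * \<mu>)) * u0\<bar> = \<bar>exp (-t) - exp (-(real n * \<mu>))\<bar> * \<bar>u0\<bar>"
      by (simp add: abs_mult flip: left_diff_distrib)
    also have "\<dots> \<le> \<mu> * K0" using exp_minus_Lipschitz[OF t0] tn u0 mu(1) by (intro mult_mono) auto
    finally have dU: "\<bar>U_path u0 q t - U_path u0 q (real n * \<mu>)\<bar> \<le> (2 * Fb + K0) * \<mu>"
      using dU1 unfolding U_path_def by (simp add: algebra_simps)
    have q: "q t = \<theta> n" "q 0 = \<theta> 0"
      using interpolate_on_cell[OF mu(1) n] interpolate_on_cell[OF mu(1), of 0 0] mu(1) by (auto simp: q_def)
    have Xt: "interpolate \<mu> (\<lambda>n. (X_rec \<mu> b F y s \<theta> r0 n, \<theta> n)) t = (X_rec \<mu> b F y s \<theta> r0 n, \<theta> n)"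
      by (rule interpolate_on_cell[OF mu(1) n])
    have ft: "flow r0 q t = ((V_path q t - F_vec F (\<theta> n), U_path u0 q t - F_min F (\<theta> n)), \<theta> n)"
      using t0 q by (simp add: flow_def u0_def)
    have split: "X_rec \<mu> b F y s \<theta> r0 n = (f_tilde \<mu> b y s n - F_vec F (\<theta> n), snd (X_rec \<mu> b F y s \<theta> r0 n))"
      by (simp add: prod_eq_iff fst_X_rec)
    have "dist (interpolate \<mu> (\<lambda>n. (X_rec \<mu> b F y s \<theta> r0 n, \<theta> n)) t) (flow r0 q t) =
      norm (f_tilde \<mu> b y s n - V_path q t, snd (X_rec \<mu> b F y s \<theta> r0 n) + F_min F (\<theta> n) - U_path u0 q t)"
      unfolding Xt ft by (subst split) (simp add: dist_Pair_Pair dist_norm norm_Pair algebra_simps)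
    also have "\<dots> \<le> norm (f_tilde \<mu> b y s n - V_path q t) + \<bar>snd (X_rec \<mu> b F y s \<theta> r0 n) + F_min F (\<theta> n) - U_path u0 q t\<bar>"
      unfolding real_norm_def[symmetric] by (rule norm_Pair_le)
    also have "\<dots> \<le> (d + 2 * Fb * \<mu>) + (D1 * \<delta> + W * w + 2 * ((2 * Fb + K0) * T) * \<mu> + (2 * Fb + K0) * \<mu>)"
    proof (rule add_mono)
      have "norm (f_tilde \<mu> b y s n - V_path q t) \<le> norm (f_tilde \<mu> b y s n - V_path q (real n * \<mu>)) + norm (V_path q t - V_path q (real n * \<mu>))"
        by (smt (verit) norm_minus_commute norm_triangle_sub diff_diff_eq2 add_diff_cancel norm_triangle_ineq4 diff_add_cancel)
      then show "norm (f_tilde \<mu> b y s n - V_path q t) \<le> d + 2 * Fb * \<mu>" using v dV by linarith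
    qed (use u dU in linarith)
    also have "\<dots> = d + D1 * \<delta> + W * w + D3 * \<mu>" by (simp add: D3_def algebra_simps)
    \<comment> \<open>The four summands are at most \<open>e/4\<close>, \<open>e/8\<close>,
      \<open>e/4\<close> and \<open>e/8\<close>.\<close>
    also have "\<dots> < e" using d(4) delta(3) w(2) D2'(2) e by linarith
    finally show "dist (interpolate \<mu> (\<lambda>n. (X_rec \<mu> b F y s \<theta> r0 n, \<theta> n)) t) (flow r0 (interpolate \<mu> \<theta>) t) < e"
      by (simp add: q_def)
  qed
qed

end

section \<open>Noise estimates\<close>

lemma floor_half_bounds: "2 \<le> x \<Longrightarrow> real (nat \<lfloor>x\<rfloor>) \<le> x \<and> x / 2 \<le> real (nat \<lfloor>x\<rfloor>) \<and> 0 < nat \<lfloor>x\<rfloor>" for x :: real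
  by linarith

lemma abs_square_le: "\<bar>a\<bar> \<le> c \<Longrightarrow> \<bar>a\<^sup>2\<bar> \<le> c\<^sup>2" for a :: real
  by (metis abs_ge_zero abs_power2 power2_abs power_mono)

context prob_space
begin

lemma bounded_integrable:
  "f \<in> borel_measurable M \<Longrightarrow> AE \<omega> in M. \<bar>f \<omega>\<bar> \<le> (B::real) \<Longrightarrow> integrable M f"
  by (rule integrable_const_bound[of _ B]) auto

lemma bounded_expectation:
  assumes "f \<in> borel_measurable M" "AE \<omega> in M. \<bar>f \<omega>\<bar> \<le> (B::real)"
  shows "\<bar>expectation f\<bar> \<le> B" "expectation (\<lambda>\<omega>. \<bar>f \<omega>\<bar>) \<le> B"
proof -
  have i: "integrable M (\<lambda>\<omega>. \<bar>f \<omega>\<bar>)" using bounded_integrable[OF assms] by simp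
  have "expectation (\<lambda>\<omega>. \<bar>f \<omega>\<bar>) \<le> expectation (\<lambda>\<omega>. B)" using i assms(2) by (intro integral_mono_AE) auto
  then show 1: "expectation (\<lambda>\<omega>. \<bar>f \<omega>\<bar>) \<le> B" by (simp add: prob_space)
  show "\<bar>expectation f\<bar> \<le> B" using integral_abs_bound[of M f] 1 by linarith
qed

lemma AE_abs_sum_le:
  fixes x :: "nat \<Rightarrow> 'a \<Rightarrow> real"
  assumes "\<And>k. AE \<omega> in M. \<bar>x k \<omega>\<bar> \<le> B"
  shows "AE \<omega> in M. \<bar>\<Sum>k<n. x k \<omega>\<bar> \<le> real n * B"
proof -
  have "AE \<omega> in M. \<forall>k. \<bar>x k \<omega>\<bar> \<le> B" using assms by (simp add: AE_all_countable)
  then show ?thesis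
  proof eventually_elim
    case (elim \<omega>)
    have "\<bar>\<Sum>k<n. x k \<omega>\<bar> \<le> (\<Sum>k<n. B)" by (rule order_trans[OF sum_abs sum_mono]) (use elim in auto)
    then show ?case by simp
  qed
qed

text \<open>Expand the square one summand at a time; only an upper bound on the correlation of a
  summand with the preceding sum is asked. For martingale differences \<open>r\<close> is 0, for
  windows of data it is small compared with the square of their number.\<close>

lemma second_moment_sum:
  fixes x :: "nat \<Rightarrow> 'a \<Rightarrow> real"
  assumes [measurable]: "\<And>k. x k \<in> borel_measurable M" and B: "\<And>k. AE \<omega> in M. \<bar>x k \<omega>\<bar> \<le> B"
    and r: "\<And>m. m < n \<Longrightarrow> expectation (\<lambda>\<omega>. (\<Sum>k<m. x k \<omega>) * x m \<omega>) \<le> r"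
  shows "expectation (\<lambda>\<omega>. (\<Sum>k<n. x k \<omega>)\<^sup>2) \<le> real n * (B\<^sup>2 + 2 * r)"
  using r
proof (induction n)
  case (Suc n)
  let ?A = "\<lambda>\<omega>. \<Sum>k<n. x k \<omega>"
  note A = AE_abs_sum_le[of x B n, OF B]
  have Ax: "AE \<omega> in M. \<bar>?A \<omega> * x n \<omega>\<bar> \<le> (real n * B) * B"
    using A B[of n] by eventually_elim (auto simp: abs_mult intro!: mult_mono)
  have AA: "AE \<omega> in M. \<bar>(?A \<omega>)\<^sup>2\<bar> \<le> (real n * B)\<^sup>2"
    using A by eventually_elim (rule abs_square_le)
  have xx: "AE \<omega> in M. \<bar>(x n \<omega>)\<^sup>2\<bar> \<le> B\<^sup>2"
    using B[of n] by eventually_elim (rule abs_square_le)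
  note ints = bounded_integrable[OF _ Ax] bounded_integrable[OF _ AA] bounded_integrable[OF _ xx]
  have "expectation (\<lambda>\<omega>. (\<Sum>k<Suc n. x k \<omega>)\<^sup>2) = expectation (\<lambda>\<omega>. (?A \<omega>)\<^sup>2 + 2 * (?A \<omega> * x n \<omega>) + (x n \<omega>)\<^sup>2)"
    by (simp add: power2_sum algebra_simps)
  also have "\<dots> = expectation (\<lambda>\<omega>. (?A \<omega>)\<^sup>2) + 2 * expectation (\<lambda>\<omega>. ?A \<omega> * x n \<omega>) + expectation (\<lambda>\<omega>. (x n \<omega>)\<^sup>2)"
    using ints by (simp add: Bochner_Integration.integral_add)
  also have "\<dots> \<le> real n * (B\<^sup>2 + 2 * r) + 2 * r + B\<^sup>2"
  proof -
    have "expectation (\<lambda>\<omega>. (x n \<omega>)\<^sup>2) \<le> B\<^sup>2" using bounded_expectation(1)[OF _ xx] by simp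
    moreover have "expectation (\<lambda>\<omega>. (?A \<omega>)\<^sup>2) \<le> real n * (B\<^sup>2 + 2 * r)" using Suc by simp
    ultimately show ?thesis using Suc.prems[of n] by linarith
  qed
  finally show ?case by (simp add: algebra_simps)
qed simp

text \<open>Increments are small, so the maximum is controlled by the values on a coarse grid.\<close>

lemma grid_max_bound:
  fixes S :: "nat \<Rightarrow> 'a \<Rightarrow> real"
  assumes [measurable]: "\<And>n. S n \<in> borel_measurable M" and S0: "\<And>\<omega>. S 0 \<omega> = 0"
    and inc: "\<And>n. AE \<omega> in M. \<bar>S (Suc n) \<omega> - S n \<omega>\<bar> \<le> \<mu> * B"
    and pos: "0 < \<mu>" "0 < B" "0 < \<delta>" "4 * B * \<mu> \<le> \<delta>" "0 \<le> T"
    and second: "\<And>n. real n * \<mu> \<le> T \<Longrightarrow> expectation (\<lambda>\<omega>. (S n \<omega>)\<^sup>2) \<le> \<kappa>"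
  shows "prob {\<omega>\<in>space M. \<exists>n. real n * \<mu> \<le> T \<and> \<delta> < \<bar>S n \<omega>\<bar>} \<le> (4 * B * T / \<delta> + 1) * (4 * \<kappa> / \<delta>\<^sup>2)"
proof -
  have inc': "AE \<omega> in M. \<forall>n. \<bar>S (Suc n) \<omega> - S n \<omega>\<bar> \<le> \<mu> * B" using inc by (simp add: AE_all_countable)
  \<comment> \<open>A block of \<open>L\<close> steps changes \<open>S\<close> by at most
    \<open>\<delta> / 2\<close>, so a large value forces one of at least \<open>\<delta> / 2\<close>
    at the preceding grid point. The assumption \<open>4 * B * \<mu> \<le> \<delta>\<close> limits
    the loss by rounding to one half.\<close>
  define L where "L = nat \<lfloor>\<delta> / (2 * B * \<mu>)\<rfloor>"
  have "2 \<le> \<delta> / (2 * B * \<mu>)" using pos by (simp add: le_divide_eq)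
  then have L: "real L \<le> \<delta> / (2 * B * \<mu>)" "\<delta> / (2 * B * \<mu>) / 2 \<le> real L" "0 < L"
    using floor_half_bounds[of "\<delta> / (2 * B * \<mu>)"] by (auto simp: L_def)
  have LB: "real L * (\<mu> * B) \<le> \<delta> / 2" using L(1) pos by (simp add: le_divide_eq field_simps)
  have Lm: "\<delta> \<le> 4 * B * (real L * \<mu>)" using L(2) pos by (simp add: divide_le_eq field_simps)
  \<comment> \<open>Grid points are at least \<open>\<delta> / (4 * B)\<close> apart in time, so
    their number up to \<open>T\<close> is bounded uniformly in the step size. A union bound with
    Chebyshev at each of them finishes.\<close>
  define J where "J = nat \<lfloor>4 * B * T / \<delta>\<rfloor>"
  have J: "real J \<le> 4 * B * T / \<delta>" using pos by (simp add: J_def)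
  let ?G = "\<lambda>j. {\<omega>\<in>space M. real (j * L) * \<mu> \<le> T \<and> (\<delta>/2)\<^sup>2 \<le> (S (j * L) \<omega>)\<^sup>2}"
  have k0: "0 \<le> \<kappa>" using second[of 0] pos S0 by simp
  have G: "prob (?G j) \<le> 4 * \<kappa> / \<delta>\<^sup>2" for j
  proof (cases "real (j * L) * \<mu> \<le> T")
    case True
    have "AE \<omega> in M. \<bar>S n \<omega>\<bar> \<le> real n * (\<mu> * B)" for n
    proof -
      have "\<bar>\<Sum>k<n. S (Suc k) \<omega> - S k \<omega>\<bar> = \<bar>S n \<omega>\<bar>" for \<omega>
        using sum_lessThan_telescope[of "\<lambda>k. S k \<omega>" n] by (simp add: S0)
      then show ?thesis using AE_abs_sum_le[of "\<lambda>k \<omega>. S (Suc k) \<omega> - S k \<omega>" "\<mu> * B" n, OF inc] by simp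
    qed
    then have "AE \<omega> in M. \<bar>(S n \<omega>)\<^sup>2\<bar> \<le> (real n * (\<mu> * B))\<^sup>2" for n
      by (rule eventually_mono) (rule abs_square_le)
    then have "integrable M (\<lambda>\<omega>. (S n \<omega>)\<^sup>2)" for n by (intro bounded_integrable) auto
    then have "prob {\<omega>\<in>space M. (\<delta>/2)\<^sup>2 \<le> (S (j * L) \<omega>)\<^sup>2} \<le> expectation (\<lambda>\<omega>. (S (j * L) \<omega>)\<^sup>2) / (\<delta>/2)\<^sup>2"
      by (intro integral_Markov_inequality_measure[where A="space M"]) (use pos in auto)
    also have "\<dots> \<le> \<kappa> / (\<delta>/2)\<^sup>2" using second[OF True] by (intro divide_right_mono) auto
    finally show ?thesis using True by (simp add: power_divide mult.commute)
  qed (use k0 in simp)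
  have "prob {\<omega>\<in>space M. \<exists>n. real n * \<mu> \<le> T \<and> \<delta> < \<bar>S n \<omega>\<bar>} \<le> prob (\<Union>j\<in>{..J}. ?G j)"
  proof (rule finite_measure_mono_AE)
    show "AE \<omega> in M. \<omega> \<in> {\<omega>\<in>space M. \<exists>n. real n * \<mu> \<le> T \<and> \<delta> < \<bar>S n \<omega>\<bar>} \<longrightarrow> \<omega> \<in> (\<Union>j\<in>{..J}. ?G j)"
      using inc'
    proof eventually_elim
      case (elim \<omega>)
      show ?case
      proof
        assume "\<omega> \<in> {\<omega>\<in>space M. \<exists>n. real n * \<mu> \<le> T \<and> \<delta> < \<bar>S n \<omega>\<bar>}"
        then obtain n where n: "\<omega> \<in> space M" "real n * \<mu> \<le> T" "\<delta> < \<bar>S n \<omega>\<bar>" by blast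
        define j where "j = n div L"
        have jn: "j * L \<le> n" "n - j * L \<le> L"
          using mod_less_divisor[OF L(3), of n] unfolding j_def
          by (simp_all add: minus_div_mult_eq_mod)
        have "\<bar>S (m + l) \<omega> - S m \<omega>\<bar> \<le> real l * (\<mu> * B)" for m l
        proof (induction l)
          case (Suc l)
          then show ?case using elim[rule_format, of "m + l"] by (simp add: algebra_simps)
        qed simp
        from this[of "j * L" "n - j * L"] have "\<bar>S n \<omega> - S (j * L) \<omega>\<bar> \<le> real (n - j * L) * (\<mu> * B)" using jn by simp
        also have "\<dots> \<le> real L * (\<mu> * B)" using jn(2) pos by (intro mult_right_mono) auto
        finally have "\<delta> / 2 \<le> \<bar>S (j * L) \<omega>\<bar>" using n(3) LB by linarith
        then have sq: "(\<delta>/2)\<^sup>2 \<le> (S (j * L) \<omega>)\<^sup>2" using pos abs_le_square_iff[of "\<delta>/2" "S (j * L) \<omega>"] by simp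
        have jT: "real (j * L) * \<mu> \<le> T"
          using n(2) jn(1) pos by (meson mult_right_mono of_nat_mono less_imp_le order_trans)
        have "real j * \<delta> \<le> real j * (4 * B * (real L * \<mu>))" using Lm by (intro mult_left_mono) auto
        also have "\<dots> = 4 * B * (real (j * L) * \<mu>)" by simp
        also have "\<dots> \<le> 4 * B * T" using jT pos by (intro mult_left_mono) auto
        finally have "real j \<le> 4 * B * T / \<delta>" using pos by (simp add: le_divide_eq)
        then have "j \<le> J" unfolding J_def by linarith
        then show "\<omega> \<in> (\<Union>j\<in>{..J}. ?G j)" using sq jT n(1) by blast
      qed
    qed
  qed measurable
  also have "\<dots> \<le> (\<Sum>j\<in>{..J}. prob (?G j))" by (rule finite_measure_subadditive_finite) auto
  also have "\<dots> \<le> (\<Sum>j\<in>{..J}. 4 * \<kappa> / \<delta>\<^sup>2)" by (rule sum_mono) (rule G)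
  also have "\<dots> = (real J + 1) * (4 * \<kappa> / \<delta>\<^sup>2)" by simp
  also have "\<dots> \<le> (4 * B * T / \<delta> + 1) * (4 * \<kappa> / \<delta>\<^sup>2)" using J k0 by (intro mult_right_mono) auto
  finally show ?thesis .
qed

end

lemma borel_measurable_vec_lambda:
  fixes h :: "'i::finite \<Rightarrow> 'a \<Rightarrow> real"
  assumes [measurable]: "\<And>i. h i \<in> borel_measurable K"
  shows "(\<lambda>\<omega>. \<chi> i. h i \<omega>) \<in> borel_measurable K"
proof -
  have "(\<lambda>\<omega>. \<chi> i. h i \<omega>) = (\<lambda>\<omega>. \<Sum>i\<in>UNIV. h i \<omega> *\<^sub>R axis i 1)"
    by (rule ext) (simp add: vec_eq_iff axis_def if_distrib cong: if_cong)
  also have "\<dots> \<in> borel_measurable K" by measurable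
  finally show ?thesis .
qed

lemma sum_of_bool_eq: "(\<Sum>j\<in>UNIV. of_bool (q = j) * h j) = (h q :: real)" for q :: "'j::finite"
proof -
  have "(\<Sum>j\<in>UNIV. of_bool (q = j) * h j) = (\<Sum>j\<in>UNIV. if q = j then h j else 0)" by (rule sum.cong) auto
  then show ?thesis by simp
qed

text \<open>One fixed step size. Of the regime chain only the bound \<open>change\<close> on the
  switching probability enters the noise estimates. \<open>C\<close> and \<open>\<beta>\<close> are
  parameters, so that the same constants can serve all step sizes.\<close>

locale simulation = prob_space M + response b F
  for M :: "'a measure" and b :: "real^'s::finite \<Rightarrow> real^'s" and F :: "'s \<Rightarrow> 'q::{finite,metric_space} \<Rightarrow> real" +
  fixes f :: "nat \<Rightarrow> 's \<Rightarrow> 'q \<Rightarrow> 'a \<Rightarrow> real" and \<theta> :: "nat \<Rightarrow> 'a \<Rightarrow> 'q" and s :: "nat \<Rightarrow> 'a \<Rightarrow> 's"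
    and \<mu> C \<beta> :: real
  assumes f_meas [measurable]: "\<And>n i j. f n i j \<in> borel_measurable M"
    and f_bound: "AE \<omega> in M. \<forall>n i j. \<bar>f n i j \<omega>\<bar> \<le> C" and C: "0 < C"
    and theta_meas [measurable]: "\<And>n. \<theta> n \<in> measurable M (count_space UNIV)"
    and change: "\<And>n. prob {\<omega>\<in>space M. \<theta> (Suc n) \<omega> \<noteq> \<theta> n \<omega>} \<le> \<mu>"
    and mu: "0 < \<mu>" "\<mu> \<le> 1"
    and sampling: "samples_from M f \<theta> s
        (\<lambda>n \<omega>. b (f_tilde \<mu> b (\<lambda>n i. f n i (\<theta> n \<omega>) \<omega>) (\<lambda>k. s k \<omega>) n))"
    and b_nonneg: "\<And>v i. 0 \<le> b v $ i"
    and b_lower: "\<And>v i. norm v \<le> F_bound F + 1 \<Longrightarrow> \<beta> \<le> b v $ i" and beta: "0 < \<beta>"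
begin

definition y :: "'a \<Rightarrow> nat \<Rightarrow> 's \<Rightarrow> real" where "y \<omega> n i = f n i (\<theta> n \<omega>) \<omega>"

definition v :: "nat \<Rightarrow> 'a \<Rightarrow> real^'s" where "v n \<omega> = f_tilde \<mu> b (y \<omega>) (\<lambda>k. s k \<omega>) n"

definition past :: "nat \<Rightarrow> 'a measure" where
  "past n = sigma (space M) (observed_data M f \<theta> UNIV \<union> {s k -` C \<inter> space M | k C. k < n})"

lemma s_meas [measurable]: "s n \<in> measurable M (count_space UNIV)"
  using sampling by (simp add: samples_from_def)

lemma y_meas [measurable]: "(\<lambda>\<omega>. y \<omega> n i) \<in> borel_measurable M"
  unfolding y_def by (rule measurable_compose_countable[of "\<lambda>j \<omega>. f n i j \<omega>"]) auto

lemma y_bound: "AE \<omega> in M. \<forall>n i. \<bar>y \<omega> n i\<bar> \<le> C"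
  using f_bound by eventually_elim (simp add: y_def)

lemma observed_subset: "observed_data M f \<theta> I \<subseteq> sets M"
proof -
  have "(\<lambda>\<omega>. f n i (\<theta> n \<omega>) \<omega>) -` B \<inter> space M \<in> sets M" if "B \<in> sets borel" for n i B
    using measurable_sets[OF y_meas that] by (simp add: y_def)
  then show ?thesis unfolding observed_data_def by (auto intro!: measurable_sets[OF theta_meas])
qed

lemma past_gen: "observed_data M f \<theta> UNIV \<union> {s k -` C \<inter> space M | k C. k < n} \<subseteq> sets M"
  using observed_subset by (auto intro!: measurable_sets[OF s_meas])

lemma past_space: "space (past n) = space M"
  unfolding past_def by (rule space_measure_of) (use past_gen sets.space_closed in blast)

lemma past_sets: "sets (past n) = sigma_sets (space M) (observed_data M f \<theta> UNIV \<union> {s k -` C \<inter> space M | k C. k < n})"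
  unfolding past_def by (rule sets_measure_of) (use past_gen sets.space_closed in blast)

lemma past_subalgebra: "finite_measure_subalgebra M (past n)"
proof unfold_locales
  have "sets (past n) \<subseteq> sets M" unfolding past_sets by (rule sets.sigma_sets_subset[OF past_gen])
  then show "subalgebra M (past n)" by (simp add: subalgebra_def past_space)
qed

text \<open>Any time \<open>k\<close> is allowed, also a future one: the draw uses randomness
  independent of all data.\<close>

lemma y_past: "(\<lambda>\<omega>. y \<omega> k i) \<in> borel_measurable (past n)"
proof (rule measurableI)
  fix B :: "real set" assume "B \<in> sets borel"
  then have "(\<lambda>\<omega>. y \<omega> k i) -` B \<inter> space M \<in> observed_data M f \<theta> UNIV"
    unfolding observed_data_def y_def by blast
  then show "(\<lambda>\<omega>. y \<omega> k i) -` B \<inter> space (past n) \<in> sets (past n)"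
    unfolding past_space past_sets by (intro sigma_sets.Basic) simp
qed simp

lemma s_past: "k < n \<Longrightarrow> s k \<in> measurable (past n) (count_space UNIV)"
proof (rule measurableI)
  fix B :: "'s set" assume "k < n"
  then show "s k -` B \<inter> space (past n) \<in> sets (past n)"
    unfolding past_space past_sets by (intro sigma_sets.Basic) auto
qed simp

lemma b_meas [measurable]: "b \<in> borel_measurable borel"
  using b_cont by (rule borel_measurable_continuous_onI)

lemma b_component_meas: "(\<lambda>x. b x $ i) \<in> borel_measurable borel"
  by (intro borel_measurable_continuous_onI continuous_on_component b_cont)

text \<open>The sigma-algebra is left open because the statement serves both \<open>past n\<close>,
  for conditioning, and the full space.\<close>

lemma f_tilde_measurable:
  assumes [measurable]: "\<And>k i. (\<lambda>\<omega>. y \<omega> k i) \<in> borel_measurable K"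
  shows "(\<And>k. k < n \<Longrightarrow> s k \<in> measurable K (count_space UNIV)) \<Longrightarrow> v n \<in> borel_measurable K"
proof (induction n)
  case 0
  then show ?case unfolding v_def by simp
next
  case (Suc n)
  have [measurable]: "v n \<in> borel_measurable K" "s n \<in> measurable K (count_space UNIV)"
    using Suc by auto
  have [measurable]: "(\<lambda>\<omega>. b (v n \<omega>) $ i) \<in> borel_measurable K" for i
    by (rule measurable_compose[OF _ b_component_meas]) measurable
  have [measurable]: "(\<lambda>\<omega>. y \<omega> n (s n \<omega>)) \<in> borel_measurable K"
    by (rule measurable_compose_countable[of "\<lambda>i \<omega>. y \<omega> n i"]) auto
  have "(\<lambda>\<omega>. g_vec (b (v n \<omega>)) (s n \<omega>) (y \<omega> n (s n \<omega>))) \<in> borel_measurable K"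
    unfolding g_vec_def by (rule borel_measurable_vec_lambda) measurable
  then have "(\<lambda>\<omega>. v n \<omega> + \<mu> *\<^sub>R (g_vec (b (v n \<omega>)) (s n \<omega>) (y \<omega> n (s n \<omega>)) - v n \<omega>)) \<in> borel_measurable K"
    by measurable
  then show ?case by (simp add: v_def)
qed

lemma v_past: "v n \<in> borel_measurable (past n)"
  by (rule f_tilde_measurable) (auto intro: y_past s_past)

lemma v_meas [measurable]: "v n \<in> borel_measurable M"
  by (rule f_tilde_measurable) auto

section \<open>Martingale noise of the draws\<close>

lemma b_le1: "b x $ i \<le> 1"
  using component_le_norm_cart[of "b x" i] b_norm[of x] by simp

text \<open>The centred draw. Sampling noise and value noise are sums of these with weights that are
  known before the draw.\<close>

definition draw :: "'s \<Rightarrow> nat \<Rightarrow> 'a \<Rightarrow> real" where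
  "draw i n \<omega> = indicator {\<omega>. s n \<omega> = i} \<omega> - b (v n \<omega>) $ i"

lemma response_meas [measurable]: "(\<lambda>\<omega>. b (v n \<omega>) $ i) \<in> borel_measurable M"
  by (rule measurable_compose[OF v_meas b_component_meas])

lemma draw_measurable:
  assumes "s n \<in> measurable K (count_space UNIV)" "v n \<in> borel_measurable K"
  shows "draw i n \<in> borel_measurable K"
proof -
  have "(\<lambda>\<omega>. (\<lambda>j. of_bool (j = i) :: real) (s n \<omega>) - b (v n \<omega>) $ i) \<in> borel_measurable K"
    by (intro borel_measurable_diff measurable_compose[OF assms(1)] measurable_compose[OF assms(2) b_component_meas]) simp
  then show ?thesis by (simp add: draw_def[abs_def] indicator_def)
qed

lemma draw_meas [measurable]: "draw i n \<in> borel_measurable M"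
  by (rule draw_measurable) auto

lemma draw_past: "k < n \<Longrightarrow> draw i k \<in> borel_measurable (past n)"
  by (intro draw_measurable s_past f_tilde_measurable y_past) auto

lemma draw_bound: "\<bar>draw i n \<omega>\<bar> \<le> 1"
  using b_nonneg[of "v n \<omega>" i] b_le1[of "v n \<omega>" i] by (auto simp: draw_def indicator_def)

text \<open>Given \<open>past n\<close> the indicator of the draw has conditional expectation
  \<open>b (v n \<omega>) $ i\<close>, and the factor \<open>A\<close> can be taken out of the
  conditional expectation.\<close>

lemma draw_orthogonal:
  assumes A: "A \<in> borel_measurable (past n)" "AE \<omega> in M. \<bar>A \<omega>\<bar> \<le> B"
  shows "expectation (\<lambda>\<omega>. A \<omega> * draw i n \<omega>) = 0"
proof -
  interpret P: finite_measure_subalgebra M "past n" by (rule past_subalgebra)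
  have [measurable]: "A \<in> borel_measurable M" using measurable_from_subalg[OF P.subalg A(1)] .
  let ?I = "indicator {\<omega>\<in>space M. s n \<omega> = i} :: 'a \<Rightarrow> real"
  have ce: "AE \<omega> in M. real_cond_exp M (past n) ?I \<omega> = b (v n \<omega>) $ i"
    using sampling unfolding samples_from_def past_def v_def y_def by blast
  have i1: "integrable M (\<lambda>\<omega>. A \<omega> * ?I \<omega>)"
  proof (rule bounded_integrable)
    show "AE \<omega> in M. \<bar>A \<omega> * ?I \<omega>\<bar> \<le> B" using A(2) by eventually_elim (auto simp: indicator_def)
  qed measurable
  have i2: "integrable M (\<lambda>\<omega>. A \<omega> * (b (v n \<omega>) $ i))"
  proof (rule bounded_integrable)
    show "AE \<omega> in M. \<bar>A \<omega> * (b (v n \<omega>) $ i)\<bar> \<le> B * 1"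
      using A(2)
    proof eventually_elim
      case (elim \<omega>)
      have "\<bar>b (v n \<omega>) $ i\<bar> \<le> 1" using b_nonneg[of "v n \<omega>" i] b_le1[of "v n \<omega>" i] by simp
      then show ?case unfolding abs_mult using elim by (intro mult_mono) auto
    qed
  qed measurable
  have "expectation (\<lambda>\<omega>. A \<omega> * ?I \<omega>) = expectation (\<lambda>\<omega>. A \<omega> * real_cond_exp M (past n) ?I \<omega>)"
    by (rule P.real_cond_exp_intg(2)[symmetric, OF i1 A(1)]) measurable
  also have "\<dots> = expectation (\<lambda>\<omega>. A \<omega> * (b (v n \<omega>) $ i))"
    by (rule integral_cong_AE) (use ce in \<open>auto elim: eventually_mono\<close>)
  finally have "expectation (\<lambda>\<omega>. A \<omega> * ?I \<omega> - A \<omega> * (b (v n \<omega>) $ i)) = 0"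
    using i1 i2 by simp
  moreover have "expectation (\<lambda>\<omega>. A \<omega> * draw i n \<omega>) = expectation (\<lambda>\<omega>. A \<omega> * ?I \<omega> - A \<omega> * (b (v n \<omega>) $ i))"
    by (rule Bochner_Integration.integral_cong) (auto simp: draw_def indicator_def algebra_simps)
  ultimately show ?thesis by simp
qed

text \<open>Orthogonality leaves only the diagonal of the second moment: at most
  \<open>T / \<mu>\<close> terms of order the square of \<open>\<mu>\<close>, hence a bound of order
  \<open>\<mu>\<close>, to which the grid argument applies.\<close>

lemma martingale_max:
  assumes c: "\<And>k. c k \<in> borel_measurable (past k)" "\<And>k. AE \<omega> in M. \<bar>c k \<omega>\<bar> \<le> B"
    and c': "\<And>k n. k \<le> n \<Longrightarrow> c k \<in> borel_measurable (past n)"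
    and pos: "0 < B" "0 < \<delta>" "4 * B * \<mu> \<le> \<delta>" "0 \<le> T"
  shows "prob {\<omega>\<in>space M. \<exists>n. real n * \<mu> \<le> T \<and> \<delta> < \<bar>\<Sum>k<n. \<mu> * (c k \<omega> * draw i k \<omega>)\<bar>}
     \<le> (4 * B * T / \<delta> + 1) * (4 * (T * B\<^sup>2 * \<mu>) / \<delta>\<^sup>2)"
proof (rule grid_max_bound[where B=B and \<mu>=\<mu>])
  have [measurable]: "c k \<in> borel_measurable M" for k
    using measurable_from_subalg[OF finite_measure_subalgebra.subalg[OF past_subalgebra] c(1)] .
  show "(\<lambda>\<omega>. \<Sum>k<n. \<mu> * (c k \<omega> * draw i k \<omega>)) \<in> borel_measurable M" for n by measurable
  have b1: "AE \<omega> in M. \<bar>c k \<omega> * draw i k \<omega>\<bar> \<le> B" for k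
    using c(2)[of k]
  proof eventually_elim
    case (elim \<omega>)
    have "\<bar>c k \<omega>\<bar> * \<bar>draw i k \<omega>\<bar> \<le> B * 1" using elim draw_bound[of i k \<omega>] by (intro mult_mono) auto
    then show ?case by (simp add: abs_mult)
  qed
  show "AE \<omega> in M. \<bar>(\<Sum>k<Suc n. \<mu> * (c k \<omega> * draw i k \<omega>)) - (\<Sum>k<n. \<mu> * (c k \<omega> * draw i k \<omega>))\<bar> \<le> \<mu> * B" for n
    using b1[of n] mu by (auto simp: abs_mult elim!: eventually_mono)
  fix n assume n: "real n * \<mu> \<le> T"
  have "expectation (\<lambda>\<omega>. (\<Sum>k<n. c k \<omega> * draw i k \<omega>)\<^sup>2) \<le> real n * (B\<^sup>2 + 2 * 0)"
  proof (rule second_moment_sum)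
    fix m
    \<comment> \<open>The weight at time \<open>m\<close> is moved to the factor that is known
      before the draw.\<close>
    let ?A = "\<lambda>\<omega>. (\<Sum>k<m. c k \<omega> * draw i k \<omega>) * c m \<omega>"
    have "expectation (\<lambda>\<omega>. ?A \<omega> * draw i m \<omega>) = 0"
    proof (rule draw_orthogonal)
      have "(\<lambda>\<omega>. \<Sum>k<m. c k \<omega> * draw i k \<omega>) \<in> borel_measurable (past m)"
        by (intro borel_measurable_sum borel_measurable_times c' draw_past) auto
      then show "?A \<in> borel_measurable (past m)" using c(1) by (intro borel_measurable_times)
      show "AE \<omega> in M. \<bar>?A \<omega>\<bar> \<le> (real m * B) * B"
        using AE_abs_sum_le[of "\<lambda>k \<omega>. c k \<omega> * draw i k \<omega>" B m, OF b1] c(2)[of m]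
        by eventually_elim (auto simp: abs_mult intro!: mult_mono)
    qed
    then show "expectation (\<lambda>\<omega>. (\<Sum>k<m. c k \<omega> * draw i k \<omega>) * (c m \<omega> * draw i m \<omega>)) \<le> 0"
      by (simp add: mult.assoc)
  qed (use b1 in auto)
  then have "\<mu>\<^sup>2 * expectation (\<lambda>\<omega>. (\<Sum>k<n. c k \<omega> * draw i k \<omega>)\<^sup>2) \<le> \<mu>\<^sup>2 * (real n * B\<^sup>2)"
    by (intro mult_left_mono) auto
  also have "\<dots> = (real n * \<mu>) * (B\<^sup>2 * \<mu>)" by (simp add: power2_eq_square)
  also have "\<dots> \<le> T * (B\<^sup>2 * \<mu>)" using n mu by (intro mult_right_mono) auto
  finally show "expectation (\<lambda>\<omega>. (\<Sum>k<n. \<mu> * (c k \<omega> * draw i k \<omega>))\<^sup>2) \<le> T * B\<^sup>2 * \<mu>"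
    by (simp add: power_mult_distrib flip: sum_distrib_left)
qed (use pos mu in auto)

text \<open>The conditioning of (A2). In contrast to \<open>past\<close>, it contains no draws and
  no data from time \<open>l\<close> on.\<close>

definition hist :: "nat \<Rightarrow> 'a measure" where
  "hist l = sigma (space M) (observed_data M f \<theta> {..<l})"

lemma hist_space: "space (hist l) = space M"
  unfolding hist_def by (rule space_measure_of) (use observed_subset sets.space_closed in blast)

lemma hist_sets: "sets (hist l) = sigma_sets (space M) (observed_data M f \<theta> {..<l})"
  unfolding hist_def by (rule sets_measure_of) (use observed_subset sets.space_closed in blast)

lemma hist_subalgebra: "finite_measure_subalgebra M (hist l)"
proof unfold_locales
  have "sets (hist l) \<subseteq> sets M" unfolding hist_sets by (rule sets.sigma_sets_subset[OF observed_subset])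
  then show "subalgebra M (hist l)" by (simp add: subalgebra_def hist_space)
qed

lemma y_hist: "k < l \<Longrightarrow> (\<lambda>\<omega>. y \<omega> k i) \<in> borel_measurable (hist l)"
proof (rule measurableI)
  fix B :: "real set" assume "k < l" "B \<in> sets borel"
  then have "(\<lambda>\<omega>. y \<omega> k i) -` B \<inter> space M \<in> observed_data M f \<theta> {..<l}"
    unfolding observed_data_def y_def by blast
  then show "(\<lambda>\<omega>. y \<omega> k i) -` B \<inter> space (hist l) \<in> sets (hist l)"
    unfolding hist_space hist_sets by (intro sigma_sets.Basic) simp
qed simp

lemma theta_hist: "k < l \<Longrightarrow> \<theta> k \<in> measurable (hist l) (count_space UNIV)"
proof (rule measurableI)
  fix B :: "'q set" assume "k < l"
  then have "\<theta> k -` B \<inter> space M \<in> observed_data M f \<theta> {..<l}"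
    unfolding observed_data_def by blast
  then show "\<theta> k -` B \<inter> space (hist l) \<in> sets (hist l)"
    unfolding hist_space hist_sets by (intro sigma_sets.Basic) simp
qed simp

definition dev :: "'s \<Rightarrow> nat \<Rightarrow> 'a \<Rightarrow> real" where
  "dev i k \<omega> = y \<omega> k i - F i (\<theta> k \<omega>)"

definition dev_bound :: real where "dev_bound = C + F_bound F"

lemma dev_bound_pos: "0 < dev_bound"
  using C F_bound_ge0[of F] by (simp add: dev_bound_def)

lemma dev_measurable:
  assumes "(\<lambda>\<omega>. y \<omega> k i) \<in> borel_measurable K" "\<theta> k \<in> measurable K (count_space UNIV)"
  shows "dev i k \<in> borel_measurable K"
proof -
  have "(\<lambda>\<omega>. y \<omega> k i - F i (\<theta> k \<omega>)) \<in> borel_measurable K"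
    by (intro borel_measurable_diff assms(1) measurable_compose[OF assms(2)]) simp
  then show ?thesis by (simp add: dev_def[abs_def])
qed

lemma dev_meas [measurable]: "dev i k \<in> borel_measurable M"
  by (rule dev_measurable) auto

lemma dev_bounded: "AE \<omega> in M. \<forall>i k. \<bar>dev i k \<omega>\<bar> \<le> dev_bound"
  using y_bound
proof eventually_elim
  case (elim \<omega>)
  have "\<bar>dev i k \<omega>\<bar> \<le> dev_bound" for i k
    using elim[rule_format, of k i] F_le_bound[of i "\<theta> k \<omega>"] unfolding dev_def dev_bound_def by linarith
  then show ?case by blast
qed

lemma change_window: "prob {\<omega>\<in>space M. \<theta> (m + d) \<omega> \<noteq> \<theta> m \<omega>} \<le> real d * \<mu>"
proof (induction d)
  case (Suc d)
  have "prob {\<omega>\<in>space M. \<theta> (m + Suc d) \<omega> \<noteq> \<theta> m \<omega>} \<le>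
    prob ({\<omega>\<in>space M. \<theta> (m + d) \<omega> \<noteq> \<theta> m \<omega>} \<union> {\<omega>\<in>space M. \<theta> (Suc (m + d)) \<omega> \<noteq> \<theta> (m + d) \<omega>})"
    by (rule finite_measure_mono) auto
  also have "\<dots> \<le> prob {\<omega>\<in>space M. \<theta> (m + d) \<omega> \<noteq> \<theta> m \<omega>} + prob {\<omega>\<in>space M. \<theta> (Suc (m + d)) \<omega> \<noteq> \<theta> (m + d) \<omega>}"
    by (rule measure_Un_le) measurable
  also have "\<dots> \<le> real (Suc d) * \<mu>" using Suc change[of "m + d"] by (simp add: algebra_simps)
  finally show ?case .
qed simp

lemma avg_cond_exp_bound:
  assumes N: "0 < N"
  shows "AE \<omega> in M. \<bar>avg_cond_exp M f \<theta> l N i j \<omega> - F i j\<bar> \<le> C + F_bound F"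
proof -
  interpret H: finite_measure_subalgebra M "hist l" by (rule hist_subalgebra)
  let ?E = "\<lambda>\<tau>. real_cond_exp M (hist l) (f \<tau> i j)"
  have fb: "AE \<omega> in M. \<bar>f \<tau> i j \<omega>\<bar> \<le> C" for \<tau> using f_bound by eventually_elim blast
  have "AE \<omega> in M. \<bar>?E \<tau> \<omega>\<bar> \<le> C" for \<tau>
  proof -
    have "AE \<omega> in M. ?E \<tau> \<omega> \<le> C"
      by (rule H.real_cond_exp_le_c[OF bounded_integrable[OF f_meas fb]]) (use fb[of \<tau>] in \<open>auto elim: eventually_mono\<close>)
    moreover have "AE \<omega> in M. - C \<le> ?E \<tau> \<omega>"
      by (rule H.real_cond_exp_ge_c[OF bounded_integrable[OF f_meas fb]]) (use fb[of \<tau>] in \<open>auto elim: eventually_mono\<close>)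
    ultimately show ?thesis by eventually_elim auto
  qed
  then have "AE \<omega> in M. \<forall>\<tau>. \<bar>?E \<tau> \<omega>\<bar> \<le> C" by (simp add: AE_all_countable)
  then show ?thesis
  proof eventually_elim
    case (elim \<omega>)
    have "\<bar>\<Sum>\<tau>\<in>{l..<l+N}. ?E \<tau> \<omega>\<bar> \<le> (\<Sum>\<tau>\<in>{l..<l+N}. C)"
      by (rule order_trans[OF sum_abs sum_mono]) (use elim in auto)
    then have "\<bar>avg_cond_exp M f \<theta> l N i j \<omega>\<bar> \<le> C"
      using N by (simp add: avg_cond_exp_def hist_def[symmetric] divide_le_eq mult.commute)
    then show ?case using F_le_bound[of i j] by linarith
  qed
qed

text \<open>
  The regime at the start of the window is known to \<open>hist\<close> and, with large probability, stays the same
  during the window, so that (A2) applies to the data of a fixed regime.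
\<close>

lemma window_cross:
  assumes A: "A \<in> borel_measurable (hist (Suc m))" "AE \<omega> in M. \<bar>A \<omega>\<bar> \<le> a" "0 \<le> a"
    and avg: "\<And>j. expectation (\<lambda>\<omega>. \<bar>avg_cond_exp M f \<theta> (Suc m) N i j \<omega> - F i j\<bar>) \<le> \<kappa>" and N: "0 < N"
  shows "\<bar>expectation (\<lambda>\<omega>. A \<omega> * (\<Sum>\<tau>\<in>{Suc m..<Suc m + N}. dev i \<tau> \<omega>))\<bar>
    \<le> a * real N * (real CARD('q) * \<kappa> + 2 * dev_bound * (real N * \<mu>))"
proof -
  define l where "l = Suc m"
  interpret H: finite_measure_subalgebra M "hist l" by (rule hist_subalgebra)
  have Ah: "A \<in> borel_measurable (hist l)" using A by (simp add: l_def)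
  have [measurable]: "A \<in> borel_measurable M" using measurable_from_subalg[OF H.subalg Ah] .
  \<comment> \<open>This is why windows start at \<open>Suc m\<close>: the regime at time
    \<open>m\<close> is then the last one known to \<open>hist\<close>.\<close>
  have thl: "\<theta> m \<in> measurable (hist l) (count_space UNIV)" by (rule theta_hist) (simp add: l_def)
  define I :: "'q \<Rightarrow> 'a \<Rightarrow> real" where "I j \<omega> = of_bool (\<theta> m \<omega> = j)" for j \<omega>
  have Ih: "I j \<in> borel_measurable (hist l)" for j
    unfolding I_def[abs_def] by (rule measurable_compose[OF thl, of "\<lambda>q. of_bool (q = j)"]) simp
  have [measurable]: "I j \<in> borel_measurable M" for j using measurable_from_subalg[OF H.subalg Ih] .
  have I1: "\<bar>I j \<omega>\<bar> \<le> 1" for j \<omega> by (simp add: I_def)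
  have fb: "AE \<omega> in M. \<bar>f \<tau> i j \<omega>\<bar> \<le> C" for \<tau> j using f_bound by eventually_elim blast
  have AI: "AE \<omega> in M. \<bar>A \<omega> * I j \<omega>\<bar> \<le> a * 1" for j
    using A(2)
  proof eventually_elim
    case (elim \<omega>) then show ?case unfolding abs_mult using I1 by (intro mult_mono) auto
  qed
  have AIf: "AE \<omega> in M. \<bar>A \<omega> * I j \<omega> * f \<tau> i j \<omega>\<bar> \<le> (a * 1) * C" for j \<tau>
    using AI[of j] fb[of \<tau> j]
  proof eventually_elim
    case (elim \<omega>) then show ?case using A(3) unfolding abs_mult[of _ "f \<tau> i j \<omega>"] by (intro mult_mono) auto
  qed
  have i_AIf: "integrable M (\<lambda>\<omega>. A \<omega> * I j \<omega> * f \<tau> i j \<omega>)" for j \<tau>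
    by (rule bounded_integrable[OF _ AIf]) measurable
  have i_AI: "integrable M (\<lambda>\<omega>. A \<omega> * I j \<omega>)" for j
    by (rule bounded_integrable[OF _ AI]) measurable
  let ?E = "\<lambda>\<tau> j. real_cond_exp M (hist l) (f \<tau> i j)"
  have AIm: "(\<lambda>\<omega>. A \<omega> * I j \<omega>) \<in> borel_measurable (hist l)" for j using Ah Ih by (rule borel_measurable_times)
  have ce: "integrable M (\<lambda>\<omega>. A \<omega> * I j \<omega> * ?E \<tau> j \<omega>)"
    "expectation (\<lambda>\<omega>. A \<omega> * I j \<omega> * ?E \<tau> j \<omega>) = expectation (\<lambda>\<omega>. A \<omega> * I j \<omega> * f \<tau> i j \<omega>)" for \<tau> j
    using H.real_cond_exp_intg[OF i_AIf AIm] by auto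
  \<comment> \<open>The deviation as if the regime had stayed at its value at time \<open>m\<close>.
    Written as a sum over fixed regimes with indicators known to \<open>hist\<close>, it exposes the
    conditional expectations that occur in (A2).\<close>
  define d where "d \<tau> \<omega> = (\<Sum>j\<in>UNIV. I j \<omega> * (f \<tau> i j \<omega> - F i j))" for \<tau> \<omega>
  have dval: "d \<tau> \<omega> = f \<tau> i (\<theta> m \<omega>) \<omega> - F i (\<theta> m \<omega>)" for \<tau> \<omega>
    unfolding d_def I_def by (rule sum_of_bool_eq)
  have [measurable]: "d \<tau> \<in> borel_measurable M" for \<tau> unfolding d_def[abs_def] by measurable
  let ?g = "\<lambda>j \<omega>. avg_cond_exp M f \<theta> l N i j \<omega> - F i j"
  have frozen: "\<bar>expectation (\<lambda>\<omega>. A \<omega> * (\<Sum>\<tau>\<in>{l..<l+N}. d \<tau> \<omega>))\<bar> \<le> a * real N * (real CARD('q) * \<kappa>)"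
  proof -
    have intd: "integrable M (\<lambda>\<omega>. A \<omega> * I j \<omega> * f \<tau> i j \<omega> - A \<omega> * I j \<omega> * F i j)" for \<tau> j
      by (intro Bochner_Integration.integrable_diff i_AIf integrable_mult_left i_AI)
    have "expectation (\<lambda>\<omega>. A \<omega> * (\<Sum>\<tau>\<in>{l..<l+N}. d \<tau> \<omega>)) =
      expectation (\<lambda>\<omega>. \<Sum>\<tau>\<in>{l..<l+N}. \<Sum>j\<in>UNIV. A \<omega> * I j \<omega> * f \<tau> i j \<omega> - A \<omega> * I j \<omega> * F i j)"
      by (simp add: d_def sum_distrib_left algebra_simps)
    also have "\<dots> = (\<Sum>\<tau>\<in>{l..<l+N}. \<Sum>j\<in>UNIV. expectation (\<lambda>\<omega>. A \<omega> * I j \<omega> * f \<tau> i j \<omega> - A \<omega> * I j \<omega> * F i j))"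
      using intd by (simp add: Bochner_Integration.integral_sum)
    also have "\<dots> = (\<Sum>\<tau>\<in>{l..<l+N}. \<Sum>j\<in>UNIV. expectation (\<lambda>\<omega>. A \<omega> * I j \<omega> * ?E \<tau> j \<omega> - A \<omega> * I j \<omega> * F i j))"
    proof (intro sum.cong refl)
      fix \<tau> j
      have "integrable M (\<lambda>\<omega>. A \<omega> * I j \<omega> * F i j)" by (intro integrable_mult_left i_AI)
      then show "expectation (\<lambda>\<omega>. A \<omega> * I j \<omega> * f \<tau> i j \<omega> - A \<omega> * I j \<omega> * F i j) =
        expectation (\<lambda>\<omega>. A \<omega> * I j \<omega> * ?E \<tau> j \<omega> - A \<omega> * I j \<omega> * F i j)"
        by (simp only: Bochner_Integration.integral_diff i_AIf ce)
    qed
    also have "\<dots> = (\<Sum>j\<in>UNIV. \<Sum>\<tau>\<in>{l..<l+N}. expectation (\<lambda>\<omega>. A \<omega> * I j \<omega> * ?E \<tau> j \<omega> - A \<omega> * I j \<omega> * F i j))"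
      by (rule sum.swap)
    also have "\<dots> = (\<Sum>j\<in>UNIV. expectation (\<lambda>\<omega>. \<Sum>\<tau>\<in>{l..<l+N}. A \<omega> * I j \<omega> * ?E \<tau> j \<omega> - A \<omega> * I j \<omega> * F i j))"
      by (intro sum.cong refl Bochner_Integration.integral_sum[symmetric] Bochner_Integration.integrable_diff ce(1)
          integrable_mult_left i_AI)
    also have "\<dots> = (\<Sum>j\<in>UNIV. expectation (\<lambda>\<omega>. A \<omega> * I j \<omega> * (real N * ?g j \<omega>)))"
    proof (intro sum.cong refl Bochner_Integration.integral_cong)
      fix j \<omega>
      have "(\<Sum>\<tau>\<in>{l..<l+N}. A \<omega> * I j \<omega> * ?E \<tau> j \<omega> - A \<omega> * I j \<omega> * F i j) =
        A \<omega> * I j \<omega> * ((\<Sum>\<tau>\<in>{l..<l+N}. ?E \<tau> j \<omega>) - real N * F i j)"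
        by (simp add: sum_subtractf sum_distrib_left algebra_simps)
      then show "(\<Sum>\<tau>\<in>{l..<l+N}. A \<omega> * I j \<omega> * ?E \<tau> j \<omega> - A \<omega> * I j \<omega> * F i j) =
        A \<omega> * I j \<omega> * (real N * ?g j \<omega>)"
        using N by (simp add: avg_cond_exp_def hist_def right_diff_distrib)
    qed
    also have "\<bar>\<dots>\<bar> \<le> (\<Sum>j\<in>(UNIV::'q set). a * real N * \<kappa>)"
    proof (rule order_trans[OF sum_abs sum_mono])
      fix j
      have [measurable]: "avg_cond_exp M f \<theta> l N i j \<in> borel_measurable M"
        unfolding avg_cond_exp_def[abs_def] by measurable
      have cb: "AE \<omega> in M. \<bar>?g j \<omega>\<bar> \<le> dev_bound"
        unfolding dev_bound_def by (rule avg_cond_exp_bound[OF N])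
      note iav = bounded_integrable[OF _ cb]
      have "\<bar>expectation (\<lambda>\<omega>. A \<omega> * I j \<omega> * (real N * ?g j \<omega>))\<bar> \<le>
        expectation (\<lambda>\<omega>. \<bar>A \<omega> * I j \<omega> * (real N * ?g j \<omega>)\<bar>)" by (rule integral_abs_bound)
      also have "\<dots> \<le> expectation (\<lambda>\<omega>. a * real N * \<bar>?g j \<omega>\<bar>)"
      proof (rule integral_mono_AE')
        show "integrable M (\<lambda>\<omega>. a * real N * \<bar>?g j \<omega>\<bar>)" using iav by simp
        show "AE \<omega> in M. \<bar>A \<omega> * I j \<omega> * (real N * ?g j \<omega>)\<bar> \<le>
           a * real N * \<bar>?g j \<omega>\<bar>"
          using AI[of j]
        proof eventually_elim
          case (elim \<omega>)
          then have "\<bar>A \<omega> * I j \<omega>\<bar> * (real N * \<bar>?g j \<omega>\<bar>) \<le> a * (real N * \<bar>?g j \<omega>\<bar>)"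
            by (intro mult_right_mono) auto
          then show ?case by (simp add: abs_mult mult.assoc)
        qed
      qed (use A(3) in simp)
      also have "\<dots> \<le> a * real N * \<kappa>" using avg[of j] A(3) by (simp add: l_def mult_left_mono)
      finally show "\<bar>expectation (\<lambda>\<omega>. A \<omega> * I j \<omega> * (real N * ?g j \<omega>))\<bar> \<le> a * real N * \<kappa>" .
    qed
    finally show ?thesis by (simp add: algebra_simps)
  qed
  have d_bound: "AE \<omega> in M. \<forall>\<tau>. \<bar>d \<tau> \<omega>\<bar> \<le> dev_bound"
    using f_bound
  proof eventually_elim
    case (elim \<omega>)
    show ?case
    proof
      show "\<bar>d \<tau> \<omega>\<bar> \<le> dev_bound" for \<tau>
        using elim[rule_format, of \<tau> i "\<theta> m \<omega>"] F_le_bound[of i "\<theta> m \<omega>"] unfolding dval dev_bound_def by linarith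
    qed
  qed
  \<comment> \<open>True and frozen deviations differ only here. Each such event has probability at
    most \<open>real N * \<mu>\<close>, which vanishes with the step size for fixed
    \<open>N\<close>.\<close>
  define X where "X \<tau> = {\<omega>\<in>space M. \<theta> \<tau> \<omega> \<noteq> \<theta> m \<omega>}" for \<tau>
  have [measurable]: "X \<tau> \<in> events" for \<tau> unfolding X_def by measurable
  have dd: "AE \<omega> in M. \<forall>\<tau>. \<bar>dev i \<tau> \<omega> - d \<tau> \<omega>\<bar> \<le> 2 * dev_bound * indicator (X \<tau>) \<omega>"
    using dev_bounded d_bound AE_space
  proof eventually_elim
    case (elim \<omega>)
    show ?case
    proof
      fix \<tau>
      have "\<bar>d \<tau> \<omega>\<bar> \<le> dev_bound" using elim(2) by blast
      moreover have "\<bar>dev i \<tau> \<omega>\<bar> \<le> dev_bound" using elim(1) by blast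
      moreover have "\<omega> \<notin> X \<tau> \<Longrightarrow> dev i \<tau> \<omega> = d \<tau> \<omega>" using elim(3) by (auto simp: X_def dval dev_def y_def)
      ultimately show "\<bar>dev i \<tau> \<omega> - d \<tau> \<omega>\<bar> \<le> 2 * dev_bound * indicator (X \<tau>) \<omega>"
        by (cases "\<omega> \<in> X \<tau>") auto
    qed
  qed
  let ?D = "\<lambda>\<omega>. \<Sum>\<tau>\<in>{l..<l+N}. dev i \<tau> \<omega>" and ?d = "\<lambda>\<omega>. \<Sum>\<tau>\<in>{l..<l+N}. d \<tau> \<omega>"
  have moved: "AE \<omega> in M. \<bar>A \<omega> * (?D \<omega> - ?d \<omega>)\<bar> \<le> (\<Sum>\<tau>\<in>{l..<l+N}. a * (2 * dev_bound) * indicator (X \<tau>) \<omega>)"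
    using A(2) dd
  proof eventually_elim
    case (elim \<omega>)
    have "\<bar>?D \<omega> - ?d \<omega>\<bar> \<le> (\<Sum>\<tau>\<in>{l..<l+N}. 2 * dev_bound * indicator (X \<tau>) \<omega>)"
      unfolding sum_subtractf[symmetric] by (rule order_trans[OF sum_abs sum_mono]) (use elim in blast)
    then have "\<bar>A \<omega>\<bar> * \<bar>?D \<omega> - ?d \<omega>\<bar> \<le> a * (\<Sum>\<tau>\<in>{l..<l+N}. 2 * dev_bound * indicator (X \<tau>) \<omega>)"
      using elim(1) A(3) by (intro mult_mono) auto
    then show ?case by (simp add: abs_mult sum_distrib_left mult.assoc)
  qed
  have pX: "prob (X \<tau>) \<le> real N * \<mu>" if "\<tau> \<in> {l..<l+N}" for \<tau>
  proof -
    have "prob (X (m + (\<tau> - m))) \<le> real (\<tau> - m) * \<mu>" unfolding X_def by (rule change_window)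
    also have "\<dots> \<le> real N * \<mu>" using that mu by (intro mult_right_mono) (auto simp: l_def)
    finally show ?thesis using that by (simp add: l_def)
  qed
  have iX: "integrable M (\<lambda>\<omega>. a * (2 * dev_bound) * indicator (X \<tau>) \<omega>)" for \<tau>
    by (intro integrable_mult_right integrable_real_indicator) (auto simp: emeasure_eq_measure)
  define H where "H \<omega> = (\<Sum>\<tau>\<in>{l..<l+N}. a * (2 * dev_bound) * indicat_real (X \<tau>) \<omega>)" for \<omega>
  have iH: "integrable M H" unfolding H_def[abs_def] by (intro Bochner_Integration.integrable_sum iX)
  have moved: "AE \<omega> in M. \<bar>A \<omega> * (?D \<omega> - ?d \<omega>)\<bar> \<le> H \<omega>" using moved unfolding H_def .
  have iM: "integrable M (\<lambda>\<omega>. A \<omega> * (?D \<omega> - ?d \<omega>))"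
  proof (rule Bochner_Integration.integrable_bound[OF iH])
    show "AE \<omega> in M. norm (A \<omega> * (?D \<omega> - ?d \<omega>)) \<le> norm (H \<omega>)"
      using moved by eventually_elim simp
  qed measurable
  have "\<bar>expectation (\<lambda>\<omega>. A \<omega> * (?D \<omega> - ?d \<omega>))\<bar> \<le> expectation (\<lambda>\<omega>. \<bar>A \<omega> * (?D \<omega> - ?d \<omega>)\<bar>)" by (rule integral_abs_bound)
  also have "\<dots> \<le> expectation H"
    by (rule integral_mono_AE[OF integrable_abs[OF iM] iH moved])
  also have "\<dots> = (\<Sum>\<tau>\<in>{l..<l+N}. expectation (\<lambda>\<omega>. a * (2 * dev_bound) * indicator (X \<tau>) \<omega>))"
    unfolding H_def by (rule Bochner_Integration.integral_sum) (rule iX)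
  also have "\<dots> = (\<Sum>\<tau>\<in>{l..<l+N}. a * (2 * dev_bound) * prob (X \<tau>))" by simp
  also have "\<dots> \<le> (\<Sum>\<tau>\<in>{l..<l+N}. a * (2 * dev_bound) * (real N * \<mu>))"
    using pX A(3) dev_bound_pos by (intro sum_mono mult_left_mono) auto
  finally have moved': "\<bar>expectation (\<lambda>\<omega>. A \<omega> * (?D \<omega> - ?d \<omega>))\<bar> \<le> real N * (a * (2 * dev_bound) * (real N * \<mu>))" by simp
  have dB: "AE \<omega> in M. \<bar>A \<omega> * ?d \<omega>\<bar> \<le> a * (real N * dev_bound)"
    using A(2) d_bound
  proof eventually_elim
    case (elim \<omega>)
    have "\<bar>?d \<omega>\<bar> \<le> (\<Sum>\<tau>\<in>{l..<l+N}. dev_bound)"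
      by (rule order_trans[OF sum_abs sum_mono]) (use elim(2) in blast)
    then show ?case unfolding abs_mult using elim(1) A(3) by (intro mult_mono) auto
  qed
  have "expectation (\<lambda>\<omega>. A \<omega> * ?D \<omega>) = expectation (\<lambda>\<omega>. A \<omega> * ?d \<omega> + A \<omega> * (?D \<omega> - ?d \<omega>))"
    by (simp add: algebra_simps)
  also have "\<dots> = expectation (\<lambda>\<omega>. A \<omega> * ?d \<omega>) + expectation (\<lambda>\<omega>. A \<omega> * (?D \<omega> - ?d \<omega>))"
    by (rule Bochner_Integration.integral_add[OF _ iM]) (rule bounded_integrable[OF _ dB], measurable)
  finally show ?thesis using frozen moved' unfolding l_def by (simp add: algebra_simps)
qed

text \<open>In the bracket stand the diagonal terms of the windows and their cross terms; the last
  summand is the incomplete final window. The outer factors 2 come from the square of a sum of two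
  terms.\<close>

definition data_moment :: "real \<Rightarrow> nat \<Rightarrow> real \<Rightarrow> real" where
  "data_moment T N \<kappa> = 2 * (T * \<mu> * real N * dev_bound\<^sup>2 +
     2 * T\<^sup>2 * dev_bound * (real CARD('q) * \<kappa> + 2 * dev_bound * (real N * \<mu>))) + 2 * (\<mu> * real N * dev_bound)\<^sup>2"

text \<open>The indices are grouped into windows of length \<open>N\<close>, on which (A2) applies.
  There are about \<open>T / (\<mu> * N)\<close> windows, so the diagonal vanishes with
  \<open>\<mu>\<close>, whereas the many cross terms are small by the averages
  \<open>\<kappa>\<close> and by rarity of switches. Fewer than \<open>N\<close> indices remain at
  the end.\<close>

lemma data_second_moment:
  assumes avg: "\<And>l j. expectation (\<lambda>\<omega>. \<bar>avg_cond_exp M f \<theta> l N i j \<omega> - F i j\<bar>) \<le> \<kappa>" and N: "0 < N"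
    and n: "real n * \<mu> \<le> T"
  shows "expectation (\<lambda>\<omega>. (\<Sum>k<n. \<mu> * dev i k \<omega>)\<^sup>2) \<le> data_moment T N \<kappa>"
proof -
  define W where "W = n div N"
  define D where "D w \<omega> = (\<Sum>\<tau>\<in>{w * N..<w * N + N}. dev i \<tau> \<omega>)" for w \<omega>
  define B where "B = dev_bound"
  define K where "K = real CARD('q) * \<kappa> + 2 * B * (real N * \<mu>)"
  have B: "0 < B" by (simp add: B_def dev_bound_pos)
  have k0: "0 \<le> \<kappa>"
  proof -
    have "0 \<le> expectation (\<lambda>\<omega>. \<bar>avg_cond_exp M f \<theta> 0 N i undefined \<omega> - F i undefined\<bar>)" by simp
    then show ?thesis using avg[of 0 undefined] by linarith
  qed
  have K: "0 \<le> K" using k0 B mu by (simp add: K_def)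
  have [measurable]: "D w \<in> borel_measurable M" for w unfolding D_def[abs_def] by measurable
  have DB: "AE \<omega> in M. \<bar>D w \<omega>\<bar> \<le> real N * B" for w
    using dev_bounded
  proof eventually_elim
    case (elim \<omega>)
    have "\<bar>D w \<omega>\<bar> \<le> (\<Sum>\<tau>\<in>{w * N..<w * N + N}. B)"
      unfolding D_def by (rule order_trans[OF sum_abs sum_mono]) (use elim in \<open>auto simp: B_def\<close>)
    then show ?case by simp
  qed
  have sumD: "(\<Sum>w<m. D w \<omega>) = (\<Sum>k<m * N. dev i k \<omega>)" for m \<omega>
  proof (induction m)
    case (Suc m)
    have "(\<Sum>k<m * N + N. dev i k \<omega>) = (\<Sum>k<m * N. dev i k \<omega>) + (\<Sum>k\<in>{m * N..<m * N + N}. dev i k \<omega>)"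
      by (metis (no_types) le_add1 lessThan_atLeast0 sum.atLeastLessThan_concat zero_le)
    then show ?case using Suc by (simp add: D_def add.commute)
  qed simp
  define r where "r = (real W * (real N * B)) * real N * K"
  have r0: "0 \<le> r" using B K by (simp add: r_def)
  have "expectation (\<lambda>\<omega>. (\<Sum>w<W. D w \<omega>)\<^sup>2) \<le> real W * ((real N * B)\<^sup>2 + 2 * r)"
  proof (rule second_moment_sum[OF _ DB])
    fix m assume m: "m < W"
    show "expectation (\<lambda>\<omega>. (\<Sum>w<m. D w \<omega>) * D m \<omega>) \<le> r"
    \<comment> \<open>For the first window the preceding sum is empty. Every later window starts at
      a positive time and so has the predecessor that \<open>window_cross\<close> uses.\<close>
    proof (cases m)
      case 0 then show ?thesis using r0 by simp
    next
      case (Suc m')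
      obtain l where l: "m * N = Suc l" using Suc N by (cases "m * N") auto
      let ?A = "\<lambda>\<omega>. \<Sum>w<m. D w \<omega>"
      have "\<bar>expectation (\<lambda>\<omega>. ?A \<omega> * (\<Sum>\<tau>\<in>{Suc l..<Suc l + N}. dev i \<tau> \<omega>))\<bar>
        \<le> (real W * (real N * B)) * real N * (real CARD('q) * \<kappa> + 2 * dev_bound * (real N * \<mu>))"
      proof (rule window_cross[OF _ _ _ avg N])
        show "?A \<in> borel_measurable (hist (Suc l))"
          unfolding sumD l by (intro borel_measurable_sum dev_measurable y_hist theta_hist) auto
        show "AE \<omega> in M. \<bar>?A \<omega>\<bar> \<le> real W * (real N * B)"
          using AE_abs_sum_le[of D "real N * B" m, OF DB]
        proof eventually_elim
          case (elim \<omega>)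
          have "real m * (real N * B) \<le> real W * (real N * B)" using m B by (intro mult_right_mono) auto
          then show ?case using elim by linarith
        qed
      qed (use B in simp)
      then show ?thesis unfolding r_def K_def B_def D_def l by linarith
    qed
  qed measurable
  then have E1: "expectation (\<lambda>\<omega>. (\<Sum>w<W. D w \<omega>)\<^sup>2) \<le> real W * (real N * B)\<^sup>2 + 2 * (real W * real N)\<^sup>2 * B * K"
    by (simp add: r_def power2_eq_square algebra_simps)
  have WN: "real W * real N * \<mu> \<le> T"
  proof -
    have "W * N \<le> n" by (simp add: W_def)
    then have "real (W * N) * \<mu> \<le> real n * \<mu>" using mu by (intro mult_right_mono of_nat_mono) auto
    then show ?thesis using n by simp
  qed
  have T0: "0 \<le> T" using n mu by (meson mult_nonneg_nonneg of_nat_0_le_iff less_imp_le order_trans)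
  let ?R = "\<lambda>\<omega>. \<Sum>w<W. D w \<omega>"
  have RB: "AE \<omega> in M. \<bar>(?R \<omega>)\<^sup>2\<bar> \<le> (real W * (real N * B))\<^sup>2"
    using AE_abs_sum_le[of D "real N * B" W, OF DB] by eventually_elim (rule abs_square_le)
  have iR: "integrable M (\<lambda>\<omega>. (?R \<omega>)\<^sup>2)" by (rule bounded_integrable[OF _ RB]) measurable
  have "expectation (\<lambda>\<omega>. (\<Sum>k<n. \<mu> * dev i k \<omega>)\<^sup>2) \<le> expectation (\<lambda>\<omega>. 2 * \<mu>\<^sup>2 * (?R \<omega>)\<^sup>2 + 2 * (\<mu> * real N * B)\<^sup>2)"
  proof (rule integral_mono_AE')
    show "integrable M (\<lambda>\<omega>. 2 * \<mu>\<^sup>2 * (?R \<omega>)\<^sup>2 + 2 * (\<mu> * real N * B)\<^sup>2)" using iR by simp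
    show "AE \<omega> in M. (\<Sum>k<n. \<mu> * dev i k \<omega>)\<^sup>2 \<le> 2 * \<mu>\<^sup>2 * (?R \<omega>)\<^sup>2 + 2 * (\<mu> * real N * B)\<^sup>2"
      using dev_bounded
    proof eventually_elim
      case (elim \<omega>)
      let ?Q = "\<Sum>k\<in>{W * N..<n}. dev i k \<omega>"
      have "W * N \<le> n" by (simp add: W_def)
      then have sp: "(\<Sum>k<n. dev i k \<omega>) = ?R \<omega> + ?Q"
        unfolding sumD by (metis (no_types) lessThan_atLeast0 sum.atLeastLessThan_concat zero_le)
      have "\<bar>?Q\<bar> \<le> (\<Sum>k\<in>{W * N..<n}. B)"
        by (rule order_trans[OF sum_abs sum_mono]) (use elim in \<open>auto simp: B_def\<close>)
      also have "\<dots> = real (n - W * N) * B" by simp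
      also have "\<dots> \<le> real N * B"
        using mod_less_divisor[OF N, of n] B unfolding W_def by (intro mult_right_mono) (auto simp: minus_div_mult_eq_mod)
      finally have "?Q\<^sup>2 \<le> (real N * B)\<^sup>2" using abs_square_le by fastforce
      moreover have "(?R \<omega> + ?Q)\<^sup>2 \<le> 2 * (?R \<omega>)\<^sup>2 + 2 * ?Q\<^sup>2"
        using zero_le_power2[of "?R \<omega> - ?Q"] by (simp add: power2_eq_square algebra_simps)
      ultimately have "\<mu>\<^sup>2 * (?R \<omega> + ?Q)\<^sup>2 \<le> \<mu>\<^sup>2 * (2 * (?R \<omega>)\<^sup>2 + 2 * (real N * B)\<^sup>2)"
        by (intro mult_left_mono) auto
      moreover have "(\<Sum>k<n. \<mu> * dev i k \<omega>)\<^sup>2 = \<mu>\<^sup>2 * (?R \<omega> + ?Q)\<^sup>2"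
        by (simp add: sp power_mult_distrib flip: sum_distrib_left)
      ultimately show ?case by (simp add: power_mult_distrib algebra_simps)
    qed
  qed simp
  also have "\<dots> = 2 * \<mu>\<^sup>2 * expectation (\<lambda>\<omega>. (?R \<omega>)\<^sup>2) + 2 * (\<mu> * real N * B)\<^sup>2"
    using iR by (simp add: Bochner_Integration.integral_add prob_space)
  also have "\<dots> \<le> 2 * \<mu>\<^sup>2 * (real W * (real N * B)\<^sup>2 + 2 * (real W * real N)\<^sup>2 * B * K) + 2 * (\<mu> * real N * B)\<^sup>2"
    using E1 by (intro add_right_mono mult_left_mono) auto
  also have "\<dots> \<le> data_moment T N \<kappa>"
  proof -
    have "(real W * real N * \<mu>) * (\<mu> * real N * B\<^sup>2) \<le> T * (\<mu> * real N * B\<^sup>2)"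
      using WN mu by (intro mult_right_mono) auto
    moreover have "(real W * real N * \<mu>)\<^sup>2 * (2 * B * K) \<le> T\<^sup>2 * (2 * B * K)"
      using WN mu B K by (intro mult_right_mono power_mono) auto
    ultimately have "\<mu>\<^sup>2 * (real W * (real N * B)\<^sup>2 + 2 * (real W * real N)\<^sup>2 * B * K) \<le>
      T * \<mu> * real N * B\<^sup>2 + 2 * T\<^sup>2 * B * K"
      by (simp add: power2_eq_square algebra_simps)
    then show ?thesis unfolding data_moment_def B_def[symmetric] K_def[symmetric] by simp
  qed
  finally show ?thesis .
qed

text \<open>Importance weighting: the \<open>i\<close>-th estimate minus the value equals the value
  divided by the sampling probability, times the centred draw. The truncation keeps that probability
  above \<open>\<beta>\<close>.\<close>

lemma sampling_noise_draw:
  "sampling_noise \<mu> (F_bound F + 1) (y \<omega>) (\<lambda>k. s k \<omega>) i n =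
    (\<Sum>k<n. \<mu> * ((if norm (v k \<omega>) \<le> F_bound F + 1 then y \<omega> k i / (b (v k \<omega>) $ i) else 0) * draw i k \<omega>))"
  unfolding sampling_noise_def v_def[symmetric]
proof (intro sum.cong refl arg_cong[where f="\<lambda>x. \<mu> * x"])
  fix k
  have "0 < b (v k \<omega>) $ i" if "norm (v k \<omega>) \<le> F_bound F + 1" using b_lower[OF that, of i] beta by simp
  then show "(if norm (v k \<omega>) \<le> F_bound F + 1 then g_vec (b (v k \<omega>)) (s k \<omega>) (y \<omega> k (s k \<omega>)) $ i - y \<omega> k i else 0) =
    (if norm (v k \<omega>) \<le> F_bound F + 1 then y \<omega> k i / (b (v k \<omega>) $ i) else 0) * draw i k \<omega>"
    by (auto simp: g_vec_def draw_def indicator_def field_simps)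
qed

lemma value_noise_draw:
  "value_noise \<mu> (y \<omega>) (\<lambda>k. s k \<omega>) n = (\<Sum>i\<in>UNIV. \<Sum>k<n. \<mu> * (y \<omega> k i * draw i k \<omega>))"
proof -
  have "y \<omega> k (s k \<omega>) - b (v k \<omega>) \<bullet> (\<chi> i. y \<omega> k i) = (\<Sum>i\<in>UNIV. y \<omega> k i * draw i k \<omega>)" for k
  proof -
    have "(\<Sum>i\<in>UNIV. y \<omega> k i * draw i k \<omega>) =
      (\<Sum>i\<in>UNIV. of_bool (s k \<omega> = i) * y \<omega> k i) - (\<Sum>i\<in>UNIV. b (v k \<omega>) $ i * y \<omega> k i)"
      unfolding sum_subtractf[symmetric] by (rule sum.cong) (auto simp: draw_def indicator_def algebra_simps)
    then show ?thesis by (simp only: sum_of_bool_eq) (simp add: inner_vec_def)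
  qed
  then have "value_noise \<mu> (y \<omega>) (\<lambda>k. s k \<omega>) n = (\<Sum>k<n. \<Sum>i\<in>UNIV. \<mu> * (y \<omega> k i * draw i k \<omega>))"
    unfolding value_noise_def v_def[symmetric] by (simp add: sum_distrib_left)
  also have "\<dots> = (\<Sum>i\<in>UNIV. \<Sum>k<n. \<mu> * (y \<omega> k i * draw i k \<omega>))" by (rule sum.swap)
  finally show ?thesis .
qed

text \<open>The event on which the noise hypotheses of \<open>pathwise_stability\<close> fail for
  this step size.\<close>

definition noisy :: "real \<Rightarrow> real \<Rightarrow> 'a set" where
  "noisy T \<delta> = {\<omega>\<in>space M. \<not> (\<forall>m. real m * \<mu> \<le> T \<longrightarrow> \<bar>value_noise \<mu> (y \<omega>) (\<lambda>k. s k \<omega>) m\<bar> \<le> \<delta> \<and>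
     (\<forall>i. \<bar>sampling_noise \<mu> (F_bound F + 1) (y \<omega>) (\<lambda>k. s k \<omega>) i m\<bar> \<le> \<delta> \<and>
       \<bar>data_noise \<mu> (y \<omega>) (\<lambda>k. \<theta> k \<omega>) i m\<bar> \<le> \<delta>))}"

lemma noisy_prob:
  assumes avg: "\<And>l i j. expectation (\<lambda>\<omega>. \<bar>avg_cond_exp M f \<theta> l N i j \<omega> - F i j\<bar>) \<le> \<kappa>" and N: "0 < N"
    and pos: "0 < \<delta>" "0 \<le> T" and B: "C \<le> B" "C / \<beta> \<le> B" "dev_bound \<le> B" and S: "S = real CARD('s)"
    and small: "4 * B * \<mu> \<le> \<delta> / S"
  shows "noisy T \<delta> \<in> events" and
    "prob (noisy T \<delta>) \<le> S * ((4 * B * T / (\<delta> / S) + 1) * (4 * (2 * (T * B\<^sup>2 * \<mu>) + data_moment T N \<kappa>) / (\<delta> / S)\<^sup>2))"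
proof -
  \<comment> \<open>The value noise is a sum over the search points, so each component gets an equal
    share of \<open>\<delta>\<close>.\<close>
  define d where "d = \<delta> / S"
  have S1: "1 \<le> S" unfolding S by (simp add: Suc_leI)
  have d: "0 < d" "d \<le> \<delta>" using pos S1 by (auto simp: d_def divide_le_eq)
  have B0: "0 < B" using C B(1) by simp
  define c where "c i k \<omega> = (if norm (v k \<omega>) \<le> F_bound F + 1 then y \<omega> k i / (b (v k \<omega>) $ i) else 0)" for i k \<omega>
  define N1 where "N1 i n \<omega> = (\<Sum>k<n. \<mu> * (c i k \<omega> * draw i k \<omega>))" for i n \<omega>
  define N2 where "N2 i n \<omega> = (\<Sum>k<n. \<mu> * (y \<omega> k i * draw i k \<omega>))" for i n \<omega>
  define N3 where "N3 i n \<omega> = (\<Sum>k<n. \<mu> * dev i k \<omega>)" for i n \<omega>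
  have c_past: "c i k \<in> borel_measurable (past n)" if "k \<le> n" for i k n
  proof -
    have [measurable]: "v k \<in> borel_measurable (past n)"
      by (rule f_tilde_measurable) (use that in \<open>auto intro: y_past s_past\<close>)
    have [measurable]: "(\<lambda>\<omega>. y \<omega> k i) \<in> borel_measurable (past n)" by (rule y_past)
    have [measurable]: "(\<lambda>\<omega>. b (v k \<omega>) $ i) \<in> borel_measurable (past n)"
      by (rule measurable_compose[OF _ b_component_meas]) measurable
    show ?thesis unfolding c_def[abs_def] by measurable
  qed
  have c_bound: "AE \<omega> in M. \<bar>c i k \<omega>\<bar> \<le> B" for i k
    using y_bound
  proof eventually_elim
    case (elim \<omega>)
    show ?case
    proof (cases "norm (v k \<omega>) \<le> F_bound F + 1")
      case True
      then have "\<bar>y \<omega> k i\<bar> / (b (v k \<omega>) $ i) \<le> C / \<beta>"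
        using elim[rule_format, of k i] b_lower[OF True, of i] beta C by (intro frac_le) auto
      then show ?thesis using True B(2) b_nonneg[of "v k \<omega>" i] by (simp add: c_def abs_divide)
    qed (use B0 in \<open>simp add: c_def\<close>)
  qed
  have yB: "AE \<omega> in M. \<bar>y \<omega> k i\<bar> \<le> B" for i k
    using y_bound by eventually_elim (use B(1) order_trans in blast)
  have [measurable]: "c i k \<in> borel_measurable M" for i k
    using measurable_from_subalg[OF finite_measure_subalgebra.subalg[OF past_subalgebra] c_past[OF order_refl]] .
  have [measurable]: "N1 i n \<in> borel_measurable M" "N2 i n \<in> borel_measurable M" "N3 i n \<in> borel_measurable M" for i n
    unfolding N1_def[abs_def] N2_def[abs_def] N3_def[abs_def] by measurable
  let ?X = "\<lambda>N i. {\<omega>\<in>space M. \<exists>n. real n * \<mu> \<le> T \<and> d < \<bar>N i n \<omega>\<bar>}"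
  define Q where "Q = 4 * B * T / d + 1"
  have Q: "0 \<le> Q" using B0 pos d by (simp add: Q_def)
  have p1: "prob (?X N1 i) \<le> Q * (4 * (T * B\<^sup>2 * \<mu>) / d\<^sup>2)" for i
    unfolding N1_def Q_def by (rule martingale_max) (use c_past c_bound B0 d small pos in \<open>auto simp: d_def\<close>)
  have p2: "prob (?X N2 i) \<le> Q * (4 * (T * B\<^sup>2 * \<mu>) / d\<^sup>2)" for i
    unfolding N2_def Q_def by (rule martingale_max) (use y_past yB B0 d small pos in \<open>auto simp: d_def\<close>)
  have p3: "prob (?X N3 i) \<le> Q * (4 * data_moment T N \<kappa> / d\<^sup>2)" for i
    unfolding Q_def
  proof (rule grid_max_bound[where \<mu>=\<mu>])
    show "AE \<omega> in M. \<bar>N3 i (Suc n) \<omega> - N3 i n \<omega>\<bar> \<le> \<mu> * B" for n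
      using dev_bounded
    proof eventually_elim
      case (elim \<omega>)
      then have "\<bar>dev i n \<omega>\<bar> \<le> B" using B(3) order_trans by blast
      then show ?case using mu by (simp add: N3_def abs_mult)
    qed
    show "expectation (\<lambda>\<omega>. (N3 i n \<omega>)\<^sup>2) \<le> data_moment T N \<kappa>" if "real n * \<mu> \<le> T" for n
      unfolding N3_def by (rule data_second_moment[OF avg N that])
  qed (use mu B0 d small pos in \<open>auto simp: N3_def d_def\<close>)
  have sn: "sampling_noise \<mu> (F_bound F + 1) (y \<omega>) (\<lambda>k. s k \<omega>) i m = N1 i m \<omega>" for \<omega> i m
    unfolding sampling_noise_draw N1_def c_def ..
  have vn: "value_noise \<mu> (y \<omega>) (\<lambda>k. s k \<omega>) m = (\<Sum>i\<in>UNIV. N2 i m \<omega>)" for \<omega> m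
    unfolding value_noise_draw N2_def ..
  have dn: "data_noise \<mu> (y \<omega>) (\<lambda>k. \<theta> k \<omega>) i m = N3 i m \<omega>" for \<omega> i m
    unfolding data_noise_def N3_def dev_def ..
  show noisy_events: "noisy T \<delta> \<in> events" unfolding noisy_def sn vn dn by measurable
  let ?Y = "\<lambda>i. (?X N1 i \<union> ?X N2 i) \<union> ?X N3 i"
  have "noisy T \<delta> \<subseteq> (\<Union>i\<in>UNIV. ?Y i)"
  proof
    fix \<omega> assume "\<omega> \<in> noisy T \<delta>"
    then obtain m where w: "\<omega> \<in> space M" and m: "real m * \<mu> \<le> T" and
      alt: "\<delta> < \<bar>\<Sum>i\<in>UNIV. N2 i m \<omega>\<bar> \<or> (\<exists>i. \<delta> < \<bar>N1 i m \<omega>\<bar> \<or> \<delta> < \<bar>N3 i m \<omega>\<bar>)"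
      unfolding noisy_def sn vn dn by (auto simp: not_le)
    have "\<exists>i. d < \<bar>N2 i m \<omega>\<bar>" if "\<delta> < \<bar>\<Sum>i\<in>UNIV. N2 i m \<omega>\<bar>"
    proof (rule ccontr)
      assume "\<not> (\<exists>i. d < \<bar>N2 i m \<omega>\<bar>)"
      then have "\<bar>\<Sum>i\<in>UNIV. N2 i m \<omega>\<bar> \<le> (\<Sum>i\<in>(UNIV::'s set). d)"
        by (intro order_trans[OF sum_abs sum_mono]) (auto simp: not_less)
      also have "\<dots> = \<delta>" using S1 by (simp add: d_def S)
      finally show False using that by simp
    qed
    then obtain i where "d < \<bar>N1 i m \<omega>\<bar> \<or> d < \<bar>N2 i m \<omega>\<bar> \<or> d < \<bar>N3 i m \<omega>\<bar>"
      using alt d(2) by (meson le_less_trans)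
    then show "\<omega> \<in> (\<Union>i\<in>UNIV. ?Y i)" using w m by blast
  qed
  then have "prob (noisy T \<delta>) \<le> prob (\<Union>i\<in>UNIV. ?Y i)" by (rule finite_measure_mono) measurable
  also have "\<dots> \<le> (\<Sum>i\<in>UNIV. prob (?Y i))" by (rule finite_measure_subadditive_finite) auto
  also have "\<dots> \<le> (\<Sum>i\<in>(UNIV::'s set). Q * (4 * (2 * (T * B\<^sup>2 * \<mu>) + data_moment T N \<kappa>) / d\<^sup>2))"
  proof (rule sum_mono)
    fix i
    have "prob (?Y i) \<le> prob (?X N1 i) + prob (?X N2 i) + prob (?X N3 i)"
      using measure_Un_le[of "?X N1 i \<union> ?X N2 i" M "?X N3 i"] measure_Un_le[of "?X N1 i" M "?X N2 i"] by auto
    also have "\<dots> \<le> Q * (4 * (T * B\<^sup>2 * \<mu>) / d\<^sup>2) + Q * (4 * (T * B\<^sup>2 * \<mu>) / d\<^sup>2) + Q * (4 * data_moment T N \<kappa> / d\<^sup>2)"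
      using p1[of i] p2[of i] p3[of i] by linarith
    also have "\<dots> = Q * (4 * (2 * (T * B\<^sup>2 * \<mu>) + data_moment T N \<kappa>) / d\<^sup>2)"
      by (simp add: add_divide_distrib algebra_simps)
    finally show "prob (?Y i) \<le> \<dots>" .
  qed
  also have "\<dots> = S * (Q * (4 * (2 * (T * B\<^sup>2 * \<mu>) + data_moment T N \<kappa>) / d\<^sup>2))" by (simp add: S)
  finally show "prob (noisy T \<delta>) \<le> S * ((4 * B * T / (\<delta> / S) + 1) * (4 * (2 * (T * B\<^sup>2 * \<mu>) + data_moment T N \<kappa>) / (\<delta> / S)\<^sup>2))"
    by (simp only: Q_def d_def)
qed

end

text \<open>The window length \<open>N\<close> of the averages is chosen before the step size.\<close>

lemma noisy_small:
  fixes M :: "'a measure" and F :: "'s::finite \<Rightarrow> 'q::{finite,metric_space} \<Rightarrow> real"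
  assumes pos: "0 < T" "0 < \<delta>" "0 < \<eta>" "0 < C" "0 < \<beta>"
  shows "\<exists>\<kappa>>0. \<forall>N>0. \<exists>\<mu>1>0. \<forall>\<theta> s \<mu>. simulation M b F f \<theta> s \<mu> C \<beta> \<longrightarrow> \<mu> \<le> \<mu>1 \<longrightarrow>
    (\<forall>l i j. (\<integral>\<omega>. \<bar>avg_cond_exp M f \<theta> l N i j \<omega> - F i j\<bar> \<partial>M) \<le> \<kappa>) \<longrightarrow>
    measure M (simulation.noisy M b F f \<theta> s \<mu> T \<delta>) \<le> \<eta>"
proof -
  define S where "S = real CARD('s)"
  define D where "D = C + F_bound F"
  define B where "B = max (C / \<beta>) D"
  define d where "d = \<delta> / S"
  have S: "0 < S" by (simp add: S_def)
  have D: "0 < D" "C \<le> D" using pos F_bound_ge0[of F] by (auto simp: D_def)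
  have B: "0 < B" "C \<le> B" "C / \<beta> \<le> B" "D \<le> B" using D by (auto simp: B_def)
  have d: "0 < d" using pos S by (simp add: d_def)
  define Q where "Q = S * ((4 * B * T / d + 1) * (4 / d\<^sup>2))"
  have Q: "0 \<le> Q" using S B pos d by (simp add: Q_def)
  define K where "K = 4 * T\<^sup>2 * D * real CARD('q)"
  have K: "0 \<le> K" using D by (simp add: K_def)
  \<comment> \<open>The part of the bound that does not vanish with the step size is proportional to
    \<open>\<kappa>\<close> and receives half of \<open>\<eta>\<close>; the other half is left for
    the choice of \<open>\<mu>1\<close> after \<open>N\<close>.\<close>
  define \<kappa> where "\<kappa> = (\<eta> / 2) / (Q * K + 1)"
  have kappa: "0 < \<kappa>" "Q * K * \<kappa> \<le> \<eta> / 2"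
    using small_scaling[of "Q * K" "\<eta> / 2"] Q K pos by (auto simp: \<kappa>_def)
  show ?thesis
  proof (rule exI[of _ \<kappa>], intro conjI kappa(1) allI impI)
    fix N :: nat assume N: "0 < N"
    \<comment> \<open>Collects the coefficients of \<open>\<mu>\<close>; the square of
      \<open>\<mu>\<close> in the last term is estimated by \<open>\<mu>\<close>.\<close>
    define K1 where "K1 = 2 * T * B\<^sup>2 * 2 + 2 * T * real N * D\<^sup>2 + 8 * T\<^sup>2 * D\<^sup>2 * real N + 2 * (real N * D)\<^sup>2"
    have K1: "0 \<le> K1" using pos D by (simp add: K1_def)
    define \<mu>1 where "\<mu>1 = min ((\<eta> / 2) / (Q * K1 + 1)) (d / (4 * B))"
    have m1: "0 < \<mu>1" "Q * K1 * \<mu>1 \<le> \<eta> / 2" "4 * B * \<mu>1 \<le> d"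
    proof -
      have QK: "0 \<le> Q * K1" using Q K1 by simp
      have 1: "0 < (\<eta> / 2) / (Q * K1 + 1)" "Q * K1 * ((\<eta> / 2) / (Q * K1 + 1)) \<le> \<eta> / 2"
        using small_scaling[OF QK, of "\<eta> / 2"] pos by auto
      then show "0 < \<mu>1" using B d by (simp add: \<mu>1_def)
      have "\<mu>1 \<le> (\<eta> / 2) / (Q * K1 + 1)" "\<mu>1 \<le> d / (4 * B)" unfolding \<mu>1_def by (rule min.cobounded1 min.cobounded2)+
      then show "Q * K1 * \<mu>1 \<le> \<eta> / 2" "4 * B * \<mu>1 \<le> d"
        using 1(2) mult_left_mono[OF _ QK] order_trans B by (blast, simp add: field_simps)
    qed
    show "\<exists>\<mu>1>0. \<forall>\<theta> s \<mu>. simulation M b F f \<theta> s \<mu> C \<beta> \<longrightarrow> \<mu> \<le> \<mu>1 \<longrightarrow>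
      (\<forall>l i j. (\<integral>\<omega>. \<bar>avg_cond_exp M f \<theta> l N i j \<omega> - F i j\<bar> \<partial>M) \<le> \<kappa>) \<longrightarrow>
      measure M (simulation.noisy M b F f \<theta> s \<mu> T \<delta>) \<le> \<eta>"
    proof (rule exI[of _ \<mu>1], intro conjI m1(1) allI impI)
      fix \<theta> s \<mu>
      assume sim: "simulation M b F f \<theta> s \<mu> C \<beta>" and mu1: "\<mu> \<le> \<mu>1"
        and avg: "\<forall>l i j. (\<integral>\<omega>. \<bar>avg_cond_exp M f \<theta> l N i j \<omega> - F i j\<bar> \<partial>M) \<le> \<kappa>"
      interpret simulation M b F f \<theta> s \<mu> C \<beta> by (rule sim)
      have "4 * B * \<mu> \<le> 4 * B * \<mu>1" using mu1 B by (intro mult_left_mono) auto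
      then have "4 * B * \<mu> \<le> \<delta> / S" using m1(3) by (simp add: d_def)
      from noisy_prob(2)[OF avg[rule_format] N pos(2) less_imp_le[OF pos(1)] B(2,3) _ S_def this]
      have "prob (noisy T \<delta>) \<le> S * ((4 * B * T / d + 1) * (4 * (2 * (T * B\<^sup>2 * \<mu>) + data_moment T N \<kappa>) / d\<^sup>2))"
        using B(4) by (simp add: dev_bound_def D_def d_def)
      also have "\<dots> = Q * (2 * (T * B\<^sup>2 * \<mu>) + data_moment T N \<kappa>)"
        unfolding Q_def by (simp only: mult.assoc times_divide_eq_left times_divide_eq_right)
      also have "\<dots> \<le> Q * (K1 * \<mu> + K * \<kappa>)"
      proof (intro mult_left_mono Q)
        have "(\<mu> * real N * D)\<^sup>2 \<le> \<mu> * (real N * D)\<^sup>2"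
        proof -
          have "\<mu>\<^sup>2 \<le> \<mu>" using mult_left_le[of \<mu> \<mu>] mu by (simp add: power2_eq_square)
          then have "\<mu>\<^sup>2 * (real N * D)\<^sup>2 \<le> \<mu> * (real N * D)\<^sup>2" by (intro mult_right_mono) auto
          then show ?thesis by (simp add: power_mult_distrib algebra_simps)
        qed
        moreover have "data_moment T N \<kappa> = (2 * T * real N * D\<^sup>2 + 8 * T\<^sup>2 * D\<^sup>2 * real N) * \<mu> + K * \<kappa> + 2 * (\<mu> * real N * D)\<^sup>2"
          unfolding data_moment_def dev_bound_def D_def[symmetric] K_def
          by (simp add: algebra_simps power2_eq_square)
        ultimately have "data_moment T N \<kappa> \<le> (2 * T * real N * D\<^sup>2 + 8 * T\<^sup>2 * D\<^sup>2 * real N + 2 * (real N * D)\<^sup>2) * \<mu> + K * \<kappa>"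
          by (simp add: distrib_right mult.commute[of "(real N * D)\<^sup>2" \<mu>])
        moreover have "0 \<le> T * B\<^sup>2 * \<mu>" using pos mu by simp
        ultimately show "2 * (T * B\<^sup>2 * \<mu>) + data_moment T N \<kappa> \<le> K1 * \<mu> + K * \<kappa>"
          unfolding K1_def by (simp add: algebra_simps)
      qed
      also have "\<dots> = Q * K1 * \<mu> + Q * K * \<kappa>" by (simp add: algebra_simps)
      also have "\<dots> \<le> \<eta>"
      proof -
        have "Q * K1 * \<mu> \<le> Q * K1 * \<mu>1" using mu1 Q K1 by (intro mult_left_mono) auto
        then show ?thesis using m1(2) kappa(2) by linarith
      qed
      finally show "prob (noisy T \<delta>) \<le> \<eta>" .
    qed
  qed
qed

section \<open>The best-response map\<close>

lemma prob_simplex_norm: "p \<in> prob_simplex \<Longrightarrow> norm p \<le> 1"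
  using norm_le_l1_cart[of p] by (simp add: prob_simplex_def)

text \<open>A relatively interior point allows the segment from the barycentre to be prolonged
  beyond it inside the simplex, which forces positive coordinates. Conversely the smallest
  coordinate is the radius of a ball that works.\<close>

lemma rel_interior_prob_simplex:
  "rel_interior prob_simplex = {p :: real^'s::finite. (\<forall>i. 0 < p $ i) \<and> (\<Sum>i\<in>UNIV. p $ i) = 1}"
proof -
  have conv: "convex (prob_simplex :: (real^'s) set)"
    unfolding prob_simplex_def convex_def
    by (auto simp: sum.distrib simp flip: sum_distrib_left)
  have aff: "affine hull prob_simplex \<subseteq> {p :: real^'s. (\<Sum>i\<in>UNIV. p $ i) = 1}"
  proof (rule hull_minimal)
    show "affine {p :: real^'s. (\<Sum>i\<in>UNIV. p $ i) = 1}"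
      unfolding affine_def by (auto simp: sum.distrib simp flip: sum_distrib_left)
  qed (auto simp: prob_simplex_def)
  define x0 :: "real^'s" where "x0 = (\<chi> i. 1 / real CARD('s))"
  have x0: "x0 \<in> prob_simplex" by (simp add: x0_def prob_simplex_def)
  show ?thesis
  proof (intro equalityI subsetI)
    fix p :: "real^'s" assume p: "p \<in> rel_interior prob_simplex"
    then have ps: "p \<in> prob_simplex" using rel_interior_subset by blast
    obtain e where e: "1 < e" "(1 - e) *\<^sub>R x0 + e *\<^sub>R p \<in> prob_simplex"
      using p x0 convex_rel_interior_iff[OF conv, of p] by blast
    have "0 < p $ i" for i
    proof -
      have "0 \<le> (1 - e) * (1 / real CARD('s)) + e * p $ i" using e(2) by (auto simp: prob_simplex_def x0_def)
      moreover have "(1 - e) * (1 / real CARD('s)) < 0" using e(1) by (intro mult_neg_pos) auto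
      ultimately have "0 < e * p $ i" by linarith
      then show ?thesis using e(1) by (simp add: zero_less_mult_iff)
    qed
    then show "p \<in> {p. (\<forall>i. 0 < p $ i) \<and> (\<Sum>i\<in>UNIV. p $ i) = 1}" using ps by (auto simp: prob_simplex_def)
  next
    fix p :: "real^'s" assume p: "p \<in> {p. (\<forall>i. 0 < p $ i) \<and> (\<Sum>i\<in>UNIV. p $ i) = 1}"
    then have ps: "p \<in> prob_simplex" by (auto simp: prob_simplex_def less_imp_le)
    define d where "d = Min (range (\<lambda>i. p $ i))"
    have d: "0 < d" "\<And>i. d \<le> p $ i" using p by (auto simp: d_def)
    have "ball p d \<inter> affine hull prob_simplex \<subseteq> prob_simplex"
    proof
      fix y assume y: "y \<in> ball p d \<inter> affine hull prob_simplex"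
      have "0 \<le> y $ i" for i
        using component_le_norm_cart[of "p - y" i] y d(2)[of i] by (auto simp: dist_norm)
      then show "y \<in> prob_simplex" using y aff by (auto simp: prob_simplex_def)
    qed
    then show "p \<in> rel_interior prob_simplex" using ps d(1) by (auto simp: mem_rel_interior_ball)
  qed
qed

locale perturbation =
  fixes \<rho> :: "real^'s::finite \<Rightarrow> real" and \<gamma> :: real and g :: "real^'s \<Rightarrow> real^'s"
    and R :: "(real^'s) set"
  assumes R_def: "R = rel_interior prob_simplex"
    and gamma: "0 < \<gamma>"
    and strict: "\<And>x y u. x \<in> R \<Longrightarrow> y \<in> R \<Longrightarrow> x \<noteq> y \<Longrightarrow> 0 < u \<Longrightarrow> u < 1 \<Longrightarrow>
        (1 - u) * \<rho> x + u * \<rho> y < \<rho> ((1 - u) *\<^sub>R x + u *\<^sub>R y)"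
    and bound: "\<And>x. x \<in> R \<Longrightarrow> \<bar>\<rho> x\<bar> \<le> 1"
    and g_cont: "continuous_on R g"
    and g_tangent: "\<And>x. x \<in> R \<Longrightarrow> (\<Sum>i\<in>UNIV. g x $ i) = 0"
    and g_deriv: "\<And>x. x \<in> R \<Longrightarrow> (\<rho> has_derivative (\<lambda>v. g x \<bullet> v)) (at x within R)"
    and blow_up: "\<And>z. z \<in> rel_frontier prob_simplex \<Longrightarrow> filterlim (\<lambda>x. norm (g x)) at_top (at z within R)"
begin

section \<open>Convexity of the cost and steepness near the boundary\<close>

definition cost :: "real^'s \<Rightarrow> real^'s \<Rightarrow> real" where
  "cost v p = p \<bullet> v - \<gamma> * \<rho> p"

lemma R_iff: "p \<in> R \<longleftrightarrow> (\<forall>i. 0 < p $ i) \<and> (\<Sum>i\<in>UNIV. p $ i) = 1"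
  by (simp add: R_def rel_interior_prob_simplex)

lemma R_norm: "p \<in> R \<Longrightarrow> norm p \<le> 1"
  using rel_interior_subset R_def prob_simplex_norm by blast

lemma segment_R: "x \<in> R \<Longrightarrow> y \<in> R \<Longrightarrow> 0 \<le> u \<Longrightarrow> u \<le> 1 \<Longrightarrow> x + u *\<^sub>R (y - x) \<in> R"
proof -
  assume *: "x \<in> R" "y \<in> R" "0 \<le> u" "u \<le> 1"
  have "0 < x $ i + u * (y $ i - x $ i)" for i
  proof -
    have "0 < (1 - u) * x $ i + u * y $ i"
      using * by (cases "u = 0") (auto simp: R_iff less_imp_le intro!: add_nonneg_pos mult_nonneg_nonneg)
    then show ?thesis by (simp add: algebra_simps)
  qed
  moreover have "(\<Sum>i\<in>UNIV. x $ i + u * (y $ i - x $ i)) = 1"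
    using * by (simp add: R_iff sum.distrib sum_subtractf flip: sum_distrib_left)
  ultimately show ?thesis by (simp add: R_iff)
qed

text \<open>By concavity the difference quotients along the segment stay above the full increment;
  their limit is the directional derivative. All is done inside \<open>R\<close>, where alone
  \<open>\<rho>\<close> is differentiable.\<close>

lemma gradient_inequality:
  assumes p: "p \<in> R" and x: "x \<in> R" shows "\<rho> x \<le> \<rho> p + g p \<bullet> (x - p)"
proof (cases "x = p")
  case False
  let ?l = "\<lambda>u. p + u *\<^sub>R (x - p)"
  have l: "(?l has_derivative (\<lambda>u. u *\<^sub>R (x - p))) (at 0 within {0..1})"
    by (auto intro!: derivative_eq_intros)
  have r: "(\<rho> has_derivative (\<lambda>v. g p \<bullet> v)) (at (?l 0) within ?l ` {0..1})"
    using g_deriv[OF p] segment_R[OF p x] by (auto intro: has_derivative_subset)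
  have "((\<rho> \<circ> ?l) has_derivative (\<lambda>v. g p \<bullet> v) \<circ> (\<lambda>u. u *\<^sub>R (x - p))) (at 0 within {0..1})"
    by (rule diff_chain_within[OF l r])
  then have "((\<lambda>u. \<rho> (?l u)) has_real_derivative g p \<bullet> (x - p)) (at 0 within {0..1})"
    unfolding has_field_derivative_def by (simp add: o_def fun_eq_iff mult_commute_abs)
  then have "((\<lambda>u. (\<rho> (?l u) - \<rho> p) / u) \<longlongrightarrow> g p \<bullet> (x - p)) (at 0 within {0..1})"
    by (simp add: has_field_derivative_iff)
  moreover have "eventually (\<lambda>u. \<rho> x - \<rho> p \<le> (\<rho> (?l u) - \<rho> p) / u) (at 0 within {0..1})"
    unfolding eventually_at
  proof (intro exI[of _ 1] conjI ballI impI)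
    fix u :: real assume u: "u \<in> {0..1}" "u \<noteq> 0 \<and> dist u 0 < 1"
    then have u: "0 < u" "u < 1" by auto
    have "(1 - u) *\<^sub>R p + u *\<^sub>R x = ?l u" by (simp add: algebra_simps)
    then have "(1 - u) * \<rho> p + u * \<rho> x < \<rho> (?l u)" using strict[OF p x _ u] False by metis
    then show "\<rho> x - \<rho> p \<le> (\<rho> (?l u) - \<rho> p) / u" using u by (simp add: le_divide_eq algebra_simps)
  qed simp
  moreover have "at 0 within {0..1::real} \<noteq> bot" by (simp add: at_within_Icc_at_right)
  ultimately have "\<rho> x - \<rho> p \<le> g p \<bullet> (x - p)" by (intro tendsto_lowerbound)
  then show ?thesis by simp
qed simp

lemma rho_continuous: "continuous_on R \<rho>"
  unfolding continuous_on_eq_continuous_within using g_deriv has_derivative_continuous by blast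

lemma cost_continuous: "continuous_on R (cost v)"
  unfolding cost_def by (intro continuous_intros rho_continuous)

lemma cost_gradient: "p \<in> R \<Longrightarrow> x \<in> R \<Longrightarrow> cost v p + (v - \<gamma> *\<^sub>R g p) \<bullet> (x - p) \<le> cost v x"
  using mult_left_mono[OF gradient_inequality[of p x], of \<gamma>] gamma
  by (simp add: cost_def inner_diff_left inner_diff_right inner_commute algebra_simps)

definition center :: "real^'s" where "center = (\<chi> i. 1 / real CARD('s))"

text \<open>Half of a coordinate of the barycentre: moving from it by this distance along the
  simplex stays inside \<open>R\<close>.\<close>

definition radius :: real where "radius = 1 / (2 * real CARD('s))"

lemma radius_pos: "0 < radius" by (simp add: radius_def)

lemma center_R: "center \<in> R" by (simp add: center_def R_iff)

text \<open>The gradient inequality is applied at the point reached from the barycentre against the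
  gradient. As \<open>\<rho>\<close> varies by at most 2, a large gradient must point from
  \<open>p\<close> towards the centre.\<close>

lemma gradient_towards_center:
  assumes p: "p \<in> R" shows "radius * norm (g p) - 2 \<le> g p \<bullet> (center - p)"
proof (cases "g p = 0")
  case False
  define w where "w = (- radius / norm (g p)) *\<^sub>R g p"
  have nw: "norm w = radius" using False radius_pos by (simp add: w_def)
  have "center + w \<in> R"
    unfolding R_iff
  proof
    have "\<bar>w $ i\<bar> \<le> radius" for i using component_le_norm_cart[of w i] nw by simp
    moreover have "radius < 1 / real CARD('s)" by (simp add: radius_def divide_strict_left_mono)
    ultimately show "\<forall>i. 0 < (center + w) $ i" unfolding center_def by (auto simp: abs_le_iff) (smt (verit))
    show "(\<Sum>i\<in>UNIV. (center + w) $ i) = 1"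
    proof -
      have "(\<Sum>i\<in>UNIV. w $ i) = (- radius / norm (g p)) * (\<Sum>i\<in>UNIV. g p $ i)"
        unfolding w_def sum_distrib_left by simp
      then show ?thesis using center_R g_tangent[OF p] by (simp add: sum.distrib R_iff)
    qed
  qed
  from gradient_inequality[OF p this] bound[OF this] bound[OF p]
  have "- 2 \<le> g p \<bullet> (center + w - p)" by linarith
  also have "\<dots> = g p \<bullet> (center - p) + g p \<bullet> w" by (simp add: inner_add_right inner_diff_right)
  also have "g p \<bullet> w = - (radius * norm (g p))" using False
    by (simp add: w_def dot_square_norm power2_eq_square)
  finally show ?thesis by simp
next
  case True then show ?thesis by simp
qed

text \<open>Of the 3, two units pay for the variation of \<open>\<rho>\<close> and one makes the
  descent strict; \<open>2 * B\<close> bounds the linear part of the cost along a segment in the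
  simplex.\<close>

definition level :: "real \<Rightarrow> real" where "level B = (2 * B / \<gamma> + 3) / radius"

definition core :: "real \<Rightarrow> (real^'s) set" where "core B = {p \<in> R. norm (g p) \<le> level B}"

lemma descent_direction:
  assumes p: "p \<in> R" "p \<notin> core B" and v: "norm v \<le> B"
  shows "(v - \<gamma> *\<^sub>R g p) \<bullet> (center - p) < 0"
proof -
  have "level B * radius < norm (g p) * radius" using p radius_pos by (auto simp: core_def)
  then have "2 * B / \<gamma> + 3 < radius * norm (g p)"
    using radius_pos by (simp add: level_def mult.commute)
  then have "2 * B / \<gamma> + 1 < g p \<bullet> (center - p)" using gradient_towards_center[OF p(1)] by linarith
  then have "\<gamma> * (2 * B / \<gamma> + 1) < \<gamma> * (g p \<bullet> (center - p))" using gamma by simp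
  then have "2 * B + \<gamma> < \<gamma> * (g p \<bullet> (center - p))" using gamma by (simp add: algebra_simps)
  moreover have "v \<bullet> (center - p) \<le> norm v * norm (center - p)" by (rule norm_cauchy_schwarz)
  moreover have "norm v * norm (center - p) \<le> B * 2"
    using v R_norm[OF p(1)] R_norm[OF center_R] norm_triangle_ineq4[of center p]
    by (intro mult_mono) (auto intro: order_trans[OF norm_ge_zero])
  ultimately show ?thesis using gamma by (simp add: inner_diff_left)
qed

text \<open>The gradient inequality is used at a nearby point \<open>q\<close> instead of
  \<open>p\<close>, since there it bounds the cost at \<open>p\<close> from below by that at
  \<open>q\<close>. Continuity of \<open>g\<close> keeps \<open>q\<close> outside the core, where
  the direction towards the centre still descends.\<close>

lemma not_minimal_outside_core:
  assumes p: "p \<in> R" "p \<notin> core B" and v: "norm v \<le> B"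
  shows "\<exists>u. 0 < u \<and> u \<le> 1 \<and> cost v (p + u *\<^sub>R (center - p)) < cost v p"
proof -
  let ?l = "\<lambda>u. p + u *\<^sub>R (center - p)"
  have "continuous_on {0..1} (\<lambda>u. norm (g (?l u)))"
    by (intro continuous_intros continuous_on_compose2[OF g_cont]) (use segment_R[OF p(1) center_R] in auto)
  then have "((\<lambda>u. norm (g (?l u))) \<longlongrightarrow> norm (g (?l 0))) (at 0 within {0..1})"
    unfolding continuous_on_def by (rule bspec) simp
  moreover have "level B < norm (g (?l 0))" using p by (auto simp: core_def)
  ultimately have "eventually (\<lambda>u. level B < norm (g (?l u))) (at 0 within {0..1})"
    by (rule order_tendstoD)
  then obtain d where d: "0 < d" "\<And>u. u \<in> {0..1} \<Longrightarrow> u \<noteq> 0 \<Longrightarrow> dist u 0 < d \<Longrightarrow> level B < norm (g (?l u))"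
    by (auto simp: eventually_at)
  define u where "u = min (d/2) (1/2)"
  have u: "0 < u" "u < 1" "u < d" using d by (auto simp: u_def)
  let ?q = "?l u"
  have q: "?q \<in> R" "?q \<notin> core B" using segment_R[OF p(1) center_R, of u] d(2)[of u] u by (auto simp: core_def)
  have "center - ?q = (1 - u) *\<^sub>R (center - p)" by (simp add: algebra_simps)
  then have "(1 - u) * ((v - \<gamma> *\<^sub>R g ?q) \<bullet> (center - p)) < 0"
    using descent_direction[OF q v] by simp
  then have "(v - \<gamma> *\<^sub>R g ?q) \<bullet> (center - p) < 0" using u by (simp add: mult_less_0_iff)
  then have "0 < (v - \<gamma> *\<^sub>R g ?q) \<bullet> (p - ?q)" using u by (simp add: mult_less_0_iff)
  then have "cost v ?q < cost v p" using cost_gradient[OF q(1) p(1), of v] by linarith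
  then show ?thesis using u by (intro exI[of _ u]) auto
qed

text \<open>A limit point on the relative frontier is impossible, because the gradients would be
  unbounded there; at a limit in \<open>R\<close> the bound passes on by continuity.\<close>

lemma compact_core: "compact (core B)"
proof -
  have cs: "compact (prob_simplex :: (real^'s) set)"
  proof -
    have "closed {p :: real^'s. (\<forall>i. 0 \<le> p $ i) \<and> (\<Sum>i\<in>UNIV. p $ i) = 1}"
      by (intro closed_Collect_conj closed_Collect_all closed_Collect_le closed_Collect_eq continuous_intros)
    moreover have "bounded (prob_simplex :: (real^'s) set)" using prob_simplex_norm bounded_iff by blast
    ultimately show ?thesis by (simp add: compact_eq_bounded_closed prob_simplex_def)
  qed
  have "closed (core B)"
    unfolding closed_sequential_limits
  proof (intro allI impI, elim conjE)
    fix x z assume x: "\<forall>n. x n \<in> core B" and z: "x \<longlonglongrightarrow> z"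
    have xR: "x n \<in> R" "norm (g (x n)) \<le> level B" for n using x by (auto simp: core_def)
    then have "x n \<in> prob_simplex" for n using rel_interior_subset R_def by blast
    then have zs: "z \<in> prob_simplex" using z compact_imp_closed[OF cs] closed_sequential_limits by blast
    show "z \<in> core B"
    proof (cases "z \<in> R")
      case True
      then have "(\<lambda>n. norm (g (x n))) \<longlonglongrightarrow> norm (g z)"
        using continuous_on_tendsto_compose[OF g_cont z] xR(1) by (intro tendsto_norm) auto
      then have "norm (g z) \<le> level B" by (rule tendsto_upperbound) (auto simp: xR(2))
      then show ?thesis using True by (simp add: core_def)
    next
      case False
      then have fr: "z \<in> rel_frontier prob_simplex" using zs by (simp add: rel_frontier_def R_def closure_closed compact_imp_closed[OF cs])
      have "filterlim x (at z within R) sequentially"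
        unfolding filterlim_at using z xR(1) False by (auto intro!: always_eventually)
      from filterlim_compose[OF blow_up[OF fr] this]
      have "eventually (\<lambda>n. level B + 1 \<le> norm (g (x n))) sequentially" by (simp add: filterlim_at_top)
      then obtain n where "level B + 1 \<le> norm (g (x n))" by (auto simp: eventually_sequentially)
      then show ?thesis using xR(2)[of n] by simp
    qed
  qed
  moreover have "core B \<subseteq> R" by (auto simp: core_def)
  then have "core B \<subseteq> prob_simplex" using subset_trans rel_interior_subset R_def by metis
  ultimately show ?thesis using compact_Int_closed[OF cs, of "core B"] by (simp add: Int_absorb1)
qed

text \<open>\<open>R\<close> is not closed, so the cost is first minimized over the compact sets
  \<open>C d\<close>. Moving towards the centre does not leave \<open>C d\<close>, hence those
  minimizers lie in the core, a compact set independent of \<open>d\<close>. Each point of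
  \<open>R\<close> belongs to some \<open>C d\<close>, so a minimizer over the core is one over
  \<open>R\<close>.\<close>

lemma minimizer_exists:
  assumes v: "norm v \<le> B"
  shows "\<exists>p\<in>core B. \<forall>x\<in>R. cost v p \<le> cost v x"
proof -
  define C where "C d = {p :: real^'s. (\<forall>i. d \<le> p $ i) \<and> (\<Sum>i\<in>UNIV. p $ i) = 1}" for d
  have C_R: "C d \<subseteq> R" if "0 < d" for d using less_le_trans[OF that] by (auto simp: C_def R_iff)
  have trunc: "\<exists>p\<in>core B. \<forall>x\<in>C d. cost v p \<le> cost v x" if d: "0 < d" "d \<le> 1 / real CARD('s)" for d
  proof -
    have cC: "center \<in> C d" using d center_R by (simp add: C_def center_def R_iff)
    have "compact (C d)"
    proof -
      have "closed (C d)" unfolding C_def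
        by (intro closed_Collect_conj closed_Collect_all closed_Collect_le closed_Collect_eq continuous_intros)
      moreover have "bounded (C d)" using C_R[OF d(1)] R_norm bounded_iff by blast
      ultimately show ?thesis by (simp add: compact_eq_bounded_closed)
    qed
    then obtain p where p: "p \<in> C d" "\<And>x. x \<in> C d \<Longrightarrow> cost v p \<le> cost v x"
      using continuous_attains_inf[of "C d" "cost v"] cC continuous_on_subset[OF cost_continuous C_R[OF d(1)]] by blast
    have "p \<in> core B"
    proof (rule ccontr)
      assume "p \<notin> core B"
      then obtain u where u: "0 < u" "u \<le> 1" "cost v (p + u *\<^sub>R (center - p)) < cost v p"
        using not_minimal_outside_core[of p B v] p(1) C_R[OF d(1)] v by blast
      have "p + u *\<^sub>R (center - p) \<in> C d"
      proof -
        have "d \<le> p $ i + u * (center $ i - p $ i)" for i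
        proof -
          have "(1 - u) * d + u * d \<le> (1 - u) * p $ i + u * center $ i"
            using u p(1) cC by (intro add_mono mult_left_mono) (auto simp: C_def)
          then show ?thesis by (simp add: algebra_simps)
        qed
        moreover have "(\<Sum>i\<in>UNIV. p $ i + u * (center $ i - p $ i)) = 1"
          using p(1) cC by (simp add: C_def sum.distrib sum_subtractf flip: sum_distrib_left)
        ultimately show ?thesis by (simp add: C_def)
      qed
      then show False using p(2) u(3) by fastforce
    qed
    then show ?thesis using p(2) by blast
  qed
  have ne: "core B \<noteq> {}" using trunc[of "1 / real CARD('s)"] by auto
  obtain p where p: "p \<in> core B" "\<And>x. x \<in> core B \<Longrightarrow> cost v p \<le> cost v x"
    using continuous_attains_inf[OF compact_core ne continuous_on_subset[OF cost_continuous]]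
    by (auto simp: core_def)
  have "cost v p \<le> cost v x" if x: "x \<in> R" for x
  proof -
    define d where "d = min (1 / real CARD('s)) (Min (range (\<lambda>i. x $ i)))"
    have "0 < d" "d \<le> 1 / real CARD('s)" "x \<in> C d" using x by (auto simp: d_def C_def R_iff min_le_iff_disj)
    then obtain y where "y \<in> core B" "cost v y \<le> cost v x" using trunc by blast
    then show ?thesis using p(2)[of y] by linarith
  qed
  then show ?thesis using p(1) by blast
qed

section \<open>Uniqueness, continuity and positivity of the best response\<close>

lemma minimizer_unique:
  assumes "p \<in> R" "q \<in> R" "\<And>x. x \<in> R \<Longrightarrow> cost v p \<le> cost v x" "\<And>x. x \<in> R \<Longrightarrow> cost v q \<le> cost v x"
  shows "p = q"
proof (rule ccontr)
  assume ne: "p \<noteq> q"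
  let ?m = "(1 - 1/2) *\<^sub>R p + (1/2) *\<^sub>R q"
  have "?m = p + (1/2) *\<^sub>R (q - p)" by (simp add: vec_eq_iff algebra_simps)
  then have m: "?m \<in> R" using segment_R[OF assms(1,2), of "1/2"] by simp
  have "(1 - 1/2) * \<rho> p + 1/2 * \<rho> q < \<rho> ?m" using strict[OF assms(1,2) ne, of "1/2"] by simp
  then have "\<gamma> * ((1 - 1/2) * \<rho> p + 1/2 * \<rho> q) < \<gamma> * \<rho> ?m" using gamma by simp
  then have "cost v ?m < (cost v p + cost v q) / 2"
    by (simp add: cost_def inner_add_left field_simps)
  then show False using assms(3)[OF m] assms(4)[OF m] by argo
qed

definition response_map :: "real^'s \<Rightarrow> real^'s" where
  "response_map v = best_response \<gamma> \<rho> v"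

lemma response_map:
  shows response_core: "norm v \<le> B \<Longrightarrow> response_map v \<in> core B"
    and response_R: "response_map v \<in> R"
    and response_min: "x \<in> R \<Longrightarrow> cost v (response_map v) \<le> cost v x"
proof -
  have c: "cost v = (\<lambda>\<sigma>. (\<Sum>i\<in>UNIV. \<sigma> $ i * v $ i) - \<gamma> * \<rho> \<sigma>)"
    by (auto simp: cost_def inner_vec_def)
  obtain p where p: "p \<in> R" "\<forall>x\<in>R. cost v p \<le> cost v x"
    using minimizer_exists[of v "norm v"] by (auto simp: core_def)
  have am: "is_arg_min (cost v) (\<lambda>x. x \<in> R) (response_map v)"
    unfolding response_map_def best_response_def arg_min_on_def arg_min_def R_def[symmetric] c[symmetric]
    by (rule someI[of _ p]) (use p in \<open>auto simp: is_arg_min_def not_less\<close>)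
  then show 1: "response_map v \<in> R" by (simp add: is_arg_min_def)
  show 2: "x \<in> R \<Longrightarrow> cost v (response_map v) \<le> cost v x" for x using am by (auto simp: is_arg_min_def not_less)
  assume "norm v \<le> B"
  then obtain q where q: "q \<in> core B" "\<forall>x\<in>R. cost v q \<le> cost v x" using minimizer_exists by blast
  then have "response_map v = q" using 1 2 by (intro minimizer_unique[of _ _ v]) (auto simp: core_def)
  then show "response_map v \<in> core B" using q by simp
qed

text \<open>For bounded arguments the minimizers stay in one compact core. A limit of a subsequence
  minimizes the limiting cost, so by uniqueness it is the response at the limit.\<close>

lemma response_continuous: "continuous_on UNIV response_map"
  unfolding continuous_on_sequentially
proof (intro allI ballI impI, elim conjE)
  fix x and v :: "real^'s" assume x: "x \<longlonglongrightarrow> v"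
  define B where "B = norm v + 1"
  have "eventually (\<lambda>n. dist (x n) v < 1) sequentially" using x by (rule tendstoD) simp
  then have evB: "eventually (\<lambda>n. norm (x n) \<le> B) sequentially"
  proof eventually_elim
    case (elim n)
    then show ?case using norm_triangle_sub[of "x n" v] by (simp add: B_def dist_norm)
  qed
  show "(response_map \<circ> x) \<longlonglongrightarrow> response_map v"
  proof (rule ccontr)
    assume "\<not> (response_map \<circ> x) \<longlonglongrightarrow> response_map v"
    then obtain e where e: "0 < e" "\<not> eventually (\<lambda>n. dist (response_map (x n)) (response_map v) < e) sequentially"
      by (auto simp: tendsto_iff)
    then have "\<exists>\<^sub>F n in sequentially. e \<le> dist (response_map (x n)) (response_map v) \<and> norm (x n) \<le> B"
      using evB by (intro frequently_eventually_frequently) (auto simp: frequently_def not_le)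
    then have "infinite {n. e \<le> dist (response_map (x n)) (response_map v) \<and> norm (x n) \<le> B}"
      by (simp add: frequently_cofinite flip: cofinite_eq_sequentially)
    from infinite_enumerate[OF this] obtain r :: "nat \<Rightarrow> nat" where r: "strict_mono r"
      "\<And>n. e \<le> dist (response_map (x (r n))) (response_map v)" "\<And>n. norm (x (r n)) \<le> B" by auto
    have "\<forall>n. (\<lambda>n. response_map (x (r n))) n \<in> core B" using response_core[OF r(3)] by simp
    then obtain l r' where l: "l \<in> core B" "strict_mono r'" "((\<lambda>n. response_map (x (r n))) \<circ> r') \<longlonglongrightarrow> l"
      using seq_compactE[OF compact_imp_seq_compact[OF compact_core]] by metis
    have l3: "(\<lambda>n. response_map (x (r (r' n)))) \<longlonglongrightarrow> l" using l(3) by (simp add: o_def)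
    have xr: "(\<lambda>n. x (r (r' n))) \<longlonglongrightarrow> v"
      using LIMSEQ_subseq_LIMSEQ[OF LIMSEQ_subseq_LIMSEQ[OF x r(1)] l(2)] by (simp add: o_def)
    have lR: "l \<in> R" using l by (simp add: core_def)
    have "(\<lambda>n. \<rho> (response_map (x (r (r' n))))) \<longlonglongrightarrow> \<rho> l"
      by (rule continuous_on_tendsto_compose[OF rho_continuous l3 lR]) (auto simp: response_R)
    then have c1: "(\<lambda>n. cost (x (r (r' n))) (response_map (x (r (r' n))))) \<longlonglongrightarrow> cost v l"
      unfolding cost_def by (intro tendsto_intros l3 xr)
    have "cost v l \<le> cost v y" if y: "y \<in> R" for y
    proof (rule LIMSEQ_le[OF c1])
      show "(\<lambda>n. cost (x (r (r' n))) y) \<longlonglongrightarrow> cost v y" unfolding cost_def by (intro tendsto_intros xr)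
    qed (use response_min[OF y] in auto)
    then have "l = response_map v" using lR response_R response_min by (intro minimizer_unique[of _ _ v])
    then have "(\<lambda>n. dist (response_map (x (r (r' n)))) (response_map v)) \<longlonglongrightarrow> 0"
      using tendsto_dist[OF l3 tendsto_const[of l]] by simp
    then have "e \<le> 0" by (rule LIMSEQ_le_const) (use r(2) in blast)
    then show False using e(1) by simp
  qed
qed

text \<open>All coordinates are positive on the core and attain their minima there by
  compactness.\<close>

lemma response_lower_bound: "\<exists>\<beta>>0. \<forall>v i. norm v \<le> B \<longrightarrow> \<beta> \<le> response_map v $ i"
proof (cases "core B = {}")
  case True
  then show ?thesis using response_core[of _ B] by (intro exI[of _ 1]) auto
next
  case False
  have "\<exists>d>0. \<forall>p\<in>core B. d \<le> p $ i" for i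
  proof -
    obtain p where "p \<in> core B" "\<forall>q\<in>core B. p $ i \<le> q $ i"
      using continuous_attains_inf[OF compact_core False, of "\<lambda>p. p $ i"]
      continuous_on_component[OF continuous_on_id] by blast
    then show ?thesis by (intro exI[of _ "p $ i"]) (auto simp: core_def R_iff)
  qed
  then obtain d where d: "\<And>i. 0 < d i" "\<And>i p. p \<in> core B \<Longrightarrow> d i \<le> p $ i" by metis
  have "Min (range d) \<le> p $ i" if "p \<in> core B" for p i using d(2)[OF that, of i] by (auto simp: Min_le_iff)
  moreover have "0 < Min (range d)" using d(1) by simp
  ultimately show ?thesis using response_core[of _ B] by (intro exI[of _ "Min (range d)"]) auto
qed

end

lemma best_response_properties:
  fixes \<rho> :: "real^'s::finite \<Rightarrow> real"
  assumes "admissible_perturbation \<rho>" "0 < \<gamma>"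
  shows "continuous_on UNIV (best_response \<gamma> \<rho>)"
    and "best_response \<gamma> \<rho> v \<in> rel_interior prob_simplex"
    and "\<exists>\<beta>>0. \<forall>v i. norm v \<le> B \<longrightarrow> \<beta> \<le> best_response \<gamma> \<rho> v $ i"
proof -
  obtain g where "perturbation \<rho> \<gamma> g (rel_interior prob_simplex)"
    using assms unfolding admissible_perturbation_def perturbation_def by blast
  then interpret perturbation \<rho> \<gamma> g "rel_interior prob_simplex" .
  show "continuous_on UNIV (best_response \<gamma> \<rho>)"
    "best_response \<gamma> \<rho> v \<in> rel_interior prob_simplex"
    "\<exists>\<beta>>0. \<forall>v i. norm v \<le> B \<longrightarrow> \<beta> \<le> best_response \<gamma> \<rho> v $ i"
    using response_continuous response_R response_lower_bound unfolding response_map_def by auto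
qed

section \<open>Uniformization of the regime chain\<close>

text \<open>Rate 1 suffices for the clock: entries of \<open>Q\<close> are at most 1 in absolute
  value, so \<open>I + Q\<close> is a stochastic matrix.\<close>

definition gap_measure :: "real measure" where
  "gap_measure = density lborel (exponential_density 1)"

lemma prob_space_gap_measure: "prob_space gap_measure"
  unfolding gap_measure_def by (rule prob_space_exponential_density) simp

lemma gap_measure_sets [simp, measurable_cong]: "sets gap_measure = sets borel"
  by (simp add: gap_measure_def)

lemma gap_memoryless:
  assumes [measurable]: "h \<in> borel_measurable borel" and l: "0 \<le> l"
  shows "(\<integral>\<^sup>+e. indicator {l..} e * h (e - l) \<partial>gap_measure) = ennreal (exp (-l)) * (\<integral>\<^sup>+e. h e \<partial>gap_measure)"
proof -
  have "(\<integral>\<^sup>+e. indicator {l..} e * h (e - l) \<partial>gap_measure) =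
    (\<integral>\<^sup>+e. ennreal (exponential_density 1 e) * (indicator {l..} e * h (e - l)) \<partial>lborel)"
    unfolding gap_measure_def by (rule nn_integral_density) auto
  also have "\<dots> = (\<integral>\<^sup>+e. ennreal (exponential_density 1 (l + 1 * e)) * (indicator {l..} (l + 1 * e) * h (l + 1 * e - l)) \<partial>lborel)"
    by (subst nn_integral_real_affine[where c=1 and t=l]) auto
  also have "\<dots> = (\<integral>\<^sup>+e. ennreal (exp (-l)) * (ennreal (exponential_density 1 e) * h e) \<partial>lborel)"
    using l by (intro nn_integral_cong)
      (auto simp: exponential_density_def indicator_def mult.assoc[symmetric] ennreal_mult[symmetric] simp flip: exp_add)
  also have "\<dots> = ennreal (exp (-l)) * (\<integral>\<^sup>+e. ennreal (exponential_density 1 e) * h e \<partial>lborel)"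
    by (rule nn_integral_cmult) auto
  also have "(\<integral>\<^sup>+e. ennreal (exponential_density 1 e) * h e \<partial>lborel) = (\<integral>\<^sup>+e. h e \<partial>gap_measure)"
    unfolding gap_measure_def by (rule nn_integral_density[symmetric]) auto
  finally show ?thesis .
qed

lemma gap_ge: "0 \<le> l \<Longrightarrow> emeasure gap_measure {l..} = ennreal (exp (-l))"
  using gap_memoryless[of "\<lambda>_. 1" l] prob_space.emeasure_space_1[OF prob_space_gap_measure] by simp

lemma gap_less: "0 \<le> l \<Longrightarrow> emeasure gap_measure {..<l} = ennreal (1 - exp (-l))"
proof -
  interpret G: prob_space gap_measure by (rule prob_space_gap_measure)
  assume l: "0 \<le> l"
  have "G.prob {..<l} = G.prob (space gap_measure - {l..})" by (rule arg_cong[where f=G.prob]) (auto simp: gap_measure_def)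
  also have "\<dots> = 1 - exp (-l)" using gap_ge[OF l] by (subst G.prob_compl) (auto simp: measure_def)
  finally show ?thesis by (simp add: G.emeasure_eq_measure)
qed

lemma gap_point: "emeasure gap_measure {c} = 0"
  unfolding gap_measure_def by (subst emeasure_density) (auto simp: nn_integral_0_iff_AE intro!: AE_mp[OF AE_lborel_singleton[of c]])

text \<open>Yields, via Markov's inequality for \<open>exp (- arrival)\<close>, that late arrivals
  are large with overwhelming probability.\<close>

lemma gap_Laplace: "(\<integral>\<^sup>+e. ennreal (exp (-e)) \<partial>gap_measure) = ennreal (1/2)"
proof -
  have "(\<integral>\<^sup>+e. ennreal (exp (-e)) \<partial>gap_measure) = (\<integral>\<^sup>+e. ennreal (exponential_density 1 e) * ennreal (exp (-e)) \<partial>lborel)"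
    unfolding gap_measure_def by (rule nn_integral_density) auto
  also have "\<dots> = (\<integral>\<^sup>+e. ennreal (1/2) * ennreal (exponential_density 2 e) \<partial>lborel)"
  proof (rule nn_integral_cong)
    fix e :: real
    have "ennreal (exponential_density 1 e) * ennreal (exp (-e)) = ennreal (1/2 * exponential_density 2 e)"
      by (auto simp: exponential_density_def ennreal_mult[symmetric] simp flip: exp_add)
    also have "\<dots> = ennreal (1/2) * ennreal (exponential_density 2 e)" by (rule ennreal_mult) (auto simp: exponential_density_def)
    finally show "ennreal (exponential_density 1 e) * ennreal (exp (-e)) = ennreal (1/2) * ennreal (exponential_density 2 e)" .
  qed
  also have "\<dots> = ennreal (1/2) * (\<integral>\<^sup>+e. ennreal (exponential_density 2 e) \<partial>lborel)" by (rule nn_integral_cmult) auto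
  also have "(\<integral>\<^sup>+e. ennreal (exponential_density 2 e) \<partial>lborel) = 1"
    using prob_space.emeasure_space_1[OF prob_space_exponential_density[of 2]] by (simp add: emeasure_density)
  finally show ?thesis by simp
qed

type_synonym 'q clock = "(real \<times> ('q \<Rightarrow> 'q)) stream"

text \<open>
  A tick of the clock is an exponential gap and a random map that moves the regime.  The \<open>n\<close>-th step of
  the chain jumps iff the running gap ends within the next \<open>l\<close> units of time; otherwise the
  remaining gap is again exponential, because the exponential distribution has no memory.
\<close>

primrec chain :: "real \<Rightarrow> nat \<Rightarrow> 'q \<Rightarrow> 'q clock \<Rightarrow> 'q" where
  "chain l 0 q \<omega> = q"
| "chain l (Suc n) q \<omega> = (if fst (shd \<omega>) < l then chain l n (snd (shd \<omega>) q) (stl \<omega>)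
     else chain l n q ((fst (shd \<omega>) - l, snd (shd \<omega>)) ## stl \<omega>))"

text \<open>The jump chain, including fictitious jumps from a state to itself.\<close>

primrec state :: "'q \<Rightarrow> 'q clock \<Rightarrow> nat \<Rightarrow> 'q" where
  "state q \<omega> 0 = q"
| "state q \<omega> (Suc k) = snd (\<omega> !! k) (state q \<omega> k)"

lemma state_shift: "state q \<omega> (Suc k) = state (snd (shd \<omega>) q) (stl \<omega>) k"
  by (induction k) auto

definition arrival :: "'q clock \<Rightarrow> nat \<Rightarrow> real" where
  "arrival \<omega> k = (\<Sum>j<k. fst (\<omega> !! j))"

text \<open>An exponential gap counted in units of \<open>l\<close> and rounded up past the next
  multiple is geometric. For \<open>l = - ln (1 - \<mu>)\<close> a step ends the gap with
  probability \<open>\<mu>\<close>.\<close>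

definition arrival_step :: "real \<Rightarrow> 'q clock \<Rightarrow> nat \<Rightarrow> nat" where
  "arrival_step l \<omega> k = (\<Sum>j<k. nat \<lfloor>fst (\<omega> !! j) / l\<rfloor> + 1)"

lemma arrival_shift: "arrival \<omega> (Suc k) = fst (shd \<omega>) + arrival (stl \<omega>) k"
  unfolding arrival_def by (subst sum.lessThan_Suc_shift) simp

lemma arrival_step_shift: "arrival_step l \<omega> (Suc k) = nat \<lfloor>fst (shd \<omega>) / l\<rfloor> + 1 + arrival_step l (stl \<omega>) k"
  unfolding arrival_step_def by (subst sum.lessThan_Suc_shift) simp

text \<open>Induction over steps for all clocks at once: a step without a jump replaces the clock by
  one with a shortened first gap.\<close>

lemma chain_eq_state:
  assumes l: "0 < l"
  shows "(\<And>j. 0 \<le> fst (\<omega> !! j)) \<Longrightarrow> arrival_step l \<omega> k \<le> n \<Longrightarrow> n < arrival_step l \<omega> (Suc k) \<Longrightarrow>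
    chain l n q \<omega> = state q \<omega> k"
proof (induction n arbitrary: q \<omega> k)
  case 0
  then have "k = 0" by (cases k) (auto simp: arrival_step_shift)
  then show ?case by simp
next
  case (Suc n)
  define e where "e = fst (shd \<omega>)"
  have e0: "0 \<le> e" using Suc.prems(1)[of 0] by (simp add: e_def)
  show ?case
  proof (cases "e < l")
    case True
    then have z: "nat \<lfloor>e / l\<rfloor> = 0" using l e0 by (simp add: floor_less_iff)
    have "k \<noteq> 0" using Suc.prems(3) z by (intro notI) (simp add: arrival_step_shift e_def arrival_step_def)
    then obtain m where m: "k = Suc m" by (cases k) auto
    have "chain l n (snd (shd \<omega>) q) (stl \<omega>) = state (snd (shd \<omega>) q) (stl \<omega>) m"
    proof (rule Suc.IH)
      show "0 \<le> fst (stl \<omega> !! j)" for j using Suc.prems(1)[of "Suc j"] by simp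
    qed (use Suc.prems(2,3) z in \<open>auto simp: m arrival_step_shift[of l \<omega>] e_def\<close>)
    then show ?thesis using True by (simp add: m state_shift e_def del: state.simps(2))
  next
    case False
    let ?\<omega> = "(e - l, snd (shd \<omega>)) ## stl \<omega>"
    have "(e - l) / l = e / l - 1" using l by (simp add: diff_divide_distrib)
    moreover have "1 \<le> e / l" using False l by (simp add: le_divide_eq)
    \<comment> \<open>Shortening the gap by \<open>l\<close> lowers its number of steps by exactly
      one.\<close>
    ultimately have f: "nat \<lfloor>e / l\<rfloor> = Suc (nat \<lfloor>(e - l) / l\<rfloor>)" by simp linarith
    have st: "state q ?\<omega> k = state q \<omega> k" for k
      by (cases k) (auto simp: state_shift simp del: state.simps(2))
    have "chain l n q ?\<omega> = state q ?\<omega> k"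
    proof (rule Suc.IH)
      show "0 \<le> fst (?\<omega> !! j)" for j using Suc.prems(1)[of j] False by (cases j) auto
      show "arrival_step l ?\<omega> k \<le> n"
        using Suc.prems(2) f by (cases k) (auto simp: arrival_step_shift e_def arrival_step_def[of _ _ 0])
      show "n < arrival_step l ?\<omega> (Suc k)"
        using Suc.prems(3) f by (auto simp: arrival_step_shift e_def)
    qed
    then show ?thesis using False st by (simp add: e_def)
  qed
qed

lemma arrival_step_Suc: "arrival_step l \<omega> (Suc k) = arrival_step l \<omega> k + (nat \<lfloor>fst (\<omega> !! k) / l\<rfloor> + 1)"
  by (simp add: arrival_step_def)

lemma arrival_step_jump_times:
  assumes "0 < \<mu>" shows "(\<lambda>k. \<mu> * real (arrival_step l \<omega> k)) \<in> jump_times"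
proof -
  have ge: "k \<le> arrival_step l \<omega> k" for k by (induction k) (auto simp: arrival_step_Suc)
  have "\<exists>k. T < \<mu> * real (arrival_step l \<omega> k)" for T
  proof -
    obtain k where "T / \<mu> < real k" using reals_Archimedean2 by blast
    then have "T < \<mu> * real k" using assms by (simp add: divide_less_eq mult.commute)
    also have "\<dots> \<le> \<mu> * real (arrival_step l \<omega> k)" using ge[of k] assms by simp
    finally show ?thesis by blast
  qed
  then show ?thesis using assms by (auto simp: jump_times_def strict_mono_Suc_iff arrival_step_Suc arrival_step_def[of _ _ 0])
qed

lemma interpolate_chain:
  assumes mu: "0 < \<mu>" and l: "0 < l" and e: "\<And>j. 0 \<le> fst (\<omega> !! j)"
  shows "interpolate \<mu> (\<lambda>n. chain l n q \<omega>) = step_path (\<lambda>k. \<mu> * real (arrival_step l \<omega> k)) (state q \<omega>)"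
proof (rule ext)
  fix t
  show "interpolate \<mu> (\<lambda>n. chain l n q \<omega>) t = step_path (\<lambda>k. \<mu> * real (arrival_step l \<omega> k)) (state q \<omega>) t"
  proof (cases "0 \<le> t")
    case True
    define k where "k = step_index (\<lambda>k. \<mu> * real (arrival_step l \<omega> k)) t"
    have k: "\<mu> * real (arrival_step l \<omega> k) \<le> t" "t < \<mu> * real (arrival_step l \<omega> (Suc k))"
      using step_index_bounds[OF arrival_step_jump_times[OF mu] True, of l \<omega>] by (auto simp: k_def)
    then have "real (arrival_step l \<omega> k) \<le> t / \<mu>" "t / \<mu> < real (arrival_step l \<omega> (Suc k))"
      using mu by (auto simp: le_divide_eq divide_less_eq mult.commute)
    then have "arrival_step l \<omega> k \<le> nat \<lfloor>t / \<mu>\<rfloor>" "nat \<lfloor>t / \<mu>\<rfloor> < arrival_step l \<omega> (Suc k)"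
      using True mu by (auto simp: le_nat_floor nat_less_iff floor_less_iff)
    then have "chain l (nat \<lfloor>t / \<mu>\<rfloor>) q \<omega> = state q \<omega> k" by (rule chain_eq_state[OF l e])
    then show ?thesis using True by (simp add: interpolate_def step_path_def k_def)
  qed (simp add: interpolate_def step_path_def)
qed

text \<open>This value of \<open>l\<close> makes the probability of a gap below \<open>l\<close>
  exactly \<open>\<mu>\<close>, while \<open>\<mu> / l\<close> tends to 1, so discrete and
  continuous time agree asymptotically.\<close>

lemma rate_bounds:
  fixes \<mu> :: real assumes "0 < \<mu>" "\<mu> \<le> 1/2"
  defines "l \<equiv> - ln (1 - \<mu>)"
  shows "\<mu> \<le> l" "l \<le> 2 * \<mu>" "0 < l" "1 - \<mu> \<le> \<mu> / l" "\<mu> / l \<le> 1" "1 - exp (-l) = \<mu>"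
proof -
  have "ln (1 - \<mu>) \<le> - \<mu>" using ln_add_one_self_le_self2[of "-\<mu>"] assms by simp
  then show l1: "\<mu> \<le> l" by (simp add: l_def)
  then show l0: "0 < l" using assms by simp
  have "ln (1 / (1 - \<mu>)) \<le> 1 / (1 - \<mu>) - 1" using assms by (intro ln_le_minus_one) auto
  then have l2: "l \<le> \<mu> / (1 - \<mu>)" using assms by (simp add: l_def ln_div field_simps)
  also have "\<dots> \<le> \<mu> / (1/2)" using assms by (intro divide_left_mono) auto
  finally show "l \<le> 2 * \<mu>" by simp
  show "1 - \<mu> \<le> \<mu> / l" using l2 l0 assms by (simp add: field_simps)
  show "\<mu> / l \<le> 1" using l1 l0 by simp
  show "1 - exp (-l) = \<mu>" using assms by (simp add: l_def)
qed

text \<open>Changing the unit of time shortens a gap by a factor of at least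
  \<open>1 - \<mu>\<close>; rounding adds at most one step.\<close>

lemma gap_step_bounds:
  fixes \<mu> e :: real assumes mu: "0 < \<mu>" "\<mu> \<le> 1/2" and e: "0 \<le> e"
  defines "l \<equiv> - ln (1 - \<mu>)"
  shows "e * (1 - \<mu>) \<le> \<mu> * real (nat \<lfloor>e / l\<rfloor> + 1)" "\<mu> * real (nat \<lfloor>e / l\<rfloor> + 1) \<le> e + \<mu>"
proof -
  have l: "0 < l" "1 - \<mu> \<le> \<mu> / l" "\<mu> / l \<le> 1" using rate_bounds[OF mu] by (auto simp: l_def)
  have f: "e / l \<le> real (nat \<lfloor>e / l\<rfloor> + 1)" "real (nat \<lfloor>e / l\<rfloor> + 1) \<le> e / l + 1"
    using e l(1) by (auto simp: of_nat_nat) linarith+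
  have "e * (1 - \<mu>) \<le> e * (\<mu> / l)" using l(2) e by (intro mult_left_mono) auto
  also have "\<dots> = \<mu> * (e / l)" by simp
  also have "\<dots> \<le> \<mu> * real (nat \<lfloor>e / l\<rfloor> + 1)" using f(1) mu by (intro mult_left_mono) auto
  finally show "e * (1 - \<mu>) \<le> \<mu> * real (nat \<lfloor>e / l\<rfloor> + 1)" .
  have "\<mu> * real (nat \<lfloor>e / l\<rfloor> + 1) \<le> \<mu> * (e / l + 1)" using f(2) mu by (intro mult_left_mono) auto
  also have "\<dots> = e * (\<mu> / l) + \<mu>" by (simp add: algebra_simps)
  also have "\<dots> \<le> e * 1 + \<mu>" using l(3) e by (intro add_mono mult_left_mono) auto
  finally show "\<mu> * real (nat \<lfloor>e / l\<rfloor> + 1) \<le> e + \<mu>" by simp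
qed

lemma arrival_step_bounds:
  fixes \<mu> :: real assumes mu: "0 < \<mu>" "\<mu> \<le> 1/2" and e: "\<And>j. 0 \<le> fst (\<omega> !! j)"
  defines "l \<equiv> - ln (1 - \<mu>)"
  shows "arrival \<omega> k * (1 - \<mu>) \<le> \<mu> * real (arrival_step l \<omega> k)"
    "\<mu> * real (arrival_step l \<omega> k) \<le> arrival \<omega> k + real k * \<mu>"
proof -
  have "arrival \<omega> k * (1 - \<mu>) \<le> \<mu> * real (arrival_step l \<omega> k) \<and> \<mu> * real (arrival_step l \<omega> k) \<le> arrival \<omega> k + real k * \<mu>"
  proof (induction k)
    case (Suc k)
    have "\<mu> * real (arrival_step l \<omega> (Suc k)) = \<mu> * real (arrival_step l \<omega> k) + \<mu> * real (nat \<lfloor>fst (\<omega> !! k) / l\<rfloor> + 1)"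
      by (simp add: arrival_step_Suc algebra_simps)
    moreover have "arrival \<omega> (Suc k) = arrival \<omega> k + fst (\<omega> !! k)" by (simp add: arrival_def)
    ultimately show ?case using Suc gap_step_bounds[OF mu e[of k]] unfolding l_def by (simp add: algebra_simps)
  qed (simp add: arrival_def arrival_step_def)
  then show "arrival \<omega> k * (1 - \<mu>) \<le> \<mu> * real (arrival_step l \<omega> k)"
    "\<mu> * real (arrival_step l \<omega> k) \<le> arrival \<omega> k + real k * \<mu>" by auto
qed

lemma arrival_step_tendsto:
  assumes m: "\<And>n. 0 < m n" "\<And>n. m n \<le> 1/2" "m \<longlonglongrightarrow> (0::real)" and e: "\<And>j. 0 \<le> fst (\<omega> !! j)"
  shows "(\<lambda>n. m n * real (arrival_step (- ln (1 - m n)) \<omega> k)) \<longlonglongrightarrow> arrival \<omega> k"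
proof (rule tendsto_sandwich)
  show "eventually (\<lambda>n. arrival \<omega> k * (1 - m n) \<le> m n * real (arrival_step (- ln (1 - m n)) \<omega> k)) sequentially"
    using arrival_step_bounds(1)[OF m(1,2) e] by (intro always_eventually) blast
  show "eventually (\<lambda>n. m n * real (arrival_step (- ln (1 - m n)) \<omega> k) \<le> arrival \<omega> k + real k * m n) sequentially"
    using arrival_step_bounds(2)[OF m(1,2) e] by (intro always_eventually) blast
  have "(\<lambda>n. arrival \<omega> k * (1 - m n)) \<longlonglongrightarrow> arrival \<omega> k * (1 - 0)" by (intro tendsto_intros m(3))
  then show "(\<lambda>n. arrival \<omega> k * (1 - m n)) \<longlonglongrightarrow> arrival \<omega> k" by simp
  have "(\<lambda>n. arrival \<omega> k + real k * m n) \<longlonglongrightarrow> arrival \<omega> k + real k * 0" by (intro tendsto_intros m(3))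
  then show "(\<lambda>n. arrival \<omega> k + real k * m n) \<longlonglongrightarrow> arrival \<omega> k" by simp
qed

locale uniformization =
  fixes Q :: "real^('q::finite)^'q"
  assumes gen: "irreducible_generator Q" and Q_le: "\<And>i j. \<bar>Q $ i $ j\<bar> \<le> 1"
begin

lemma Q_off: "i \<noteq> j \<Longrightarrow> 0 \<le> Q $ i $ j"
  using gen by (auto simp: irreducible_generator_def)

lemma Q_row: "(\<Sum>j\<in>UNIV. Q $ i $ j) = 0"
  using gen by (auto simp: irreducible_generator_def)

definition trans :: "real \<Rightarrow> 'q \<Rightarrow> 'q \<Rightarrow> real" where
  "trans \<mu> i j = (mat 1 + \<mu> *\<^sub>R Q) $ i $ j"

lemma trans_nonneg: "0 \<le> \<mu> \<Longrightarrow> \<mu> \<le> 1 \<Longrightarrow> 0 \<le> trans \<mu> i j"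
proof (cases "i = j")
  case True
  assume "0 \<le> \<mu>" "\<mu> \<le> 1"
  then have "\<bar>\<mu> * Q $ i $ i\<bar> \<le> 1 * 1" unfolding abs_mult using Q_le[of i i] by (intro mult_mono) auto
  then show ?thesis using True by (simp add: trans_def mat_def abs_le_iff)
qed (simp add: trans_def mat_def Q_off)

lemma trans_row: "(\<Sum>j\<in>UNIV. trans \<mu> i j) = 1"
  by (simp add: trans_def mat_def sum.distrib Q_row flip: sum_distrib_left)

definition jump :: "'q \<Rightarrow> 'q pmf" where "jump i = embed_pmf (trans 1 i)"

lemma pmf_jump: "pmf (jump i) j = trans 1 i j"
  unfolding jump_def
proof (rule pmf_embed_pmf)
  show "(\<integral>\<^sup>+x. ennreal (trans 1 i x) \<partial>count_space UNIV) = 1"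
    by (simp add: nn_integral_count_space_finite sum_ennreal trans_nonneg trans_row)
qed (simp add: trans_nonneg)

text \<open>A mark draws a successor for every state independently. The randomness of a tick thus
  does not depend on the current state, and all ticks can be identically distributed; only the
  component at the current state acts.\<close>

definition mark :: "('q \<Rightarrow> 'q) measure" where
  "mark = measure_pmf (Pi_pmf UNIV undefined jump)"

lemma mark_prob: "emeasure mark {\<phi>. \<phi> i = j} = ennreal (trans 1 i j)"
proof -
  have "emeasure mark {\<phi>. \<phi> i = j} = emeasure (map_pmf (\<lambda>\<phi>. \<phi> i) (Pi_pmf UNIV undefined jump)) {j}"
    by (simp add: mark_def vimage_def)
  also have "\<dots> = ennreal (trans 1 i j)"
    by (subst Pi_pmf_component) (auto simp: emeasure_pmf_single pmf_jump)
  finally show ?thesis .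
qed

lemma prob_space_mark: "prob_space mark" unfolding mark_def by (rule measure_pmf.prob_space_axioms)

lemma mark_sets [simp, measurable_cong]: "sets mark = sets (count_space UNIV)" by (simp add: mark_def)

definition tick :: "(real \<times> ('q \<Rightarrow> 'q)) measure" where "tick = gap_measure \<Otimes>\<^sub>M mark"

lemma tick_sets [measurable_cong]: "sets tick = sets (borel \<Otimes>\<^sub>M count_space UNIV)"
  unfolding tick_def by (rule sets_pair_measure_cong) auto

lemma tick_space [simp]: "space tick = UNIV"
  by (simp add: tick_def space_pair_measure gap_measure_def mark_def)

lemma prob_space_tick: "prob_space tick"
proof -
  interpret G: prob_space gap_measure by (rule prob_space_gap_measure)
  interpret K: prob_space mark by (rule prob_space_mark)
  interpret pair_prob_space gap_measure mark ..
  show ?thesis unfolding tick_def by (rule prob_space_axioms)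
qed

abbreviation clock :: "'q clock measure" where "clock \<equiv> stream_space tick"

lemma prob_space_clock: "prob_space clock"
  by (rule prob_space.prob_space_stream_space[OF prob_space_tick])

lemma clock_space [simp]: "space clock = UNIV"
  by (simp add: space_stream_space)

lemma fst_tick [measurable]: "fst \<in> borel_measurable tick"
  by (simp add: measurable_cong_sets[OF tick_sets refl])

lemma snd_tick [measurable]: "snd \<in> measurable tick (count_space UNIV)"
  by (simp add: measurable_cong_sets[OF tick_sets refl])

lemma apply_mark: "(\<lambda>\<phi>. \<phi> q) \<in> measurable (count_space UNIV) (count_space UNIV)"
  by simp

lemma chain_measurable [measurable]: "chain l n q \<in> measurable clock (count_space UNIV)"
proof (induction n arbitrary: q)
  case 0
  have "chain l 0 q = (\<lambda>_. q)" by auto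
  then show ?case by simp
next
  case (Suc n)
  have [measurable]: "chain l n q \<in> measurable clock (count_space UNIV)" for q by (rule Suc)
  have s: "(\<lambda>\<omega>. snd (shd \<omega>) q) \<in> measurable clock (count_space UNIV)"
    by (rule measurable_compose[OF _ apply_mark]) measurable
  have 1: "(\<lambda>\<omega>. chain l n (snd (shd \<omega>) q) (stl \<omega>)) \<in> measurable clock (count_space UNIV)"
    by (rule measurable_compose_countable[OF _ s]) measurable
  have "(\<lambda>\<omega>. (fst (shd \<omega>) - l, snd (shd \<omega>))) \<in> measurable clock tick"
    unfolding measurable_cong_sets[OF refl tick_sets] by measurable
  then have "(\<lambda>\<omega>. (fst (shd \<omega>) - l, snd (shd \<omega>)) ## stl \<omega>) \<in> measurable clock clock" by measurable
  then have 2: "(\<lambda>\<omega>. chain l n q ((fst (shd \<omega>) - l, snd (shd \<omega>)) ## stl \<omega>)) \<in> measurable clock (count_space UNIV)"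
    by (rule measurable_compose) measurable
  show ?case using 1 2 by simp
qed

lemma nn_integral_tick:
  assumes "g \<in> borel_measurable tick"
  shows "(\<integral>\<^sup>+x. g x \<partial>tick) = (\<integral>\<^sup>+e. \<integral>\<^sup>+\<phi>. g (e, \<phi>) \<partial>mark \<partial>gap_measure)"
proof -
  interpret K: prob_space mark by (rule prob_space_mark)
  show ?thesis using K.nn_integral_fst[of g gap_measure] assms by (simp add: tick_def)
qed

text \<open>Split according to the first step. With probability \<open>\<mu>\<close> the gap ends,
  the mark moves the state by \<open>I + Q\<close> and the rest of the clock is fresh. Otherwise the
  remaining gap is again exponential, and the whole clock is fresh in law.\<close>

lemma chain_law_emeasure:
  assumes l: "0 \<le> l"
  shows "emeasure clock {\<omega>. \<forall>k\<le>n. chain l k (x 0) \<omega> = x k} = ennreal (\<Prod>k<n. trans (1 - exp (-l)) (x k) (x (Suc k)))"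
proof (induction n arbitrary: x)
  case 0
  then show ?case using prob_space.emeasure_space_1[OF prob_space_clock] by simp
next
  case (Suc n)
  interpret T: prob_space tick by (rule prob_space_tick)
  define \<mu> where "\<mu> = 1 - exp (-l)"
  have mu: "0 \<le> \<mu>" "\<mu> \<le> 1" using l by (auto simp: \<mu>_def)
  define q where "q = x 0"
  define x' where "x' k = x (Suc k)" for k
  define A where "A q = {\<omega>. \<forall>k\<le>n. chain l k q \<omega> = x' k}" for q
  have A_meas [measurable]: "A q \<in> sets clock" for q
  proof -
    have "{\<omega>\<in>space clock. \<forall>k\<le>n. chain l k q \<omega> = x' k} \<in> sets clock" by measurable
    then show ?thesis by (simp add: A_def)
  qed
  define E where "E = {\<omega>. \<forall>k\<le>Suc n. chain l k q \<omega> = x k}"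
  have E_meas: "E \<in> sets clock"
  proof -
    have "{\<omega>\<in>space clock. \<forall>k\<le>Suc n. chain l k q \<omega> = x k} \<in> sets clock" by measurable
    then show ?thesis by (simp add: E_def)
  qed
  have split: "(e, \<phi>) ## \<omega> \<in> E \<longleftrightarrow> (if e < l then \<omega> \<in> A (\<phi> q) else (e - l, \<phi>) ## \<omega> \<in> A q)" for e \<phi> \<omega>
  proof -
    have "(\<forall>k\<le>Suc n. P k) \<longleftrightarrow> P 0 \<and> (\<forall>k\<le>n. P (Suc k))" for P
      by (metis Suc_le_mono le0 not0_implies_Suc)
    then have "(e, \<phi>) ## \<omega> \<in> E \<longleftrightarrow> (\<forall>k\<le>n. chain l (Suc k) q ((e, \<phi>) ## \<omega>) = x (Suc k))"
      unfolding E_def by (simp add: q_def del: chain.simps(2))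
    then show ?thesis by (auto simp: A_def x'_def)
  qed
  define p where "p = (\<Prod>k<n. trans \<mu> (x' k) (x' (Suc k)))"
  have p0: "0 \<le> p" unfolding p_def by (intro prod_nonneg) (use mu trans_nonneg in auto)
  have emA: "emeasure clock (A q) = (if q = x' 0 then ennreal p else 0)" for q
  proof (cases "q = x' 0")
    case True
    then show ?thesis using Suc[of x'] by (simp add: A_def p_def \<mu>_def)
  next
    case False
    then have "A q = {}" by (auto simp: A_def)
    then show ?thesis using False by simp
  qed
  interpret C: prob_space clock by (rule prob_space_clock)
  have sec: "(\<lambda>t. emeasure clock {\<omega>\<in>space clock. t ## \<omega> \<in> X}) \<in> borel_measurable tick" if [measurable]: "X \<in> sets clock" for X
    by (rule C.measurable_emeasure) measurable
  \<comment> \<open>The remaining gap is regarded as the first gap of a complete clock, so that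
    \<open>gap_memoryless\<close> returns the probability for that clock.\<close>
  define H where "H t = emeasure clock {\<omega>\<in>space clock. t ## \<omega> \<in> A q}" for t
  define h where "h e = (\<integral>\<^sup>+\<phi>. H (e, \<phi>) \<partial>mark)" for e
  have H_meas: "H \<in> borel_measurable tick" unfolding H_def[abs_def] by (rule sec) measurable
  interpret K: prob_space mark by (rule prob_space_mark)
  have h_meas: "h \<in> borel_measurable borel"
    using K.borel_measurable_nn_integral_fst[of H gap_measure] H_meas unfolding h_def tick_def by simp
  have Ehint: "(\<integral>\<^sup>+e. h e \<partial>gap_measure) = emeasure clock (A q)"
  proof -
    have "(\<integral>\<^sup>+e. h e \<partial>gap_measure) = (\<integral>\<^sup>+t. H t \<partial>tick)" unfolding h_def by (rule nn_integral_tick[OF H_meas, symmetric])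
    also have "\<dots> = emeasure clock (A q)" unfolding H_def by (rule T.emeasure_stream_space[symmetric]) measurable
    finally show ?thesis .
  qed
  define c where "c = ennreal (trans 1 q (x' 0)) * ennreal p"
  have c: "(\<integral>\<^sup>+\<phi>. emeasure clock (A (\<phi> q)) \<partial>mark) = c"
  proof -
    have "(\<integral>\<^sup>+\<phi>. emeasure clock (A (\<phi> q)) \<partial>mark) = (\<integral>\<^sup>+\<phi>. ennreal p * indicator {\<phi>. \<phi> q = x' 0} \<phi> \<partial>mark)"
      by (intro nn_integral_cong) (simp add: emA indicator_def)
    also have "\<dots> = ennreal p * emeasure mark {\<phi>. \<phi> q = x' 0}" by (rule nn_integral_cmult_indicator) simp
    finally show ?thesis by (simp add: mark_prob c_def mult.commute)
  qed
  have inner: "(\<integral>\<^sup>+\<phi>. emeasure clock {\<omega>\<in>space clock. (e, \<phi>) ## \<omega> \<in> E} \<partial>mark) =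
      c * indicator {..<l} e + indicator {l..} e * h (e - l)" for e
    unfolding split by (cases "e < l") (simp_all add: c h_def H_def)
  have "emeasure clock E = (\<integral>\<^sup>+t. emeasure clock {\<omega>\<in>space clock. t ## \<omega> \<in> E} \<partial>tick)"
    by (rule T.emeasure_stream_space[OF E_meas])
  also have "\<dots> = (\<integral>\<^sup>+e. c * indicator {..<l} e + indicator {l..} e * h (e - l) \<partial>gap_measure)"
    unfolding nn_integral_tick[OF sec[OF E_meas]] inner ..
  also have "\<dots> = (\<integral>\<^sup>+e. c * indicator {..<l} e \<partial>gap_measure) + (\<integral>\<^sup>+e. indicator {l..} e * h (e - l) \<partial>gap_measure)"
    by (rule nn_integral_add) (use h_meas in measurable)
  also have "(\<integral>\<^sup>+e. c * indicator {..<l} e \<partial>gap_measure) = c * ennreal \<mu>"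
    using gap_less[OF l] by (subst nn_integral_cmult_indicator) (auto simp: \<mu>_def)
  also have "(\<integral>\<^sup>+e. indicator {l..} e * h (e - l) \<partial>gap_measure) = ennreal (1 - \<mu>) * emeasure clock (A q)"
    using gap_memoryless[OF h_meas l] by (simp add: Ehint \<mu>_def)
  also have "c * ennreal \<mu> + ennreal (1 - \<mu>) * emeasure clock (A q) =
      ennreal (trans 1 q (x' 0) * p * \<mu> + (1 - \<mu>) * (if q = x' 0 then p else 0))"
    using mu p0 trans_nonneg[of 1 q "x' 0"] by (auto simp: c_def emA ennreal_mult ennreal_plus)
  \<comment> \<open>The mixture of \<open>I + Q\<close> with weight \<open>\<mu>\<close> and
    \<open>I\<close> with weight \<open>1 - \<mu>\<close> is \<open>I + \<mu> Q\<close>.\<close>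
  also have "trans 1 q (x' 0) * p * \<mu> + (1 - \<mu>) * (if q = x' 0 then p else 0) = trans \<mu> q (x' 0) * p"
    by (auto simp: trans_def mat_def algebra_simps)
  also have "\<dots> = (\<Prod>k<Suc n. trans \<mu> (x k) (x (Suc k)))"
    unfolding prod.lessThan_Suc_shift p_def x'_def q_def by simp
  finally show ?case by (simp add: E_def q_def \<mu>_def)
qed

lemma chain_law:
  assumes l: "0 \<le> l"
  shows "measure clock {\<omega>. \<forall>k\<le>n. chain l k q \<omega> = x k} =
    (if q = x 0 then (\<Prod>k<n. trans (1 - exp (-l)) (x k) (x (Suc k))) else 0)"
proof (cases "q = x 0")
  case True
  have "0 \<le> (\<Prod>k<n. trans (1 - exp (-l)) (x k) (x (Suc k)))" using l by (intro prod_nonneg) (auto intro: trans_nonneg)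
  then show ?thesis using chain_law_emeasure[OF l, of n x] True by (simp add: measure_def)
next
  case False
  then have "{\<omega>. \<forall>k\<le>n. chain l k q \<omega> = x k} = {}" by auto
  then show ?thesis using False by (simp only: measure_empty if_False)
qed

lemma snth_meas [measurable]: "(\<lambda>\<omega>. fst (\<omega> !! k)) \<in> borel_measurable clock"
  by (rule measurable_compose[OF measurable_snth fst_tick])

lemma arrival_meas [measurable]: "(\<lambda>\<omega>. arrival \<omega> k) \<in> borel_measurable clock"
  unfolding arrival_def by measurable

lemma state_meas [measurable]: "(\<lambda>\<omega>. state q \<omega> k) \<in> measurable clock (count_space UNIV)"
proof (induction k)
  case (Suc k)
  have [measurable]: "(\<lambda>\<omega>. snd (\<omega> !! k)) \<in> measurable clock (count_space UNIV)"
    by (rule measurable_compose[OF measurable_snth snd_tick])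
  have "(\<lambda>\<omega>. snd (\<omega> !! k) i) \<in> measurable clock (count_space UNIV)" for i
    by (rule measurable_compose[OF _ apply_mark]) measurable
  then show ?case using measurable_compose_countable[OF _ Suc, of "\<lambda>i \<omega>. snd (\<omega> !! k) i"] by simp
qed simp

lemma gap_law: "B \<in> sets borel \<Longrightarrow> emeasure clock {\<omega>. fst (\<omega> !! k) \<in> B} = emeasure gap_measure B"
proof (induction k)
  assume [measurable]: "B \<in> sets borel"
  interpret T: prob_space tick by (rule prob_space_tick)
  interpret C: prob_space clock by (rule prob_space_clock)
  interpret K: prob_space mark by (rule prob_space_mark)
  have X: "{\<omega>. fst (\<omega> !! k) \<in> B} \<in> sets clock" for k
  proof -
    have "{\<omega>\<in>space clock. fst (\<omega> !! k) \<in> B} \<in> sets clock" by measurable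
    then show ?thesis by simp
  qed
  case 0
  have "emeasure clock {\<omega>. fst (\<omega> !! 0) \<in> B} = (\<integral>\<^sup>+t. emeasure clock {\<omega>\<in>space clock. t ## \<omega> \<in> {\<omega>. fst (\<omega> !! 0) \<in> B}} \<partial>tick)"
    by (rule T.emeasure_stream_space[OF X])
  also have "\<dots> = (\<integral>\<^sup>+t. indicator B (fst t) \<partial>tick)"
    using C.emeasure_space_1 by (intro nn_integral_cong) (auto simp: indicator_def)
  also have "\<dots> = (\<integral>\<^sup>+e. \<integral>\<^sup>+\<phi>. indicator B e \<partial>mark \<partial>gap_measure)"
    by (subst nn_integral_tick) auto
  also have "\<dots> = emeasure gap_measure B" by (simp add: K.emeasure_space_1)
  finally show ?case .
next
  case (Suc k)
  interpret T: prob_space tick by (rule prob_space_tick)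
  have X: "{\<omega>. fst (\<omega> !! Suc k) \<in> B} \<in> sets clock"
  proof -
    note Suc.prems[measurable]
    have "{\<omega>\<in>space clock. fst (\<omega> !! Suc k) \<in> B} \<in> sets clock" by measurable
    then show ?thesis by simp
  qed
  have "emeasure clock {\<omega>. fst (\<omega> !! Suc k) \<in> B} = (\<integral>\<^sup>+t. emeasure clock {\<omega>\<in>space clock. t ## \<omega> \<in> {\<omega>. fst (\<omega> !! Suc k) \<in> B}} \<partial>tick)"
    by (rule T.emeasure_stream_space[OF X])
  also have "\<dots> = emeasure gap_measure B" using Suc T.emeasure_space_1 by simp
  finally show ?case .
qed

lemma arrival_Laplace: "(\<integral>\<^sup>+\<omega>. ennreal (exp (- arrival \<omega> k)) \<partial>clock) = ennreal ((1/2)^k)"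
proof (induction k)
  case 0
  then show ?case using prob_space.emeasure_space_1[OF prob_space_clock] by (simp add: arrival_def)
next
  case (Suc k)
  interpret T: prob_space tick by (rule prob_space_tick)
  interpret K: prob_space mark by (rule prob_space_mark)
  have "(\<integral>\<^sup>+\<omega>. ennreal (exp (- arrival \<omega> (Suc k))) \<partial>clock) =
     (\<integral>\<^sup>+t. \<integral>\<^sup>+\<omega>. ennreal (exp (- arrival (t ## \<omega>) (Suc k))) \<partial>clock \<partial>tick)"
    by (rule T.nn_integral_stream_space) measurable
  also have "\<dots> = (\<integral>\<^sup>+t. \<integral>\<^sup>+\<omega>. ennreal (exp (- fst t)) * ennreal (exp (- arrival \<omega> k)) \<partial>clock \<partial>tick)"
    by (simp add: arrival_shift ennreal_mult[symmetric] flip: exp_add)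
  also have "\<dots> = (\<integral>\<^sup>+t. ennreal (exp (- fst t)) * ennreal ((1/2)^k) \<partial>tick)"
    by (subst nn_integral_cmult) (auto simp: Suc)
  also have "\<dots> = (\<integral>\<^sup>+t. ennreal (exp (- fst t)) \<partial>tick) * ennreal ((1/2)^k)"
    by (rule nn_integral_multc) measurable
  also have "(\<integral>\<^sup>+t. ennreal (exp (- fst t)) \<partial>tick) = ennreal (1/2)"
    by (subst nn_integral_tick) (auto simp: K.emeasure_space_1 gap_Laplace)
  finally show ?case by (simp only: ennreal_mult[symmetric] power_Suc zero_le_divide_1_iff zero_le_power)
qed

text \<open>Integrating over the first gap before the rest of the clock, one meets the probability
  of a single point under a law with a density.\<close>

lemma arrival_ne: "0 < k \<Longrightarrow> AE \<omega> in clock. arrival \<omega> k \<noteq> t"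
proof -
  assume "0 < k"
  then obtain m where m: "k = Suc m" by (cases k) auto
  interpret T: prob_space tick by (rule prob_space_tick)
  interpret C: prob_space clock by (rule prob_space_clock)
  interpret K: prob_space mark by (rule prob_space_mark)
  interpret TC: pair_sigma_finite tick clock ..
  have zero: "(\<integral>\<^sup>+x. indicator {t} (fst x + a) \<partial>tick) = 0" for a
  proof -
    have "(\<integral>\<^sup>+x. indicator {t} (fst x + a) \<partial>tick) = (\<integral>\<^sup>+e. \<integral>\<^sup>+\<phi>. indicator {t} (e + a) \<partial>mark \<partial>gap_measure)"
      by (subst nn_integral_tick) auto
    also have "\<dots> = (\<integral>\<^sup>+e. indicator {t - a} e \<partial>gap_measure)"
      by (intro nn_integral_cong) (auto simp: K.emeasure_space_1 indicator_def)
    also have "\<dots> = 0" using gap_point by simp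
    finally show ?thesis .
  qed
  have "(\<integral>\<^sup>+\<omega>. indicator {t} (arrival \<omega> k) \<partial>clock) = (\<integral>\<^sup>+x. \<integral>\<^sup>+\<omega>. indicator {t} (arrival (x ## \<omega>) k) \<partial>clock \<partial>tick)"
    by (rule T.nn_integral_stream_space) measurable
  also have "\<dots> = (\<integral>\<^sup>+x. \<integral>\<^sup>+\<omega>. indicator {t} (fst x + arrival \<omega> m) \<partial>clock \<partial>tick)"
    by (simp add: m arrival_shift)
  also have "\<dots> = (\<integral>\<^sup>+\<omega>. \<integral>\<^sup>+x. indicator {t} (fst x + arrival \<omega> m) \<partial>tick \<partial>clock)"
    by (rule TC.Fubini'[symmetric]) measurable
  also have "\<dots> = 0" by (simp add: zero)
  finally have "AE \<omega> in clock. indicator {t} (arrival \<omega> k) = (0::ennreal)"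
    by (subst (asm) nn_integral_0_iff_AE) auto
  then show ?thesis by eventually_elim (auto simp: indicator_def split: if_splits)
qed

end

section \<open>The regime process in the limit\<close>

text \<open>Suited to path properties whose measurability is not at hand: measurable subsets of
  probability near 1 are enough.\<close>

lemma (in prob_space) AE_from_large_sets:
  assumes "\<And>\<eta>. 0 < \<eta> \<Longrightarrow> \<exists>E\<in>events. 1 - \<eta> \<le> prob E \<and> (\<forall>\<omega>\<in>E. P \<omega>)"
  shows "AE \<omega> in M. P \<omega>"
proof -
  have "\<exists>E\<in>events. 1 - inverse (real (Suc n)) \<le> prob E \<and> (\<forall>\<omega>\<in>E. P \<omega>)" for n by (rule assms) simp
  then obtain E where E: "\<And>n. E n \<in> events" "\<And>n. 1 - inverse (real (Suc n)) \<le> prob (E n)" "\<And>n \<omega>. \<omega> \<in> E n \<Longrightarrow> P \<omega>"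
    by metis
  have U: "(\<Union>n. E n) \<in> events" using E(1) by auto
  have "1 - inverse (real (Suc n)) \<le> prob (\<Union>n. E n)" for n
    using E(2)[of n] finite_measure_mono[of "E n" "\<Union>n. E n"] U by (meson UN_upper UNIV_I order_trans)
  then have "1 \<le> prob (\<Union>n. E n)"
    using LIMSEQ_le_const2[OF LIMSEQ_inverse_real_of_nat_add_minus[of 1], of "prob (\<Union>n. E n)"] by auto
  then have "prob (\<Union>n. E n) = 1" using prob_le_1[of "\<Union>n. E n"] by linarith
  then have "AE \<omega> in M. \<omega> \<in> (\<Union>n. E n)" using U prob_eq_1 by blast
  then show ?thesis by eventually_elim (use E(3) in blast)
qed

context uniformization
begin

text \<open>The last condition is needed because small gaps may be summable.\<close>

definition good_clock :: "(nat \<Rightarrow> real) \<Rightarrow> (nat \<Rightarrow> real) \<Rightarrow> (nat \<Rightarrow> nat) \<Rightarrow> 'q clock set" where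
  "good_clock d A K = {\<omega>. (\<forall>k. d k \<le> fst (\<omega> !! k) \<and> fst (\<omega> !! k) \<le> A k) \<and> (\<forall>m. real m \<le> arrival \<omega> (K m))}"

lemma good_clock_measurable: "good_clock d A K \<in> sets clock"
proof -
  have "{\<omega>\<in>space clock. (\<forall>k. d k \<le> fst (\<omega> !! k) \<and> fst (\<omega> !! k) \<le> A k) \<and> (\<forall>m. real m \<le> arrival \<omega> (K m))} \<in> sets clock"
    by measurable
  then show ?thesis by (simp add: good_clock_def)
qed

text \<open>Three families of bad events, namely too short gaps, too long gaps and too small
  arrivals, are each given probability at most \<open>h k\<close>. Their total is summable with sum
  at most \<open>\<eta>\<close>.\<close>

lemma good_clock_exists:
  assumes eta: "0 < \<eta>"
  shows "\<exists>d A K. (\<forall>k. 0 < d k) \<and> 1 - \<eta> \<le> measure clock (good_clock d A K)"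
proof -
  interpret C: prob_space clock by (rule prob_space_clock)
  interpret G: prob_space gap_measure by (rule prob_space_gap_measure)
  define h where "h k = \<eta> / 3 * (1/2)^(Suc k)" for k :: nat
  have h: "0 < h k" for k using eta by (simp add: h_def)
  define A where "A k = max 0 (- ln (h k))" for k
  have A: "exp (- A k) \<le> h k" "0 \<le> A k" for k using h[of k] unfolding A_def
    by (auto simp: max_def)
  \<comment> \<open>By Markov's inequality for \<open>exp (- arrival)\<close>, this expression
    bounds the probability that the \<open>K\<close>-th arrival is at most \<open>m\<close>.\<close>
  have "\<exists>K. exp (real m) * (1/2)^K \<le> h m" for m
  proof -
    obtain K where "(1/2)^K < h m / exp (real m)" using real_arch_pow_inv[of "h m / exp (real m)" "1/2"] h[of m] by auto
    then show ?thesis by (intro exI[of _ K]) (simp add: field_simps)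
  qed
  then obtain K where K: "\<And>m. exp (real m) * (1/2)^(K m) \<le> h m" by metis
  let ?X = "\<lambda>k. {\<omega> :: 'q clock. fst (\<omega> !! k) \<in> {..<h k}}" and ?Y = "\<lambda>k. {\<omega> :: 'q clock. fst (\<omega> !! k) \<in> {A k..}}"
    and ?Z = "\<lambda>m. {\<omega> :: 'q clock. arrival \<omega> (K m) \<le> real m}"
  have sets: "?X k \<in> sets clock" "?Y k \<in> sets clock" "?Z k \<in> sets clock" for k
  proof -
    have "{\<omega>\<in>space clock. fst (\<omega> !! k) \<in> {..<h k}} \<in> sets clock" "{\<omega>\<in>space clock. fst (\<omega> !! k) \<in> {A k..}} \<in> sets clock"
      "{\<omega>\<in>space clock. arrival \<omega> (K k) \<le> real k} \<in> sets clock" by measurable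
    then show "?X k \<in> sets clock" "?Y k \<in> sets clock" "?Z k \<in> sets clock" by simp_all
  qed
  have X: "measure clock (?X k) \<le> h k" for k
  proof -
    have "emeasure clock (?X k) = ennreal (1 - exp (- h k))" using gap_law[of "{..<h k}"] gap_less[of "h k"] h[of k] by simp
    then have "measure clock (?X k) = 1 - exp (- h k)" using h[of k] by (simp add: measure_def)
    then show ?thesis using exp_minus_bounds(1)[of "h k"] h[of k] by simp
  qed
  have Y: "measure clock (?Y k) \<le> h k" for k
  proof -
    have "emeasure clock (?Y k) = ennreal (exp (- A k))" using gap_law[of "{A k..}"] gap_ge[OF A(2)] by simp
    then have "measure clock (?Y k) = exp (- A k)" by (simp add: measure_def)
    then show ?thesis using A(1) by simp
  qed
  have Z: "measure clock (?Z m) \<le> h m" for m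
  proof -
    have "emeasure clock (?Z m) = (\<integral>\<^sup>+\<omega>. indicator (?Z m) \<omega> \<partial>clock)" using sets by simp
    also have "\<dots> \<le> (\<integral>\<^sup>+\<omega>. ennreal (exp (real m)) * ennreal (exp (- arrival \<omega> (K m))) \<partial>clock)"
      by (intro nn_integral_mono) (auto simp: indicator_def ennreal_mult[symmetric] simp flip: exp_add ennreal_1 intro!: ennreal_leI)
    also have "\<dots> = ennreal (exp (real m) * (1/2)^(K m))"
      by (subst nn_integral_cmult) (auto simp: arrival_Laplace ennreal_mult)
    finally have "measure clock (?Z m) \<le> exp (real m) * (1/2)^(K m)" by (simp add: C.emeasure_eq_measure)
    then show ?thesis using K[of m] by linarith
  qed
  define B where "B k = (?X k \<union> ?Y k) \<union> ?Z k" for k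
  have B: "measure clock (B k) \<le> \<eta> * (1/2)^(Suc k)" for k
    using measure_Un_le[of "?X k \<union> ?Y k" clock "?Z k"] measure_Un_le[of "?X k" clock "?Y k"] sets X[of k] Y[of k] Z[of k]
    unfolding B_def h_def by fastforce
  have sB: "summable (\<lambda>k. \<eta> * (1/2)^(Suc k))" "(\<Sum>k. \<eta> * (1/2)^(Suc k)) = \<eta>"
    using sums_mult[OF power_half_series, of \<eta>] by (auto simp: sums_iff)
  have Bs: "range B \<subseteq> sets clock" using sets by (auto simp: B_def)
  have sm: "summable (\<lambda>k. measure clock (B k))"
    by (rule summable_comparison_test'[OF sB(1)]) (use B in simp)
  have "measure clock (\<Union>k. B k) \<le> (\<Sum>k. measure clock (B k))" by (rule C.finite_measure_subadditive_countably[OF Bs sm])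
  also have "\<dots> \<le> \<eta>" using suminf_le[OF B sm sB(1)] sB(2) by simp
  finally have UB: "measure clock (\<Union>k. B k) \<le> \<eta>" .
  have "1 - \<eta> \<le> measure clock (space clock - (\<Union>k. B k))" using UB Bs by (subst C.prob_compl) auto
  also have "\<dots> \<le> measure clock (good_clock h A K)"
    by (rule C.finite_measure_mono[OF _ good_clock_measurable]) (auto simp: B_def good_clock_def not_le not_less less_imp_le)
  finally show ?thesis using h by blast
qed

lemma clock_AE: "AE \<omega> in clock. (\<forall>k. 0 < fst (\<omega> !! k)) \<and> (\<forall>T. \<exists>k. T < arrival \<omega> k)"
proof (rule prob_space.AE_from_large_sets[OF prob_space_clock])
  fix \<eta> :: real assume "0 < \<eta>"
  then obtain d A K where *: "\<forall>k. 0 < d k" "1 - \<eta> \<le> measure clock (good_clock d A K)" using good_clock_exists by blast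
  have "(\<forall>k. 0 < fst (\<omega> !! k)) \<and> (\<forall>T. \<exists>k. T < arrival \<omega> k)" if w: "\<omega> \<in> good_clock d A K" for \<omega>
  proof (intro conjI allI)
    show "0 < fst (\<omega> !! k)" for k using w * unfolding good_clock_def by (metis (mono_tags, lifting) less_le_trans mem_Collect_eq)
    fix T :: real
    obtain m where "T < real m" using reals_Archimedean2 by blast
    moreover have "real m \<le> arrival \<omega> (K m)" using w by (simp add: good_clock_def)
    ultimately show "\<exists>k. T < arrival \<omega> k" by (meson less_le_trans)
  qed
  then show "\<exists>E\<in>sets clock. 1 - \<eta> \<le> measure clock E \<and> (\<forall>\<omega>\<in>E. (\<forall>k. 0 < fst (\<omega> !! k)) \<and> (\<forall>T. \<exists>k. T < arrival \<omega> k))"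
    using * good_clock_measurable by blast
qed

end

lemma arrival_jump_times:
  assumes "\<And>k. 0 < fst (\<omega> !! k)" "\<And>T. \<exists>k. T < arrival \<omega> k" shows "arrival \<omega> \<in> jump_times"
  using assms by (auto simp: jump_times_def strict_mono_Suc_iff arrival_def)

section \<open>Finite-dimensional laws of the regime chain\<close>

definition mat_pow :: "real^'q::finite^'q \<Rightarrow> nat \<Rightarrow> real^'q^'q" where
  "mat_pow P d = ((\<lambda>B. P ** B) ^^ d) (mat 1)"

lemma mat_pow_0: "mat_pow P 0 = mat 1" and mat_pow_Suc: "mat_pow P (Suc d) = P ** mat_pow P d"
  by (auto simp: mat_pow_def)

lemma mat_pow_commute: "P ** mat_pow P d = mat_pow P d ** P"
  by (induction d) (auto simp: mat_pow_0 mat_pow_Suc matrix_mul_assoc)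

lemma mat_pow_Suc_right: "mat_pow P (Suc d) $ i $ j = (\<Sum>m\<in>UNIV. mat_pow P d $ i $ m * P $ m $ j)"
  unfolding mat_pow_Suc mat_pow_commute by (simp add: matrix_matrix_mult_def)

locale regime_chain = prob_space M for M :: "'a measure" +
  fixes \<pi> :: "'q::finite \<Rightarrow> real" and P :: "real^'q^'q" and \<theta> :: "nat \<Rightarrow> 'a \<Rightarrow> 'q"
  assumes mc: "markov_chain M \<pi> P \<theta>"
begin

lemma theta_meas [measurable]: "\<theta> n \<in> measurable M (count_space UNIV)"
  using mc by (simp add: markov_chain_def)

lemma cylinder: "prob {\<omega>\<in>space M. \<forall>k\<le>n. \<theta> k \<omega> = x k} = \<pi> (x 0) * (\<Prod>k<n. P $ x k $ x (Suc k))"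
  using mc by (simp add: markov_chain_def)

lemma cylinder_Suc:
  "prob {\<omega>\<in>space M. (\<forall>k\<le>n. \<theta> k \<omega> = x k) \<and> \<theta> (Suc n) \<omega> = j} =
   prob {\<omega>\<in>space M. \<forall>k\<le>n. \<theta> k \<omega> = x k} * P $ x n $ j"
proof -
  define x' where "x' = x(Suc n := j)"
  have "{\<omega>\<in>space M. (\<forall>k\<le>n. \<theta> k \<omega> = x k) \<and> \<theta> (Suc n) \<omega> = j} = {\<omega>\<in>space M. \<forall>k\<le>Suc n. \<theta> k \<omega> = x' k}"
    by (auto simp: x'_def le_Suc_eq)
  then show ?thesis by (simp add: cylinder) (simp add: x'_def)
qed

text \<open>An event that depends on the first \<open>n + 1\<close> states is a finite disjoint
  union of cylinders. This lifts product formulas for cylinders to the Markov property for general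
  past events.\<close>

lemma past_sum:
  assumes dep: "\<And>x y. (\<And>k. k \<le> n \<Longrightarrow> x k = y k) \<Longrightarrow> A x = A y" and [measurable]: "Z \<in> events"
  shows "prob {\<omega>\<in>space M. A (\<lambda>k. \<theta> k \<omega>) \<and> \<omega> \<in> Z} =
    (\<Sum>x\<in>{x \<in> {..n} \<rightarrow>\<^sub>E UNIV. A x}. prob {\<omega>\<in>space M. (\<forall>k\<le>n. \<theta> k \<omega> = x k) \<and> \<omega> \<in> Z})"
proof -
  let ?I = "{x \<in> {..n} \<rightarrow>\<^sub>E (UNIV :: 'q set). A x}"
  let ?C = "\<lambda>x. {\<omega>\<in>space M. (\<forall>k\<le>n. \<theta> k \<omega> = x k) \<and> \<omega> \<in> Z}"
  have fin: "finite ?I" by (simp add: finite_PiE)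
  have "{\<omega>\<in>space M. A (\<lambda>k. \<theta> k \<omega>) \<and> \<omega> \<in> Z} = (\<Union>x\<in>?I. ?C x)"
  proof (intro equalityI subsetI)
    fix \<omega> assume w: "\<omega> \<in> {\<omega>\<in>space M. A (\<lambda>k. \<theta> k \<omega>) \<and> \<omega> \<in> Z}"
    define x where "x = (\<lambda>k\<in>{..n}. \<theta> k \<omega>)"
    have "A x" using w dep[of x "\<lambda>k. \<theta> k \<omega>"] by (simp add: x_def)
    then show "\<omega> \<in> (\<Union>x\<in>?I. ?C x)" using w by (intro UN_I[of x]) (auto simp: x_def)
  next
    fix \<omega> assume "\<omega> \<in> (\<Union>x\<in>?I. ?C x)"
    then obtain x where x: "A x" "\<omega> \<in> space M" "\<forall>k\<le>n. \<theta> k \<omega> = x k" "\<omega> \<in> Z" by auto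
    then have "A (\<lambda>k. \<theta> k \<omega>)" using dep[of "\<lambda>k. \<theta> k \<omega>" x] by simp
    then show "\<omega> \<in> {\<omega>\<in>space M. A (\<lambda>k. \<theta> k \<omega>) \<and> \<omega> \<in> Z}" using x by simp
  qed
  moreover have "prob (\<Union>x\<in>?I. ?C x) = (\<Sum>x\<in>?I. prob (?C x))"
  proof (rule finite_measure_finite_Union[OF fin])
    show "?C ` ?I \<subseteq> events" by auto
    show "disjoint_family_on ?C ?I"
      unfolding disjoint_family_on_def
    proof (intro ballI impI)
      fix x y assume "x \<in> ?I" "y \<in> ?I" "x \<noteq> y"
      then obtain k where "k \<le> n" "x k \<noteq> y k" by (metis (no_types, lifting) PiE_ext atMost_iff mem_Collect_eq)
      then show "?C x \<inter> ?C y = {}" by auto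
    qed
  qed
  ultimately show ?thesis by simp
qed

lemma markov_step:
  assumes dep: "\<And>x y. (\<And>k. k \<le> n \<Longrightarrow> x k = y k) \<Longrightarrow> A x = A y"
  shows "prob {\<omega>\<in>space M. A (\<lambda>k. \<theta> k \<omega>) \<and> \<theta> n \<omega> = i \<and> \<theta> (Suc n) \<omega> = j} =
    prob {\<omega>\<in>space M. A (\<lambda>k. \<theta> k \<omega>) \<and> \<theta> n \<omega> = i} * P $ i $ j"
proof -
  let ?A = "\<lambda>x. A x \<and> x n = i"
  have dep': "?A x = ?A y" if "\<And>k. k \<le> n \<Longrightarrow> x k = y k" for x y using dep[OF that] that[of n] by auto
  have "prob {\<omega>\<in>space M. ?A (\<lambda>k. \<theta> k \<omega>) \<and> \<omega> \<in> {\<omega>\<in>space M. \<theta> (Suc n) \<omega> = j}} =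
    (\<Sum>x\<in>{x \<in> {..n} \<rightarrow>\<^sub>E UNIV. ?A x}. prob {\<omega>\<in>space M. (\<forall>k\<le>n. \<theta> k \<omega> = x k) \<and> \<omega> \<in> {\<omega>\<in>space M. \<theta> (Suc n) \<omega> = j}})"
    by (rule past_sum[OF dep']) measurable
  also have "\<dots> = (\<Sum>x\<in>{x \<in> {..n} \<rightarrow>\<^sub>E UNIV. ?A x}. prob {\<omega>\<in>space M. (\<forall>k\<le>n. \<theta> k \<omega> = x k) \<and> \<omega> \<in> space M} * P $ i $ j)"
  proof (rule sum.cong[OF refl])
    fix x assume "x \<in> {x \<in> {..n} \<rightarrow>\<^sub>E UNIV. ?A x}"
    then have "x n = i" by simp
    moreover have "{\<omega>\<in>space M. (\<forall>k\<le>n. \<theta> k \<omega> = x k) \<and> \<omega> \<in> {\<omega>\<in>space M. \<theta> (Suc n) \<omega> = j}} =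
      {\<omega>\<in>space M. (\<forall>k\<le>n. \<theta> k \<omega> = x k) \<and> \<theta> (Suc n) \<omega> = j}" by auto
    moreover have "{\<omega>\<in>space M. (\<forall>k\<le>n. \<theta> k \<omega> = x k) \<and> \<omega> \<in> space M} = {\<omega>\<in>space M. \<forall>k\<le>n. \<theta> k \<omega> = x k}" by auto
    ultimately show "prob {\<omega>\<in>space M. (\<forall>k\<le>n. \<theta> k \<omega> = x k) \<and> \<omega> \<in> {\<omega>\<in>space M. \<theta> (Suc n) \<omega> = j}} =
      prob {\<omega>\<in>space M. (\<forall>k\<le>n. \<theta> k \<omega> = x k) \<and> \<omega> \<in> space M} * P $ i $ j" using cylinder_Suc[of n x j] by simp
  qed
  also have "\<dots> = prob {\<omega>\<in>space M. ?A (\<lambda>k. \<theta> k \<omega>) \<and> \<omega> \<in> space M} * P $ i $ j"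
    unfolding sum_distrib_right[symmetric] by (subst past_sum[OF dep']) auto
  finally show ?thesis by (simp add: conj_ac cong: conj_cong)
qed

lemma markov_iterate:
  assumes dep: "\<And>x y. (\<And>k. k \<le> n \<Longrightarrow> x k = y k) \<Longrightarrow> A x = A y"
  shows "prob {\<omega>\<in>space M. A (\<lambda>k. \<theta> k \<omega>) \<and> \<theta> n \<omega> = i \<and> \<theta> (n + d) \<omega> = j} =
    prob {\<omega>\<in>space M. A (\<lambda>k. \<theta> k \<omega>) \<and> \<theta> n \<omega> = i} * mat_pow P d $ i $ j"
proof (induction d arbitrary: j)
  case 0
  have "{\<omega>\<in>space M. A (\<lambda>k. \<theta> k \<omega>) \<and> \<theta> n \<omega> = i \<and> \<theta> (n + 0) \<omega> = j} =
    (if i = j then {\<omega>\<in>space M. A (\<lambda>k. \<theta> k \<omega>) \<and> \<theta> n \<omega> = i} else {})" by auto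
  then show ?case by (simp only: mat_pow_0) (simp add: mat_def)
next
  case (Suc d)
  let ?A = "\<lambda>x. A x \<and> x n = i"
  let ?S = "\<lambda>m. {\<omega>\<in>space M. ?A (\<lambda>k. \<theta> k \<omega>) \<and> \<theta> (n + d) \<omega> = m \<and> \<theta> (Suc (n + d)) \<omega> = j}"
  have dep': "?A x = ?A y" if "\<And>k. k \<le> n + d \<Longrightarrow> x k = y k" for x y using dep[of x y] that by auto
  have A_meas: "{\<omega>\<in>space M. ?A (\<lambda>k. \<theta> k \<omega>)} \<in> events"
  proof -
    have "{\<omega>\<in>space M. ?A (\<lambda>k. \<theta> k \<omega>)} = (\<Union>x\<in>{x \<in> {..n} \<rightarrow>\<^sub>E UNIV. ?A x}. {\<omega>\<in>space M. \<forall>k\<le>n. \<theta> k \<omega> = x k})"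
    proof (intro equalityI subsetI)
      fix \<omega> assume w: "\<omega> \<in> {\<omega>\<in>space M. ?A (\<lambda>k. \<theta> k \<omega>)}"
      have "?A (\<lambda>k\<in>{..n}. \<theta> k \<omega>)" using w dep[of "\<lambda>k\<in>{..n}. \<theta> k \<omega>" "\<lambda>k. \<theta> k \<omega>"] by simp
      then show "\<omega> \<in> (\<Union>x\<in>{x \<in> {..n} \<rightarrow>\<^sub>E UNIV. ?A x}. {\<omega>\<in>space M. \<forall>k\<le>n. \<theta> k \<omega> = x k})"
        using w by (intro UN_I[of "\<lambda>k\<in>{..n}. \<theta> k \<omega>"]) auto
    next
      fix \<omega> assume "\<omega> \<in> (\<Union>x\<in>{x \<in> {..n} \<rightarrow>\<^sub>E UNIV. ?A x}. {\<omega>\<in>space M. \<forall>k\<le>n. \<theta> k \<omega> = x k})"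
      then obtain x where "?A x" "\<omega> \<in> space M" "\<forall>k\<le>n. \<theta> k \<omega> = x k" by auto
      then show "\<omega> \<in> {\<omega>\<in>space M. ?A (\<lambda>k. \<theta> k \<omega>)}" using dep[of "\<lambda>k. \<theta> k \<omega>" x] by simp
    qed
    also have "\<dots> \<in> events" by (intro sets.finite_UN) (auto simp: finite_PiE)
    finally show ?thesis .
  qed
  have S_meas: "?S m \<in> events" for m
  proof -
    have "?S m = {\<omega>\<in>space M. ?A (\<lambda>k. \<theta> k \<omega>)} \<inter> {\<omega>\<in>space M. \<theta> (n + d) \<omega> = m \<and> \<theta> (Suc (n + d)) \<omega> = j}" by auto
    also have "\<dots> \<in> events" using A_meas by (rule sets.Int) measurable
    finally show ?thesis .
  qed
  have "{\<omega>\<in>space M. A (\<lambda>k. \<theta> k \<omega>) \<and> \<theta> n \<omega> = i \<and> \<theta> (n + Suc d) \<omega> = j} = (\<Union>m\<in>UNIV. ?S m)" by auto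
  then have "prob {\<omega>\<in>space M. A (\<lambda>k. \<theta> k \<omega>) \<and> \<theta> n \<omega> = i \<and> \<theta> (n + Suc d) \<omega> = j} = prob (\<Union>m\<in>UNIV. ?S m)" by simp
  also have "\<dots> = (\<Sum>m\<in>UNIV. prob (?S m))"
    by (rule finite_measure_finite_Union) (use S_meas in \<open>auto simp: disjoint_family_on_def\<close>)
  also have "\<dots> = (\<Sum>m\<in>UNIV. prob {\<omega>\<in>space M. ?A (\<lambda>k. \<theta> k \<omega>) \<and> \<theta> (n + d) \<omega> = m} * P $ m $ j)"
    by (intro sum.cong refl markov_step[OF dep'])
  also have "\<dots> = prob {\<omega>\<in>space M. A (\<lambda>k. \<theta> k \<omega>) \<and> \<theta> n \<omega> = i} * mat_pow P (Suc d) $ i $ j"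
    using Suc by (simp add: mat_pow_Suc_right sum_distrib_left mult.assoc)
  finally show ?case .
qed

text \<open>Equal consecutive times are allowed, the zeroth matrix power being the identity. This
  occurs when nearby times fall into the same mesh cell.\<close>

lemma marginals:
  assumes m: "incseq m"
  shows "prob {\<omega>\<in>space M. \<forall>k\<le>n. \<theta> (m k) \<omega> = x k} =
    prob {\<omega>\<in>space M. \<theta> (m 0) \<omega> = x 0} * (\<Prod>k<n. mat_pow P (m (Suc k) - m k) $ x k $ x (Suc k))"
proof (induction n)
  case (Suc n)
  have mm: "m k \<le> m n" if "k \<le> n" for k using m that by (simp add: incseq_def)
  have mS: "m n + (m (Suc n) - m n) = m (Suc n)" using m by (simp add: incseq_SucD)
  let ?A = "\<lambda>y. \<forall>k\<le>n. y (m k) = x k"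
  have e1: "{\<omega>\<in>space M. \<forall>k\<le>Suc n. \<theta> (m k) \<omega> = x k} =
    {\<omega>\<in>space M. ?A (\<lambda>k. \<theta> k \<omega>) \<and> \<theta> (m n) \<omega> = x n \<and> \<theta> (m n + (m (Suc n) - m n)) \<omega> = x (Suc n)}"
    unfolding mS by (auto simp: le_Suc_eq)
  have e2: "{\<omega>\<in>space M. ?A (\<lambda>k. \<theta> k \<omega>) \<and> \<theta> (m n) \<omega> = x n} = {\<omega>\<in>space M. \<forall>k\<le>n. \<theta> (m k) \<omega> = x k}" by auto
  have "prob {\<omega>\<in>space M. \<forall>k\<le>Suc n. \<theta> (m k) \<omega> = x k} =
    prob {\<omega>\<in>space M. ?A (\<lambda>k. \<theta> k \<omega>) \<and> \<theta> (m n) \<omega> = x n} * mat_pow P (m (Suc n) - m n) $ x n $ x (Suc n)"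
    unfolding e1 by (rule markov_iterate) (use mm in auto)
  then show ?case unfolding e2 Suc by simp
qed simp

lemma change_prob:
  assumes c: "\<And>i. 1 - c \<le> P $ i $ i"
  shows "prob {\<omega>\<in>space M. \<theta> (Suc n) \<omega> \<noteq> \<theta> n \<omega>} \<le> c"
proof -
  let ?S = "\<lambda>i. {\<omega>\<in>space M. \<theta> n \<omega> = i \<and> \<theta> (Suc n) \<omega> = i}"
  have "prob (?S i) = prob {\<omega>\<in>space M. \<theta> n \<omega> = i} * P $ i $ i" for i
    using markov_step[of n "\<lambda>_. True" i i] by simp
  then have S: "prob {\<omega>\<in>space M. \<theta> n \<omega> = i} * (1 - c) \<le> prob (?S i)" for i
    using c[of i] by (simp add: mult_left_mono)
  have one: "(\<Sum>i\<in>UNIV. prob {\<omega>\<in>space M. \<theta> n \<omega> = i}) = 1"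
  proof -
    have "(\<Sum>i\<in>UNIV. prob {\<omega>\<in>space M. \<theta> n \<omega> = i}) = prob (\<Union>i\<in>UNIV. {\<omega>\<in>space M. \<theta> n \<omega> = i})"
      by (rule finite_measure_finite_Union[symmetric]) (auto simp: disjoint_family_on_def)
    also have "(\<Union>i\<in>UNIV. {\<omega>\<in>space M. \<theta> n \<omega> = i}) = space M" by auto
    finally show ?thesis by (simp add: prob_space)
  qed
  have "1 - c = (\<Sum>i\<in>UNIV. prob {\<omega>\<in>space M. \<theta> n \<omega> = i} * (1 - c))" using one by (simp flip: sum_distrib_right)
  also have "\<dots> \<le> (\<Sum>i\<in>UNIV. prob (?S i))" by (rule sum_mono) (rule S)
  also have "\<dots> = prob (\<Union>i\<in>UNIV. ?S i)"
    by (rule finite_measure_finite_Union[symmetric]) (auto simp: disjoint_family_on_def)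
  also have "(\<Union>i\<in>UNIV. ?S i) = space M - {\<omega>\<in>space M. \<theta> (Suc n) \<omega> \<noteq> \<theta> n \<omega>}" by auto
  also have "prob \<dots> = 1 - prob {\<omega>\<in>space M. \<theta> (Suc n) \<omega> \<noteq> \<theta> n \<omega>}" by (rule prob_compl) measurable
  finally show ?thesis by simp
qed

end

section \<open>From matrix powers to the matrix exponential\<close>

lemma mat_pow_entry: "mat_pow Q (Suc k) $ i $ j = (\<Sum>l\<in>UNIV. Q $ i $ l * mat_pow Q k $ l $ j)"
  by (simp add: mat_pow_Suc matrix_matrix_mult_def)

lemma mat_pow_bound:
  fixes Q :: "real^'q::finite^'q" assumes "\<And>i j. \<bar>Q $ i $ j\<bar> \<le> 1"
  shows "\<bar>mat_pow Q k $ i $ j\<bar> \<le> real CARD('q) ^ k"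
proof (induction k arbitrary: i)
  case (Suc k)
  have "\<bar>mat_pow Q (Suc k) $ i $ j\<bar> \<le> (\<Sum>l\<in>(UNIV::'q set). 1 * real CARD('q) ^ k)"
    unfolding mat_pow_entry
  proof (rule order_trans[OF sum_abs sum_mono])
    show "\<bar>Q $ i $ l * mat_pow Q k $ l $ j\<bar> \<le> 1 * real CARD('q) ^ k" for l
      unfolding abs_mult by (rule mult_mono[OF assms Suc]) auto
  qed
  then show ?case by simp
qed (simp add: mat_pow_0 mat_def)

text \<open>The binomial theorem, valid since the identity commutes with \<open>Q\<close>; it makes
  powers and exponential comparable term by term.\<close>

lemma mat_pow_binomial:
  fixes Q :: "real^'q::finite^'q"
  shows "mat_pow (mat 1 + \<mu> *\<^sub>R Q) m $ i $ j = (\<Sum>k\<le>m. real (m choose k) * \<mu> ^ k * mat_pow Q k $ i $ j)"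
proof (induction m arbitrary: i)
  case (Suc m)
  define f where "f k = \<mu> ^ k * mat_pow Q k $ i $ j" for k
  have "mat_pow (mat 1 + \<mu> *\<^sub>R Q) (Suc m) $ i $ j =
    (\<Sum>l\<in>UNIV. of_bool (i = l) * mat_pow (mat 1 + \<mu> *\<^sub>R Q) m $ l $ j) + (\<Sum>l\<in>UNIV. \<mu> * Q $ i $ l * mat_pow (mat 1 + \<mu> *\<^sub>R Q) m $ l $ j)"
    unfolding mat_pow_entry sum.distrib[symmetric] by (rule sum.cong) (auto simp: mat_def algebra_simps)
  also have "(\<Sum>l\<in>UNIV. of_bool (i = l) * mat_pow (mat 1 + \<mu> *\<^sub>R Q) m $ l $ j) = (\<Sum>k\<le>m. real (m choose k) * f k)"
  proof -
    have "(\<Sum>l\<in>UNIV. of_bool (i = l) * mat_pow (mat 1 + \<mu> *\<^sub>R Q) m $ l $ j) =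
      (\<Sum>l\<in>UNIV. if i = l then mat_pow (mat 1 + \<mu> *\<^sub>R Q) m $ l $ j else 0)" by (rule sum.cong) auto
    then show ?thesis using Suc[of i] by (simp add: f_def mult.assoc)
  qed
  also have "(\<Sum>l\<in>UNIV. \<mu> * Q $ i $ l * mat_pow (mat 1 + \<mu> *\<^sub>R Q) m $ l $ j) = (\<Sum>k\<le>m. real (m choose k) * f (Suc k))"
  proof -
    have "(\<Sum>l\<in>UNIV. \<mu> * Q $ i $ l * mat_pow (mat 1 + \<mu> *\<^sub>R Q) m $ l $ j) =
      (\<Sum>l\<in>UNIV. \<Sum>k\<le>m. real (m choose k) * \<mu> ^ Suc k * (Q $ i $ l * mat_pow Q k $ l $ j))"
      by (simp add: Suc sum_distrib_left algebra_simps)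
    also have "\<dots> = (\<Sum>k\<le>m. \<Sum>l\<in>UNIV. real (m choose k) * \<mu> ^ Suc k * (Q $ i $ l * mat_pow Q k $ l $ j))" by (rule sum.swap)
    also have "\<dots> = (\<Sum>k\<le>m. real (m choose k) * f (Suc k))"
      by (simp add: f_def mat_pow_entry mult.assoc flip: sum_distrib_left)
    finally show ?thesis .
  qed
  also have "(\<Sum>k\<le>m. real (m choose k) * f k) + (\<Sum>k\<le>m. real (m choose k) * f (Suc k)) = (\<Sum>k\<le>Suc m. real (Suc m choose k) * f k)"
  proof -
    have "(\<Sum>k\<le>Suc m. real (Suc m choose k) * f k) = f 0 + (\<Sum>k\<le>m. real (m choose Suc k) * f (Suc k)) + (\<Sum>k\<le>m. real (m choose k) * f (Suc k))"
      unfolding sum.atMost_Suc_shift by (simp add: sum.distrib algebra_simps)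
    also have "f 0 + (\<Sum>k\<le>m. real (m choose Suc k) * f (Suc k)) = (\<Sum>k\<le>Suc m. real (m choose k) * f k)"
      unfolding sum.atMost_Suc_shift by simp
    also have "\<dots> = (\<Sum>k\<le>m. real (m choose k) * f k)" by simp
    finally show ?thesis by simp
  qed
  finally show ?case by (simp add: f_def mult.assoc)
qed (simp add: mat_pow_0)

lemma matrix_exp_entry:
  fixes Q :: "real^'q::finite^'q" assumes Q: "\<And>i j. \<bar>Q $ i $ j\<bar> \<le> 1"
  shows "matrix_exp (t *\<^sub>R Q) $ i $ j = (\<Sum>k. t ^ k / fact k * mat_pow Q k $ i $ j)"
proof -
  have it: "((\<lambda>B. (t *\<^sub>R Q) ** B) ^^ k) (mat 1) = t ^ k *\<^sub>R mat_pow Q k" for k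
  proof (induction k)
    case (Suc k)
    then show ?case
      by (simp add: mat_pow_Suc matrix_matrix_mult_def vec_eq_iff sum_distrib_left algebra_simps)
  qed (simp add: mat_pow_0)
  define L where "L = (\<chi> i j. \<Sum>k. t ^ k / fact k * mat_pow Q k $ i $ j)"
  have sm: "summable (\<lambda>k. t ^ k / fact k * mat_pow Q k $ i $ j)" for i j
  proof (rule summable_comparison_test')
    show "summable (\<lambda>k. inverse (fact k) * (\<bar>t\<bar> * real CARD('q)) ^ k)" by (rule summable_exp)
    show "norm (t ^ k / fact k * mat_pow Q k $ i $ j) \<le> inverse (fact k) * (\<bar>t\<bar> * real CARD('q)) ^ k" for k
      using mult_left_mono[OF mat_pow_bound[OF Q, of k i j], of "\<bar>t\<bar> ^ k / fact k"]
      by (simp add: abs_mult power_abs power_mult_distrib divide_inverse algebra_simps)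
  qed
  have "(\<lambda>k. (1 / fact k) *\<^sub>R ((\<lambda>B. (t *\<^sub>R Q) ** B) ^^ k) (mat 1)) sums L"
    unfolding sums_def it
  proof (intro vec_tendstoI)
    fix i j
    have "(\<lambda>n. \<Sum>k<n. t ^ k / fact k * mat_pow Q k $ i $ j) \<longlonglongrightarrow> L $ i $ j"
      using summable_sums[OF sm[of i j]] by (simp add: sums_def L_def)
    then show "(\<lambda>n. (\<Sum>k<n. (1 / fact k) *\<^sub>R t ^ k *\<^sub>R mat_pow Q k) $ i $ j) \<longlonglongrightarrow> L $ i $ j" by simp
  qed
  then have "matrix_exp (t *\<^sub>R Q) = L" unfolding matrix_exp_def by (rule sums_unique[symmetric])
  then show ?thesis by (simp add: L_def)
qed

text \<open>Termwise the binomial coefficient times \<open>\<mu> n ^ k\<close> tends to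
  \<open>t ^ k / fact k\<close>. Interchange of limit and sum is Tannery's theorem, with an
  exponential series as majorant.\<close>

lemma mat_pow_tendsto_exp:
  fixes Q :: "real^'q::finite^'q" assumes Q: "\<And>i j. \<bar>Q $ i $ j\<bar> \<le> 1"
    and mu: "\<And>n. 0 < \<mu> n" "\<mu> \<longlonglongrightarrow> 0" and m: "(\<lambda>n. real (m n) * \<mu> n) \<longlonglongrightarrow> t"
  shows "(\<lambda>n. mat_pow (mat 1 + \<mu> n *\<^sub>R Q) (m n) $ i $ j) \<longlonglongrightarrow> matrix_exp (t *\<^sub>R Q) $ i $ j"
proof -
  define a where "a k n = real (m n choose k) * \<mu> n ^ k * mat_pow Q k $ i $ j" for k n
  define T where "T = \<bar>t\<bar> + 1"
  have ev: "eventually (\<lambda>n. real (m n) * \<mu> n \<le> T) sequentially"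
  proof -
    have "eventually (\<lambda>n. real (m n) * \<mu> n < T) sequentially" by (rule order_tendstoD(2)[OF m]) (simp add: T_def)
    then show ?thesis by eventually_elim simp
  qed
  \<comment> \<open>The factor \<open>\<mu> n ^ k\<close> is distributed over the falling product,
    so that each factor visibly tends to \<open>t\<close>.\<close>
  have gb: "real (m n choose k) * \<mu> n ^ k = (\<Prod>l<k. real (m n) * \<mu> n - real l * \<mu> n) / fact k" for k n
  proof -
    have "real (m n choose k) * \<mu> n ^ k = (\<Prod>l<k. real (m n) - real l) * (\<Prod>l<k. \<mu> n) / fact k"
      by (simp add: binomial_gbinomial gbinomial_prod_rev atLeast0LessThan)
    also have "(\<Prod>l<k. real (m n) - real l) * (\<Prod>l<k. \<mu> n) = (\<Prod>l<k. real (m n) * \<mu> n - real l * \<mu> n)"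
      unfolding prod.distrib[symmetric] by (simp add: left_diff_distrib)
    finally show ?thesis .
  qed
  have "eventually (\<lambda>n. summable (\<lambda>k. norm (a k n))) sequentially \<and>
      summable (\<lambda>k. norm (t ^ k / fact k * mat_pow Q k $ i $ j)) \<and>
      (\<lambda>n. suminf (\<lambda>k. a k n)) \<longlonglongrightarrow> (\<Sum>k. t ^ k / fact k * mat_pow Q k $ i $ j)"
  proof (rule tannerys_theorem)
    show "(\<lambda>n. a k n) \<longlonglongrightarrow> t ^ k / fact k * mat_pow Q k $ i $ j" for k
    proof -
      have "(\<lambda>n. (\<Prod>l<k. real (m n) * \<mu> n - real l * \<mu> n) / fact k * mat_pow Q k $ i $ j) \<longlonglongrightarrow>
        (\<Prod>l<k. t - real l * 0) / fact k * mat_pow Q k $ i $ j"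
        by (intro tendsto_intros m mu) simp
      then show ?thesis unfolding a_def gb by simp
    qed
    show "summable (\<lambda>k. inverse (fact k) * (T * real CARD('q)) ^ k)" by (rule summable_exp)
    show "eventually (\<lambda>(k, n). norm (a k n) \<le> inverse (fact k) * (T * real CARD('q)) ^ k) (at_top \<times>\<^sub>F sequentially)"
      unfolding eventually_prod_filter
    proof (rule exI[of _ "\<lambda>_. True"], rule exI[of _ "\<lambda>n. real (m n) * \<mu> n \<le> T"], intro conjI allI impI ev)
      fix k n assume mT: "real (m n) * \<mu> n \<le> T"
      have "real (m n choose k) * fact k \<le> real (m n) ^ k"
        using binomial_fact_pow[of "m n" k] by (metis of_nat_fact of_nat_le_iff of_nat_mult of_nat_power)
      then have "real (m n choose k) * \<mu> n ^ k \<le> (real (m n) ^ k / fact k) * \<mu> n ^ k"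
        using mu(1)[of n] by (intro mult_right_mono) (auto simp: le_divide_eq less_imp_le)
      also have "\<dots> = inverse (fact k) * (real (m n) * \<mu> n) ^ k" by (simp add: power_mult_distrib divide_inverse)
      also have "\<dots> \<le> inverse (fact k) * T ^ k"
        using mT mu(1)[of n] by (intro mult_left_mono power_mono mult_nonneg_nonneg) auto
      finally have b: "real (m n choose k) * \<mu> n ^ k \<le> inverse (fact k) * T ^ k" .
      have "norm (a k n) = (real (m n choose k) * \<mu> n ^ k) * \<bar>mat_pow Q k $ i $ j\<bar>"
        using mu(1)[of n] by (simp add: a_def abs_mult)
      also have "\<dots> \<le> (inverse (fact k) * T ^ k) * real CARD('q) ^ k"
        by (rule mult_mono[OF b mat_pow_bound[OF Q]]) (auto simp: T_def)
      finally show "case (k, n) of (k, n) \<Rightarrow> norm (a k n) \<le> inverse (fact k) * (T * real CARD('q)) ^ k"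
        by (simp add: power_mult_distrib mult.assoc)
    qed simp
  qed simp
  moreover have "suminf (\<lambda>k. a k n) = mat_pow (mat 1 + \<mu> n *\<^sub>R Q) (m n) $ i $ j" for n
  proof -
    have "(\<lambda>k. a k n) sums (\<Sum>k\<in>{..m n}. a k n)" by (rule sums_finite) (auto simp: a_def binomial_eq_0)
    then show ?thesis by (simp add: mat_pow_binomial a_def sums_iff)
  qed
  ultimately show ?thesis by (simp add: matrix_exp_entry[OF Q])
qed

section \<open>Compact sets of paths\<close>

lemma compact_sequences:
  fixes S :: "nat \<Rightarrow> 'a::topological_space set"
  assumes "\<And>n. compact (S n)" shows "compact {x. \<forall>n. x n \<in> S n}"
proof -
  have "compactin (product_topology (\<lambda>i. euclidean) UNIV) (PiE UNIV S)"
    unfolding compactin_PiE using assms by auto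
  then have "compact (PiE UNIV S)" by (simp add: euclidean_product_topology)
  then show ?thesis by (simp add: PiE_UNIV_domain Pi_def)
qed

text \<open>Sequences of states are coded by natural numbers: in
  \<open>nat \<Rightarrow> nat\<close> convergence is eventual equality at each index, and Borel
  measurability is checked coordinatewise.\<close>

lemma compact_codes: "compact {m :: nat \<Rightarrow> nat. \<forall>n. m n \<in> range (to_nat :: 'q::finite \<Rightarrow> nat)}"
  by (rule compact_sequences[of "\<lambda>_. range (to_nat :: 'q \<Rightarrow> nat)"]) (simp add: finite_imp_compact)

lemma coordinate_tendsto:
  fixes X :: "nat \<Rightarrow> 'i \<Rightarrow> 'a::topological_space"
  assumes "X \<longlonglongrightarrow> x" shows "(\<lambda>n. X n i) \<longlonglongrightarrow> x i"
proof -
  have "continuous_on UNIV (\<lambda>x::'i \<Rightarrow> 'a. x i)" by (rule continuous_on_product_coordinates)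
  from continuous_on_tendsto_compose[OF this assms] show ?thesis by simp
qed

lemma nat_sequence_tendsto:
  fixes X :: "nat \<Rightarrow> 'i \<Rightarrow> nat"
  assumes "X \<longlonglongrightarrow> x" shows "eventually (\<lambda>n. X n i = x i) sequentially"
  using coordinate_tendsto[OF assms, of i] by (simp add: tendsto_discrete)

text \<open>The cylinders \<open>C B n x\<close>, with the empty set and the whole space, form a
  generator stable under intersection, so agreement there determines the law.\<close>

lemma law_eqI:
  fixes p :: "'a \<Rightarrow> real \<times> (nat \<Rightarrow> nat)" and p' :: "'b \<Rightarrow> real \<times> (nat \<Rightarrow> nat)"
  assumes "prob_space M" "prob_space N" and p: "p \<in> borel_measurable M" and p': "p' \<in> borel_measurable N"
    and eq: "\<And>B n x. B \<in> sets borel \<Longrightarrow> measure M {\<omega>\<in>space M. fst (p \<omega>) \<in> B \<and> (\<forall>k\<le>n. snd (p \<omega>) k = x k)} =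
       measure N {\<omega>\<in>space N. fst (p' \<omega>) \<in> B \<and> (\<forall>k\<le>n. snd (p' \<omega>) k = x k)}"
  shows "distr M borel p = distr N borel p'"
proof -
  interpret M: prob_space M by fact
  interpret N: prob_space N by fact
  define C :: "real set \<Rightarrow> nat \<Rightarrow> (nat \<Rightarrow> nat) \<Rightarrow> (real \<times> (nat \<Rightarrow> nat)) set"
    where "C B n x = {z. fst z \<in> B \<and> (\<forall>k\<le>n. snd z k = x k)}" for B n x
  define G where "G = {C B n x | B n x. B \<in> sets borel} \<union> {{}, UNIV}"
  have fm: "fst \<in> borel_measurable (borel :: (real \<times> (nat \<Rightarrow> nat)) measure)" by (intro borel_measurable_continuous_onI continuous_intros)
  have sm: "(\<lambda>z. snd z k) \<in> borel_measurable (borel :: (real \<times> (nat \<Rightarrow> nat)) measure)" for k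
    by (rule borel_measurable_continuous_onI, rule continuous_on_product_then_coordinatewise)
      (rule continuous_on_snd, rule continuous_on_id)
  have CB: "C B n x \<in> sets borel" if [measurable]: "B \<in> sets borel" for B n x
  proof -
    note fm[measurable] sm[measurable]
    have "{z \<in> space borel. fst z \<in> B \<and> (\<forall>k\<le>n. snd z k = x k)} \<in> sets borel" by measurable
    then show ?thesis by (simp add: C_def)
  qed
  have Gb: "G \<subseteq> sets borel" unfolding G_def by (auto intro!: CB)
  let ?S = "sigma UNIV G"
  have Ss: "sets ?S = sigma_sets UNIV G" "space ?S = UNIV" by (rule sets_measure_of space_measure_of; simp)+
  have CS: "C B n x \<in> sets ?S" if "B \<in> sets borel" for B n x
    unfolding Ss using that by (intro sigma_sets.Basic) (auto simp: G_def)
  \<comment> \<open>That cylinders generate all Borel sets is shown by measurability of the identity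
    into the Borel space, which may be tested on coordinates.\<close>
  have "(\<lambda>z. (fst z, snd z)) \<in> borel_measurable ?S"
  proof (rule borel_measurable_Pair)
    show "fst \<in> borel_measurable ?S"
    proof (rule measurableI)
      fix B :: "real set" assume B: "B \<in> sets borel"
      have "fst -` B \<inter> space ?S = (\<Union>j. C B 0 (\<lambda>_. j))" by (auto simp: C_def Ss)
      also have "\<dots> \<in> sets ?S" by (rule sets.countable_UN) (use CS[OF B] in blast)
      finally show "fst -` B \<inter> space ?S \<in> sets ?S" .
    qed (simp add: Ss)
    show "snd \<in> borel_measurable ?S"
    proof (rule measurable_coordinatewise_then_product)
      fix k
      show "(\<lambda>z. snd z k) \<in> borel_measurable ?S"
      proof (rule measurableI)
        fix B :: "nat set"
        let ?I = "{x \<in> {..k} \<rightarrow>\<^sub>E UNIV. x k \<in> B}"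
        have cI: "countable ?I" by (rule countable_subset[of _ "{..k} \<rightarrow>\<^sub>E UNIV"]) (auto intro: countable_PiE)
        have "(\<lambda>z. snd z k) -` B \<inter> space ?S = (\<Union>x\<in>?I. C UNIV k x)"
        proof (intro equalityI subsetI)
          fix z :: "real \<times> (nat \<Rightarrow> nat)" assume "z \<in> (\<lambda>z. snd z k) -` B \<inter> space ?S"
          then show "z \<in> (\<Union>x\<in>?I. C UNIV k x)"
            by (intro UN_I[of "\<lambda>j\<in>{..k}. snd z j"]) (auto simp: C_def)
        next
          fix z assume "z \<in> (\<Union>x\<in>?I. C UNIV k x)"
          then show "z \<in> (\<lambda>z. snd z k) -` B \<inter> space ?S" by (auto simp: C_def Ss)
        qed
        also have "\<dots> \<in> sets ?S" by (rule sets.countable_UN''[OF cI]) (rule CS, simp)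
        finally show "(\<lambda>z. snd z k) -` B \<inter> space ?S \<in> sets ?S" .
      qed (simp add: Ss)
    qed
  qed
  then have id: "(\<lambda>z. z) \<in> measurable ?S borel" by simp
  have sets_eq: "sets borel = sigma_sets UNIV G"
  proof
    show "sets borel \<subseteq> sigma_sets UNIV G"
    proof
      fix X :: "(real \<times> (nat \<Rightarrow> nat)) set" assume "X \<in> sets borel"
      from measurable_sets[OF id this] show "X \<in> sigma_sets UNIV G" by (simp add: Ss)
    qed
    show "sigma_sets UNIV G \<subseteq> sets borel" using sets.sigma_sets_subset[OF Gb] by simp
  qed
  show ?thesis
  proof (rule measure_eqI_generator_eq[where E=G and \<Omega>=UNIV and A="\<lambda>_. UNIV"])
    show "Int_stable G"
      unfolding Int_stable_def
    proof (intro ballI)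
      fix a b assume ab: "a \<in> G" "b \<in> G"
      show "a \<inter> b \<in> G"
      proof (cases "a \<inter> b = {} \<or> a = UNIV \<or> b = UNIV")
        case True
        then show ?thesis
        proof (elim disjE)
          assume "a \<inter> b = {}" then show ?thesis by (simp add: G_def)
        qed (use ab in simp_all)
      next
        case False
        have "\<exists>B n x. z = C B n x \<and> B \<in> sets borel" if "z \<in> G" "z \<noteq> {}" "z \<noteq> UNIV" for z
          using that unfolding G_def by blast
        moreover have "a \<noteq> {}" "b \<noteq> {}" using False by auto
        ultimately obtain B n x B' n' x' where *: "a = C B n x" "B \<in> sets borel" "b = C B' n' x'" "B' \<in> sets borel"
          using ab False by meson
        \<comment> \<open>A common point supplies the prescribed coordinates of the intersection,
          which is therefore again a cylinder.\<close>
        obtain z where z: "z \<in> a" "z \<in> b" using False by blast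
        have "a \<inter> b = C (B \<inter> B') (max n n') (snd z)" using z unfolding * by (auto simp: C_def le_max_iff_disj)
        moreover have "B \<inter> B' \<in> sets borel" using * by auto
        ultimately show ?thesis unfolding G_def by blast
      qed
    qed
  next
    fix X assume "X \<in> G"
    then consider "X = {}" | "X = UNIV" | B n x where "X = C B n x" "B \<in> sets borel" unfolding G_def by blast
    then show "emeasure (distr M borel p) X = emeasure (distr N borel p') X"
    proof cases
      case 2
      then show ?thesis using p p' by (simp add: emeasure_distr M.emeasure_space_1 N.emeasure_space_1)
    next
      case 3
      have "emeasure (distr M borel p) X = ennreal (measure M {\<omega>\<in>space M. fst (p \<omega>) \<in> B \<and> (\<forall>k\<le>n. snd (p \<omega>) k = x k)})"
        using CB[OF 3(2)] p unfolding 3(1) by (subst emeasure_distr) (auto simp: C_def M.emeasure_eq_measure intro!: arg_cong[where f="measure M"])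
      moreover have "emeasure (distr N borel p') X = ennreal (measure N {\<omega>\<in>space N. fst (p' \<omega>) \<in> B \<and> (\<forall>k\<le>n. snd (p' \<omega>) k = x k)})"
        using CB[OF 3(2)] p' unfolding 3(1) by (subst emeasure_distr) (auto simp: C_def N.emeasure_eq_measure intro!: arg_cong[where f="measure N"])
      ultimately show ?thesis using eq[OF 3(2)] by simp
    qed simp
  next
    show "range (\<lambda>_. UNIV) \<subseteq> G" by (simp add: G_def)
    show "emeasure (distr M borel p) UNIV \<noteq> \<infinity>" by (simp add: emeasure_distr p M.emeasure_eq_measure)
  qed (use Gb sets_eq in simp_all)
qed

text \<open>The mesh size is a parameter too, so a whole range of step sizes bounded away from 0 is
  covered by one compact set.\<close>

lemma interpolate_continuous:
  fixes P :: "(real \<times> (nat \<Rightarrow> 'v::metric_space) \<times> (nat \<Rightarrow> nat)) set"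
  assumes "\<And>p. p \<in> P \<Longrightarrow> 0 < fst p"
  shows "continuous_map (top_of_set P) skorohod_topology
    (\<lambda>p. interpolate (fst p) (\<lambda>n. (fst (snd p) n, from_nat (snd (snd p) n) :: 'q::{countable,metric_space})))"
proof (rule continuous_map_skorohodI)
  show "interpolate (fst p) (\<lambda>n. (fst (snd p) n, from_nat (snd (snd p) n) :: 'q)) \<in> cadlag" if "p \<in> P" for p
    using assms[OF that] by (simp add: interpolate_eq_step_path step_path_cadlag mesh_jump_times)
  fix p X and T e :: real
  assume *: "p \<in> P" "\<And>n. X n \<in> P" "X \<longlonglongrightarrow> p" "0 < T" "0 < e"
  have lim: "(\<lambda>n. fst (X n)) \<longlonglongrightarrow> fst p" "(\<lambda>n. fst (snd (X n))) \<longlonglongrightarrow> fst (snd p)" "(\<lambda>n. snd (snd (X n))) \<longlonglongrightarrow> snd (snd p)"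
    by (intro tendsto_fst tendsto_snd *(3))+
  have "(\<lambda>n. (fst (snd (X n)) k, from_nat (snd (snd (X n)) k) :: 'q)) \<longlonglongrightarrow> (fst (snd p) k, from_nat (snd (snd p) k))" for k
  proof (rule tendsto_Pair)
    show "(\<lambda>n. from_nat (snd (snd (X n)) k) :: 'q) \<longlonglongrightarrow> from_nat (snd (snd p) k)"
      using nat_sequence_tendsto[OF lim(3), of k] by (intro tendsto_eventually) (auto elim: eventually_mono)
  qed (rule coordinate_tendsto[OF lim(2)])
  moreover have "(\<lambda>n. real k * fst (X n)) \<longlonglongrightarrow> real k * fst p" for k by (intro tendsto_mult tendsto_const lim(1))
  ultimately show "\<forall>\<^sub>F n in sequentially. interpolate (fst (X n)) (\<lambda>k. (fst (snd (X n)) k, from_nat (snd (snd (X n)) k) :: 'q)) \<in>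
     skorohod_nbhd (interpolate (fst p) (\<lambda>n. (fst (snd p) n, from_nat (snd (snd p) n)))) T e"
    using assms[OF *(1)] assms[OF *(2)] *(5)
    by (simp add: interpolate_eq_step_path step_path_tendsto mesh_jump_times)
qed

text \<open>The closed conditions satisfied by the arrivals of a good clock, relaxed by factors 1/2
  and a summand 1 so that rounded gaps with step size at most 1/2 satisfy them as well. The last one
  keeps jump times from accumulating in the limit.\<close>

definition gap_bounded :: "(nat \<Rightarrow> real) \<Rightarrow> (nat \<Rightarrow> real) \<Rightarrow> (nat \<Rightarrow> nat) \<Rightarrow> (nat \<Rightarrow> real) set" where
  "gap_bounded d A K = {\<tau>. \<tau> 0 = 0 \<and> (\<forall>k. d k / 2 \<le> \<tau> (Suc k) - \<tau> k \<and> \<tau> (Suc k) - \<tau> k \<le> A k + 1) \<and>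
     (\<forall>m. real m / 2 \<le> \<tau> (K m))}"

lemma gap_bounded_jump_times:
  assumes "\<And>k. 0 < d k" shows "gap_bounded d A K \<subseteq> jump_times"
proof
  fix \<tau> assume t: "\<tau> \<in> gap_bounded d A K"
  have "\<tau> k < \<tau> (Suc k)" for k using t assms[of k] unfolding gap_bounded_def by (auto dest!: spec[of _ k])
  moreover have "\<exists>k. T < \<tau> k" for T
  proof -
    obtain m where "2 * T < real m" using reals_Archimedean2 by blast
    moreover have "real m / 2 \<le> \<tau> (K m)" using t by (simp add: gap_bounded_def)
    ultimately show ?thesis by (intro exI[of _ "K m"]) linarith
  qed
  ultimately show "\<tau> \<in> jump_times" using t by (auto simp: jump_times_def strict_mono_Suc_iff gap_bounded_def)
qed

lemma compact_gap_bounded: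
  assumes d: "\<And>k. 0 < d k" shows "compact (gap_bounded d A K)"
proof -
  define B where "B k = (\<Sum>j<k. A j + 1)" for k
  have "compact {\<tau>. \<forall>k. \<tau> k \<in> {0..B k}}" by (rule compact_sequences) simp
  moreover have "closed (gap_bounded d A K)"
    unfolding gap_bounded_def
    by (intro closed_Collect_conj closed_Collect_all closed_Collect_le closed_Collect_eq continuous_on_diff
        continuous_on_const continuous_on_product_coordinates)
  moreover have "gap_bounded d A K \<subseteq> {\<tau>. \<forall>k. \<tau> k \<in> {0..B k}}"
  proof
    fix \<tau> assume t: "\<tau> \<in> gap_bounded d A K"
    have "0 \<le> \<tau> k \<and> \<tau> k \<le> B k" for k
    proof (induction k)
      case (Suc k)
      have "d k / 2 \<le> \<tau> (Suc k) - \<tau> k" "\<tau> (Suc k) - \<tau> k \<le> A k + 1" using t by (auto simp: gap_bounded_def)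
      then show ?case using Suc d[of k] by (simp add: B_def)
    qed (use t in \<open>simp add: gap_bounded_def B_def\<close>)
    then show "\<tau> \<in> {\<tau>. \<forall>k. \<tau> k \<in> {0..B k}}" by simp
  qed
  ultimately show ?thesis using compact_Int_closed by (metis inf.absorb_iff2)
qed

section \<open>Compact families of flows\<close>

context response
begin

definition param_flow :: "real \<times> (nat \<Rightarrow> real) \<times> (nat \<Rightarrow> nat) \<Rightarrow> real \<Rightarrow> ((real^'s) \<times> real) \<times> 'q" where
  "param_flow p = flow (fst p) (step_path (fst (snd p)) (\<lambda>k. from_nat (snd (snd p) k)))"

lemma param_flow_continuous:
  assumes "\<And>p. p \<in> P \<Longrightarrow> fst (snd p) \<in> jump_times"
  shows "continuous_map (top_of_set P) skorohod_topology param_flow"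
proof (rule continuous_map_skorohodI)
  show "param_flow p \<in> cadlag" if "p \<in> P" for p
    unfolding param_flow_def by (intro regime_path_flow_cadlag regime_path_step_path assms that)
  fix p X and T e :: real
  assume *: "p \<in> P" "\<And>n. X n \<in> P" "X \<longlonglongrightarrow> p" "0 < T" "0 < e"
  have lim: "(\<lambda>n. fst (X n)) \<longlonglongrightarrow> fst p" "(\<lambda>n. fst (snd (X n))) \<longlonglongrightarrow> fst (snd p)" "(\<lambda>n. snd (snd (X n))) \<longlonglongrightarrow> snd (snd p)"
    by (intro tendsto_fst tendsto_snd *(3))+
  show "\<forall>\<^sub>F n in sequentially. param_flow (X n) \<in> skorohod_nbhd (param_flow p) T e"
    unfolding param_flow_def
  proof (rule flow_tendsto[OF assms[OF *(1)] assms[OF *(2)] coordinate_tendsto[OF lim(2)] _ lim(1) *(5)])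
    show "\<forall>\<^sub>F n in sequentially. (from_nat (snd (snd (X n)) k) :: 'q) = from_nat (snd (snd p) k)" for k
      using nat_sequence_tendsto[OF lim(3), of k] by eventually_elim simp
  qed
qed

text \<open>A continuous image of a compact parameter set. It is shared by the limit and the
  approximations, and all its members solve the switched equation.\<close>

definition flow_core :: "(nat \<Rightarrow> real) \<Rightarrow> (nat \<Rightarrow> real) \<Rightarrow> (nat \<Rightarrow> nat) \<Rightarrow> real \<Rightarrow> (real \<Rightarrow> ((real^'s) \<times> real) \<times> 'q) set" where
  "flow_core d A K R = {flow r (step_path \<tau> j) | r \<tau> j. \<bar>r\<bar> \<le> R \<and> \<tau> \<in> gap_bounded d A K}"

lemma compactin_flow_core:
  assumes d: "\<And>k. 0 < d k" shows "compactin skorohod_topology (flow_core d A K R)"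
proof -
  define P where "P = {-R..R} \<times> gap_bounded d A K \<times> {m :: nat \<Rightarrow> nat. \<forall>k. m k \<in> range (to_nat :: 'q \<Rightarrow> nat)}"
  have cP: "compact P" unfolding P_def by (intro compact_Times compact_Icc compact_gap_bounded compact_codes d)
  have c: "continuous_map (top_of_set P) skorohod_topology param_flow"
    by (rule param_flow_continuous) (use gap_bounded_jump_times[where d=d and A=A and K=K, OF d] in \<open>auto simp: P_def\<close>)
  have "compactin (top_of_set P) P" using cP by (simp add: compactin_subtopology)
  then have "compactin skorohod_topology (param_flow ` P)" using c by (rule image_compactin)
  moreover have "param_flow ` P = flow_core d A K R"
  proof (intro equalityI subsetI)
    fix z assume "z \<in> param_flow ` P"
    then show "z \<in> flow_core d A K R" unfolding flow_core_def param_flow_def P_def by fastforce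
  next
    fix z assume "z \<in> flow_core d A K R"
    then obtain r \<tau> j where z: "z = flow r (step_path \<tau> j)" "\<bar>r\<bar> \<le> R" "\<tau> \<in> gap_bounded d A K"
      by (auto simp: flow_core_def)
    then have "z = param_flow (r, \<tau>, \<lambda>k. to_nat (j k))" by (simp add: param_flow_def)
    moreover have "(r, \<tau>, \<lambda>k. to_nat (j k)) \<in> P" using z by (auto simp: P_def)
    ultimately show "z \<in> param_flow ` P" by blast
  qed
  ultimately show ?thesis by simp
qed

lemma flow_core_solves:
  fixes A d :: "nat \<Rightarrow> real"
  assumes d: "\<And>k. 0 < d k" and z: "z \<in> flow_core d A K R"
  shows "solves_switched_ode (G_field b F) (\<lambda>t. fst (z t)) (\<lambda>t. snd (z t))"
    "regime_resets F (\<lambda>t. fst (z t)) (\<lambda>t. snd (z t))"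
proof -
  obtain r \<tau> j where z: "z = flow r (step_path \<tau> j)" "\<tau> \<in> gap_bounded d A K"
    using z by (auto simp: flow_core_def)
  then have "step_path \<tau> j \<in> measurable borel (count_space UNIV)"
    using regime_path_step_path[of \<tau> j] gap_bounded_jump_times[where d=d and A=A and K=K, OF d] by (auto simp: regime_path_def)
  then show "solves_switched_ode (G_field b F) (\<lambda>t. fst (z t)) (\<lambda>t. snd (z t))"
    "regime_resets F (\<lambda>t. fst (z t)) (\<lambda>t. snd (z t))" unfolding z(1) by (rule flow_solves flow_resets)+
qed

text \<open>The response is bounded below on the ball reached after \<open>n\<close> steps, which
  bounds the next step. The bounds may grow with \<open>n\<close> without control; for compactness
  in the product of all iterates one bound per index is enough.\<close>

lemma X_rec_bounded:
  fixes C R :: real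
  assumes lower: "\<And>B. \<exists>\<beta>>0. \<forall>v i. norm v \<le> B \<longrightarrow> \<beta> \<le> b v $ i" and C: "0 \<le> C"
  shows "\<exists>B. \<forall>n \<mu> y s \<theta> r0. 0 < \<mu> \<longrightarrow> \<mu> \<le> 1 \<longrightarrow> (\<forall>k i. \<bar>y k i\<bar> \<le> C) \<longrightarrow> \<bar>r0\<bar> \<le> R \<longrightarrow>
    norm (X_rec \<mu> b F y s \<theta> r0 n) \<le> B n"
proof -
  have v: "\<exists>B. \<forall>\<mu> y s. 0 < \<mu> \<longrightarrow> \<mu> \<le> 1 \<longrightarrow> (\<forall>k i. \<bar>y k i\<bar> \<le> C) \<longrightarrow> norm (f_tilde \<mu> b y s n) \<le> B" for n
  proof (induction n)
    case (Suc n)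
    then obtain B where B: "\<And>\<mu> y s. 0 < \<mu> \<Longrightarrow> \<mu> \<le> 1 \<Longrightarrow> (\<forall>k i. \<bar>y k i\<bar> \<le> C) \<Longrightarrow> norm (f_tilde \<mu> b y s n) \<le> B" by blast
    obtain \<beta> where beta: "0 < \<beta>" "\<And>v i. norm v \<le> B \<Longrightarrow> \<beta> \<le> b v $ i" using lower[of B] by blast
    have "norm (f_tilde \<mu> b y s (Suc n)) \<le> B + C / \<beta>"
      if mu: "0 < \<mu>" "\<mu> \<le> 1" and y: "\<forall>k i. \<bar>y k i\<bar> \<le> C" for \<mu> y and s :: "nat \<Rightarrow> 's"
    proof -
      let ?v = "f_tilde \<mu> b y s n"
      let ?g = "g_vec (b ?v) (s n) (y n (s n))"
      have "?g = axis (s n) (y n (s n) / b ?v $ s n)" by (auto simp: g_vec_def vec_eq_iff axis_def)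
      then have "norm ?g = \<bar>y n (s n)\<bar> / \<bar>b ?v $ s n\<bar>" by (simp add: norm_eq_sqrt_inner inner_axis_axis abs_divide flip: power2_eq_square)
      also have "\<dots> \<le> C / \<beta>" using beta(2)[OF B[OF mu y, of s], of "s n"] beta(1) y C by (intro frac_le) auto
      finally have g: "norm ?g \<le> C / \<beta>" .
      have "f_tilde \<mu> b y s (Suc n) = (1 - \<mu>) *\<^sub>R ?v + \<mu> *\<^sub>R ?g" by (simp add: algebra_simps)
      also have "norm \<dots> \<le> (1 - \<mu>) * norm ?v + \<mu> * norm ?g"
        using mu by (intro norm_triangle_le) simp
      also have "\<dots> \<le> 1 * B + 1 * (C / \<beta>)"
        using mu B[OF mu y] g by (intro add_mono mult_mono) (auto intro: order_trans[OF norm_ge_zero])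
      finally show ?thesis by simp
    qed
    then show ?case by blast
  qed (auto intro!: exI[of _ 0])
  obtain Bv where Bv: "\<And>n \<mu> y s. 0 < \<mu> \<Longrightarrow> \<mu> \<le> 1 \<Longrightarrow> (\<forall>k i. \<bar>y k i\<bar> \<le> C) \<Longrightarrow> norm (f_tilde \<mu> b y s n) \<le> Bv n"
    using choice[of "\<lambda>n B. \<forall>\<mu> y s. 0 < \<mu> \<longrightarrow> \<mu> \<le> 1 \<longrightarrow> (\<forall>k i. \<bar>y k i\<bar> \<le> C) \<longrightarrow> norm (f_tilde \<mu> b y s n) \<le> B", OF allI[OF v]] by blast
  have r: "\<bar>snd (X_rec \<mu> b F y s \<theta> r0 n)\<bar> \<le> R + real n * (C + 3 * F_bound F)"
    if mu: "0 < \<mu>" "\<mu> \<le> 1" and y: "\<forall>k i. \<bar>y k i\<bar> \<le> C" and r0: "\<bar>r0\<bar> \<le> R" for n \<mu> y and s :: "nat \<Rightarrow> 's" and \<theta> r0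
  proof (induction n)
    case (Suc n)
    let ?r = "snd (X_rec \<mu> b F y s \<theta> r0 n)"
    define t1 where "t1 = (1 - \<mu>) * ?r"
    define t2 where "t2 = \<mu> * (y n (s n) - F_min F (\<theta> n))"
    define c where "c = real n * (C + 3 * F_bound F)"
    have eq: "snd (X_rec \<mu> b F y s \<theta> r0 (Suc n)) = t1 + t2 + (F_min F (\<theta> n) - F_min F (\<theta> (Suc n)))"
      by (simp add: algebra_simps t1_def t2_def)
    have t: "\<bar>t1\<bar> \<le> 1 * (R + c)" unfolding abs_mult t1_def using Suc mu by (intro mult_mono) (auto simp: c_def)
    have t': "\<bar>t2\<bar> \<le> 1 * (C + F_bound F)"
      unfolding abs_mult t2_def using mu y[rule_format, of n "s n"] F_min_le_bound[of "\<theta> n"] C by (intro mult_mono) auto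
    have sum4: "\<bar>w + x + (p - q)\<bar> \<le> 1 * W + 1 * Z + 2 * D"
      if "\<bar>w\<bar> \<le> 1 * W" "\<bar>x\<bar> \<le> 1 * Z" "\<bar>p\<bar> \<le> D" "\<bar>q\<bar> \<le> D" for w x p q W Z D :: real
      using that by linarith
    have "\<bar>snd (X_rec \<mu> b F y s \<theta> r0 (Suc n))\<bar> \<le> 1 * (R + c) + 1 * (C + F_bound F) + 2 * F_bound F"
      unfolding eq by (intro sum4 t t' F_min_le_bound)
    also have "\<dots> = R + real (Suc n) * (C + 3 * F_bound F)" by (simp add: algebra_simps c_def)
    finally show ?case .
  qed (use r0 in simp)
  have "norm (X_rec \<mu> b F y s \<theta> r0 n) \<le> (Bv n + F_bound F) + (R + real n * (C + 3 * F_bound F))"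
    if mu: "0 < \<mu>" "\<mu> \<le> 1" and y: "\<forall>k i. \<bar>y k i\<bar> \<le> C" and r0: "\<bar>r0\<bar> \<le> R" for n \<mu> y and s :: "nat \<Rightarrow> 's" and \<theta> r0
  proof -
    let ?X = "X_rec \<mu> b F y s \<theta> r0 n"
    have "norm ?X \<le> norm (fst ?X) + norm (snd ?X)" using norm_Pair_le[of "fst ?X" "snd ?X"] by simp
    moreover have "norm (fst ?X) \<le> Bv n + F_bound F"
      unfolding fst_X_rec using norm_triangle_ineq4[of "f_tilde \<mu> b y s n" "F_vec F (\<theta> n)"] Bv[OF mu y, of s n] F_bound[of F "\<theta> n"] by linarith
    ultimately show ?thesis using r[OF mu y r0, of s \<theta> n] by simp
  qed
  then show ?thesis
    by (intro exI[of _ "\<lambda>n. (Bv n + F_bound F) + (R + real n * (C + 3 * F_bound F))"] allI impI)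
qed

end

section \<open>The limit law\<close>

lemma (in prob_space) bounded_with_large_probability:
  fixes r :: "'a \<Rightarrow> real"
  assumes [measurable]: "r \<in> borel_measurable M" and eta: "0 < \<eta>"
  shows "\<exists>R\<ge>0. 1 - \<eta> \<le> prob {\<omega>\<in>space M. \<bar>r \<omega>\<bar> \<le> R}"
proof -
  let ?A = "\<lambda>n. {\<omega>\<in>space M. \<bar>r \<omega>\<bar> \<le> real n}"
  have "(\<lambda>n. prob (?A n)) \<longlonglongrightarrow> prob (\<Union>n. ?A n)"
    by (rule finite_Lim_measure_incseq) (auto simp: incseq_def)
  moreover have "(\<Union>n. ?A n) = space M" using real_arch_simple by auto
  ultimately have "(\<lambda>n. prob (?A n)) \<longlonglongrightarrow> 1" by (simp add: prob_space)
  then have "eventually (\<lambda>n. 1 - \<eta> < prob (?A n)) sequentially" by (rule order_tendstoD) (use eta in simp)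
  then obtain n where "1 - \<eta> < prob (?A n)" by (auto simp: eventually_sequentially)
  then show ?thesis by (intro exI[of _ "real n"]) auto
qed

text \<open>The measure \<open>\<nu>\<close> is the joint law of initial regret and initial regime;
  the clock is taken independent of both.\<close>

locale switched_flow = uniformization Q + response b F
  for Q :: "real^('q::{finite,metric_space})^('q::{finite,metric_space})" and b :: "real^'s::finite \<Rightarrow> real^'s" and F :: "'s \<Rightarrow> 'q \<Rightarrow> real" +
  fixes \<nu> :: "(real \<times> 'q) measure"
  assumes nu: "prob_space \<nu>" and sets_nu [measurable_cong]: "sets \<nu> = sets (borel \<Otimes>\<^sub>M count_space UNIV)"
begin

abbreviation \<Omega> :: "((real \<times> 'q) \<times> 'q clock) measure" where "\<Omega> \<equiv> \<nu> \<Otimes>\<^sub>M clock"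

sublocale nu: prob_space \<nu> by (rule nu)
sublocale clock: prob_space clock by (rule prob_space_clock)
sublocale pair: pair_prob_space \<nu> clock ..

lemma space_nu [simp]: "space \<nu> = UNIV"
  using sets_eq_imp_space_eq[OF sets_nu] by (simp add: space_pair_measure)

lemma space_Omega [simp]: "space \<Omega> = UNIV" by (simp add: space_pair_measure)

text \<open>Replaces exceptional arrival sequences by a default, so that \<open>limit_path\<close>
  is a measurable cadlag path at every sample point. Almost surely nothing changes.\<close>

definition clean :: "(nat \<Rightarrow> real) \<Rightarrow> nat \<Rightarrow> real" where
  "clean \<tau> = (if \<tau> \<in> jump_times then \<tau> else real)"

lemma clean: "clean \<tau> \<in> jump_times"
  using mesh_jump_times[of 1] by (simp add: clean_def)

definition limit_path :: "(real \<times> 'q) \<times> 'q clock \<Rightarrow> real \<Rightarrow> ((real^'s) \<times> real) \<times> 'q" where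
  "limit_path z = flow (fst (fst z)) (step_path (clean (arrival (snd z))) (state (snd (fst z)) (snd z)))"

definition chain_at :: "real \<Rightarrow> nat \<Rightarrow> (real \<times> 'q) \<times> 'q clock \<Rightarrow> 'q" where
  "chain_at \<mu> n z = chain (- ln (1 - \<mu>)) n (snd (fst z)) (snd z)"

definition approx :: "real \<Rightarrow> (real \<times> 'q) \<times> 'q clock \<Rightarrow> real \<Rightarrow> ((real^'s) \<times> real) \<times> 'q" where
  "approx \<mu> z = flow (fst (fst z)) (interpolate \<mu> (\<lambda>n. chain_at \<mu> n z))"

lemma chain_at_measurable [measurable]: "chain_at \<mu> n \<in> measurable \<Omega> (count_space UNIV)"
  unfolding chain_at_def
  by (rule measurable_compose_countable[of "\<lambda>q z. chain (- ln (1 - \<mu>)) n q (snd z)"]) measurable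

lemma state_at_measurable [measurable]: "(\<lambda>z. state (snd (fst z)) (snd z) k) \<in> measurable \<Omega> (count_space UNIV)"
  by (rule measurable_compose_countable[of "\<lambda>q z. state q (snd z) k"]) measurable

lemma jump_times_measurable: "(\<lambda>z. arrival (snd z) \<in> jump_times) \<in> measurable \<Omega> (count_space UNIV)"
proof -
  have eq: "\<tau> \<in> jump_times \<longleftrightarrow> \<tau> 0 = 0 \<and> (\<forall>k. \<tau> k < \<tau> (Suc k)) \<and> (\<forall>m::nat. \<exists>k. real m < \<tau> k)" for \<tau> :: "nat \<Rightarrow> real"
  proof -
    have "(\<forall>T. \<exists>k. T < \<tau> k) \<longleftrightarrow> (\<forall>m::nat. \<exists>k. real m < \<tau> k)"
    proof (intro iffI allI)
      fix T assume *: "\<forall>m::nat. \<exists>k. real m < \<tau> k"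
      obtain m where "T < real m" using reals_Archimedean2 by blast
      moreover obtain k where "real m < \<tau> k" using * by blast
      ultimately show "\<exists>k. T < \<tau> k" by (intro exI[of _ k]) linarith
    qed simp
    then show ?thesis unfolding jump_times_def strict_mono_Suc_iff by simp
  qed
  show ?thesis unfolding eq by measurable
qed

lemma encoding_measurable:
  fixes m :: "'p \<Rightarrow> nat \<Rightarrow> 'q"
  assumes "\<And>k. (\<lambda>w. m w k) \<in> measurable N (count_space UNIV)"
  shows "(\<lambda>w k. to_nat (m w k)) \<in> borel_measurable N"
proof (rule measurable_coordinatewise_then_product)
  show "(\<lambda>w. to_nat (m w k)) \<in> borel_measurable N" for k
    using measurable_compose[OF assms[of k], of to_nat borel] by simp
qed

lemma param_flow_measurable:
  fixes r :: "'p \<Rightarrow> real" and m :: "'p \<Rightarrow> nat \<Rightarrow> 'q"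
  assumes "r \<in> borel_measurable N" "\<And>k. (\<lambda>w. \<tau> w k) \<in> borel_measurable N"
    "\<And>k. (\<lambda>w. m w k) \<in> measurable N (count_space UNIV)" "\<And>w. \<tau> w \<in> jump_times"
  shows "(\<lambda>w. flow (r w) (step_path (\<tau> w) (m w))) \<in> measurable N skorohod_borel"
proof -
  have "(\<lambda>w. param_flow (r w, \<tau> w, \<lambda>k. to_nat (m w k))) \<in> measurable N skorohod_borel"
    by (rule measurable_skorohod_borel[OF param_flow_continuous[of "UNIV \<times> jump_times \<times> UNIV"]])
      (use assms in \<open>auto intro!: borel_measurable_Pair measurable_coordinatewise_then_product encoding_measurable\<close>)
  then show ?thesis by (simp add: param_flow_def)
qed

lemma limit_path_measurable [measurable]: "limit_path \<in> measurable \<Omega> skorohod_borel"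
proof -
  have c: "(\<lambda>z. clean (arrival (snd z)) k) \<in> borel_measurable \<Omega>" for k
  proof -
    have "(\<lambda>z. if arrival (snd z) \<in> jump_times then arrival (snd z) k else real k) \<in> borel_measurable \<Omega>"
      by (rule measurable_If[OF _ _ predE[OF jump_times_measurable]]) measurable
    then show ?thesis unfolding clean_def by (simp add: if_distrib[of "\<lambda>h. h k"])
  qed
  show ?thesis unfolding limit_path_def by (intro param_flow_measurable clean c state_at_measurable) measurable
qed

lemma approx_measurable:
  assumes "0 < \<mu>" shows "approx \<mu> \<in> measurable \<Omega> skorohod_borel"
  unfolding approx_def interpolate_eq_step_path[OF assms]
  by (intro param_flow_measurable mesh_jump_times assms) measurable

lemma AE_clock:
  assumes "AE \<omega> in clock. P \<omega>" shows "AE z in \<Omega>. P (snd z)"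
proof -
  from assms obtain N where N: "{\<omega>\<in>space clock. \<not> P \<omega>} \<subseteq> N" "emeasure clock N = 0" "N \<in> sets clock"
    by (rule AE_E)
  show ?thesis
  proof (rule AE_I)
    show "{z\<in>space \<Omega>. \<not> P (snd z)} \<subseteq> space \<nu> \<times> N" using N(1) by (auto simp: space_pair_measure)
    show "emeasure \<Omega> (space \<nu> \<times> N) = 0" using N sets.top[of \<nu>] by (simp add: clock.emeasure_pair_measure_Times)
    show "space \<nu> \<times> N \<in> sets \<Omega>" by (intro pair_measureI sets.top N(3))
  qed
qed

text \<open>Under this event the jump times of the approximations converge to those of the limit.\<close>
definition regular_clock :: "'q clock \<Rightarrow> bool" where
  "regular_clock \<omega> \<longleftrightarrow> (\<forall>k. 0 < fst (\<omega> !! k)) \<and> (\<forall>T. \<exists>k. T < arrival \<omega> k)"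

lemma AE_regular: "AE z in \<Omega>. regular_clock (snd z)"
  unfolding regular_clock_def by (rule AE_clock[OF clock_AE])

lemma regular_clock:
  assumes "regular_clock \<omega>"
  shows "arrival \<omega> \<in> jump_times" "clean (arrival \<omega>) = arrival \<omega>" "\<And>k. 0 \<le> fst (\<omega> !! k)"
proof -
  show "arrival \<omega> \<in> jump_times" using assms by (intro arrival_jump_times) (auto simp: regular_clock_def)
  then show "clean (arrival \<omega>) = arrival \<omega>" by (simp add: clean_def)
  show "0 \<le> fst (\<omega> !! k)" for k using assms by (simp add: regular_clock_def less_imp_le)
qed

lemma approx_step_path:
  assumes "0 < \<mu>" "\<mu> \<le> 1/2" "\<And>k. 0 \<le> fst (snd z !! k)"
  shows "interpolate \<mu> (\<lambda>n. chain_at \<mu> n z) =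
    step_path (\<lambda>k. \<mu> * real (arrival_step (- ln (1 - \<mu>)) (snd z) k)) (state (snd (fst z)) (snd z))"
  unfolding chain_at_def using assms rate_bounds(3)[OF assms(1,2)] by (intro interpolate_chain)

lemma approx_tendsto:
  assumes m: "\<And>n. 0 < m n" "\<And>n. m n \<le> 1/2" "m \<longlonglongrightarrow> (0::real)" and z: "regular_clock (snd z)" and e: "0 < e"
  shows "eventually (\<lambda>n. approx (m n) z \<in> skorohod_nbhd (limit_path z) T e) sequentially"
  unfolding approx_def limit_path_def approx_step_path[OF m(1,2) regular_clock(3)[OF z]] regular_clock(2)[OF z]
  by (intro flow_tendsto regular_clock[OF z] arrival_step_jump_times arrival_step_tendsto m e) auto

lemma approx_cadlag: "0 < \<mu> \<Longrightarrow> approx \<mu> z \<in> cadlag"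
  unfolding approx_def by (simp add: interpolate_eq_step_path regime_path_flow_cadlag regime_path_step_path mesh_jump_times)

lemma limit_path_cadlag: "limit_path z \<in> cadlag"
  unfolding limit_path_def by (intro regime_path_flow_cadlag regime_path_step_path clean)

definition limit_law :: "(real \<Rightarrow> ((real^'s) \<times> real) \<times> 'q) measure" where
  "limit_law = distr \<Omega> skorohod_borel limit_path"

lemma sets_limit_law [simp, measurable_cong]: "sets limit_law = sets skorohod_borel"
  by (simp add: limit_law_def)

sublocale limit: prob_space limit_law
  unfolding limit_law_def by (rule pair.prob_space_distr) measurable

text \<open>Along sequences of step sizes the coupled flows converge almost surely in path space,
  and bounded continuous functionals follow by dominated convergence.\<close>

lemma approx_integral_tendsto:
  assumes h: "continuous_map skorohod_topology euclideanreal h" "bounded (h ` topspace skorohod_topology)"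
  shows "((\<lambda>\<mu>. \<integral>z. h (approx \<mu> z) \<partial>\<Omega>) \<longlongrightarrow> (\<integral>z. h z \<partial>limit_law)) (at_right 0)"
proof (rule tendsto_at_right_sequentially[of 0 "1/2"])
  fix m :: "nat \<Rightarrow> real" assume m: "\<And>n. 0 < m n" "\<And>n. m n < 1/2" "m \<longlonglongrightarrow> 0"
  obtain B where B: "\<And>x. x \<in> cadlag \<Longrightarrow> \<bar>h x\<bar> \<le> B"
    using h(2) unfolding bounded_iff topspace_skorohod by auto
  note [measurable] = continuous_skorohod_borel_measurable[OF h(1)] approx_measurable[OF m(1)]
  have "(\<lambda>n. \<integral>z. h (approx (m n) z) \<partial>\<Omega>) \<longlonglongrightarrow> (\<integral>z. h (limit_path z) \<partial>\<Omega>)"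
  proof (rule integral_dominated_convergence[where w="\<lambda>_. B"])
    show "AE z in \<Omega>. (\<lambda>n. h (approx (m n) z)) \<longlonglongrightarrow> h (limit_path z)"
      using AE_regular
    proof eventually_elim
      case (elim z)
      show ?case
      proof (rule tendstoI)
        fix d :: real assume d: "0 < d"
        \<comment> \<open>Continuity of \<open>h\<close> at one path, read off from the uniform
          statement for a one-point compact set.\<close>
        have "compactin skorohod_topology {limit_path z}" by (simp add: compactin_sing topspace_skorohod limit_path_cadlag)
        from compactin_skorohod_continuous[OF this h(1) d]
        obtain T e where Te: "0 < e" "\<And>y. y \<in> skorohod_nbhd (limit_path z) T e \<Longrightarrow> \<bar>h y - h (limit_path z)\<bar> < d" by auto
        have "eventually (\<lambda>n. approx (m n) z \<in> skorohod_nbhd (limit_path z) T e) sequentially"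
          by (rule approx_tendsto[OF m(1) less_imp_le[OF m(2)] m(3) elim Te(1)])
        then show "eventually (\<lambda>n. dist (h (approx (m n) z)) (h (limit_path z)) < d) sequentially"
          by (rule eventually_mono) (use Te(2) in \<open>simp add: dist_real_def\<close>)
      qed
    qed
    show "AE z in \<Omega>. norm (h (approx (m n) z)) \<le> B" for n using B approx_cadlag[OF m(1)] by simp
  qed auto
  also have "(\<integral>z. h (limit_path z) \<partial>\<Omega>) = (\<integral>z. h z \<partial>limit_law)"
    unfolding limit_law_def by (subst integral_distr) auto
  finally show "(\<lambda>n. \<integral>z. h (approx (m n) z) \<partial>\<Omega>) \<longlonglongrightarrow> (\<integral>z. h z \<partial>limit_law)" .
qed simp

text \<open>A single event, a good clock together with a bounded initial regret, puts the limit and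
  all approximations into the same compact set.\<close>

lemma flow_core_probability:
  assumes eta: "0 < \<eta>"
  shows "\<exists>d A K R. (\<forall>k. 0 < d k) \<and> 1 - \<eta> \<le> measure limit_law (flow_core d A K R) \<and>
    (\<forall>\<mu>. 0 < \<mu> \<longrightarrow> \<mu> \<le> 1/2 \<longrightarrow> 1 - \<eta> \<le> measure (distr \<Omega> skorohod_borel (approx \<mu>)) (flow_core d A K R))"
proof -
  have "0 < \<eta> / 2" using eta by simp
  from good_clock_exists[OF this] obtain d A K where d: "\<And>k. 0 < d k"
    and good: "1 - \<eta> / 2 \<le> measure clock (good_clock d A K)" by blast
  from nu.bounded_with_large_probability[OF _ \<open>0 < \<eta> / 2\<close>, of fst]
  obtain R where R: "1 - \<eta> / 2 \<le> measure \<nu> {p\<in>space \<nu>. \<bar>fst p\<bar> \<le> R}" by auto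
  define B where "B = {p\<in>space \<nu>. \<bar>fst p\<bar> \<le> R}"
  define G where "G = B \<times> good_clock d A K"
  have B [measurable]: "B \<in> sets \<nu>" unfolding B_def by measurable
  have G: "G \<in> sets \<Omega>" unfolding G_def by (intro pair_measureI B good_clock_measurable)
  have "measure \<Omega> (space \<Omega> - G) \<le> \<eta>"
  proof -
    have "space \<Omega> - G \<subseteq> (UNIV - B) \<times> UNIV \<union> UNIV \<times> (UNIV - good_clock d A K)" by (auto simp: G_def)
    moreover have m: "(UNIV - B) \<times> UNIV \<in> sets \<Omega>" "UNIV \<times> (UNIV - good_clock d A K) \<in> sets \<Omega>"
      using sets.compl_sets[OF B] sets.compl_sets[OF good_clock_measurable[of d A K]] sets.top[of \<nu>] sets.top[of clock]
      by (auto intro!: pair_measureI)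
    ultimately have "measure \<Omega> (space \<Omega> - G) \<le> measure \<Omega> ((UNIV - B) \<times> UNIV \<union> UNIV \<times> (UNIV - good_clock d A K))"
      by (intro pair.finite_measure_mono) auto
    also have "\<dots> \<le> measure \<Omega> ((UNIV - B) \<times> UNIV) + measure \<Omega> (UNIV \<times> (UNIV - good_clock d A K))"
      using m by (rule measure_Un_le)
    also have "measure \<Omega> ((UNIV - B) \<times> UNIV) = measure \<nu> (UNIV - B)"
      using sets.compl_sets[OF B] clock.emeasure_space_1 sets.top[of clock] by (simp add: measure_def clock.emeasure_pair_measure_Times)
    also have "measure \<Omega> (UNIV \<times> (UNIV - good_clock d A K)) = measure clock (UNIV - good_clock d A K)"
      using sets.compl_sets[OF good_clock_measurable[of d A K]] sets.top[of \<nu>] nu.emeasure_space_1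
      by (simp add: measure_def clock.emeasure_pair_measure_Times)
    also have "measure \<nu> (UNIV - B) \<le> \<eta> / 2" using nu.prob_compl[OF B] R by (simp add: B_def)
    also have "measure clock (UNIV - good_clock d A K) \<le> \<eta> / 2"
      using clock.prob_compl[OF good_clock_measurable[of d A K]] good by simp
    finally show ?thesis by simp
  qed
  then have PG: "1 - \<eta> \<le> measure \<Omega> G" using pair.prob_compl[OF G] by simp
  note core = compact_in_skorohod_borel[OF compactin_flow_core[OF d]]
  have lower: "1 - \<eta> \<le> measure (distr \<Omega> skorohod_borel g) (flow_core d A K R)"
    if g: "g \<in> measurable \<Omega> skorohod_borel" "\<And>z. z \<in> G \<Longrightarrow> g z \<in> flow_core d A K R" for g
  proof -
    have "measure \<Omega> G \<le> measure \<Omega> (g -` flow_core d A K R \<inter> space \<Omega>)"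
      using g core by (intro pair.finite_measure_mono measurable_sets) auto
    then show ?thesis using PG g core by (simp add: measure_distr)
  qed
  have G_D: "\<bar>fst (fst z)\<bar> \<le> R" "snd z \<in> good_clock d A K" if "z \<in> G" for z using that by (auto simp: G_def B_def)
  have gap: "d k \<le> fst (snd z !! k)" "fst (snd z !! k) \<le> A k" "real m \<le> arrival (snd z) (K m)" if "z \<in> G" for z k m
    using G_D(2)[OF that] by (auto simp: good_clock_def)
  have gap0: "0 \<le> fst (snd z !! k)" if "z \<in> G" for z k using gap(1)[OF that, of k] d[of k] by linarith
  have "approx \<mu> z \<in> flow_core d A K R" if z: "z \<in> G" and mu: "0 < \<mu>" "\<mu> \<le> 1/2" for \<mu> z
  proof -
    let ?\<tau> = "\<lambda>k. \<mu> * real (arrival_step (- ln (1 - \<mu>)) (snd z) k)"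
    have "?\<tau> \<in> gap_bounded d A K"
      unfolding gap_bounded_def
    proof (intro CollectI conjI allI)
      fix k
      let ?e = "fst (snd z !! k)"
      have "?\<tau> (Suc k) - ?\<tau> k = \<mu> * real (nat \<lfloor>?e / - ln (1 - \<mu>)\<rfloor> + 1)"
        by (simp add: arrival_step_Suc algebra_simps)
      \<comment> \<open>Here \<open>\<mu> \<le> 1/2\<close> gives the factor one half that
        \<open>gap_bounded\<close> allows for.\<close>
      moreover have "?e * (1/2) \<le> ?e * (1 - \<mu>)" using gap0[OF z] mu by (intro mult_left_mono) auto
      ultimately show "d k / 2 \<le> ?\<tau> (Suc k) - ?\<tau> k" "?\<tau> (Suc k) - ?\<tau> k \<le> A k + 1"
        using gap_step_bounds[OF mu gap0[OF z, of k]] gap(1,2)[OF z, of k] mu by linarith+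
      have "arrival (snd z) (K k) * (1/2) \<le> arrival (snd z) (K k) * (1 - \<mu>)"
        using gap(3)[OF z, of k] mu by (intro mult_left_mono) auto
      then show "real k / 2 \<le> ?\<tau> (K k)"
        using arrival_step_bounds(1)[OF mu gap0[OF z], of "K k"] gap(3)[OF z, of k] by linarith
    qed (simp add: arrival_step_def)
    then show ?thesis unfolding approx_def approx_step_path[OF mu gap0[OF z]] flow_core_def using G_D(1)[OF z] by blast
  qed
  moreover have "limit_path z \<in> flow_core d A K R" if z: "z \<in> G" for z
  proof -
    have a: "arrival (snd z) \<in> gap_bounded d A K"
      unfolding gap_bounded_def
    proof (intro CollectI conjI allI)
      fix k
      show "d k / 2 \<le> arrival (snd z) (Suc k) - arrival (snd z) k" "arrival (snd z) (Suc k) - arrival (snd z) k \<le> A k + 1"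
        using gap(1,2)[OF z, of k] d[of k] by (simp_all add: arrival_def)
      show "real k / 2 \<le> arrival (snd z) (K k)" using gap(3)[OF z, of k] by simp
    qed (simp add: arrival_def)
    then have "clean (arrival (snd z)) = arrival (snd z)"
      using gap_bounded_jump_times[where d=d and A=A and K=K, OF d] by (auto simp: clean_def)
    then show ?thesis unfolding limit_path_def flow_core_def using G_D(1)[OF z] a by auto
  qed
  ultimately show ?thesis using d
    by (intro exI[of _ d] exI[of _ A] exI[of _ K] exI[of _ R])
      (auto simp: limit_law_def intro!: lower limit_path_measurable approx_measurable)
qed

lemma limit_law_solves:
  "AE z in limit_law. solves_switched_ode (G_field b F) (\<lambda>t. fst (z t)) (\<lambda>t. snd (z t)) \<and>
    regime_resets F (\<lambda>t. fst (z t)) (\<lambda>t. snd (z t))"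
proof (rule limit.AE_from_large_sets)
  fix \<eta> :: real assume "0 < \<eta>"
  then obtain d A K R where *: "\<And>k. 0 < d k" "1 - \<eta> \<le> measure limit_law (flow_core d A K R)"
    using flow_core_probability by meson
  show "\<exists>E\<in>sets limit_law. 1 - \<eta> \<le> measure limit_law E \<and> (\<forall>z\<in>E. solves_switched_ode (G_field b F) (\<lambda>t. fst (z t)) (\<lambda>t. snd (z t)) \<and>
    regime_resets F (\<lambda>t. fst (z t)) (\<lambda>t. snd (z t)))"
    using * flow_core_solves[where d=d, OF *(1)] compact_in_skorohod_borel[OF compactin_flow_core[OF *(1)]]
    by (intro bexI[of _ "flow_core d A K R"]) auto
qed

end

lemma (in prob_space) prob_tendsto_AE_eventually:
  assumes [measurable]: "\<And>n. A n \<in> events" "B \<in> events"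
    and lim: "AE \<omega> in M. eventually (\<lambda>n. \<omega> \<in> A n \<longleftrightarrow> \<omega> \<in> B) sequentially"
  shows "(\<lambda>n. prob (A n)) \<longlonglongrightarrow> prob B"
proof -
  have "(\<lambda>n. \<integral>\<omega>. indicator (A n) \<omega> \<partial>M) \<longlonglongrightarrow> (\<integral>\<omega>. indicator B \<omega> \<partial>M :: real)"
  proof (rule integral_dominated_convergence[where w="\<lambda>_. 1"])
    show "AE \<omega> in M. (\<lambda>n. indicator (A n) \<omega>) \<longlonglongrightarrow> (indicator B \<omega> :: real)"
      using lim
    proof eventually_elim
      case (elim \<omega>)
      show ?case by (rule tendsto_eventually, rule eventually_mono[OF elim]) (simp add: indicator_def)
    qed
  qed auto
  then show ?thesis by simp
qed

section \<open>Transfer of laws and finite-dimensional limits\<close>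

context switched_flow
begin

lemma chain_cylinder:
  assumes mu: "0 < \<mu>" "\<mu> \<le> 1/2" and B [measurable]: "B \<in> sets borel"
  shows "measure \<Omega> {z\<in>space \<Omega>. fst (fst z) \<in> B \<and> (\<forall>k\<le>n. chain_at \<mu> k z = x k)} =
    measure \<nu> (B \<times> {x 0}) * (\<Prod>k<n. (mat 1 + \<mu> *\<^sub>R Q) $ x k $ x (Suc k))"
proof -
  let ?l = "- ln (1 - \<mu>)"
  let ?C = "{\<omega>. \<forall>k\<le>n. chain ?l k (x 0) \<omega> = x k}"
  have "{z\<in>space \<Omega>. fst (fst z) \<in> B \<and> (\<forall>k\<le>n. chain_at \<mu> k z = x k)} = (B \<times> {x 0}) \<times> ?C"
  proof (intro equalityI subsetI)
    fix z assume z: "z \<in> {z\<in>space \<Omega>. fst (fst z) \<in> B \<and> (\<forall>k\<le>n. chain_at \<mu> k z = x k)}"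
    then have "chain_at \<mu> 0 z = x 0" by blast
    then have "snd (fst z) = x 0" by (simp add: chain_at_def)
    with z show "z \<in> (B \<times> {x 0}) \<times> ?C" by (cases z, cases "fst z") (auto simp: chain_at_def)
  qed (auto simp: chain_at_def)
  moreover have "B \<times> {x 0} \<in> sets \<nu>" unfolding sets_nu by (intro pair_measureI B) auto
  moreover have "{\<omega>\<in>space clock. \<forall>k\<le>n. chain ?l k (x 0) \<omega> = x k} \<in> sets clock" by measurable
  ultimately have "measure \<Omega> {z\<in>space \<Omega>. fst (fst z) \<in> B \<and> (\<forall>k\<le>n. chain_at \<mu> k z = x k)} =
      measure \<nu> (B \<times> {x 0}) * measure clock ?C"
    by (simp add: measure_def clock.emeasure_pair_measure_Times enn2real_mult)
  also have "measure clock ?C = (\<Prod>k<n. (mat 1 + \<mu> *\<^sub>R Q) $ x k $ x (Suc k))"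
    using rate_bounds(3,6)[OF mu] by (subst chain_law) (simp_all add: trans_def)
  finally show ?thesis .
qed

text \<open>Both sides are the image, under the same measurable map, of the initial regret with the
  coded sequence of regimes, and the cylinder probabilities of these agree.\<close>

lemma law_transfer:
  fixes M :: "'a measure" and \<theta> :: "nat \<Rightarrow> 'a \<Rightarrow> 'q"
  assumes M: "prob_space M" and r0: "r0 \<in> borel_measurable M"
    and th: "\<And>n. \<theta> n \<in> measurable M (count_space UNIV)" and mu: "0 < \<mu>" "\<mu> \<le> 1/2"
    and cyl: "\<And>B n x. B \<in> sets borel \<Longrightarrow> measure M {\<omega>\<in>space M. r0 \<omega> \<in> B \<and> (\<forall>k\<le>n. \<theta> k \<omega> = x k)} =
      measure \<nu> (B \<times> {x 0}) * (\<Prod>k<n. (mat 1 + \<mu> *\<^sub>R Q) $ x k $ x (Suc k))"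
  shows "distr M skorohod_borel (\<lambda>\<omega>. flow (r0 \<omega>) (interpolate \<mu> (\<lambda>n. \<theta> n \<omega>))) = distr \<Omega> skorohod_borel (approx \<mu>)"
proof -
  define g where "g p = param_flow (fst p, \<lambda>k. real k * \<mu>, snd p)" for p
  define pM where "pM \<omega> = (r0 \<omega>, \<lambda>k. to_nat (\<theta> k \<omega>))" for \<omega>
  define pO where "pO z = (fst (fst z), \<lambda>k. to_nat (chain_at \<mu> k z))" for z
  have pM: "pM \<in> borel_measurable M" unfolding pM_def by (intro borel_measurable_Pair encoding_measurable r0 th)
  have pO: "pO \<in> borel_measurable \<Omega>" unfolding pO_def by (intro borel_measurable_Pair encoding_measurable chain_at_measurable) measurable
  have shift: "continuous_on UNIV (\<lambda>p :: real \<times> (nat \<Rightarrow> nat). (fst p, \<lambda>k. real k * \<mu>, snd p))"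
    by (intro continuous_intros)
  have g: "g \<in> measurable borel skorohod_borel"
    unfolding g_def
    by (rule measurable_skorohod_borel[OF param_flow_continuous[of "UNIV \<times> jump_times \<times> UNIV"] borel_measurable_continuous_onI[OF shift]])
      (use mesh_jump_times[OF mu(1)] in auto)
  have "distr M borel pM = distr \<Omega> borel pO"
  proof (rule law_eqI[OF M pair.prob_space_axioms pM pO])
    fix B :: "real set" and n and x :: "nat \<Rightarrow> nat" assume B: "B \<in> sets borel"
    show "measure M {\<omega>\<in>space M. fst (pM \<omega>) \<in> B \<and> (\<forall>k\<le>n. snd (pM \<omega>) k = x k)} =
       measure \<Omega> {z\<in>space \<Omega>. fst (pO z) \<in> B \<and> (\<forall>k\<le>n. snd (pO z) k = x k)}"
    proof (cases "\<forall>k\<le>n. x k \<in> range (to_nat :: 'q \<Rightarrow> nat)")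
      case True
      define x' where "x' k = (from_nat (x k) :: 'q)" for k
      have eq: "to_nat q = x k \<longleftrightarrow> q = x' k" if "k \<le> n" for k q using True that by (auto simp: x'_def)
      show ?thesis unfolding pM_def pO_def fst_conv snd_conv
        using cyl[OF B, of n x'] chain_cylinder[OF mu B, of n x'] by (simp add: eq cong: conj_cong)
    next
      case False
      then obtain k where k: "k \<le> n" "x k \<notin> range (to_nat :: 'q \<Rightarrow> nat)" by blast
      \<comment> \<open>A number that codes no state makes both cylinders empty.\<close>
      then have none: "(\<forall>k\<le>n. to_nat (q k) = x k) = False" for q :: "nat \<Rightarrow> 'q" by (metis rangeI)
      show ?thesis unfolding pM_def pO_def fst_conv snd_conv none by simp
    qed
  qed
  then have "distr M skorohod_borel (g \<circ> pM) = distr \<Omega> skorohod_borel (g \<circ> pO)"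
    by (simp only: distr_distr[OF g pM, symmetric] distr_distr[OF g pO, symmetric])
  moreover have "g \<circ> pM = (\<lambda>\<omega>. flow (r0 \<omega>) (interpolate \<mu> (\<lambda>n. \<theta> n \<omega>)))" "g \<circ> pO = approx \<mu>"
    by (simp_all add: fun_eq_iff g_def pM_def pO_def param_flow_def approx_def interpolate_eq_step_path[OF mu(1)])
  ultimately show ?thesis by simp
qed

lemma limit_regime_measurable:
  assumes "0 \<le> t" shows "(\<lambda>z. snd (z t)) \<in> measurable limit_law (count_space UNIV)"
proof (subst measurable_count_space_eq2, simp, intro conjI ballI)
  fix q :: 'q
  have "(\<lambda>z. snd (z t)) -` {q} \<inter> space limit_law = {z \<in> cadlag. snd (z t) = q}"
    using sets_eq_imp_space_eq[OF sets_limit_law] by auto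
  then show "(\<lambda>z. snd (z t)) -` {q} \<inter> space limit_law \<in> limit.events"
    using measurable_skorohod_snd[OF assms, of q] by simp
qed simp

text \<open>At a fixed time the limit almost surely does not jump, except for the start at time 0.
  So the states of the chains at that time are eventually those of the limit, and the Markov formula
  of the chains passes to the limit together with the matrix powers.\<close>

lemma limit_ctmc: "ctmc limit_law Q (\<lambda>t z. snd (z t))"
  unfolding ctmc_def
proof (intro conjI allI impI limit_regime_measurable)
  fix n and t :: "nat \<Rightarrow> real" and x :: "nat \<Rightarrow> 'q"
  assume t: "0 \<le> t 0 \<and> incseq t"
  then have t0: "0 \<le> t k" for k using incseqD[of t 0 k] by linarith
  \<comment> \<open>The shift by 2 keeps every step size at most 1/2.\<close>
  define m :: "nat \<Rightarrow> real" where "m j = inverse (real (Suc (Suc j)))" for j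
  have m: "0 < m j" "m j \<le> 1/2" for j by (simp_all add: m_def field_simps)
  have m0: "m \<longlonglongrightarrow> 0" unfolding m_def by (rule LIMSEQ_Suc[OF LIMSEQ_inverse_real_of_nat])
  define N where "N j k = nat \<lfloor>t k / m j\<rfloor>" for j k
  define p where "p n = measure limit_law {z\<in>space limit_law. \<forall>k\<le>n. snd (z (t k)) = x k}" for n
  define pj where "pj j n = measure \<Omega> {z\<in>space \<Omega>. \<forall>k\<le>n. chain_at (m j) (N j k) z = x k}" for j n
  have lim: "(\<lambda>j. pj j n) \<longlonglongrightarrow> p n" for n
  proof -
    note [measurable] = limit_regime_measurable[OF t0]
    let ?B = "{z\<in>space limit_law. \<forall>k\<le>n. snd (z (t k)) = x k}"
    have B: "?B \<in> limit.events" by measurable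
    have sp: "space limit_law = cadlag" using sets_eq_imp_space_eq[OF sets_limit_law] by simp
    have pre: "limit_path -` ?B \<inter> space \<Omega> = {z\<in>space \<Omega>. \<forall>k\<le>n. snd (limit_path z (t k)) = x k}"
      by (auto simp: sp limit_path_cadlag)
    have B': "?B \<in> sets skorohod_borel" using B by (simp only: sets_limit_law)
    have p: "p n = measure \<Omega> {z\<in>space \<Omega>. \<forall>k\<le>n. snd (limit_path z (t k)) = x k}"
      unfolding p_def pre[symmetric] by (subst limit_law_def, rule measure_distr[OF limit_path_measurable B'])
    have E: "{z\<in>space \<Omega>. \<forall>k\<le>n. snd (limit_path z (t k)) = x k} \<in> pair.events"
      unfolding pre[symmetric] by (rule measurable_sets[OF limit_path_measurable B'])
    have ne: "AE z in \<Omega>. \<forall>i k. 0 < k \<longrightarrow> arrival (snd z) k \<noteq> t i"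
      by (intro AE_clock[where P="\<lambda>\<omega>. \<forall>i k. 0 < k \<longrightarrow> arrival \<omega> k \<noteq> t i"] AE_all_countable[THEN iffD2] allI)
        (auto simp: arrival_ne)
    show ?thesis unfolding p pj_def
    proof (rule pair.prob_tendsto_AE_eventually[OF _ E])
      show "AE z in \<Omega>. eventually (\<lambda>j. z \<in> {z\<in>space \<Omega>. \<forall>k\<le>n. chain_at (m j) (N j k) z = x k} \<longleftrightarrow>
         z \<in> {z\<in>space \<Omega>. \<forall>k\<le>n. snd (limit_path z (t k)) = x k}) sequentially"
        using ne AE_regular
      proof eventually_elim
        case (elim z)
        have "eventually (\<lambda>j. chain_at (m j) (N j k) z = snd (limit_path z (t k))) sequentially" for k
        proof -
          have "eventually (\<lambda>j. step_path (\<lambda>i. m j * real (arrival_step (- ln (1 - m j)) (snd z) i)) (state (snd (fst z)) (snd z)) (t k) =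
             step_path (arrival (snd z)) (state (snd (fst z)) (snd z)) (t k)) sequentially"
            by (intro step_path_eventually regular_clock[OF elim(2)] arrival_step_jump_times arrival_step_tendsto m m0 t0)
              (use elim(1) in auto)
          then show ?thesis
          proof eventually_elim
            case (elim j)
            have "chain_at (m j) (N j k) z = interpolate (m j) (\<lambda>n. chain_at (m j) n z) (t k)"
              using t0 by (simp add: interpolate_def N_def)
            also have "\<dots> = step_path (arrival (snd z)) (state (snd (fst z)) (snd z)) (t k)"
              using elim approx_step_path[OF m(1,2) regular_clock(3)] \<open>regular_clock (snd z)\<close> by simp
            also have "\<dots> = snd (limit_path z (t k))"
              using t0 regular_clock(2)[OF \<open>regular_clock (snd z)\<close>] by (simp add: limit_path_def flow_def)
            finally show ?case .
          qed
        qed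
        then have "eventually (\<lambda>j. \<forall>k\<in>{..n}. chain_at (m j) (N j k) z = snd (limit_path z (t k))) sequentially"
          by (intro eventually_ball_finite) auto
        then show ?case by (rule eventually_mono) auto
      qed
    qed measurable
  qed
  have "pj j n = pj j 0 * (\<Prod>k<n. mat_pow (mat 1 + m j *\<^sub>R Q) (N j (Suc k) - N j k) $ x k $ x (Suc k))" for j
  proof -
    interpret C: regime_chain \<Omega> "\<lambda>i. measure \<nu> (UNIV \<times> {i})" "mat 1 + m j *\<^sub>R Q" "chain_at (m j)"
    proof
      show "markov_chain \<Omega> (\<lambda>i. measure \<nu> (UNIV \<times> {i})) (mat 1 + m j *\<^sub>R Q) (chain_at (m j))"
        unfolding markov_chain_def using chain_cylinder[OF m, where B=UNIV] by simp
    qed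
    have "incseq (N j)" unfolding N_def incseq_def
      using t m(1)[of j] by (auto intro!: nat_mono floor_mono divide_right_mono simp: incseq_def)
    from C.marginals[OF this] show ?thesis unfolding pj_def by simp
  qed
  moreover have "(\<lambda>j. pj j 0 * (\<Prod>k<n. mat_pow (mat 1 + m j *\<^sub>R Q) (N j (Suc k) - N j k) $ x k $ x (Suc k)))
     \<longlonglongrightarrow> p 0 * (\<Prod>k<n. matrix_exp ((t (Suc k) - t k) *\<^sub>R Q) $ x k $ x (Suc k))"
  proof (intro tendsto_mult tendsto_prod lim mat_pow_tendsto_exp Q_le m m0)
    fix k
    have Nm: "(\<lambda>j. real (N j k) * m j) \<longlonglongrightarrow> t k" for k
    proof (rule tendsto_sandwich[of "\<lambda>j. t k - m j" _ _ "\<lambda>_. t k"])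
      have "t k - m j \<le> real (N j k) * m j \<and> real (N j k) * m j \<le> t k" for j
      proof -
        have "t k / m j - 1 \<le> real (N j k)" "real (N j k) \<le> t k / m j"
          using t0[of k] m(1)[of j] unfolding N_def by (simp_all add: of_nat_nat)
        then show ?thesis using m(1)[of j] by (simp add: field_simps)
      qed
      then show "eventually (\<lambda>j. t k - m j \<le> real (N j k) * m j) sequentially"
        "eventually (\<lambda>j. real (N j k) * m j \<le> t k) sequentially" by simp_all
      show "(\<lambda>j. t k - m j) \<longlonglongrightarrow> t k" using tendsto_diff[OF tendsto_const m0, of "t k"] by simp
    qed simp
    have "N j k \<le> N j (Suc k)" for j
      using t m(1)[of j] by (auto intro!: nat_mono floor_mono divide_right_mono simp: incseq_def N_def)
    then have "(\<lambda>j. real (N j (Suc k) - N j k) * m j) = (\<lambda>j. real (N j (Suc k)) * m j - real (N j k) * m j)"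
      by (simp add: of_nat_diff left_diff_distrib)
    then show "(\<lambda>j. real (N j (Suc k) - N j k) * m j) \<longlonglongrightarrow> t (Suc k) - t k"
      using tendsto_diff[OF Nm Nm] by simp
  qed
  ultimately have "p n = p 0 * (\<Prod>k<n. matrix_exp ((t (Suc k) - t k) *\<^sub>R Q) $ x k $ x (Suc k))"
    using lim[of n] by (simp add: LIMSEQ_unique)
  then show "measure limit_law {z\<in>space limit_law. \<forall>k\<le>n. snd (z (t k)) = x k} =
        measure limit_law {z\<in>space limit_law. snd (z (t 0)) = x 0} *
          (\<Prod>k<n. matrix_exp ((t (Suc k) - t k) *\<^sub>R Q) $ x k $ x (Suc k))"
    by (simp add: p_def)
qed

end

section \<open>Convergence and tightness\<close>

text \<open>All step sizes at once, with common \<open>C\<close> and \<open>\<beta>\<close>. The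
  response bound at every radius, \<open>lower\<close>, serves the iterates of processes whose step
  size stays away from 0.\<close>

locale tracking = prob_space M + uniformization Q + response b F
  for M :: "'a measure" and Q :: "real^('q::{finite,metric_space})^('q::{finite,metric_space})"
    and b :: "real^'s::finite \<Rightarrow> real^'s" and F :: "'s \<Rightarrow> 'q \<Rightarrow> real" +
  fixes f :: "nat \<Rightarrow> 's \<Rightarrow> 'q \<Rightarrow> 'a \<Rightarrow> real" and \<theta> :: "real \<Rightarrow> nat \<Rightarrow> 'a \<Rightarrow> 'q" and s :: "real \<Rightarrow> nat \<Rightarrow> 'a \<Rightarrow> 's"
    and r0 :: "'a \<Rightarrow> real" and \<mu>0 C \<beta> :: real
  assumes mu0: "0 < \<mu>0" "\<mu>0 \<le> 1"
    and simulation: "\<And>\<mu>. \<mu> \<in> {0<..\<mu>0} \<Longrightarrow> simulation M b F f (\<theta> \<mu>) (s \<mu>) \<mu> C \<beta>"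
    and averages: "\<And>i j \<delta>. 0 < \<delta> \<Longrightarrow> uniform_limit ({0<..\<mu>0} \<times> UNIV)
        (\<lambda>n (\<epsilon>, l). prob {\<omega>\<in>space M. \<bar>avg_cond_exp M f (\<theta> \<epsilon>) l n i j \<omega> - F i j\<bar> > \<delta>}) (\<lambda>_. 0) sequentially"
    and initial: "admissible_initial_regret M {0<..\<mu>0} (\<lambda>e. mat 1 + e *\<^sub>R Q) \<theta> r0"
    and lower: "\<And>B. \<exists>\<beta>>0. \<forall>v i. norm v \<le> B \<longrightarrow> \<beta> \<le> b v $ i"
begin

definition y :: "real \<Rightarrow> 'a \<Rightarrow> nat \<Rightarrow> 's \<Rightarrow> real" where "y \<mu> \<omega> n i = f n i (\<theta> \<mu> n \<omega>) \<omega>"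

definition X :: "real \<Rightarrow> 'a \<Rightarrow> nat \<Rightarrow> (real^'s) \<times> real" where
  "X \<mu> \<omega> = X_rec \<mu> b F (y \<mu> \<omega>) (\<lambda>n. s \<mu> n \<omega>) (\<lambda>n. \<theta> \<mu> n \<omega>) (r0 \<omega>)"

definition Z :: "real \<Rightarrow> 'a \<Rightarrow> real \<Rightarrow> ((real^'s) \<times> real) \<times> 'q" where
  "Z \<mu> \<omega> = interpolate \<mu> (\<lambda>n. (X \<mu> \<omega> n, \<theta> \<mu> n \<omega>))"

text \<open>The intermediate process: it lives on the space of the algorithm, so it is compared with
  \<open>Z\<close> pathwise, and it has the law of \<open>approx\<close>, so it is compared with the
  limit in distribution.\<close>

definition W :: "real \<Rightarrow> 'a \<Rightarrow> real \<Rightarrow> ((real^'s) \<times> real) \<times> 'q" where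
  "W \<mu> \<omega> = flow (r0 \<omega>) (interpolate \<mu> (\<lambda>n. \<theta> \<mu> n \<omega>))"

text \<open>The step size \<open>\<mu>0\<close> is a representative; the joint initial law is the
  same for all of them.\<close>

definition \<nu> :: "(real \<times> 'q) measure" where
  "\<nu> = distr M (borel \<Otimes>\<^sub>M count_space UNIV) (\<lambda>\<omega>. (r0 \<omega>, \<theta> \<mu>0 0 \<omega>))"

lemma C_beta: "0 < C" "0 < \<beta>"
  using simulation.C simulation.beta simulation mu0 by (metis greaterThanAtMost_iff order_refl)+

lemma f_meas [measurable]: "f n i j \<in> borel_measurable M"
  using simulation.f_meas[OF simulation[of \<mu>0]] mu0 by simp

lemma theta_meas: "\<mu> \<in> {0<..\<mu>0} \<Longrightarrow> \<theta> \<mu> n \<in> measurable M (count_space UNIV)"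
  using simulation.theta_meas[OF simulation] .

lemma r0_meas [measurable]: "r0 \<in> borel_measurable M"
  using initial by (simp add: admissible_initial_regret_def)

lemma initial_measurable:
  assumes "\<mu> \<in> {0<..\<mu>0}" shows "(\<lambda>\<omega>. (r0 \<omega>, \<theta> \<mu> 0 \<omega>)) \<in> measurable M (borel \<Otimes>\<^sub>M count_space UNIV)"
  using theta_meas[OF assms, of 0] by simp

lemma prob_space_initial: "prob_space \<nu>"
  unfolding \<nu>_def by (rule prob_space_distr, rule initial_measurable) (use mu0 in simp)

sublocale switched_flow Q b F \<nu>
  by (intro switched_flow.intro switched_flow_axioms.intro uniformization_axioms response_axioms prob_space_initial)
    (simp add: \<nu>_def)

lemma X_measurable:
  assumes mu: "\<mu> \<in> {0<..\<mu>0}" shows "(\<lambda>\<omega>. X \<mu> \<omega> n) \<in> borel_measurable M"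
proof -
  interpret S: simulation M b F f "\<theta> \<mu>" "s \<mu>" \<mu> C \<beta> by (rule simulation[OF mu])
  have y: "S.y = y \<mu>" by (simp add: fun_eq_iff y_def S.y_def)
  have yS [measurable]: "(\<lambda>\<omega>. y \<mu> \<omega> n (s \<mu> n \<omega>)) \<in> borel_measurable M" for n
    using measurable_compose_countable[OF S.y_meas S.s_meas] by (simp add: y)
  have q [measurable]: "(\<lambda>\<omega>. g (\<theta> \<mu> n \<omega>)) \<in> borel_measurable M" for g :: "'q \<Rightarrow> 'v::topological_space" and n
    using measurable_compose[OF S.theta_meas[of n], of g borel] by simp
  have "(\<lambda>\<omega>. fst (X \<mu> \<omega> n)) \<in> borel_measurable M" for n
    using S.v_meas[of n] unfolding S.v_def y X_def fst_X_rec by measurable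
  moreover have "(\<lambda>\<omega>. snd (X \<mu> \<omega> n)) \<in> borel_measurable M" for n
  proof (induction n)
    case (Suc n)
    note [measurable] = this
    have "snd (X \<mu> \<omega> (Suc n)) = snd (X \<mu> \<omega> n) + \<mu> * (y \<mu> \<omega> n (s \<mu> n \<omega>) - F_min F (\<theta> \<mu> n \<omega>) - snd (X \<mu> \<omega> n)) +
        (F_min F (\<theta> \<mu> n \<omega>) - F_min F (\<theta> \<mu> (Suc n) \<omega>))" for \<omega> by (simp add: X_def)
    then show ?case by simp
  qed (simp add: X_def)
  ultimately have "(\<lambda>\<omega>. (fst (X \<mu> \<omega> n), snd (X \<mu> \<omega> n))) \<in> borel_measurable M" by (rule borel_measurable_Pair)
  then show ?thesis by simp
qed

lemma Z_measurable:
  assumes mu: "\<mu> \<in> {0<..\<mu>0}" shows "Z \<mu> \<in> measurable M skorohod_borel"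
proof -
  let ?P = "{p :: real \<times> (nat \<Rightarrow> (real^'s) \<times> real) \<times> (nat \<Rightarrow> nat). 0 < fst p}"
  have "(\<lambda>\<omega>. (\<mu>, \<lambda>n. X \<mu> \<omega> n, \<lambda>n. to_nat (\<theta> \<mu> n \<omega>))) \<in> borel_measurable M"
    by (intro borel_measurable_Pair encoding_measurable measurable_coordinatewise_then_product X_measurable theta_meas mu) simp
  from measurable_skorohod_borel[OF interpolate_continuous[where 'q='q and P="?P"] this] mu
  show ?thesis by (simp add: Z_def[abs_def])
qed

lemma W_measurable:
  assumes mu: "\<mu> \<in> {0<..\<mu>0}" shows "W \<mu> \<in> measurable M skorohod_borel"
proof -
  have pos: "0 < \<mu>" using mu by simp
  show ?thesis unfolding W_def[abs_def] interpolate_eq_step_path[OF pos]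
    by (intro param_flow_measurable mesh_jump_times theta_meas[OF mu] r0_meas pos) simp
qed

lemma W_law:
  assumes mu: "\<mu> \<in> {0<..\<mu>0}" "\<mu> \<le> 1/2"
  shows "distr M skorohod_borel (W \<mu>) = distr \<Omega> skorohod_borel (approx \<mu>)"
  unfolding W_def[abs_def]
proof (rule law_transfer[OF prob_space_axioms r0_meas theta_meas[OF mu(1)] _ mu(2)])
  show "0 < \<mu>" using mu by simp
  fix B :: "real set" and n and x :: "nat \<Rightarrow> 'q" assume B: "B \<in> sets borel"
  have 0: "\<mu>0 \<in> {0<..\<mu>0}" using mu0 by simp
  note pm = initial_measurable[OF mu(1)]
  have BX: "B \<times> {x 0} \<in> sets (borel \<Otimes>\<^sub>M count_space UNIV)" using B by (intro pair_measureI) auto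
  have "prob {\<omega>\<in>space M. r0 \<omega> \<in> B \<and> (\<forall>k\<le>n. \<theta> \<mu> k \<omega> = x k)} =
    prob {\<omega>\<in>space M. r0 \<omega> \<in> B \<and> \<theta> \<mu> 0 \<omega> = x 0} * (\<Prod>k<n. (mat 1 + \<mu> *\<^sub>R Q) $ x k $ x (Suc k))"
    using initial mu(1) B unfolding admissible_initial_regret_def by blast
  also have "prob {\<omega>\<in>space M. r0 \<omega> \<in> B \<and> \<theta> \<mu> 0 \<omega> = x 0} =
      measure (distr M (borel \<Otimes>\<^sub>M count_space UNIV) (\<lambda>\<omega>. (r0 \<omega>, \<theta> \<mu> 0 \<omega>))) (B \<times> {x 0})"
    unfolding measure_distr[OF pm BX] by (rule arg_cong[where f=prob]) auto
  also have "\<dots> = measure \<nu> (B \<times> {x 0})"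
    using initial mu(1) 0 unfolding admissible_initial_regret_def \<nu>_def by (metis (no_types, lifting))
  finally show "prob {\<omega>\<in>space M. r0 \<omega> \<in> B \<and> (\<forall>k\<le>n. \<theta> \<mu> k \<omega> = x k)} =
    measure \<nu> (B \<times> {x 0}) * (\<Prod>k<n. (mat 1 + \<mu> *\<^sub>R Q) $ x k $ x (Suc k))" .
qed

end

section \<open>Closeness of the process to the flow of its own regime\<close>

context tracking
begin

text \<open>Bounded averages that converge in probability converge in mean. Uniformity in (A2) gives
  one window length for all starting times and all step sizes.\<close>

lemma averages_L1:
  assumes kappa: "0 < \<kappa>"
  shows "\<exists>N>0. \<forall>\<mu>\<in>{0<..\<mu>0}. \<forall>l i j. expectation (\<lambda>\<omega>. \<bar>avg_cond_exp M f (\<theta> \<mu>) l N i j \<omega> - F i j\<bar>) \<le> \<kappa>"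
proof -
  define D where "D = C + F_bound F"
  have D: "0 \<le> D" using C_beta F_bound_ge0[of F] by (simp add: D_def)
  define \<delta> where "\<delta> = \<kappa> / 2"
  \<comment> \<open>The exceptional event contributes at most \<open>D * \<rho>\<close>, which is at
    most \<open>\<kappa> / 2\<close>.\<close>
  define \<rho> where "\<rho> = \<kappa> / (2 * (D + 1))"
  have pos: "0 < \<delta>" "0 < \<rho>" using kappa D by (auto simp: \<delta>_def \<rho>_def)
  let ?P = "\<lambda>n i j \<mu> l. prob {\<omega>\<in>space M. \<bar>avg_cond_exp M f (\<theta> \<mu>) l n i j \<omega> - F i j\<bar> > \<delta>}"
  have "eventually (\<lambda>n. \<forall>\<mu>\<in>{0<..\<mu>0}. \<forall>l. ?P n i j \<mu> l < \<rho>) sequentially" for i j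
    using uniform_limitD[OF averages[OF pos(1), of i j] pos(2)] by (rule eventually_mono) auto
  then have "eventually (\<lambda>n. \<forall>p. \<forall>\<mu>\<in>{0<..\<mu>0}. \<forall>l. ?P n (fst p) (snd p) \<mu> l < \<rho>) sequentially"
    by (intro eventually_all_finite) blast
  then have "eventually (\<lambda>n. 0 < n \<and> (\<forall>p. \<forall>\<mu>\<in>{0<..\<mu>0}. \<forall>l. ?P n (fst p) (snd p) \<mu> l < \<rho>)) sequentially"
    using eventually_gt_at_top[of 0] by (rule eventually_conj[rotated])
  then obtain N where N: "0 < N" "\<And>\<mu> l i j. \<mu> \<in> {0<..\<mu>0} \<Longrightarrow> ?P N i j \<mu> l < \<rho>"
    by (auto simp: eventually_sequentially)
  have "expectation (\<lambda>\<omega>. \<bar>avg_cond_exp M f (\<theta> \<mu>) l N i j \<omega> - F i j\<bar>) \<le> \<kappa>" if mu: "\<mu> \<in> {0<..\<mu>0}" for \<mu> l i j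
  proof -
    interpret S: simulation M b F f "\<theta> \<mu>" "s \<mu>" \<mu> C \<beta> by (rule simulation[OF mu])
    let ?g = "\<lambda>\<omega>. \<bar>avg_cond_exp M f (\<theta> \<mu>) l N i j \<omega> - F i j\<bar>"
    have [measurable]: "avg_cond_exp M f (\<theta> \<mu>) l N i j \<in> borel_measurable M"
      unfolding avg_cond_exp_def[abs_def] by measurable
    let ?A = "{\<omega>\<in>space M. \<delta> < ?g \<omega>}"
    have b: "AE \<omega> in M. ?g \<omega> \<le> D" using S.avg_cond_exp_bound[OF N(1)] by (simp add: D_def)
    have "expectation ?g \<le> expectation (\<lambda>\<omega>. \<delta> + D * indicator ?A \<omega>)"
    proof (rule integral_mono_AE)
      show "integrable M ?g" using b by (intro bounded_integrable) auto
      show "integrable M (\<lambda>\<omega>. \<delta> + D * indicator ?A \<omega>)" by (intro Bochner_Integration.integrable_add integrable_mult_right integrable_real_indicator) (auto simp: emeasure_eq_measure)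
      show "AE \<omega> in M. ?g \<omega> \<le> \<delta> + D * indicator ?A \<omega>"
        using b AE_space by eventually_elim (use pos in \<open>auto simp: indicator_def\<close>)
    qed
    also have "\<dots> = \<delta> + D * prob ?A" by (subst Bochner_Integration.integral_add) (auto simp: emeasure_eq_measure prob_space)
    also have "\<dots> \<le> \<delta> + D * \<rho>" using N(2)[OF mu, of l i j] D by (intro add_left_mono mult_left_mono) auto
    also have "D * \<rho> = \<kappa> / 2 * (D / (D + 1))" using D by (simp add: \<rho>_def)
    also have "\<dots> \<le> \<kappa> / 2 * 1" using D kappa by (intro mult_left_mono) simp_all
    finally show ?thesis by (simp add: \<delta>_def)
  qed
  then show ?thesis using N(1) by blast
qed

text \<open>Constants are fixed in the order initial bound \<open>R\<close>, noise level
  \<open>\<delta>\<close>, averaging accuracy \<open>\<kappa>\<close>, window length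
  \<open>N\<close>, step size. Both processes switch at the same instants, so the identity time
  change is enough.\<close>

lemma closeness:
  assumes pos: "0 < T" "0 < e" "0 < \<eta>"
  shows "\<exists>\<mu>1>0. \<forall>\<mu>\<in>{0<..\<mu>0}. \<mu> \<le> \<mu>1 \<longrightarrow> (\<exists>A\<in>events. 1 - \<eta> \<le> prob A \<and> (\<forall>\<omega>\<in>A. Z \<mu> \<omega> \<in> skorohod_nbhd (W \<mu> \<omega>) T e))"
proof -
  have eta: "0 < \<eta> / 2" using pos by simp
  obtain R where R: "0 \<le> R" "1 - \<eta> / 2 \<le> prob {\<omega>\<in>space M. \<bar>r0 \<omega>\<bar> \<le> R}"
    using bounded_with_large_probability[OF r0_meas eta] by blast
  obtain \<delta> \<mu>1 where \<delta>: "0 < \<delta>" and \<mu>1: "0 < \<mu>1" and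
    stable: "\<forall>\<mu> y s \<theta> r0. 0 < \<mu> \<longrightarrow> \<mu> \<le> \<mu>1 \<longrightarrow> \<bar>r0\<bar> \<le> R \<longrightarrow> (\<forall>k i. \<bar>y k i\<bar> \<le> C) \<longrightarrow>
     (\<forall>m. real m * \<mu> \<le> T \<longrightarrow> \<bar>value_noise \<mu> y s m\<bar> \<le> \<delta> \<and>
       (\<forall>i. \<bar>sampling_noise \<mu> (F_bound F + 1) y s i m\<bar> \<le> \<delta> \<and> \<bar>data_noise \<mu> y \<theta> i m\<bar> \<le> \<delta>)) \<longrightarrow>
     (\<forall>t\<in>{0..T}. dist (interpolate \<mu> (\<lambda>n. (X_rec \<mu> b F y s \<theta> r0 n, \<theta> n)) t) (flow r0 (interpolate \<mu> \<theta>) t) < e)"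
    using pathwise_stability[OF pos(1,2) less_imp_le[OF C_beta(1)] R(1)] by (elim exE conjE) (rule that)
  obtain \<kappa> where kappa: "0 < \<kappa>" and noise: "\<forall>N>0. \<exists>\<mu>1>0. \<forall>\<theta> s \<mu>. simulation M b F f \<theta> s \<mu> C \<beta> \<longrightarrow> \<mu> \<le> \<mu>1 \<longrightarrow>
    (\<forall>l i j. (\<integral>\<omega>. \<bar>avg_cond_exp M f \<theta> l N i j \<omega> - F i j\<bar> \<partial>M) \<le> \<kappa>) \<longrightarrow>
    measure M (simulation.noisy M b F f \<theta> s \<mu> T \<delta>) \<le> \<eta> / 2"
    using noisy_small[OF pos(1) \<delta> eta C_beta, of M b F f] by (elim exE conjE) (rule that)
  obtain N where N0: "0 < N" and N: "\<forall>\<mu>\<in>{0<..\<mu>0}. \<forall>l i j. expectation (\<lambda>\<omega>. \<bar>avg_cond_exp M f (\<theta> \<mu>) l N i j \<omega> - F i j\<bar>) \<le> \<kappa>"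
    using averages_L1[OF kappa] by (elim exE conjE) (rule that)
  obtain \<mu>2 where \<mu>2: "0 < \<mu>2" and small: "\<forall>\<theta> s \<mu>. simulation M b F f \<theta> s \<mu> C \<beta> \<longrightarrow> \<mu> \<le> \<mu>2 \<longrightarrow>
    (\<forall>l i j. (\<integral>\<omega>. \<bar>avg_cond_exp M f \<theta> l N i j \<omega> - F i j\<bar> \<partial>M) \<le> \<kappa>) \<longrightarrow>
    measure M (simulation.noisy M b F f \<theta> s \<mu> T \<delta>) \<le> \<eta> / 2"
    using noise[rule_format, OF N0] by (elim exE conjE) (rule that)
  define B where "B = max (max C (C / \<beta>)) (C + F_bound F)"
  have B: "0 < B" "C \<le> B" "C / \<beta> \<le> B" "C + F_bound F \<le> B" using C_beta by (auto simp: B_def)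
  \<comment> \<open>Ensures the smallness of single increments that the grid argument for the noise
    demands.\<close>
  define \<mu>3 where "\<mu>3 = \<delta> / real CARD('s) / (4 * B)"
  have \<mu>3: "0 < \<mu>3" using B \<delta> by (simp add: \<mu>3_def)
  have "\<exists>A\<in>events. 1 - \<eta> \<le> prob A \<and> (\<forall>\<omega>\<in>A. Z \<mu> \<omega> \<in> skorohod_nbhd (W \<mu> \<omega>) T e)"
    if mu: "\<mu> \<in> {0<..\<mu>0}" and le: "\<mu> \<le> min \<mu>1 (min \<mu>2 \<mu>3)" for \<mu>
  proof -
    interpret S: simulation M b F f "\<theta> \<mu>" "s \<mu>" \<mu> C \<beta> by (rule simulation[OF mu])
    have y: "S.y = y \<mu>" by (simp add: fun_eq_iff y_def S.y_def)
    have noisy: "prob (S.noisy T \<delta>) \<le> \<eta> / 2"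
      by (rule small[rule_format, OF S.simulation_axioms]) (use le N mu in auto)
    have noisy_event: "S.noisy T \<delta> \<in> events"
    proof (rule S.noisy_prob(1)[OF N[rule_format, OF mu] N0 \<delta> less_imp_le[OF pos(1)] _ _ _ refl])
      show "4 * B * \<mu> \<le> \<delta> / real CARD('s)"
        using mult_left_mono[of \<mu> \<mu>3 "4 * B"] le B by (simp add: \<mu>3_def field_simps)
    qed (use B in \<open>simp_all add: S.dev_bound_def\<close>)
    define G where "G = {\<omega>\<in>space M. \<bar>r0 \<omega>\<bar> \<le> R}"
    define Y where "Y = {\<omega>\<in>space M. \<forall>n i. \<bar>S.y \<omega> n i\<bar> \<le> C}"
    have GY: "G \<in> events" "Y \<in> events" unfolding G_def Y_def by measurable
    have "prob Y = 1" unfolding Y_def using S.y_bound by (subst prob_Collect_eq_1) measurable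
    define A where "A = G \<inter> Y - S.noisy T \<delta>"
    have A: "A \<in> events" unfolding A_def using GY noisy_event by auto
    have "prob (space M - A) \<le> \<eta>"
    proof -
      have "space M - A \<subseteq> (space M - G) \<union> ((space M - Y) \<union> S.noisy T \<delta>)" by (auto simp: A_def)
      then have "prob (space M - A) \<le> prob ((space M - G) \<union> ((space M - Y) \<union> S.noisy T \<delta>))"
        using GY noisy_event by (intro finite_measure_mono) auto
      also have "\<dots> \<le> prob (space M - G) + prob ((space M - Y) \<union> S.noisy T \<delta>)"
        using GY noisy_event by (intro measure_Un_le) auto
      also have "prob ((space M - Y) \<union> S.noisy T \<delta>) \<le> prob (space M - Y) + prob (S.noisy T \<delta>)"
        using GY noisy_event by (intro measure_Un_le) auto
      also have "prob (space M - G) \<le> \<eta> / 2" using prob_compl[OF GY(1)] R(2) by (simp add: G_def)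
      also have "prob (space M - Y) = 0" using prob_compl[OF GY(2)] \<open>prob Y = 1\<close> by simp
      finally show ?thesis using noisy by simp
    qed
    then have "1 - \<eta> \<le> prob A" using prob_compl[OF A] by simp
    moreover have "Z \<mu> \<omega> \<in> skorohod_nbhd (W \<mu> \<omega>) T e" if w: "\<omega> \<in> A" for \<omega>
    proof -
      have "Z \<mu> \<omega> \<in> cadlag" using measurable_space[OF Z_measurable[OF mu]] w A sets.sets_into_space by fastforce
      moreover have "dist (Z \<mu> \<omega> t) (W \<mu> \<omega> t) < e" if "t \<in> {0..T}" for t
        unfolding Z_def W_def X_def
        by (rule stable[rule_format, OF _ _ _ _ _ that]) (use w le mu in \<open>auto simp: A_def G_def Y_def S.noisy_def y\<close>)
      ultimately show ?thesis unfolding skorohod_nbhd_def using pos(2) time_changes_id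
        by (auto intro!: bexI[of _ "\<lambda>t. t"])
    qed
    ultimately show ?thesis using A by blast
  qed
  then show ?thesis using \<mu>1 \<mu>2 \<mu>3 by (intro exI[of _ "min \<mu>1 (min \<mu>2 \<mu>3)"]) auto
qed

end

lemma (in prob_space) prob_Int_ge:
  assumes "A \<in> events" "B \<in> events" "1 - a \<le> prob A" "1 - c \<le> prob B"
  shows "1 - (a + c) \<le> prob (A \<inter> B)"
proof -
  have "prob (space M - A \<inter> B) \<le> prob ((space M - A) \<union> (space M - B))"
    using assms by (intro finite_measure_mono) auto
  also have "\<dots> \<le> prob (space M - A) + prob (space M - B)" using assms by (intro measure_Un_le) auto
  finally show ?thesis using assms prob_compl[of A] prob_compl[of B] prob_compl[of "A \<inter> B"] by auto
qed

section \<open>Weak limit and tightness\<close>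

context tracking
begin

lemma Z_cadlag: "\<mu> \<in> {0<..\<mu>0} \<Longrightarrow> \<omega> \<in> space M \<Longrightarrow> Z \<mu> \<omega> \<in> cadlag"
  using measurable_space[OF Z_measurable] by simp

lemma W_cadlag: "\<mu> \<in> {0<..\<mu>0} \<Longrightarrow> \<omega> \<in> space M \<Longrightarrow> W \<mu> \<omega> \<in> cadlag"
  using measurable_space[OF W_measurable] by simp

lemma W_in_core:
  assumes "0 < \<eta>"
  shows "\<exists>K. compactin skorohod_topology K \<and>
    (\<forall>\<mu>\<in>{0<..\<mu>0}. \<mu> \<le> 1/2 \<longrightarrow> 1 - \<eta> \<le> prob (W \<mu> -` K \<inter> space M))"
proof -
  obtain d A K R where d: "\<And>k. 0 < d k" and
    core: "\<forall>\<mu>. 0 < \<mu> \<longrightarrow> \<mu> \<le> 1/2 \<longrightarrow> 1 - \<eta> \<le> measure (distr \<Omega> skorohod_borel (approx \<mu>)) (flow_core d A K R)"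
    using flow_core_probability[OF assms] by meson
  have c: "compactin skorohod_topology (flow_core d A K R)" by (rule compactin_flow_core[OF d])
  have "1 - \<eta> \<le> prob (W \<mu> -` flow_core d A K R \<inter> space M)" if mu: "\<mu> \<in> {0<..\<mu>0}" "\<mu> \<le> 1/2" for \<mu>
  proof -
    have "1 - \<eta> \<le> measure (distr \<Omega> skorohod_borel (approx \<mu>)) (flow_core d A K R)"
      using core mu by simp
    then show ?thesis
      unfolding W_law[OF mu, symmetric] measure_distr[OF W_measurable[OF mu(1)] compact_in_skorohod_borel[OF c]] .
  qed
  then show ?thesis using c by blast
qed

text \<open>The integrals of \<open>W\<close> converge by equality of laws with
  \<open>approx\<close>. Those of \<open>Z\<close> differ little: with large probability
  \<open>W\<close> lies in a compact set at which \<open>h\<close> is uniformly continuous, and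
  \<open>Z\<close> lies near \<open>W\<close>.\<close>

lemma weak_limit:
  assumes h: "continuous_map skorohod_topology euclideanreal h" "bounded (h ` topspace skorohod_topology)"
  shows "((\<lambda>\<mu>. \<integral>\<omega>. h (Z \<mu> \<omega>) \<partial>M) \<longlongrightarrow> (\<integral>z. h z \<partial>limit_law)) (at_right 0)"
proof -
  obtain B' where B': "\<And>x. x \<in> cadlag \<Longrightarrow> \<bar>h x\<bar> \<le> B'"
    using h(2) unfolding bounded_iff topspace_skorohod by auto
  define B where "B = max 1 B'"
  have B: "0 < B" "\<And>x. x \<in> cadlag \<Longrightarrow> \<bar>h x\<bar> \<le> B" using B' by (auto simp: B_def le_max_iff_disj)
  note hm [measurable] = continuous_skorohod_borel_measurable[OF h(1)]
  define \<mu>h where "\<mu>h = min \<mu>0 (1/2)"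
  have muh: "0 < \<mu>h" using mu0 by (simp add: \<mu>h_def)
  have near: "eventually (\<lambda>\<mu>. \<mu> \<in> {0<..\<mu>0} \<and> \<mu> \<le> 1/2) (at_right 0)"
    using eventually_at_right_less[of "0::real"] eventually_at_right_real[OF muh]
    by eventually_elim (auto simp: \<mu>h_def)
  have "((\<lambda>\<mu>. \<integral>\<omega>. h (W \<mu> \<omega>) \<partial>M) \<longlongrightarrow> (\<integral>z. h z \<partial>limit_law)) (at_right 0)"
  proof (rule Lim_transform_eventually[OF approx_integral_tendsto[OF h]])
    show "eventually (\<lambda>\<mu>. (\<integral>z. h (approx \<mu> z) \<partial>\<Omega>) = (\<integral>\<omega>. h (W \<mu> \<omega>) \<partial>M)) (at_right 0)"
      using near
    proof eventually_elim
      case (elim \<mu>)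
      then have mu: "\<mu> \<in> {0<..\<mu>0}" "\<mu> \<le> 1/2" "0 < \<mu>" by auto
      have "(\<integral>z. h (approx \<mu> z) \<partial>\<Omega>) = (\<integral>z. h z \<partial>distr \<Omega> skorohod_borel (approx \<mu>))"
        by (rule integral_distr[OF approx_measurable[OF mu(3)] hm, symmetric])
      also have "\<dots> = (\<integral>\<omega>. h (W \<mu> \<omega>) \<partial>M)"
        unfolding W_law[OF mu(1,2), symmetric] by (rule integral_distr[OF W_measurable[OF mu(1)] hm])
      finally show ?case .
    qed
  qed
  moreover have "((\<lambda>\<mu>. (\<integral>\<omega>. h (Z \<mu> \<omega>) \<partial>M) - (\<integral>\<omega>. h (W \<mu> \<omega>) \<partial>M)) \<longlongrightarrow> 0) (at_right 0)"
  proof (rule tendstoI)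
    fix d :: real assume d: "0 < d"
    \<comment> \<open>Two exceptional events of probability \<open>\<eta>\<close> each, where the
      integrands differ by at most \<open>2 * B\<close>, contribute \<open>d / 2\<close>; the rest
      contributes \<open>d / 4\<close>.\<close>
    define \<eta> where "\<eta> = d / (8 * B)"
    have eta: "0 < \<eta>" using d B by (simp add: \<eta>_def)
    obtain K where K: "compactin skorohod_topology K"
      and WK: "\<forall>\<mu>\<in>{0<..\<mu>0}. \<mu> \<le> 1/2 \<longrightarrow> 1 - \<eta> \<le> prob (W \<mu> -` K \<inter> space M)"
      using W_in_core[OF eta] by blast
    have "0 < d / 4" using d by simp
    from compactin_skorohod_continuous[OF K h(1) this]
    obtain T e where Te: "0 < T" "0 < e" and osc: "\<And>x y. x \<in> K \<Longrightarrow> y \<in> skorohod_nbhd x T e \<Longrightarrow> \<bar>h y - h x\<bar> < d / 4"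
      by blast
    obtain \<mu>1 where mu1: "0 < \<mu>1" and close: "\<forall>\<mu>\<in>{0<..\<mu>0}. \<mu> \<le> \<mu>1 \<longrightarrow>
        (\<exists>A\<in>events. 1 - \<eta> \<le> prob A \<and> (\<forall>\<omega>\<in>A. Z \<mu> \<omega> \<in> skorohod_nbhd (W \<mu> \<omega>) T e))"
      using closeness[OF Te eta] by blast
    have "\<bar>(\<integral>\<omega>. h (Z \<mu> \<omega>) \<partial>M) - (\<integral>\<omega>. h (W \<mu> \<omega>) \<partial>M)\<bar> < d"
      if mu: "\<mu> \<in> {0<..\<mu>0}" "\<mu> \<le> 1/2" "\<mu> \<le> \<mu>1" for \<mu>
    proof -
      note [measurable] = Z_measurable[OF mu(1)] W_measurable[OF mu(1)]
      obtain A where A: "A \<in> events" "1 - \<eta> \<le> prob A" "\<And>\<omega>. \<omega> \<in> A \<Longrightarrow> Z \<mu> \<omega> \<in> skorohod_nbhd (W \<mu> \<omega>) T e"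
        using close mu(1,3) by blast
      define G where "G = A \<inter> (W \<mu> -` K \<inter> space M)"
      have WKe: "W \<mu> -` K \<inter> space M \<in> events"
        by (rule measurable_sets[OF W_measurable[OF mu(1)] compact_in_skorohod_borel[OF K]])
      have G: "G \<in> events" "1 - (\<eta> + \<eta>) \<le> prob G"
        using A WKe prob_Int_ge[OF A(1) WKe A(2) WK[rule_format, OF mu(1,2)]] by (auto simp: G_def)
      have bound: "\<bar>h (Z \<mu> \<omega>) - h (W \<mu> \<omega>)\<bar> \<le> d / 4 + 2 * B * indicator (space M - G) \<omega>" if w: "\<omega> \<in> space M" for \<omega>
      proof (cases "\<omega> \<in> G")
        case True
        then show ?thesis using osc[of "W \<mu> \<omega>" "Z \<mu> \<omega>"] A(3)[of \<omega>] by (auto simp: G_def)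
      next
        case False
        then show ?thesis
          using w B(2)[OF Z_cadlag[OF mu(1) w]] B(2)[OF W_cadlag[OF mu(1) w]] d by (simp add: indicator_def)
      qed
      have iZ: "integrable M (\<lambda>\<omega>. h (Z \<mu> \<omega>))" "integrable M (\<lambda>\<omega>. h (W \<mu> \<omega>))"
        using B(2)[OF Z_cadlag[OF mu(1)]] B(2)[OF W_cadlag[OF mu(1)]] by (auto intro!: bounded_integrable[where B=B])
      then have "\<bar>(\<integral>\<omega>. h (Z \<mu> \<omega>) \<partial>M) - (\<integral>\<omega>. h (W \<mu> \<omega>) \<partial>M)\<bar> = \<bar>\<integral>\<omega>. h (Z \<mu> \<omega>) - h (W \<mu> \<omega>) \<partial>M\<bar>"
        by simp
      also have "\<dots> \<le> (\<integral>\<omega>. \<bar>h (Z \<mu> \<omega>) - h (W \<mu> \<omega>)\<bar> \<partial>M)" by (rule integral_abs_bound)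
      also have "\<dots> \<le> (\<integral>\<omega>. d / 4 + 2 * B * indicator (space M - G) \<omega> \<partial>M)"
        using iZ G bound by (intro integral_mono) (auto simp: emeasure_eq_measure)
      also have "\<dots> = d / 4 + 2 * B * prob (space M - G)"
        using G by (subst Bochner_Integration.integral_add) (auto simp: emeasure_eq_measure prob_space)
      also have "\<dots> \<le> d / 4 + 2 * B * (2 * \<eta>)"
        using G prob_compl[OF G(1)] B by (intro add_left_mono mult_left_mono) auto
      also have "\<dots> < d" using d B by (simp add: \<eta>_def)
      finally show ?thesis .
    qed
    note small = this
    have "eventually (\<lambda>\<mu>. \<mu> \<le> \<mu>1) (at_right 0)"
      using eventually_at_right_real[OF mu1] by (rule eventually_mono) simp
    then show "eventually (\<lambda>\<mu>. dist ((\<integral>\<omega>. h (Z \<mu> \<omega>) \<partial>M) - (\<integral>\<omega>. h (W \<mu> \<omega>) \<partial>M)) 0 < d) (at_right 0)"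
      using near by eventually_elim (simp add: dist_real_def small)
  qed
  ultimately show ?thesis by (rule Lim_transform)
qed

text \<open>For step sizes at least \<open>a\<close> jumps cannot accumulate, and the paths are
  continuous images of mesh size, iterates and regimes. Deterministic bounds on the iterates make
  these parameters compact.\<close>

lemma compact_for_meshes:
  assumes a: "0 < a" and eta: "0 < \<eta>"
  shows "\<exists>K. compactin skorohod_topology K \<and> (\<forall>\<mu>\<in>{0<..\<mu>0}. a \<le> \<mu> \<longrightarrow> 1 - \<eta> \<le> prob (Z \<mu> -` K \<inter> space M))"
proof -
  obtain R where R: "1 - \<eta> \<le> prob {\<omega>\<in>space M. \<bar>r0 \<omega>\<bar> \<le> R}"
    using bounded_with_large_probability[OF r0_meas eta] by blast
  obtain B where B: "\<forall>n \<mu> y s \<theta> r0. 0 < \<mu> \<longrightarrow> \<mu> \<le> 1 \<longrightarrow> (\<forall>k i. \<bar>y k i\<bar> \<le> C) \<longrightarrow> \<bar>r0\<bar> \<le> R \<longrightarrow>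
      norm (X_rec \<mu> b F y s \<theta> r0 n) \<le> B n"
    using X_rec_bounded[OF lower less_imp_le[OF C_beta(1)], of R] by (elim exE) (rule that)
  define P :: "(real \<times> (nat \<Rightarrow> (real^'s) \<times> real) \<times> (nat \<Rightarrow> nat)) set"
    where "P = {a..1} \<times> {X. \<forall>n. X n \<in> cball 0 (B n)} \<times> {m. \<forall>n. m n \<in> range (to_nat :: 'q \<Rightarrow> nat)}"
  define g where "g p = interpolate (fst p) (\<lambda>n. (fst (snd p) n, from_nat (snd (snd p) n) :: 'q))"
    for p :: "real \<times> (nat \<Rightarrow> (real^'s) \<times> real) \<times> (nat \<Rightarrow> nat)"
  have "compact {X. \<forall>n. X n \<in> cball (0 :: (real^'s) \<times> real) (B n)}" by (rule compact_sequences) simp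
  then have "compact P" unfolding P_def by (intro compact_Times compact_Icc compact_codes)
  then have "compactin (top_of_set P) P" by (simp add: compactin_subtopology)
  moreover have "continuous_map (top_of_set P) skorohod_topology g"
    unfolding g_def by (rule interpolate_continuous) (use a in \<open>auto simp: P_def\<close>)
  ultimately have K: "compactin skorohod_topology (g ` P)" by (rule image_compactin)
  have "1 - \<eta> \<le> prob (Z \<mu> -` (g ` P) \<inter> space M)" if mu: "\<mu> \<in> {0<..\<mu>0}" "a \<le> \<mu>" for \<mu>
  proof -
    interpret S: simulation M b F f "\<theta> \<mu>" "s \<mu>" \<mu> C \<beta> by (rule simulation[OF mu(1)])
    have y: "S.y = y \<mu>" by (simp add: fun_eq_iff y_def S.y_def)
    have "prob {\<omega>\<in>space M. \<bar>r0 \<omega>\<bar> \<le> R} \<le> prob (Z \<mu> -` (g ` P) \<inter> space M)"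
    proof (rule finite_measure_mono_AE)
      show "AE \<omega> in M. \<omega> \<in> {\<omega>\<in>space M. \<bar>r0 \<omega>\<bar> \<le> R} \<longrightarrow> \<omega> \<in> Z \<mu> -` (g ` P) \<inter> space M"
        using S.y_bound
      proof eventually_elim
        case (elim \<omega>)
        show ?case
        proof
          assume w: "\<omega> \<in> {\<omega>\<in>space M. \<bar>r0 \<omega>\<bar> \<le> R}"
          let ?p = "(\<mu>, X \<mu> \<omega>, \<lambda>n. to_nat (\<theta> \<mu> n \<omega>))"
          have "norm (X \<mu> \<omega> n) \<le> B n" for n
            unfolding X_def by (rule B[rule_format]) (use mu mu0 w elim in \<open>auto simp: y\<close>)
          then have "?p \<in> P" using mu mu0 by (auto simp: P_def)
          moreover have "Z \<mu> \<omega> = g ?p" by (simp add: Z_def g_def)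
          ultimately show "\<omega> \<in> Z \<mu> -` (g ` P) \<inter> space M" using w by blast
        qed
      qed
      show "Z \<mu> -` (g ` P) \<inter> space M \<in> events"
        by (rule measurable_sets[OF Z_measurable[OF mu(1)] compact_in_skorohod_borel[OF K]])
    qed
    then show ?thesis using R by linarith
  qed
  then show ?thesis using K by blast
qed

text \<open>Step sizes are sorted into shells between consecutive values of \<open>m\<close>. In the
  \<open>k\<close>-th shell the process lies, with large probability, both in the
  \<open>k\<close>-th tube around \<open>K0\<close> and in the compact set \<open>A k\<close> for
  meshes of at least \<open>m (Suc k)\<close>. By \<open>compactin_tubes\<close> the union of all
  these intersections with \<open>K0\<close> is compact.\<close>

lemma tightness: "tight_family skorohod_topology {0<..\<mu>0} (\<lambda>\<mu>. distr M skorohod_borel (Z \<mu>))"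
  unfolding tight_family_def
proof (intro allI impI)
  fix \<eta> :: real assume eta: "0 < \<eta>"
  have eta': "0 < \<eta> / 2" "0 < \<eta> / 4" using eta by simp_all
  obtain K0 where K0: "compactin skorohod_topology K0"
    and WK: "\<forall>\<mu>\<in>{0<..\<mu>0}. \<mu> \<le> 1/2 \<longrightarrow> 1 - \<eta> / 2 \<le> prob (W \<mu> -` K0 \<inter> space M)"
    using W_in_core[OF eta'(1)] by blast
  have "\<exists>c>0. \<forall>\<mu>\<in>{0<..\<mu>0}. \<mu> \<le> c \<longrightarrow>
      (\<exists>A\<in>events. 1 - \<eta> / 4 \<le> prob A \<and> (\<forall>\<omega>\<in>A. Z \<mu> \<omega> \<in> skorohod_nbhd (W \<mu> \<omega>) (real k + 1) (1 / (real k + 1))))" for k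
    by (rule closeness[OF _ _ eta'(2)]) simp_all
  then obtain c where c: "\<And>k. 0 < c k" and close: "\<And>k \<mu>. \<mu> \<in> {0<..\<mu>0} \<Longrightarrow> \<mu> \<le> c k \<Longrightarrow>
      (\<exists>A\<in>events. 1 - \<eta> / 4 \<le> prob A \<and> (\<forall>\<omega>\<in>A. Z \<mu> \<omega> \<in> skorohod_nbhd (W \<mu> \<omega>) (real k + 1) (1 / (real k + 1))))"
    by metis
  \<comment> \<open>Decreasing to 0 by halving, and small enough at stage \<open>k\<close> for
    closeness of order \<open>k\<close>.\<close>
  define m where "m = rec_nat (min (1/2) (c 0)) (\<lambda>k x. min (x / 2) (c (Suc k)))"
  have m_simps: "m 0 = min (1/2) (c 0)" "\<And>k. m (Suc k) = min (m k / 2) (c (Suc k))" by (simp_all add: m_def)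
  have m: "0 < m k" "m k \<le> c k" "m k \<le> (1/2) ^ Suc k" for k
    using c by (induction k) (auto simp: m_simps min_less_iff_disj min_le_iff_disj)
  have "\<exists>K. compactin skorohod_topology K \<and> (\<forall>\<mu>\<in>{0<..\<mu>0}. m (Suc k) \<le> \<mu> \<longrightarrow> 1 - \<eta> / 4 \<le> prob (Z \<mu> -` K \<inter> space M))" for k
    by (rule compact_for_meshes[OF m(1) eta'(2)])
  then obtain A where A: "\<And>k. compactin skorohod_topology (A k)"
    and ZA: "\<And>k \<mu>. \<mu> \<in> {0<..\<mu>0} \<Longrightarrow> m (Suc k) \<le> \<mu> \<Longrightarrow> 1 - \<eta> / 4 \<le> prob (Z \<mu> -` A k \<inter> space M)"
    by metis
  \<comment> \<open>Step sizes of at least \<open>m 0\<close> belong to no shell and get a compact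
    set of their own.\<close>
  obtain A' where A': "compactin skorohod_topology A'"
    and ZA': "\<forall>\<mu>\<in>{0<..\<mu>0}. m 0 \<le> \<mu> \<longrightarrow> 1 - \<eta> \<le> prob (Z \<mu> -` A' \<inter> space M)"
    using compact_for_meshes[OF m(1) eta, of 0] by blast
  define K where "K = A' \<union> (K0 \<union> (\<Union>k. A k \<inter> skorohod_topology closure_of skorohod_tube K0 k))"
  have K: "compactin skorohod_topology K" unfolding K_def by (intro compactin_Un A' compactin_tubes K0 A)
  have "1 - \<eta> \<le> prob (Z \<mu> -` K \<inter> space M)" if mu: "\<mu> \<in> {0<..\<mu>0}" for \<mu>
  proof -
    have ZE: "Z \<mu> -` S \<inter> space M \<in> events" if "compactin skorohod_topology S" for S
      by (rule measurable_sets[OF Z_measurable[OF mu] compact_in_skorohod_borel[OF that]])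
    show ?thesis
    proof (cases "m 0 \<le> \<mu>")
      case True
      have "prob (Z \<mu> -` A' \<inter> space M) \<le> prob (Z \<mu> -` K \<inter> space M)"
        using ZE[OF K] by (intro finite_measure_mono) (auto simp: K_def)
      then show ?thesis using ZA' mu True by fastforce
    next
      case False
      obtain k' where "(1/2) ^ k' < \<mu>" using real_arch_pow_inv[of \<mu> "1/2"] mu by auto
      moreover have "(1/2::real) ^ Suc (Suc k') \<le> (1/2) ^ k'" by (rule power_decreasing) auto
      ultimately have ex: "\<exists>k. m (Suc k) < \<mu>"
        using m(3)[of "Suc k'"] by (intro exI[of _ k']) linarith
      \<comment> \<open>By minimality \<open>\<mu>\<close> lies above \<open>m (Suc k)\<close> and
        not above \<open>m k\<close>, so the estimates of the \<open>k\<close>-th shell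
        apply.\<close>
      define k where "k = (LEAST k. m (Suc k) < \<mu>)"
      have k: "m (Suc k) < \<mu>" unfolding k_def by (rule LeastI_ex[OF ex])
      have le: "\<mu> \<le> m k"
      proof (cases k)
        case (Suc l)
        then have "\<not> m (Suc l) < \<mu>" using not_less_Least[of l "\<lambda>k. m (Suc k) < \<mu>"] by (simp add: k_def)
        then show ?thesis by (simp add: Suc)
      qed (use False in simp)
      obtain G where G: "G \<in> events" "1 - \<eta> / 4 \<le> prob G"
        "\<And>\<omega>. \<omega> \<in> G \<Longrightarrow> Z \<mu> \<omega> \<in> skorohod_nbhd (W \<mu> \<omega>) (real k + 1) (1 / (real k + 1))"
        using close[OF mu, of k] le m(2)[of k] by auto
      have half: "\<mu> \<le> 1/2" using False m(3)[of 0] by simp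
      let ?W = "W \<mu> -` K0 \<inter> space M" and ?A = "Z \<mu> -` A k \<inter> space M"
      have W: "?W \<in> events" by (rule measurable_sets[OF W_measurable[OF mu] compact_in_skorohod_borel[OF K0]])
      \<comment> \<open>The budget \<open>\<eta>\<close> is split between \<open>W\<close> leaving
        \<open>K0\<close>, failure of closeness, and \<open>Z\<close> leaving
        \<open>A k\<close>.\<close>
      have "1 - (\<eta> / 2 + (\<eta> / 4 + \<eta> / 4)) \<le> prob (?W \<inter> (G \<inter> ?A))"
        by (rule prob_Int_ge[OF W sets.Int[OF G(1) ZE[OF A]] WK[rule_format, OF mu half]
            prob_Int_ge[OF G(1) ZE[OF A] G(2) ZA[OF mu less_imp_le[OF k]]]])
      also have "\<dots> \<le> prob (Z \<mu> -` K \<inter> space M)"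
      proof (intro finite_measure_mono subsetI)
        fix \<omega> assume w: "\<omega> \<in> ?W \<inter> (G \<inter> ?A)"
        then have "Z \<mu> \<omega> \<in> skorohod_tube K0 k" unfolding skorohod_tube_def using G(3)[of \<omega>] by blast
        moreover have "skorohod_tube K0 k \<subseteq> topspace skorohod_topology"
          unfolding skorohod_tube_def topspace_skorohod by (auto dest: skorohod_nbhd_cadlag)
        ultimately have "Z \<mu> \<omega> \<in> skorohod_topology closure_of skorohod_tube K0 k"
          using closure_of_subset by blast
        then show "\<omega> \<in> Z \<mu> -` K \<inter> space M" using w by (auto simp: K_def)
      qed (rule ZE[OF K])
      finally show ?thesis by simp
    qed
  qed
  then have "\<forall>\<mu>\<in>{0<..\<mu>0}. 1 - \<eta> \<le> measure (distr M skorohod_borel (Z \<mu>)) K"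
    by (simp add: measure_distr[OF Z_measurable compact_in_skorohod_borel[OF K]])
  then show "\<exists>K. compactin skorohod_topology K \<and> (\<forall>\<mu>\<in>{0<..\<mu>0}. 1 - \<eta> \<le> measure (distr M skorohod_borel (Z \<mu>)) K)"
    using K by blast
qed

end

theorem mainTheorem3:
  fixes M :: "'a measure"
    and Q :: "real^('q::{finite,metric_space})^('q::{finite,metric_space})"
    and \<pi>0 :: "'q \<Rightarrow> real"
    and F :: "'s::finite \<Rightarrow> 'q \<Rightarrow> real"
    and f :: "nat \<Rightarrow> 's \<Rightarrow> 'q \<Rightarrow> 'a \<Rightarrow> real"
    and \<epsilon> :: "real \<Rightarrow> real"
    and \<theta> :: "real \<Rightarrow> nat \<Rightarrow> 'a \<Rightarrow> 'q"
    and s :: "real \<Rightarrow> nat \<Rightarrow> 'a \<Rightarrow> 's"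
    and \<rho> :: "real^'s \<Rightarrow> real"
    and \<gamma> \<mu>0 :: real
    and r0 :: "'a \<Rightarrow> real"
  defines "b \<equiv> best_response \<gamma> \<rho>"
    and "y \<equiv> \<lambda>\<mu> \<omega> n i. f n i (\<theta> (\<epsilon> \<mu>) n \<omega>) \<omega>"
  defines "X \<equiv> \<lambda>\<mu> \<omega>. X_rec \<mu> b F (y \<mu> \<omega>) (\<lambda>n. s \<mu> n \<omega>) (\<lambda>n. \<theta> (\<epsilon> \<mu>) n \<omega>) (r0 \<omega>)"
  defines "Z \<equiv> \<lambda>\<mu> \<omega>. interpolate \<mu> (\<lambda>n. (X \<mu> \<omega> n, \<theta> (\<epsilon> \<mu>) n \<omega>))"
  defines "law \<equiv> \<lambda>\<mu>. distr M skorohod_borel (Z \<mu>)"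
  assumes "prob_space M"
    and "0 < \<mu>0" "\<mu>0 \<le> 1"
    and generator: "irreducible_generator Q" "\<And>i j. \<bar>Q $ i $ j\<bar> \<le> 1"
    and A1: "\<And>e. e \<in> {0<..\<mu>0} \<Longrightarrow> markov_chain M \<pi>0 (mat 1 + e *\<^sub>R Q) (\<theta> e)"
    and mean: "\<And>n i j. F i j = integral\<^sup>L M (f n i j)"
    and A2: "admissible_data M {0<..\<mu>0} f \<theta> F"
    and A3: "\<And>\<mu>. \<mu> \<in> {0<..\<mu>0} \<Longrightarrow> \<epsilon> \<mu> = \<mu>"
    and perturbation: "admissible_perturbation \<rho>" "0 < \<gamma>"
    and sampling: "\<And>\<mu>. \<mu> \<in> {0<..\<mu>0} \<Longrightarrow>
      samples_from M f (\<theta> (\<epsilon> \<mu>)) (s \<mu>)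
        (\<lambda>n \<omega>. b (f_tilde \<mu> b (y \<mu> \<omega>) (\<lambda>k. s \<mu> k \<omega>) n))"
    and initial_regret: "admissible_initial_regret M {0<..\<mu>0} (\<lambda>e. mat 1 + e *\<^sub>R Q) \<theta> r0"
  shows "tight_family skorohod_topology {0<..\<mu>0} law \<and>
     (\<exists>L. prob_space L \<and> sets L = sets skorohod_borel \<and>
      weakly_converges skorohod_topology law L (at_right 0) \<and>
      ctmc L Q (\<lambda>t z. snd (z t)) \<and>
      (AE z in L. solves_switched_ode (G_field b F) (\<lambda>t. fst (z t)) (\<lambda>t. snd (z t)) \<and>
        regime_resets F (\<lambda>t. fst (z t)) (\<lambda>t. snd (z t))))"
proof -
  interpret prob_space M by fact
  define E where "E = {0<..\<mu>0}"
  have E: "\<mu>0 \<in> E" "\<And>\<mu>. \<mu> \<in> E \<Longrightarrow> 0 < \<mu> \<and> \<mu> \<le> 1" using \<open>0 < \<mu>0\<close> \<open>\<mu>0 \<le> 1\<close> by (auto simp: E_def)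
  note response = best_response_properties[OF perturbation, folded b_def]
  interpret uniformization Q using generator by unfold_locales
  have b_pos: "0 < b v $ i" for v i using response(2)[of v] by (simp add: rel_interior_prob_simplex)
  have "b v \<in> prob_simplex" for v using response(2)[of v] rel_interior_subset by blast
  then interpret response b F using response(1) by unfold_locales (auto intro: prob_simplex_norm)
  obtain \<beta> where beta: "0 < \<beta>" "\<And>v i. norm v \<le> F_bound F + 1 \<Longrightarrow> \<beta> \<le> b v $ i"
    using response(3)[of "F_bound F + 1"] by blast
  have f_meas: "f n i j \<in> borel_measurable M" for n i j using A2 by (simp add: admissible_data_def)
  obtain C0 where C0: "\<And>n i j. AE \<omega> in M. \<bar>f n i j \<omega>\<bar> \<le> C0" using A2 unfolding admissible_data_def by blast
  \<comment> \<open>A bound for the data that is also positive, as the locales require.\<close>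
  define C where "C = max 1 C0"
  have fC: "AE \<omega> in M. \<forall>n i j. \<bar>f n i j \<omega>\<bar> \<le> C"
  proof -
    have "AE \<omega> in M. \<bar>f n i j \<omega>\<bar> \<le> C" for n i j
      using C0[of n i j] by (rule eventually_mono) (simp add: C_def)
    then show ?thesis by (simp add: AE_all_countable)
  qed
  have sim: "simulation M b F f (\<theta> \<mu>) (s \<mu>) \<mu> C \<beta>" if mu: "\<mu> \<in> E" for \<mu>
  proof -
    interpret chain: regime_chain M \<pi>0 "mat 1 + \<mu> *\<^sub>R Q" "\<theta> \<mu>"
      by (intro regime_chain.intro regime_chain_axioms.intro prob_space_axioms A1) (use mu in \<open>simp add: E_def\<close>)
    \<comment> \<open>Since no diagonal entry of \<open>Q\<close> lies below -1, a step switches the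
      regime with probability at most \<open>\<mu>\<close>.\<close>
    have diag: "1 - \<mu> \<le> (mat 1 + \<mu> *\<^sub>R Q) $ i $ i" for i
    proof -
      have "\<mu> * (- 1) \<le> \<mu> * Q $ i $ i" using generator(2)[of i i] E(2)[OF mu] by (intro mult_left_mono) auto
      then show ?thesis by (simp add: mat_def)
    qed
    show ?thesis
    proof (intro simulation.intro simulation_axioms.intro prob_space_axioms response_axioms f_meas fC chain.theta_meas
        chain.change_prob diag beta less_imp_le[OF b_pos])
      show "samples_from M f (\<theta> \<mu>) (s \<mu>) (\<lambda>n \<omega>. b (f_tilde \<mu> b (\<lambda>n i. f n i (\<theta> \<mu> n \<omega>) \<omega>) (\<lambda>k. s \<mu> k \<omega>) n))"
        using sampling[of \<mu>] A3[of \<mu>] mu by (simp add: y_def E_def)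
    qed (use E(2)[OF mu] in \<open>simp_all add: C_def\<close>)
  qed
  interpret T: tracking M Q b F f \<theta> s r0 \<mu>0 C \<beta>
  proof (intro tracking.intro tracking_axioms.intro prob_space_axioms uniformization_axioms response_axioms
      response(3) initial_regret \<open>0 < \<mu>0\<close> \<open>\<mu>0 \<le> 1\<close>)
    show "simulation M b F f (\<theta> \<mu>) (s \<mu>) \<mu> C \<beta>" if "\<mu> \<in> {0<..\<mu>0}" for \<mu> using sim that by (simp add: E_def)
    show "uniform_limit ({0<..\<mu>0} \<times> UNIV)
        (\<lambda>n (\<epsilon>, l). prob {\<omega>\<in>space M. \<bar>avg_cond_exp M f (\<theta> \<epsilon>) l n i j \<omega> - F i j\<bar> > \<delta>}) (\<lambda>_. 0) sequentially"
      if "0 < \<delta>" for i j \<delta> using A2 that unfolding admissible_data_def by blast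
  qed
  have Z: "Z \<mu> = T.Z \<mu>" if "\<mu> \<in> E" for \<mu>
    using A3[of \<mu>] that by (simp add: fun_eq_iff Z_def T.Z_def X_def T.X_def y_def T.y_def[abs_def] E_def)
  have "tight_family skorohod_topology {0<..\<mu>0} law"
    using T.tightness unfolding tight_family_def law_def by (simp add: Z E_def)
  moreover have "weakly_converges skorohod_topology law T.limit_law (at_right 0)"
    unfolding weakly_converges_def
  proof (intro allI impI)
    fix h :: "(real \<Rightarrow> ((real^'s) \<times> real) \<times> 'q) \<Rightarrow> real"
    assume h: "continuous_map skorohod_topology euclideanreal h \<and> bounded (h ` topspace skorohod_topology)"
    show "((\<lambda>\<mu>. \<integral>z. h z \<partial>law \<mu>) \<longlongrightarrow> (\<integral>z. h z \<partial>T.limit_law)) (at_right 0)"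
    proof (rule Lim_transform_eventually[OF T.weak_limit])
      have "(\<integral>\<omega>. h (T.Z \<mu> \<omega>) \<partial>M) = (\<integral>z. h z \<partial>law \<mu>)" if "\<mu> \<in> E" for \<mu>
        unfolding law_def Z[OF that]
        by (rule integral_distr[symmetric, OF T.Z_measurable continuous_skorohod_borel_measurable])
          (use h that in \<open>auto simp: E_def\<close>)
      then show "eventually (\<lambda>\<mu>. (\<integral>\<omega>. h (T.Z \<mu> \<omega>) \<partial>M) = (\<integral>z. h z \<partial>law \<mu>)) (at_right 0)"
        using eventually_at_right_real[OF \<open>0 < \<mu>0\<close>] by (auto elim!: eventually_mono simp: E_def)
    qed (use h in auto)
  qed
  ultimately show ?thesis
    by (intro conjI exI[of _ T.limit_law] T.limit_ctmc T.limit_law_solves T.limit.prob_space_axioms T.sets_limit_law)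
qed

end
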